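(* Let $\mu>0$ be small, $\rho>0$, $N\ge1$, $T>0$, and for $\epsilon>0$ let $\{(\alpha^\epsilon(n),\lambda^\epsilon(n))\}_{n\ge0}$ be generated by $$\alpha^\epsilon(n+1)=\alpha^\epsilon(n)-\epsilon\Big(\widehat{\nabla_\alpha C}(n)+\sum_{l=1}^L\big(\lambda^\epsilon_l(n)+\rho\hat B_l(n)\big)\widehat{\nabla_\alpha B_l}(n)+Z^\mu(n)\Big),\qquad\alpha^\epsilon(0)=\alpha(0)\in\boldsymbol\alpha^\mu,$$ $$\lambda^\epsilon(n+1)=\lambda^\epsilon(n)+\epsilon\hat B(n),\qquad \lambda^\epsilon(0)=\lambda(0)\in\mathbb R^L,$$ where $Z^\mu(n)$ is the projection term ensuring $\alpha^\epsilon(n+1)\in\boldsymbol\alpha^\mu$. Define the piecewise constant interpolations $\alpha^\epsilon(t)=\alpha^\epsilon(n)$, $\lambda^\epsilon(t)=\lambda^\epsilon(n)$ for $t\in[n\epsilon,(n+1)\epsilon)$. Then as $\epsilon\to0$, $\{(\alpha^\epsilon(t),\lambda^\epsilon(t)),\,t\in[0,T]\}$ converges in distribution to the solution of the ODE $$\frac{d}{dt}\alpha(t)=-\Big[h_0(\alpha(t))+\sum_{l=1}^L\big(\lambda_l(t)+\rho B_l(\alpha(t))\big)h_l(\alpha(t))+\kappa(\alpha(t))\Big]_\mu,\quad\alpha(0)\in\boldsymbol\alpha^\mu,\qquad \frac{d}{dt}\lambda(t)=B(\alpha(t)),$$ where $[\cdot]_\mu$ denotes truncation of the ODE onto $\boldsymbol\alpha^\mu$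 and $$\kappa(\alpha)=\rho\lim_{n\to\infty}\sum_{l=1}^L\mathrm{Cov}_{\pi(\alpha)}\big[\hat B_l(n),\widehat{\nabla_\alpha B_l}(n)\big].$$
   Context: $S$ is a finite state space. For each $i\in S$ the action set is $\mathcal U_i=\{0,1,\dots,d(i)\}$ with $d(i)\ge1$. For $a\in\mathcal U_i$, $A_{ij}(a)=\mathbb P[X_{n+1}=j\mid X_n=i,u_n=a]$ are transition probabilities on $S$. $c(i,a)$ (cost) and $\beta_l(i,a)$, $l=1,\dots,L$ (constraint functions), are bounded real functions and $\gamma_l$ are real constants. Spherical-coordinate randomized policy: the parameter is $\alpha=(\alpha_{ip})_{i\in S,\,1\le p\le d(i)}$, and in state $i$ action $a$ is chosen with probability $$\theta_{ia}(\alpha)=\begin{cases}\cos^2(\alpha_{i1}) & a=0,\\ \cos^2(\alpha_{i,a+1})\prod_{m=1}^a\sin^2(\alpha_{im}) & 1\le a\le d(i)-1,\\ \prod_{m=1}^{d(i)}\sin^2(\alpha_{im}) & a=d(i).\end{cases}$$ $\boldsymbol\alpha^\mu=\{\alpha:\alpha_{ip}\in[\mu,\pi/2-\mu]\ \forall i,p\}$. The chain $Z_n=(X_n,u_n)$ on $\{(i,a):i\in S,a\in\mathcal U_i\}$ has transition probabilities $P_{(i,a),(j,a')}(\alpha)=A_{ij}(a)\,\theta_{ja'}(\alpha)$. Standing assumption: for every $\alpha$ with all coordinates in $(0,\pi/2)$ this chain is irreducible and aperiodic; $\pi(\alpha)$ is its invariant distribution, $\mathbb E_{\pi(\alpha)},\mathrm{Cov}_{\pi(\alpha)}$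 denote expectation and covariance in the stationary regime with fixed parameter $\alpha$, and $C(\alpha)=\mathbb E_{\pi(\alpha)}[c(Z)]$, $B_l(\alpha)=\mathbb E_{\pi(\alpha)}[\beta_l(Z)]-\gamma_l$, $B=(B_1,\dots,B_L)$. The process is run in batches $I_n=\{nN+1,\dots,(n+1)N\}$; during $I_n$ the policy $\theta(\alpha^\epsilon(n))$ is used. $\hat B(n)=(\hat B_1(n),\dots,\hat B_L(n))$ is an estimator computed from the observations in $I_n$ with $\mathbb E_{\pi(\alpha)}[\hat B(n)]=B(\alpha)$ (e.g. $\hat B_l(n)=\frac1N\sum_{m\in I_n}\beta_l(Z_m)-\gamma_l$). The gradient estimates are the following fast frozen phantom estimators. With $\delta_{iq}(k)=\mathbf 1\{Z_k=(i,q-1)\}$, $$K_{ip}(\alpha,k)=\begin{cases}-\tan(\alpha_{ip})\,\delta_{i,p}(k) & p<d(i),\\ -\cos(\alpha_{i,d(i)})\sin(\alpha_{i,d(i)})\,[\delta_{i,d(i)}(k)-\delta_{i,d(i)+1}(k)] & p=d(i).\end{cases}$$ At each time $k$ a phantom decision $\tilde u_k$ is generated (for each $(i,p)$): if $p<d(i)$, independently of everything else given the current $\alpha$, with $\mathbb P(\tilde u_k=a)=\theta_{ia}(\alpha)/\prod_{m=1}^p\sin^2(\alpha_{im})$, $a\in\{p,\dots,d(i)\}$; if $p=d(i)$, $\tilde u_k=d(i)\mathbf 1\{u_k=d(i)-1\}+(d(i)-1)\mathbf 1\{u_k=d(i)\}$. Let $\nu(k)=\min\{m>0:Z_{k+m}=(i,\tilde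 u_k)\}$, $\mathcal D_n(k)=\mathbf 1\{k+\nu(k)\in I_n\}$, $\mathcal L(j)=\{k\le j:k+\nu(k)>j\}$, and let $\hat\Gamma_n$ be an estimator of $C(\alpha)$ computed from the trajectory in $I_n$ (e.g. the sample average of $c$). The $(i,p)$ component of $\widehat{\nabla_\alpha C}(n)$ is, with $\alpha=\alpha^\epsilon(n)$, $$\frac2N\Big[\sum_{k=nN+1}^{(n+1)N}K_{ip}(\alpha,k)\Big(c(i,u_k)-c(i,\tilde u_k)+\sum_{j=k+1}^{\min\{k+\nu(k),(n+1)N\}}c(Z_j)-\nu(k)\hat\Gamma_n\mathcal D_n(k)\Big)$$ $$\qquad+\sum_{k\in\mathcal L(nN)}K_{ip}(\alpha,k)\Big(\sum_{j=nN+1}^{\min\{k+\nu(k),(n+1)N\}}c(Z_j)-\nu(k)\hat\Gamma_n\mathcal D_n(k)\Big)\Big]$$ (terms with $K_{ip}=0$ are zero). $\widehat{\nabla_\alpha B_l}(n)$ is defined identically with $c$ replaced by $\beta_l$ and $\hat\Gamma_n$ by the corresponding estimator of $\mathbb E_{\pi(\alpha)}[\beta_l(Z)]$. Invariant averages: $h_0(\alpha)=\mathbb E_{\pi(\alpha)}[\widehat{\nabla_\alpha C}(n)]$, $h_l(\alpha)=\mathbb E_{\pi(\alpha)}[\widehat{\nabla_\alpha B_l}(n)]$. Projection: the update of $\alpha^\epsilon$ is the Euclidean projection onto the box $\boldsymbol\alpha^\mu$ of the unprojected update. Truncated ODE: $\dot\alpha=-[v]_\mu$ means $\dot\alpha=-v+z$,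 where $z(t)$ is the minimal term (in the negative normal cone of $\boldsymbol\alpha^\mu$ at $\alpha(t)$) keeping $\alpha(t)$ in $\boldsymbol\alpha^\mu$. Convergence in distribution is in the Skorokhod space of right-continuous paths with left limits on $[0,T]$. *)

theory Defs
  imports "HOL-Probability.Probability"
begin

section \<open>The controlled chain and its spherical randomized policy\<close>

text \<open>
  In state \<open>i\<close> the actions are \<open>0, \<dots>, top_act M i\<close>. The policy parameter has one coordinate for each
  pair \<open>(i, p)\<close> with \<open>1 \<le> p \<le> top_act M i\<close>. So that it lives in a Euclidean space \<open>real ^ 'k\<close>, these
  pairs are enumerated by the finite type \<open>'k\<close> through the bijection \<open>coord M\<close>.
\<close>

record ('s, 'k) ctrl_chain =
  top_act :: "'s \<Rightarrow> nat"
  coord :: "'k \<Rightarrow> 's \<times> nat"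
  trans_law :: "'s \<Rightarrow> nat \<Rightarrow> 's pmf"

definition wf_ctrl_chain :: "('s::finite, 'k::finite) ctrl_chain \<Rightarrow> bool" where
  "wf_ctrl_chain M \<longleftrightarrow>
     (\<forall>i. 1 \<le> top_act M i) \<and> bij_betw (coord M) UNIV (SIGMA i:UNIV. {1..top_act M i})"

definition par :: "('s, 'k::finite) ctrl_chain \<Rightarrow> real ^ 'k \<Rightarrow> 's \<Rightarrow> nat \<Rightarrow> real" where
  "par M \<alpha> i p = \<alpha> $ inv (coord M) (i, p)"

definition theta :: "('s, 'k::finite) ctrl_chain \<Rightarrow> real ^ 'k \<Rightarrow> 's \<Rightarrow> nat \<Rightarrow> real" where
  "theta M \<alpha> i a =
     (if a = 0 then (cos (par M \<alpha> i 1))\<^sup>2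
      else if a < top_act M i
        then (cos (par M \<alpha> i (a + 1)))\<^sup>2 * (\<Prod>m=1..a. (sin (par M \<alpha> i m))\<^sup>2)
      else if a = top_act M i then (\<Prod>m=1..a. (sin (par M \<alpha> i m))\<^sup>2)
      else 0)"

definition action_law :: "('s, 'k::finite) ctrl_chain \<Rightarrow> real ^ 'k \<Rightarrow> 's \<Rightarrow> nat pmf" where
  "action_law M \<alpha> i = embed_pmf (theta M \<alpha> i)"

definition open_params :: "(real ^ 'k::finite) set" where
  "open_params = {\<alpha>. \<forall>e. 0 < \<alpha> $ e \<and> \<alpha> $ e < pi / 2}"

definition param_box :: "real \<Rightarrow> (real ^ 'k::finite) set" where
  "param_box \<mu> = {\<alpha>. \<forall>e. \<mu> \<le> \<alpha> $ e \<and> \<alpha> $ e \<le> pi / 2 - \<mu>}"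

definition state_acts :: "('s, 'k) ctrl_chain \<Rightarrow> ('s \<times> nat) set" where
  "state_acts M = (SIGMA i:UNIV. {0..top_act M i})"

definition pair_kernel ::
    "('s, 'k::finite) ctrl_chain \<Rightarrow> real ^ 'k \<Rightarrow> 's \<times> nat \<Rightarrow> ('s \<times> nat) pmf" where
  "pair_kernel M \<alpha> z =
     bind_pmf (trans_law M (fst z) (snd z)) (\<lambda>j. map_pmf (Pair j) (action_law M \<alpha> j))"

primrec kernel_pow :: "('z \<Rightarrow> 'z pmf) \<Rightarrow> nat \<Rightarrow> 'z \<Rightarrow> 'z pmf" where
  "kernel_pow K 0 z = return_pmf z"
| "kernel_pow K (Suc n) z = bind_pmf (kernel_pow K n z) K"

definition irreducible_on :: "'z set \<Rightarrow> ('z \<Rightarrow> 'z pmf) \<Rightarrow> bool" where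
  "irreducible_on E K \<longleftrightarrow> (\<forall>x\<in>E. \<forall>y\<in>E. \<exists>n. 0 < pmf (kernel_pow K n x) y)"

definition aperiodic_on :: "'z set \<Rightarrow> ('z \<Rightarrow> 'z pmf) \<Rightarrow> bool" where
  "aperiodic_on E K \<longleftrightarrow> (\<forall>x\<in>E. Gcd {n. 0 < n \<and> 0 < pmf (kernel_pow K n x) x} = 1)"

definition inv_dist :: "('s, 'k::finite) ctrl_chain \<Rightarrow> real ^ 'k \<Rightarrow> ('s \<times> nat) pmf" where
  "inv_dist M \<alpha> = (THE q. set_pmf q \<subseteq> state_acts M \<and> bind_pmf q (pair_kernel M \<alpha>) = q)"

definition constraint_mean ::
    "('s, 'k::finite) ctrl_chain \<Rightarrow> ('l \<Rightarrow> 's \<times> nat \<Rightarrow> real) \<Rightarrow> real ^ 'l \<Rightarrow> real ^ 'k \<Rightarrow> real ^ 'l::finite"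
  where
  "constraint_mean M \<beta> \<gamma> \<alpha> = (\<chi> l. measure_pmf.expectation (inv_dist M \<alpha>) (\<beta> l) - \<gamma> $ l)"

section \<open>Law of the trajectory with its phantom decisions\<close>

definition phantom_prob ::
    "('s, 'k::finite) ctrl_chain \<Rightarrow> real ^ 'k \<Rightarrow> 's \<Rightarrow> nat \<Rightarrow> nat \<Rightarrow> real" where
  "phantom_prob M \<alpha> i p a =
     (if p \<le> a \<and> a \<le> top_act M i
      then theta M \<alpha> i a / (\<Prod>m=1..p. (sin (par M \<alpha> i m))\<^sup>2) else 0)"

lemma theta_nonneg: "0 \<le> theta M \<alpha> i a"
  by (auto simp: theta_def intro!: mult_nonneg_nonneg prod_nonneg)

lemma sum_theta_tail:
  assumes "1 \<le> top_act M i" "p \<le> top_act M i"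
  shows "(\<Sum>a=p..top_act M i. theta M \<alpha> i a) = (\<Prod>m=1..p. (sin (par M \<alpha> i m))\<^sup>2)"
  using assms(2)
proof (induction rule: inc_induct)
  case base
  then show ?case using assms(1) by (simp add: theta_def)
next
  case (step n)
  have "theta M \<alpha> i n = (cos (par M \<alpha> i (Suc n)))\<^sup>2 * (\<Prod>m=1..n. (sin (par M \<alpha> i m))\<^sup>2)"
    using step by (simp add: theta_def)
  moreover have "(\<Sum>a=n..top_act M i. theta M \<alpha> i a) =
      theta M \<alpha> i n + (\<Sum>a=Suc n..top_act M i. theta M \<alpha> i a)"
    using step by (simp add: sum.atLeast_Suc_atMost)
  ultimately show ?case
    using step by (simp add: cos_squared_eq algebra_simps)
qed

lemma pmf_embed_finite:
  fixes f :: "'a \<Rightarrow> real"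
  assumes "finite E" "\<And>x. 0 \<le> f x" "\<And>x. x \<notin> E \<Longrightarrow> f x = 0" "(\<Sum>x\<in>E. f x) = 1"
  shows "pmf (embed_pmf f) x = f x"
proof (rule pmf_embed_pmf)
  have "(\<integral>\<^sup>+x. ennreal (f x) \<partial>count_space UNIV) = (\<Sum>x\<in>E. ennreal (f x))"
    using assms by (intro nn_integral_count_space'[of E]) auto
  also have "\<dots> = ennreal (\<Sum>x\<in>E. f x)" using assms by (intro sum_ennreal) auto
  finally show "(\<integral>\<^sup>+x. ennreal (f x) \<partial>count_space UNIV) = 1" using assms by simp
qed (rule assms)

lemma pmf_action_law:
  assumes "wf_ctrl_chain M"
  shows "pmf (action_law M \<alpha> i) a = theta M \<alpha> i a"
proof -
  have d: "1 \<le> top_act M i" using assms by (auto simp: wf_ctrl_chain_def)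
  show ?thesis unfolding action_law_def
    by (rule pmf_embed_finite[of "{0..top_act M i}"])
       (use d sum_theta_tail[of M i 0 \<alpha>] in \<open>auto simp: theta_nonneg\<close>, auto simp: theta_def)
qed

lemma pmf_phantom_law_component:
  assumes "wf_ctrl_chain M" "\<alpha> \<in> open_params" "p \<le> top_act M i"
  shows "pmf (embed_pmf (phantom_prob M \<alpha> i p)) a = phantom_prob M \<alpha> i p a"
proof (rule pmf_embed_finite[of "{p..top_act M i}"])
  have s: "0 < sin (par M \<alpha> i m)" for m
  proof -
    have "0 < par M \<alpha> i m" "par M \<alpha> i m < pi / 2"
      using assms(2) by (auto simp: open_params_def par_def)
    then show ?thesis by (intro sin_gt_zero) auto
  qed
  then have "0 < (\<Prod>m=1..p. (sin (par M \<alpha> i m))\<^sup>2)"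
    by (intro prod_pos) (metis zero_less_power)
  moreover have "(\<Sum>x\<in>{p..top_act M i}. phantom_prob M \<alpha> i p x)
      = (\<Sum>a=p..top_act M i. theta M \<alpha> i a) / (\<Prod>m=1..p. (sin (par M \<alpha> i m))\<^sup>2)"
    by (simp add: phantom_prob_def sum_divide_distrib)
  moreover have "1 \<le> top_act M i" using assms(1) by (simp add: wf_ctrl_chain_def)
  ultimately show "(\<Sum>x\<in>{p..top_act M i}. phantom_prob M \<alpha> i p x) = 1"
    using sum_theta_tail[of M i p \<alpha>] assms(3) by (metis div_self less_irrefl)
qed (auto simp: phantom_prob_def theta_nonneg intro!: divide_nonneg_nonneg prod_nonneg)

text \<open>
  Joint law of the phantom decisions of all coordinates at a time when action \<open>u\<close> is taken. For
  \<open>p = top_act M i\<close> the phantom decision is the deterministic swap of the two largest actions (its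
  value matters only if the current state is \<open>i\<close>).
\<close>

definition phantom_law ::
    "('s, 'k::finite) ctrl_chain \<Rightarrow> real ^ 'k \<Rightarrow> nat \<Rightarrow> ('k \<Rightarrow> nat) pmf" where
  "phantom_law M \<alpha> u =
     Pi_pmf UNIV 0 (\<lambda>e. case coord M e of (i, p) \<Rightarrow>
       if p < top_act M i then embed_pmf (phantom_prob M \<alpha> i p)
       else return_pmf (top_act M i * of_bool (u = top_act M i - 1)
                        + (top_act M i - 1) * of_bool (u = top_act M i)))"

text \<open>A path lists \<open>((X\<^sub>k, u\<^sub>k), phantom decisions at time k)\<close> for \<open>k = 1, 2, \<dots>\<close>; index 0 is unused.\<close>

type_synonym ('s, 'k) path = "nat \<Rightarrow> ('s \<times> nat) \<times> ('k \<Rightarrow> nat)"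

abbreviation Z :: "('s, 'k) path \<Rightarrow> nat \<Rightarrow> 's \<times> nat" where
  "Z \<omega> k \<equiv> fst (\<omega> k)"

abbreviation phantom :: "('s, 'k) path \<Rightarrow> nat \<Rightarrow> 'k \<Rightarrow> nat" where
  "phantom \<omega> k \<equiv> snd (\<omega> k)"

text \<open>
  Law of the path up to a finite time, when \<open>X\<^sub>1\<close> has law \<open>\<nu>\<close> and the parameter \<open>a n \<omega>\<close> is used
  during the batch \<open>{n * N + 1..Suc n * N}\<close>. Here \<open>a n \<omega>\<close> must depend on \<open>\<omega>\<close> only up to time
  \<open>n * N\<close>. The values of \<open>\<omega>\<close> beyond the time horizon are meaningless.
\<close>

primrec path_law ::
    "('s, 'k::finite) ctrl_chain \<Rightarrow> nat \<Rightarrow> 's pmf \<Rightarrow> (nat \<Rightarrow> ('s, 'k) path \<Rightarrow> real ^ 'k) \<Rightarrow> nat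
     \<Rightarrow> ('s, 'k) path pmf" where
  "path_law M N \<nu> a 0 = return_pmf (\<lambda>_. undefined)"
| "path_law M N \<nu> a (Suc k) =
     bind_pmf (path_law M N \<nu> a k) (\<lambda>\<omega>.
     bind_pmf (if k = 0 then \<nu> else trans_law M (fst (Z \<omega> k)) (snd (Z \<omega> k))) (\<lambda>x.
     bind_pmf (action_law M (a (k div N) \<omega>) x) (\<lambda>u.
     bind_pmf (phantom_law M (a (k div N) \<omega>) u) (\<lambda>w.
     return_pmf ((\<omega>)(Suc k := ((x, u), w)))))))"

section \<open>Fast frozen phantom estimators\<close>

definition batch :: "nat \<Rightarrow> nat \<Rightarrow> nat set" where
  "batch N n = {n * N + 1..Suc n * N}"

definition batch_obs :: "nat \<Rightarrow> nat \<Rightarrow> ('s, 'k) path \<Rightarrow> ('s \<times> nat) list" where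
  "batch_obs N n \<omega> = map (Z \<omega>) [n * N + 1..<Suc n * N + 1]"

definition K_weight ::
    "('s, 'k::finite) ctrl_chain \<Rightarrow> real ^ 'k \<Rightarrow> ('s, 'k) path \<Rightarrow> 'k \<Rightarrow> nat \<Rightarrow> real" where
  "K_weight M \<alpha> \<omega> e k = (case coord M e of (i, p) \<Rightarrow>
     if p < top_act M i then - tan (\<alpha> $ e) * of_bool (Z \<omega> k = (i, p - 1))
     else - cos (\<alpha> $ e) * sin (\<alpha> $ e) * (of_bool (Z \<omega> k = (i, p - 1)) - of_bool (Z \<omega> k = (i, p))))"

definition phantom_pair ::
    "('s, 'k) ctrl_chain \<Rightarrow> ('s, 'k) path \<Rightarrow> 'k \<Rightarrow> nat \<Rightarrow> 's \<times> nat" where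
  "phantom_pair M \<omega> e k = (fst (coord M e), phantom \<omega> k e)"

text \<open>
  The hitting time is infinite if the phantom pair is never visited. The estimators of batch \<open>n\<close>
  only use whether it ends by time \<open>Suc n * N\<close>, hence they depend only on \<open>\<omega>\<close> up to that time.
\<close>

definition hit_time :: "('s, 'k) ctrl_chain \<Rightarrow> ('s, 'k) path \<Rightarrow> 'k \<Rightarrow> nat \<Rightarrow> enat" where
  "hit_time M \<omega> e k = (INF m\<in>{m. 0 < m \<and> Z \<omega> (k + m) = phantom_pair M \<omega> e k}. enat m)"

definition carried :: "('s, 'k) ctrl_chain \<Rightarrow> ('s, 'k) path \<Rightarrow> 'k \<Rightarrow> nat \<Rightarrow> nat set" where
  "carried M \<omega> e j = {k \<in> {1..j}. enat k + hit_time M \<omega> e k > enat j}"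

definition end_time :: "('s, 'k) ctrl_chain \<Rightarrow> nat \<Rightarrow> nat \<Rightarrow> ('s, 'k) path \<Rightarrow> 'k \<Rightarrow> nat \<Rightarrow> nat" where
  "end_time M N n \<omega> e k = the_enat (min (enat k + hit_time M \<omega> e k) (enat (Suc n * N)))"

text \<open>\<open>\<nu>(k) D\<^sub>n(k)\<close>, which is 0 when \<open>\<nu>(k)\<close> is infinite\<close>

definition hit_in_batch :: "('s, 'k) ctrl_chain \<Rightarrow> nat \<Rightarrow> nat \<Rightarrow> ('s, 'k) path \<Rightarrow> 'k \<Rightarrow> nat \<Rightarrow> real" where
  "hit_in_batch M N n \<omega> e k =
     (if enat k + hit_time M \<omega> e k \<in> enat ` batch N n then real (the_enat (hit_time M \<omega> e k)) else 0)"

text \<open>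
  Gradient estimate for the stationary mean of \<open>f\<close>; \<open>\<Gamma>\<close> maps the trajectory in the batch to the
  estimate of that mean.
\<close>

definition grad_est ::
    "('s, 'k::finite) ctrl_chain \<Rightarrow> nat \<Rightarrow> ('s \<times> nat \<Rightarrow> real) \<Rightarrow> (('s \<times> nat) list \<Rightarrow> real)
     \<Rightarrow> real ^ 'k \<Rightarrow> nat \<Rightarrow> ('s, 'k) path \<Rightarrow> real ^ 'k" where
  "grad_est M N f \<Gamma> \<alpha> n \<omega> = (\<chi> e. 2 / real N *
     ((\<Sum>k\<in>batch N n. K_weight M \<alpha> \<omega> e k *
         (f (fst (coord M e), snd (Z \<omega> k)) - f (phantom_pair M \<omega> e k)
          + (\<Sum>j\<in>{k + 1..end_time M N n \<omega> e k}. f (Z \<omega> j))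
          - hit_in_batch M N n \<omega> e k * \<Gamma> (batch_obs N n \<omega>)))
      + (\<Sum>k\<in>carried M \<omega> e (n * N). K_weight M \<alpha> \<omega> e k *
         ((\<Sum>j\<in>{n * N + 1..end_time M N n \<omega> e k}. f (Z \<omega> j))
          - hit_in_batch M N n \<omega> e k * \<Gamma> (batch_obs N n \<omega>)))))"

section \<open>Stationary regime and invariant averages\<close>

text \<open>
  If \<open>X\<^sub>1\<close> has the first marginal of \<open>inv_dist M \<alpha>\<close> and the parameter is frozen at \<open>\<alpha>\<close>, then
  every \<open>Z\<^sub>k\<close> has law \<open>inv_dist M \<alpha>\<close>. \<open>stat_exp M N \<alpha> n\<close> is the expectation of functionals of this
  process up to the end of batch \<open>n\<close>.
\<close>

definition stat_exp ::
    "('s, 'k::finite) ctrl_chain \<Rightarrow> nat \<Rightarrow> real ^ 'k \<Rightarrow> nat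
     \<Rightarrow> (('s, 'k) path \<Rightarrow> 'b::{banach, second_countable_topology}) \<Rightarrow> 'b" where
  "stat_exp M N \<alpha> n F = measure_pmf.expectation
     (path_law M N (map_pmf fst (inv_dist M \<alpha>)) (\<lambda>_ _. \<alpha>) (Suc n * N)) F"

definition stat_cov ::
    "('s, 'k::finite) ctrl_chain \<Rightarrow> nat \<Rightarrow> real ^ 'k \<Rightarrow> nat
     \<Rightarrow> (('s, 'k) path \<Rightarrow> real) \<Rightarrow> (('s, 'k) path \<Rightarrow> real ^ 'k) \<Rightarrow> real ^ 'k" where
  "stat_cov M N \<alpha> n F G =
     stat_exp M N \<alpha> n (\<lambda>\<omega>. (F \<omega> - stat_exp M N \<alpha> n F) *\<^sub>R (G \<omega> - stat_exp M N \<alpha> n G))"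

text \<open>
  The stationary process above starts at time 1, so batch \<open>n\<close> sees phantoms carried over from the
  last \<open>n\<close> batches only. By stationarity the limit \<open>n \<rightarrow> \<infinity>\<close> is the average in the regime with
  infinite past, which does not depend on the batch.
\<close>

definition inv_grad ::
    "('s, 'k::finite) ctrl_chain \<Rightarrow> nat \<Rightarrow> ('s \<times> nat \<Rightarrow> real) \<Rightarrow> (('s \<times> nat) list \<Rightarrow> real)
     \<Rightarrow> real ^ 'k \<Rightarrow> real ^ 'k" where
  "inv_grad M N f \<Gamma> \<alpha> = lim (\<lambda>n. stat_exp M N \<alpha> n (grad_est M N f \<Gamma> \<alpha> n))"

definition cov_sum ::
    "('s, 'k::finite) ctrl_chain \<Rightarrow> nat \<Rightarrow> ('l::finite \<Rightarrow> 's \<times> nat \<Rightarrow> real)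
     \<Rightarrow> ('l \<Rightarrow> ('s \<times> nat) list \<Rightarrow> real) \<Rightarrow> (('s \<times> nat) list \<Rightarrow> real ^ 'l)
     \<Rightarrow> real ^ 'k \<Rightarrow> nat \<Rightarrow> real ^ 'k" where
  "cov_sum M N \<beta> \<Gamma> Bhat \<alpha> n =
     (\<Sum>l\<in>UNIV. stat_cov M N \<alpha> n (\<lambda>\<omega>. Bhat (batch_obs N n \<omega>) $ l) (grad_est M N (\<beta> l) (\<Gamma> l) \<alpha> n))"

definition kappa ::
    "('s, 'k::finite) ctrl_chain \<Rightarrow> nat \<Rightarrow> real \<Rightarrow> ('l::finite \<Rightarrow> 's \<times> nat \<Rightarrow> real)
     \<Rightarrow> ('l \<Rightarrow> ('s \<times> nat) list \<Rightarrow> real) \<Rightarrow> (('s \<times> nat) list \<Rightarrow> real ^ 'l)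
     \<Rightarrow> real ^ 'k \<Rightarrow> real ^ 'k" where
  "kappa M N \<rho> \<beta> \<Gamma> Bhat \<alpha> = \<rho> *\<^sub>R lim (cov_sum M N \<beta> \<Gamma> Bhat \<alpha>)"

section \<open>Truncated ODE\<close>

definition normal_cone :: "'a::real_inner set \<Rightarrow> 'a \<Rightarrow> 'a set" where
  "normal_cone H x = {y. \<forall>x'\<in>H. inner y (x' - x) \<le> 0}"

text \<open>For a polyhedral \<open>H\<close>, such as a box, this cone is closed and is the tangent cone.\<close>

definition feasible_directions :: "'a::real_vector set \<Rightarrow> 'a \<Rightarrow> 'a set" where
  "feasible_directions H x = {y. \<exists>r>0. x + r *\<^sub>R y \<in> H}"

definition minimal_reflection :: "'a::real_inner set \<Rightarrow> 'a \<Rightarrow> 'a \<Rightarrow> 'a \<Rightarrow> bool" where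
  "minimal_reflection H x w z \<longleftrightarrow>
     is_arg_min norm (\<lambda>\<zeta>. - \<zeta> \<in> normal_cone H x \<and> w + \<zeta> \<in> feasible_directions H x) z"

text \<open>
  \<open>x' = - [v]\<close> on \<open>[0, T]\<close> with truncation onto \<open>H\<close>. Since \<open>z\<close> jumps when \<open>x\<close> reaches or leaves the
  boundary, the equation is meant in integrated (almost everywhere) form.
\<close>

definition solves_truncated ::
    "'a::euclidean_space set \<Rightarrow> real \<Rightarrow> (real \<Rightarrow> 'a) \<Rightarrow> (real \<Rightarrow> 'a) \<Rightarrow> bool" where
  "solves_truncated H T v x \<longleftrightarrow> (\<exists>z. \<forall>t\<in>{0..T}.
     x t \<in> H \<and> minimal_reflection H (x t) (- v t) (z t) \<and>
     ((\<lambda>s. - v s + z s) has_integral (x t - x 0)) {0..t})"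

section \<open>Skorokhod space and convergence in distribution\<close>

definition skorokhod_paths :: "real \<Rightarrow> (real \<Rightarrow> 'e::metric_space) set" where
  "skorokhod_paths T = {f \<in> extensional {0..T}.
     (\<forall>t\<in>{0..<T}. (f \<longlongrightarrow> f t) (at_right t)) \<and>
     (\<forall>t\<in>{0<..T}. \<exists>l. (f \<longlongrightarrow> l) (at_left t))}"

definition time_changes :: "real \<Rightarrow> (real \<Rightarrow> real) set" where
  "time_changes T = {\<phi>. strict_mono_on {0..T} \<phi> \<and> \<phi> ` {0..T} = {0..T}}"

definition skorokhod_close ::
    "real \<Rightarrow> (real \<Rightarrow> 'e::metric_space) \<Rightarrow> (real \<Rightarrow> 'e) \<Rightarrow> real \<Rightarrow> bool" where
  "skorokhod_close T f g r \<longleftrightarrow> 0 \<le> r \<and> (\<exists>\<phi>\<in>time_changes T. \<forall>t\<in>{0..T}.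
     \<bar>\<phi> t - t\<bar> \<le> r \<and> dist (f t) (g (\<phi> t)) \<le> r)"

text \<open>The value off the path space only serves to match the locale \<open>Metric_space\<close>.\<close>

definition skorokhod_dist :: "real \<Rightarrow> (real \<Rightarrow> 'e::metric_space) \<Rightarrow> (real \<Rightarrow> 'e) \<Rightarrow> real" where
  "skorokhod_dist T f g =
     (if f \<in> skorokhod_paths T \<and> g \<in> skorokhod_paths T then Inf {r. skorokhod_close T f g r} else 0)"

definition skorokhod_topology :: "real \<Rightarrow> (real \<Rightarrow> 'e::metric_space) topology" where
  "skorokhod_topology T = Metric_space.mtopology (skorokhod_paths T) (skorokhod_dist T)"

lemma time_change_bounds:
  assumes "\<phi> \<in> time_changes T" "t \<in> {0..T}" shows "\<phi> t \<in> {0..T}"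
proof -
  have "\<phi> ` {0..T} = {0..T}" using assms(1) by (simp add: time_changes_def)
  then show ?thesis using imageI[OF assms(2), of \<phi>] by simp
qed

lemma time_change_end:
  assumes "\<phi> \<in> time_changes T" "0 \<le> T" shows "\<phi> T = T"
proof -
  have sm: "strict_mono_on {0..T} \<phi>" and im: "\<phi> ` {0..T} = {0..T}"
    using assms(1) by (simp_all add: time_changes_def)
  have "T \<in> \<phi> ` {0..T}" using im assms(2) by simp
  then obtain s where s: "s \<in> {0..T}" "\<phi> s = T" by (metis imageE)
  then have "\<phi> s \<le> \<phi> T"
    using assms(2) by (intro strict_mono_on_leD[OF sm]) auto
  then show ?thesis using s time_change_bounds[OF assms(1), of T] assms by auto
qed

lemma time_change_id: "(\<lambda>t. t) \<in> time_changes T"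
  by (auto simp: time_changes_def strict_mono_on_def)

lemma time_change_comp:
  assumes "\<phi> \<in> time_changes T" "\<psi> \<in> time_changes T" shows "(\<psi> \<circ> \<phi>) \<in> time_changes T"
proof -
  have "(\<psi> \<circ> \<phi>) ` {0..T} = {0..T}"
    using assms by (simp add: time_changes_def image_comp [symmetric] del: o_apply)
  moreover have "strict_mono_on {0..T} (\<psi> \<circ> \<phi>)"
    using assms time_change_bounds[OF assms(1)]
    unfolding time_changes_def strict_mono_on_def by simp
  ultimately show ?thesis by (simp add: time_changes_def)
qed

lemma time_change_inv:
  assumes "\<phi> \<in> time_changes T"
  shows "inv_into {0..T} \<phi> \<in> time_changes T"
proof -
  have sm: "strict_mono_on {0..T} \<phi>" and im: "\<phi> ` {0..T} = {0..T}"
    using assms by (auto simp: time_changes_def)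
  have inj: "inj_on \<phi> {0..T}" using sm by (rule strict_mono_on_imp_inj_on)
  have im': "inv_into {0..T} \<phi> ` {0..T} = {0..T}"
    by (metis im inj inv_into_image_cancel order_refl)
  have "strict_mono_on {0..T} (inv_into {0..T} \<phi>)"
  proof (rule strict_mono_onI)
    fix r s assume rs: "r \<in> {0..T}" "s \<in> {0..T}" "r < s"
    let ?g = "inv_into {0..T} \<phi>"
    have "?g r \<in> {0..T}" "?g s \<in> {0..T}" using rs im' by blast+
    moreover have "\<phi> (?g r) = r" "\<phi> (?g s) = s" using rs im by (auto simp: f_inv_into_f)
    ultimately show "?g r < ?g s" using rs strict_mono_on_leD[OF sm, of "?g s" "?g r"]
      by (cases "?g s \<le> ?g r") auto
  qed
  then show ?thesis using im' by (simp add: time_changes_def)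
qed

lemma skorokhod_path_bounded:
  fixes f :: "real \<Rightarrow> 'e::metric_space"
  assumes f: "f \<in> skorokhod_paths T"
  shows "bounded (f ` {0..T})"
proof -
  have loc: "\<exists>e>0. bounded (f ` ({t - e<..<t + e} \<inter> {0..T}))" if t: "t \<in> {0..T}" for t
  proof -
    have "\<exists>e>0. bounded (f ` ({t<..<t + e} \<inter> {0..T}))"
    proof (cases "t < T")
      case True
      then have "(f \<longlongrightarrow> f t) (at_right t)" using f t by (auto simp: skorokhod_paths_def)
      then have "\<forall>\<^sub>F s in at_right t. dist (f s) (f t) < 1" by (rule tendstoD) simp
      then obtain b where b: "b > t" "\<And>y. t < y \<Longrightarrow> y < b \<Longrightarrow> dist (f y) (f t) < 1"
        unfolding eventually_at_right_field by auto
      have "f ` ({t<..<t + (b - t)} \<inter> {0..T}) \<subseteq> ball (f t) 1" using b by (auto simp: dist_commute)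
      then show ?thesis using b by (intro exI[of _ "b - t"]) (simp add: bounded_subset[OF bounded_ball])
    next
      case False
      then have "{t<..<t + 1} \<inter> {0..T} = {}" using t by auto
      then show ?thesis by (intro exI[of _ 1]) auto
    qed
    then obtain e1 where e1: "e1 > 0" "bounded (f ` ({t<..<t + e1} \<inter> {0..T}))" by blast
    have "\<exists>e>0. bounded (f ` ({t - e<..<t} \<inter> {0..T}))"
    proof (cases "0 < t")
      case True
      then have "\<exists>l. (f \<longlongrightarrow> l) (at_left t)" using f t by (simp add: skorokhod_paths_def)
      then obtain l where "(f \<longlongrightarrow> l) (at_left t)" by blast
      then have "\<forall>\<^sub>F s in at_left t. dist (f s) l < 1" by (rule tendstoD) simp
      then obtain b where b: "b < t" "\<And>y. b < y \<Longrightarrow> y < t \<Longrightarrow> dist (f y) l < 1"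
        unfolding eventually_at_left_field by auto
      have "f ` ({t - (t - b)<..<t} \<inter> {0..T}) \<subseteq> ball l 1" using b by (auto simp: dist_commute)
      then show ?thesis using b by (intro exI[of _ "t - b"]) (simp add: bounded_subset[OF bounded_ball])
    next
      case False
      then have "{t - 1<..<t} \<inter> {0..T} = {}" using t by auto
      then show ?thesis by (intro exI[of _ 1]) auto
    qed
    then obtain e2 where e2: "e2 > 0" "bounded (f ` ({t - e2<..<t} \<inter> {0..T}))" by blast
    have "{t - min e1 e2<..<t + min e1 e2} \<inter> {0..T} \<subseteq>
        insert t (({t<..<t + e1} \<inter> {0..T}) \<union> ({t - e2<..<t} \<inter> {0..T}))"
      by auto
    then have "f ` ({t - min e1 e2<..<t + min e1 e2} \<inter> {0..T}) \<subseteq>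
        f ` insert t (({t<..<t + e1} \<inter> {0..T}) \<union> ({t - e2<..<t} \<inter> {0..T}))"
      by (rule image_mono)
    then have "bounded (f ` ({t - min e1 e2<..<t + min e1 e2} \<inter> {0..T}))"
      by (rule bounded_subset[rotated]) (use e1 e2 in \<open>simp add: image_Un\<close>)
    then show ?thesis using e1 e2 by (intro exI[of _ "min e1 e2"]) auto
  qed
  then have "\<forall>t\<in>{0..T}. \<exists>e>0. bounded (f ` ({t - e<..<t + e} \<inter> {0..T}))" by (intro ballI)
  from bchoice[OF this] obtain e where
    e0: "\<forall>t\<in>{0..T}. e t > 0 \<and> bounded (f ` ({t - e t<..<t + e t} \<inter> {0..T}))" ..
  have e: "e t > 0 \<and> bounded (f ` ({t - e t<..<t + e t} \<inter> {0..T}))" if "t \<in> {0..T}" for t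
    using bspec[OF e0 that] .
  have "{0..T} \<subseteq> (\<Union>t\<in>{0..T}. {t - e t<..<t + e t})"
  proof
    fix t assume "t \<in> {0..T}" then show "t \<in> (\<Union>t\<in>{0..T}. {t - e t<..<t + e t})"
      using e[of t] by (intro UN_I[of t]) auto
  qed
  then obtain C where C: "C \<subseteq> {0..T}" "finite C" "{0..T} \<subseteq> (\<Union>t\<in>C. {t - e t<..<t + e t})"
    by (rule compactE_image[OF compact_Icc, rotated]) auto
  then have "f ` {0..T} \<subseteq> (\<Union>t\<in>C. f ` ({t - e t<..<t + e t} \<inter> {0..T}))" by blast
  moreover have "bounded (\<Union>t\<in>C. f ` ({t - e t<..<t + e t} \<inter> {0..T}))"
    using C e by (intro bounded_UN) auto
  ultimately show ?thesis by (rule bounded_subset[rotated])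
qed

lemma skorokhod_close_ex:
  fixes f g :: "real \<Rightarrow> 'e::metric_space"
  assumes "f \<in> skorokhod_paths T" "g \<in> skorokhod_paths T"
  shows "\<exists>r. skorokhod_close T f g r"
proof -
  have "bounded (f ` {0..T} \<union> g ` {0..T})"
    using skorokhod_path_bounded[OF assms(1)] skorokhod_path_bounded[OF assms(2)] by simp
  then obtain B where
    B: "\<forall>x\<in>f ` {0..T} \<union> g ` {0..T}. \<forall>y\<in>f ` {0..T} \<union> g ` {0..T}. dist x y \<le> B"
    unfolding bounded_two_points ..
  have "dist (f t) (g t) \<le> B" if "t \<in> {0..T}" for t
    using B that by simp
  then have "skorokhod_close T f g (max 0 B)"
    unfolding skorokhod_close_def using time_change_id[of T]
    by (intro conjI bexI[of _ "\<lambda>t. t"]) (simp_all add: le_max_iff_disj)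
  then show ?thesis ..
qed

lemma skorokhod_close_sym: assumes "skorokhod_close T f g r" shows "skorokhod_close T g f r"
proof -
  obtain \<phi> where \<phi>: "\<phi> \<in> time_changes T" "0 \<le> r"
      "\<And>t. t \<in> {0..T} \<Longrightarrow> \<bar>\<phi> t - t\<bar> \<le> r \<and> dist (f t) (g (\<phi> t)) \<le> r"
    using assms unfolding skorokhod_close_def by blast
  let ?g = "inv_into {0..T} \<phi>"
  have "\<bar>?g t - t\<bar> \<le> r \<and> dist (g t) (f (?g t)) \<le> r" if t: "t \<in> {0..T}" for t
  proof -
    have im: "t \<in> \<phi> ` {0..T}" using t \<phi>(1) by (simp add: time_changes_def)
    have "?g t \<in> {0..T}" "\<phi> (?g t) = t"
      using inv_into_into[OF im] f_inv_into_f[OF im] by auto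
    then show ?thesis using \<phi>(3)[of "?g t"] by (simp add: dist_commute abs_minus_commute)
  qed
  then show ?thesis unfolding skorokhod_close_def using time_change_inv[OF \<phi>(1)] \<phi>(2) by blast
qed

lemma skorokhod_close_trans:
  assumes "skorokhod_close T f g r" "skorokhod_close T g h s" shows "skorokhod_close T f h (r + s)"
proof -
  obtain \<phi> where \<phi>: "\<phi> \<in> time_changes T" "0 \<le> r"
      "\<And>t. t \<in> {0..T} \<Longrightarrow> \<bar>\<phi> t - t\<bar> \<le> r \<and> dist (f t) (g (\<phi> t)) \<le> r"
    using assms(1) unfolding skorokhod_close_def by blast
  obtain \<psi> where \<psi>: "\<psi> \<in> time_changes T" "0 \<le> s"
      "\<And>t. t \<in> {0..T} \<Longrightarrow> \<bar>\<psi> t - t\<bar> \<le> s \<and> dist (g t) (h (\<psi> t)) \<le> s"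
    using assms(2) unfolding skorokhod_close_def by blast
  have "\<bar>(\<psi> \<circ> \<phi>) t - t\<bar> \<le> r + s \<and> dist (f t) (h ((\<psi> \<circ> \<phi>) t)) \<le> r + s" if t: "t \<in> {0..T}" for t
    using \<phi>(3)[OF t] \<psi>(3)[OF time_change_bounds[OF \<phi>(1) t]]
      dist_triangle[of "f t" "h (\<psi> (\<phi> t))" "g (\<phi> t)"] by auto
  then show ?thesis unfolding skorokhod_close_def using time_change_comp[OF \<phi>(1) \<psi>(1)] \<phi>(2) \<psi>(2)
    by (intro conjI add_nonneg_nonneg bexI[of _ "\<psi> \<circ> \<phi>"] ballI) simp_all
qed

lemma skorokhod_close_eq:
  fixes f g :: "real \<Rightarrow> 'e::metric_space"
  assumes f: "f \<in> skorokhod_paths T" and g: "g \<in> skorokhod_paths T"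
    and cl: "\<And>e. e > 0 \<Longrightarrow> skorokhod_close T f g e"
  shows "f = g"
proof (rule extensionalityI[of f "{0..T}"])
  show "f \<in> extensional {0..T}" "g \<in> extensional {0..T}"
    using f g by (auto simp: skorokhod_paths_def)
  fix t assume t: "t \<in> {0..T}"
  have "dist (f t) (g t) \<le> 0 + e" if e: "e > 0" for e
  proof (cases "t = T")
    case True
    obtain \<phi> where "\<phi> \<in> time_changes T" "\<And>t. t \<in> {0..T} \<Longrightarrow> dist (f t) (g (\<phi> t)) \<le> e"
      using cl[OF e] unfolding skorokhod_close_def by blast
    then show ?thesis using time_change_end[of \<phi> T] t True by force
  next
    case False
    then have tT: "t < T" using t by auto
    have lim: "(f \<longlongrightarrow> f t) (at_right t)" "(g \<longlongrightarrow> g t) (at_right t)"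
      using f g t tT by (auto simp: skorokhod_paths_def)
    have "\<forall>\<^sub>F s in at_right t. dist (f s) (f t) < e / 3 \<and> dist (g s) (g t) < e / 3"
      using lim[THEN tendstoD, of "e / 3"] e by (auto intro: eventually_conj)
    then obtain b where b: "b > t" "\<And>y. t < y \<Longrightarrow> y < b \<Longrightarrow> dist (f y) (f t) < e / 3 \<and> dist (g y) (g t) < e / 3"
      unfolding eventually_at_right_field by auto
    define b' where "b' = min b T"
    define s where "s = (t + b') / 2"
    define r where "r = min (e / 3) ((b' - t) / 4)"
    have b': "t < b'" "b' \<le> b" "b' \<le> T" using b tT by (auto simp: b'_def)
    then have s: "t < s" "s < b" "s \<in> {0..T}" and r: "0 < r" "r \<le> e / 3" "r < s - t" "r < b - s"
      using e t by (auto simp: s_def r_def min_def field_simps)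
    obtain \<phi> where \<phi>: "\<bar>\<phi> s - s\<bar> \<le> r" "dist (f s) (g (\<phi> s)) \<le> r"
      using cl[OF r(1)] s unfolding skorokhod_close_def by blast
    have "dist (f s) (f t) < e / 3" "dist (g (\<phi> s)) (g t) < e / 3"
      using b(2)[of s] b(2)[of "\<phi> s"] \<phi> r s by auto
    then show ?thesis using \<phi>(2) r(2)
        dist_triangle[of "f t" "g t" "f s"] dist_triangle[of "f s" "g t" "g (\<phi> s)"]
      by (simp add: dist_commute)
  qed
  then have "dist (f t) (g t) \<le> 0" by (rule field_le_epsilon)
  then show "f t = g t" by simp
qed

lemma skorokhod_metric:
  "Metric_space (skorokhod_paths T :: (real \<Rightarrow> 'e::metric_space) set) (skorokhod_dist T)"
proof -
  let ?M = "skorokhod_paths T :: (real \<Rightarrow> 'e) set"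
  have d: "skorokhod_dist T f g = (if f \<in> ?M \<and> g \<in> ?M then Inf {r. skorokhod_close T f g r} else 0)" for f g
    by (simp add: skorokhod_dist_def)
  have ne: "{r. skorokhod_close T f g r} \<noteq> {}" if "f \<in> ?M" "g \<in> ?M" for f g
    using skorokhod_close_ex[OF that] by auto
  have pos: "0 \<le> r" if "skorokhod_close T f g r" for r and f g :: "real \<Rightarrow> 'e" using that by (simp add: skorokhod_close_def)
  have bb: "bdd_below {r. skorokhod_close T f g r}" for f g :: "real \<Rightarrow> 'e"
    by (rule bdd_belowI[of _ 0]) (auto dest: pos)
  have up: "\<exists>r<e. skorokhod_close T f g r" if "f \<in> ?M" "g \<in> ?M" "skorokhod_dist T f g < e" for f g e
    using that cInf_lessD[OF ne[OF that(1,2)], of e] by (auto simp: d)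
  have le: "skorokhod_dist T f g \<le> r" if "f \<in> ?M" "g \<in> ?M" "skorokhod_close T f g r" for f g r
    using that cInf_lower[OF _ bb, of r f g] by (auto simp: d)
  have mono: "skorokhod_close T f g s" if "skorokhod_close T f g r" "r \<le> s" for r s and f g :: "real \<Rightarrow> 'e"
    using that unfolding skorokhod_close_def by (meson order_trans)
  have refl: "skorokhod_close T f f 0" for f :: "real \<Rightarrow> 'e"
    unfolding skorokhod_close_def using time_change_id by (intro conjI bexI[of _ "\<lambda>t. t"]) auto
  have nn: "0 \<le> skorokhod_dist T f g" for f g :: "real \<Rightarrow> 'e"
    using ne[of f g] by (auto simp: d intro!: cInf_greatest dest: pos)
  show ?thesis
  proof
    show "0 \<le> skorokhod_dist T f g" for f g :: "real \<Rightarrow> 'e" by (rule nn)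
    show "skorokhod_dist T f g = skorokhod_dist T g f" for f g :: "real \<Rightarrow> 'e"
    proof -
      have "{r. skorokhod_close T f g r} = {r. skorokhod_close T g f r}" using skorokhod_close_sym by blast
      then show ?thesis by (auto simp: d)
    qed
    show "skorokhod_dist T f g = 0 \<longleftrightarrow> f = g" if fg: "f \<in> ?M" "g \<in> ?M" for f g
    proof
      assume z: "skorokhod_dist T f g = 0"
      show "f = g"
      proof (rule skorokhod_close_eq[OF fg])
        fix e :: real assume "e > 0"
        then show "skorokhod_close T f g e" using up[OF fg, of e] z mono by (metis less_imp_le)
      qed
    next
      assume "f = g"
      then show "skorokhod_dist T f g = 0" using le[OF fg] refl nn by (metis order_antisym)
    qed
    show "skorokhod_dist T f h \<le> skorokhod_dist T f g + skorokhod_dist T g h"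
      if m: "f \<in> ?M" "g \<in> ?M" "h \<in> ?M" for f g h
    proof (rule field_le_epsilon)
      fix e :: real assume e: "e > 0"
      obtain r where r: "r < skorokhod_dist T f g + e / 2" "skorokhod_close T f g r"
        using up[OF m(1,2), of "skorokhod_dist T f g + e / 2"] e by auto
      obtain s where s: "s < skorokhod_dist T g h + e / 2" "skorokhod_close T g h s"
        using up[OF m(2,3), of "skorokhod_dist T g h + e / 2"] e by auto
      show "skorokhod_dist T f h \<le> skorokhod_dist T f g + skorokhod_dist T g h + e"
        using le[OF m(1,3) skorokhod_close_trans[OF r(2) s(2)]] r(1) s(1) by linarith
    qed
  qed
qed

lemma topspace_skorokhod: "topspace (skorokhod_topology T) = skorokhod_paths T"
  unfolding skorokhod_topology_def
  by (rule Metric_space.topspace_mtopology[OF skorokhod_metric])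

definition converges_in_distribution ::
    "'a topology \<Rightarrow> ('i \<Rightarrow> 'a pmf) \<Rightarrow> 'a pmf \<Rightarrow> 'i filter \<Rightarrow> bool" where
  "converges_in_distribution X P Q F \<longleftrightarrow>
     (\<forall>\<^sub>F i in F. set_pmf (P i) \<subseteq> topspace X) \<and> set_pmf Q \<subseteq> topspace X \<and>
     (\<forall>f. continuous_map X euclideanreal f \<and> bounded (f ` topspace X) \<longrightarrow>
       ((\<lambda>i. measure_pmf.expectation (P i) f) \<longlongrightarrow> measure_pmf.expectation Q f) F)"

definition interpolation :: "real \<Rightarrow> real \<Rightarrow> (nat \<Rightarrow> 'e) \<Rightarrow> real \<Rightarrow> 'e" where
  "interpolation \<epsilon> T y = restrict (\<lambda>t. y (nat \<lfloor>t / \<epsilon>\<rfloor>)) {0..T}"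

end

theory Submission imports Defs
begin

text \<open>
 The gradient estimator of a batch is affine in finitely many memory variables: the signed number and
 the signed total age of the phantoms carried over for each possible target. Together with the state at the
 beginning of the batch they form a Markov chain, on which the batch acts by a linear operator on
 functions affine in the memory. Irreducibility, aperiodicity and the compactness of the parameter
 box give, uniformly in the parameter, a minorization for the state and a geometric decay of the
 memory (each target is hit), hence geometric ergodicity and stationary means that are Lipschitz in
 the parameter. The covariance \<open>\<kappa>\<close> enters because \<open>Bhat\<close> and the gradient estimator are computed from
 the same batch.

 Since parameter and multipliers move by \<open>O(\<epsilon>)\<close> per batch, a finite Poisson sum replaces estimators
 by their stationary means at a total cost \<open>o(1 / \<epsilon>)\<close>. The projection is nonexpansive and the
 reflection term of the ODE is normal to the box, so a discrete Gronwall inequality shows that the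
 mean square distance to any solution tends to 0, uniformly over the batches. This yields
 uniqueness; existence comes from the projected Euler scheme. Short blocks and Markov's inequality
 turn the mean square convergence into uniform convergence in probability.
\<close>

section \<open>Uniformly ergodic families of operators\<close>

text \<open>The obstacle is that the gradient estimator is unbounded: arbitrarily many phantoms of
  arbitrary age may be pending, and only second moments are available. Increments of the parameter
  are therefore bounded by \<open>ep\<close> times a random envelope \<open>V\<close> that is
  controlled in mean square, and every averaging estimate is written for such increments. The memory
  closes up because pending phantoms with a common target are either all released or all kept, and
  those kept age by the same \<open>N\<close>; the number feeds the age, but not conversely.
  Survival depends on the target, so each target gets its own two-dimensional memory and its own
  operator, and the estimator is a sum over targets. Multiplying by a function of the batch
  observations preserves affinity, so products of \<open>Bhat\<close> with a gradient estimator are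
  averaged by the same means. Frozen averages have the same limit from every initial law, in
  particular from the one in \<open>stat_exp\<close>. The comparison with the ODE starts from a
  solution already in hand, which is why existence has a construction of its own.\<close>

abbreviation expect :: "'a pmf => ('a => 'b) => 'b::{banach, second_countable_topology}" where
 "expect p \<equiv> measure_pmf.expectation p"

text \<open>The increments beyond \<open>n\<close> sum to at most the geometric tail
  \<open>A / (1 - r) * r ^ n\<close>, so the sequence is Cauchy with a rate. Serves the ergodic
  means as well as the dyadic Euler paths.\<close>

lemma geometric_increments_limit:
 fixes s :: "nat => 'v::banach"
 assumes inc: "\<And>n. norm (s (Suc n) - s n) <= A * r ^ n" and r: "0 < r" "r < 1"
 shows "s \<longlonglongrightarrow> lim s" "norm (s n - lim s) <= A / (1 - r) * r ^ n"
proof -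
 have sum1: "summable (%n. A * r ^ n)"
  using r by (intro summable_mult summable_geometric) auto
 have sabs: "summable (%n. s (Suc n) - s n)"
  by (rule summable_comparison_test'[OF sum1]) (use inc in auto)
 have tel: "(\<Sum>i<m. s (Suc (i + n)) - s (i + n)) = s (m + n) - s n" for m n
  by (induction m) auto
 have "(%m. s m - s 0) \<longlonglongrightarrow> (\<Sum>n. s (Suc n) - s n)"
  using summable_LIMSEQ[OF sabs] by (simp add: sum_lessThan_telescope)
 then have L: "s \<longlonglongrightarrow> (\<Sum>n. s (Suc n) - s n) + s 0"
  using tendsto_add[OF _ tendsto_const[of "s 0"]] by fastforce
 then show L2: "s \<longlonglongrightarrow> lim s" by (metis convergentI convergent_LIMSEQ_iff)
 have bnd: "norm (s (m + n) - s n) <= A / (1 - r) * r ^ n" for m n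
 proof -
  have A: "0 <= A" using order_trans[OF norm_ge_zero inc[of 0]] by simp
  have "norm (s (m + n) - s n) <= (\<Sum>i<m. norm (s (Suc (i + n)) - s (i + n)))"
   unfolding tel[symmetric] by (rule norm_sum)
  also have "... <= (\<Sum>i<m. A * r ^ n * r ^ i)"
   by (intro sum_mono) (use inc[of "_ + n"] in \<open>simp add: power_add mult_ac\<close>)
  also have "... = A * r ^ n * (\<Sum>i<m. r ^ i)" by (simp add: sum_distrib_left)
  also have "... <= A * r ^ n * (1 / (1 - r))"
  proof (intro mult_left_mono)
   have "(\<Sum>i<m. r ^ i) = (1 - r ^ m) / (1 - r)" using r by (simp add: sum_gp_strict)
   also have "... <= 1 / (1 - r)" using r by (intro divide_right_mono) auto
   finally show "(\<Sum>i<m. r ^ i) <= 1 / (1 - r)" .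
  qed (use A r in auto)
  finally show ?thesis by simp
 qed
 have "(%m. norm (s (m + n) - s n)) \<longlonglongrightarrow> norm (lim s - s n)"
  by (intro tendsto_intros LIMSEQ_ignore_initial_segment L2)
 then have "norm (lim s - s n) <= A / (1 - r) * r ^ n"
  by (rule LIMSEQ_le_const2) (use bnd in auto)
 then show "norm (s n - lim s) <= A / (1 - r) * r ^ n" by (simp add: norm_minus_commute)
qed

lemma linear_funpow:
 fixes f :: "'v::real_vector => 'v"
 shows "linear f ==> linear (f ^^ n)"
 by (induction n) (auto intro: linear_compose linear_id)

text \<open>\<open>geom\<close> only grants some constant for each \<open>p\<close>,
  \<open>n\<close> and \<open>v\<close>; the functional \<open>ev\<close>, normalised at
  \<open>one\<close>, turns it into a definite number. All constants are uniform over
  \<open>H\<close>, which is what makes the limits Lipschitz in the parameter.\<close>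

locale ergodic_family =
 fixes H :: "'p::metric_space set" and U :: "'p => 'v::real_normed_vector => 'v"
  and one :: 'v and ev :: "'v => real" and K L C r :: real
 assumes lin: "p \<in> H ==> linear (U p)"
  and bd: "p \<in> H ==> norm (U p v) <= K * norm v" and K: "1 <= K"
  and U_one: "p \<in> H ==> U p one = one"
  and lip: "p \<in> H ==> p' \<in> H ==> norm (U p v - U p' v) <= L * dist p p' * norm v" and L: "0 <= L"
  and lin_ev: "linear ev" and ev_bd: "\<bar>ev v\<bar> <= norm v" and ev_one: "ev one = 1"
  and r: "0 < r" "r < 1" and C: "0 <= C"
  and geom: "p \<in> H ==> \<exists>c. norm ((U p ^^ n) v - c *\<^sub>R one) <= C * r ^ n * norm v"
begin

definition erg_mean :: "'p => 'v => real" where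
 "erg_mean p v = lim (%n. ev ((U p ^^ n) v))"

text \<open>Uniform constants, in the order in which they arise: centring by \<open>ev\<close>
  instead of the unknown constant, speed of convergence of \<open>ev\<close>, distance of the
  iterates to the limit, bound on all powers, Lipschitz constant of the powers.\<close>

definition C1 where "C1 = C * (1 + norm one)"
definition C2 where "C2 = (K + 1) * C1 / (1 - r)"
definition C3 where "C3 = C1 + C2 * norm one"
definition C4 where "C4 = C3 + (C2 + 1) * norm one"
definition C5 where "C5 = C4 * L * C3 / (1 - r)"

lemma consts_nonneg: "0 <= C1" "0 <= C2" "0 <= C3" "0 <= C4" "0 <= C5"
proof -
 show 1: "0 <= C1" using C by (simp add: C1_def)
 show 2: "0 <= C2" using 1 K r by (simp add: C2_def)
 show 3: "0 <= C3" using 1 2 by (simp add: C3_def)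
 show 4: "0 <= C4" using 2 3 by (simp add: C4_def)
 show "0 <= C5" using L r 3 4 by (simp add: C5_def)
qed

text \<open>Applying \<open>ev\<close> to the bound in \<open>geom\<close> shows that the unknown
  constant is within the same distance of \<open>ev ((U p ^^ n) v)\<close>; exchanging the two costs
  the factor \<open>1 + norm one\<close>.\<close>

lemma centered_bound:
 assumes p: "p \<in> H"
 shows "norm ((U p ^^ n) v - ev ((U p ^^ n) v) *\<^sub>R one) <= C1 * r ^ n * norm v"
proof -
 let ?u = "(U p ^^ n) v"
 obtain c where c: "norm (?u - c *\<^sub>R one) <= C * r ^ n * norm v" using geom[OF p] by blast
 have "ev ?u - c = ev (?u - c *\<^sub>R one)"
  by (simp add: linear_diff[OF lin_ev] linear_scale[OF lin_ev] ev_one)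
 then have e: "\<bar>ev ?u - c\<bar> <= C * r ^ n * norm v" using ev_bd[of "?u - c *\<^sub>R one"] c by linarith
 have "?u - ev ?u *\<^sub>R one = (?u - c *\<^sub>R one) - (ev ?u - c) *\<^sub>R one" by (simp add: algebra_simps)
 then have "norm (?u - ev ?u *\<^sub>R one) <= norm (?u - c *\<^sub>R one) + \<bar>ev ?u - c\<bar> * norm one"
  by (metis norm_triangle_ineq4 norm_scaleR)
 also have "... <= C * r ^ n * norm v + C * r ^ n * norm v * norm one"
  using c e by (intro add_mono mult_right_mono) auto
 finally show ?thesis by (simp add: C1_def algebra_simps)
qed

text \<open>Since \<open>U p\<close> fixes \<open>one\<close>, the increment equals
  \<open>ev\<close> of \<open>U p\<close> applied to the centred iterate, which is geometrically
  small.\<close>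

lemma ev_increment:
 assumes p: "p \<in> H"
 shows "\<bar>ev ((U p ^^ Suc n) v) - ev ((U p ^^ n) v)\<bar> <= ((K + 1) * C1 * norm v) * r ^ n"
proof -
 let ?u = "(U p ^^ n) v"
 let ?w = "?u - ev ?u *\<^sub>R one"
 have "U p ?w = U p ?u - ev ?u *\<^sub>R one"
  by (simp add: linear_diff[OF lin[OF p]] linear_scale[OF lin[OF p]] U_one[OF p])
 then have "ev (U p ?u) - ev ?u = ev (U p ?w)"
  by (simp add: linear_diff[OF lin_ev] linear_scale[OF lin_ev] ev_one)
 then have "\<bar>ev (U p ?u) - ev ?u\<bar> <= K * norm ?w"
  using ev_bd[of "U p ?w"] bd[OF p, of ?w] by linarith
 also have "... <= (K + 1) * norm ?w" by (intro mult_right_mono) auto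
 also have "... <= (K + 1) * (C1 * r ^ n * norm v)"
  using K by (intro mult_left_mono centered_bound p) auto
 finally show ?thesis by (simp add: mult_ac)
qed

lemma erg_mean_convergent:
 assumes p: "p \<in> H"
 shows "(%n. ev ((U p ^^ n) v)) \<longlonglongrightarrow> erg_mean p v"
 using geometric_increments_limit(1)[of "%n. ev ((U p ^^ n) v)", unfolded real_norm_def, OF ev_increment[OF p, of _ v] r]
 by (simp add: erg_mean_def)

lemma ev_rate:
 assumes p: "p \<in> H"
 shows "\<bar>ev ((U p ^^ n) v) - erg_mean p v\<bar> <= C2 * r ^ n * norm v"
 using geometric_increments_limit(2)[of "%n. ev ((U p ^^ n) v)", unfolded real_norm_def, OF ev_increment[OF p, of _ v] r, of n]
 by (simp add: erg_mean_def C2_def mult_ac)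

lemma funpow_rate:
 assumes p: "p \<in> H"
 shows "norm ((U p ^^ n) v - erg_mean p v *\<^sub>R one) <= C3 * r ^ n * norm v"
proof -
 let ?u = "(U p ^^ n) v"
 have "?u - erg_mean p v *\<^sub>R one = (?u - ev ?u *\<^sub>R one) + (ev ?u - erg_mean p v) *\<^sub>R one"
  by (simp add: algebra_simps)
 then have "norm (?u - erg_mean p v *\<^sub>R one)
   <= norm (?u - ev ?u *\<^sub>R one) + \<bar>ev ?u - erg_mean p v\<bar> * norm one"
  by (metis norm_triangle_ineq norm_scaleR)
 also have "... <= C1 * r ^ n * norm v + C2 * r ^ n * norm v * norm one"
  by (intro add_mono mult_right_mono centered_bound ev_rate p) auto
 finally show ?thesis by (simp add: C3_def algebra_simps)
qed

lemma erg_mean_bound: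
 assumes p: "p \<in> H"
 shows "\<bar>erg_mean p v\<bar> <= (C2 + 1) * norm v"
 using ev_rate[OF p, of 0 v] ev_bd[of v] by (simp add: algebra_simps)

lemma funpow_bound:
 assumes p: "p \<in> H"
 shows "norm ((U p ^^ n) v) <= C4 * norm v"
proof -
 have "norm ((U p ^^ n) v) <= norm ((U p ^^ n) v - erg_mean p v *\<^sub>R one) + norm (erg_mean p v *\<^sub>R one)"
  by (metis norm_triangle_ineq diff_add_cancel)
 also have "... <= C3 * r ^ n * norm v + (C2 + 1) * norm v * norm one"
  using erg_mean_bound[OF p, of v] funpow_rate[OF p, of n v]
  by (auto intro!: add_mono mult_right_mono)
 also have "C3 * r ^ n * norm v <= C3 * 1 * norm v"
  using r consts_nonneg by (intro mult_right_mono mult_left_mono power_le_one) auto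
 finally show ?thesis by (simp add: C4_def algebra_simps)
qed

text \<open>
 Telescoping \<open>U\<^sup>n - U'\<^sup>n = \<Sum> U\<^sup>j (U - U') U'\<^sup>i\<close>: the difference \<open>U - U'\<close> kills the constants, so that
 only the geometrically small part of \<open>U'\<^sup>i v\<close> counts.
\<close>

lemma funpow_lipschitz:
 assumes p: "p \<in> H" "p' \<in> H"
 shows "norm ((U p ^^ n) v - (U p' ^^ n) v) <= C5 * dist p p' * norm v"
proof -
 have tel: "(U p ^^ n) v - (U p' ^^ n) v =
   (\<Sum>i<n. (U p ^^ (n - Suc i)) (U p ((U p' ^^ i) v) - U p' ((U p' ^^ i) v)))"
 proof (induction n)
  case (Suc n)
  have "(U p ^^ Suc n) v - (U p' ^^ Suc n) v
    = U p ((U p ^^ n) v - (U p' ^^ n) v) + (U p ((U p' ^^ n) v) - U p' ((U p' ^^ n) v))"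
   by (simp add: linear_diff[OF lin[OF p(1)]])
  also have "U p ((U p ^^ n) v - (U p' ^^ n) v) =
   (\<Sum>i<n. (U p ^^ (Suc n - Suc i)) (U p ((U p' ^^ i) v) - U p' ((U p' ^^ i) v)))"
   unfolding Suc linear_sum[OF lin[OF p(1)]]
  proof (intro sum.cong refl)
   fix i assume "i \<in> {..<n}"
   then have "Suc n - Suc i = Suc (n - Suc i)" by auto
   then show "U p ((U p ^^ (n - Suc i)) (U p ((U p' ^^ i) v) - U p' ((U p' ^^ i) v))) =
     (U p ^^ (Suc n - Suc i)) (U p ((U p' ^^ i) v) - U p' ((U p' ^^ i) v))" by simp
  qed
  finally show ?case by simp
 qed simp
 have term1: "norm (U p ((U p' ^^ i) v) - U p' ((U p' ^^ i) v)) <= L * dist p p' * (C3 * r ^ i * norm v)" for i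
 proof -
  let ?w = "(U p' ^^ i) v" and ?c = "erg_mean p' v *\<^sub>R one"
  have "U p ?w - U p' ?w = U p (?w - ?c) - U p' (?w - ?c)"
   using p by (simp add: linear_diff[OF lin] linear_scale[OF lin] U_one)
  also have "norm ... <= L * dist p p' * norm (?w - ?c)" by (rule lip[OF p])
  also have "... <= L * dist p p' * (C3 * r ^ i * norm v)"
   using L by (intro mult_left_mono funpow_rate p) auto
  finally show ?thesis .
 qed
 have "norm ((U p ^^ n) v - (U p' ^^ n) v) <= (\<Sum>i<n. C4 * (L * dist p p' * (C3 * r ^ i * norm v)))"
  unfolding tel
 proof (intro order_trans[OF norm_sum] sum_mono)
  fix i
  have "norm ((U p ^^ (n - Suc i)) (U p ((U p' ^^ i) v) - U p' ((U p' ^^ i) v)))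
    <= C4 * norm (U p ((U p' ^^ i) v) - U p' ((U p' ^^ i) v))" by (rule funpow_bound[OF p(1)])
  also have "... <= C4 * (L * dist p p' * (C3 * r ^ i * norm v))"
   using consts_nonneg by (intro mult_left_mono term1) auto
  finally show "norm ((U p ^^ (n - Suc i)) (U p ((U p' ^^ i) v) - U p' ((U p' ^^ i) v)))
    <= C4 * (L * dist p p' * (C3 * r ^ i * norm v))" .
 qed
 also have "... = (C4 * L * C3 * dist p p' * norm v) * (\<Sum>i<n. r ^ i)"
  unfolding sum_distrib_left by (intro sum.cong) (simp_all add: mult_ac)
 also have "... <= (C4 * L * C3 * dist p p' * norm v) * (1 / (1 - r))"
 proof (intro mult_left_mono)
  have "(\<Sum>i<n. r ^ i) = (1 - r ^ n) / (1 - r)" using r by (simp add: sum_gp_strict)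
  also have "... <= 1 / (1 - r)" using r by (intro divide_right_mono) auto
  finally show "(\<Sum>i<n. r ^ i) <= 1 / (1 - r)" .
 qed (use consts_nonneg L in auto)
 finally show ?thesis by (simp add: C5_def mult_ac)
qed

lemma erg_mean_diff: "p \<in> H ==> erg_mean p (v - w) = erg_mean p v - erg_mean p w"
proof -
 assume p: "p \<in> H"
 have "(%n. ev ((U p ^^ n) (v - w))) = (%n. ev ((U p ^^ n) v) - ev ((U p ^^ n) w))"
  by (simp add: linear_diff[OF linear_funpow[OF lin[OF p]]] linear_diff[OF lin_ev])
 then have "(%n. ev ((U p ^^ n) (v - w))) \<longlonglongrightarrow> erg_mean p v - erg_mean p w"
  using tendsto_diff[OF erg_mean_convergent[OF p] erg_mean_convergent[OF p]] by simp
 then show ?thesis using erg_mean_convergent[OF p] by (rule LIMSEQ_unique[rotated])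
qed

lemma erg_mean_lipschitz:
 assumes p: "p \<in> H" "p' \<in> H"
 shows "\<bar>erg_mean p v - erg_mean p' v\<bar> <= C5 * dist p p' * norm v"
proof -
 have "(%n. \<bar>ev ((U p ^^ n) v) - ev ((U p' ^^ n) v)\<bar>) \<longlonglongrightarrow> \<bar>erg_mean p v - erg_mean p' v\<bar>"
  by (intro tendsto_intros erg_mean_convergent p)
 moreover have "\<bar>ev ((U p ^^ n) v) - ev ((U p' ^^ n) v)\<bar> <= C5 * dist p p' * norm v" for n
  using ev_bd[of "(U p ^^ n) v - (U p' ^^ n) v"] funpow_lipschitz[OF p, of n v]
  by (simp add: linear_diff[OF lin_ev])
 ultimately show ?thesis by (intro LIMSEQ_le_const2) auto
qed

text \<open>Meant for test vectors that themselves depend on the parameter, such as the expectation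
  of a batch functional.\<close>

lemma erg_mean_lipschitz2:
 assumes p: "p \<in> H" "p' \<in> H"
 shows "\<bar>erg_mean p v - erg_mean p' v'\<bar> <= C5 * dist p p' * norm v + (C2 + 1) * norm (v - v')"
 using erg_mean_lipschitz[OF p, of v] erg_mean_bound[OF p(2), of "v - v'"]
 by (simp add: erg_mean_diff[OF p(2)])

end

section \<open>Markov chains with an affine memory\<close>

text \<open>All path laws below have finite support, so expectations are finite sums and even
  unbounded functionals of the memory are integrable.\<close>

lemma expectation_finite_sum:
 fixes f :: "'a => real"
 assumes "finite A" "set_pmf p \<subseteq> A"
 shows "expect p f = (\<Sum>z\<in>A. pmf p z * f z)"
 using assms by (subst integral_measure_pmf[of A]) auto

lemma expectation_mono_finite:
 fixes f g :: "'a => real"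
 assumes "finite (set_pmf p)" "\<And>z. z \<in> set_pmf p ==> f z <= g z"
 shows "expect p f <= expect p g"
 using assms by (intro integral_mono_AE integrable_measure_pmf_finite) (auto simp: AE_measure_pmf_iff)

lemma expectation_cong_pmf:
 fixes f g :: "'a => 'b::{banach, second_countable_topology}"
 assumes "\<And>z. z \<in> set_pmf p ==> f z = g z"
 shows "expect p f = expect p g"
 using assms by (intro integral_cong_AE) (auto simp: AE_measure_pmf_iff)

lemma expectation_abs_le_finite:
 fixes f g :: "'a => real"
 assumes "finite (set_pmf p)" "\<And>z. z \<in> set_pmf p ==> \<bar>f z\<bar> <= g z"
 shows "\<bar>expect p f\<bar> <= expect p g"
 using assms by (intro order_trans[OF integral_abs_bound] expectation_mono_finite)

lemma expectation_add_finite: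
 fixes f g :: "'a => real"
 assumes "finite (set_pmf p)"
 shows "expect p (%z. f z + g z) = expect p f + expect p g"
 using assms by (intro Bochner_Integration.integral_add integrable_measure_pmf_finite)

lemma expectation_diff_finite:
 fixes f g :: "'a => real"
 assumes "finite (set_pmf p)"
 shows "expect p (%z. f z - g z) = expect p f - expect p g"
 using assms by (intro Bochner_Integration.integral_diff integrable_measure_pmf_finite)

lemma expectation_sum_finite:
 fixes f :: "'i => 'a => real"
 assumes "finite (set_pmf p)"
 shows "expect p (%z. \<Sum>i\<in>I. f i z) = (\<Sum>i\<in>I. expect p (f i))"
 using assms by (intro Bochner_Integration.integral_sum integrable_measure_pmf_finite)

lemma expectation_const [simp]:
 "expect p (%_. c :: real) = c"
 by (simp add: measure_pmf.prob_space)

lemma finite_set_bind_pmf: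
 assumes "finite (set_pmf p)" "\<And>x. x \<in> set_pmf p ==> finite (set_pmf (f x))"
 shows "finite (set_pmf (bind_pmf p f))"
 using assms by (simp add: set_bind_pmf)

lemma expectation_bind_finite:
 fixes g :: "'b => real"
 assumes fin: "finite (set_pmf p)" "\<And>x. x \<in> set_pmf p ==> finite (set_pmf (f x))"
 shows "expect (bind_pmf p f) g =
  expect p (%x. expect (f x) g)"
proof -
 let ?A = "set_pmf (bind_pmf p f)"
 have A: "finite ?A" by (rule finite_set_bind_pmf[OF fin])
 have "expect (bind_pmf p f) g = (\<Sum>z\<in>?A. pmf (bind_pmf p f) z * g z)"
  by (rule expectation_finite_sum[OF A]) simp
 also have "... = (\<Sum>z\<in>?A. (\<Sum>x\<in>set_pmf p. pmf p x * pmf (f x) z) * g z)"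
  by (intro sum.cong refl) (simp add: pmf_bind expectation_finite_sum[OF fin(1)])
 also have "... = (\<Sum>x\<in>set_pmf p. pmf p x * (\<Sum>z\<in>?A. pmf (f x) z * g z))"
  unfolding sum_distrib_left sum_distrib_right by (subst sum.swap) (simp add: mult_ac)
 also have "... = (\<Sum>x\<in>set_pmf p. pmf p x * expect (f x) g)"
 proof (intro sum.cong refl)
  fix x assume "x \<in> set_pmf p"
  then have "set_pmf (f x) \<subseteq> ?A" by (auto simp: set_bind_pmf)
  then show "pmf p x * (\<Sum>z\<in>?A. pmf (f x) z * g z) = pmf p x * expect (f x) g"
   using expectation_finite_sum[OF A] by simp
 qed
 finally show ?thesis using expectation_finite_sum[OF fin(1)] by simp
qed

definition seg_exp :: "('b \<times> 's) pmf => ('b => 's => real) => real" where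
 "seg_exp q F = expect q (%z. F (fst z) (snd z))"

lemma norm_vec_lambda_le:
 fixes f :: "'s::finite => real"
 assumes "\<And>x. \<bar>f x\<bar> <= c"
 shows "norm (\<chi> x. f x) <= real CARD('s) * c"
proof -
 have "norm (\<chi> x. f x) <= (\<Sum>x\<in>UNIV. \<bar>f x\<bar>)" using norm_le_l1_cart[of "\<chi> x. f x"] by simp
 also have "... <= (\<Sum>x\<in>(UNIV::'s set). c)" by (intro sum_mono assms)
 finally show ?thesis by simp
qed

text \<open>With \<open>C = (2 / \<delta> + 2) * A\<close> one has
  \<open>(1 - \<delta>) * C + A <= C * (1 - \<delta> / 2)\<close>, so the bound reproduces itself
  when \<open>1 - \<delta> / 2 <= r ^ m\<close>. The summand \<open>2\<close> covers the first
  \<open>m\<close> terms, where \<open>A <= 2 * A * (1 - \<delta> / 2)\<close>.\<close>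

lemma geometric_recursion_bound:
 fixes s :: "nat => real"
 assumes rec: "\<And>j. s (j + m) <= (1 - \<delta>) * s j + A * t ^ j"
  and init: "\<And>j. j < m ==> s j <= A" and m: "1 <= m" and A: "0 <= A"
  and \<delta>: "0 < \<delta>" "\<delta> <= 1" and r: "0 < r" "r < 1" "t <= r" "0 <= t" "1 - \<delta> / 2 <= r ^ m"
 shows "s j <= (2 / \<delta> + 2) * A * r ^ j"
proof (induction j rule: less_induct)
 case (less j)
 let ?C = "(2 / \<delta> + 2) * A"
 show ?case
 proof (cases "j < m")
  case True
  have "s j <= A" using init True .
  also have "A <= 2 * A * (1 - \<delta> / 2)" using A \<delta> by (simp add: algebra_simps mult_left_le)
  also have "... <= 2 * A * r ^ m" using A r by (intro mult_left_mono) auto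
  also have "... <= ?C * r ^ m" using A \<delta> r by (intro mult_right_mono) auto
  also have "... <= ?C * r ^ j" using A \<delta> r True by (intro mult_left_mono power_decreasing) auto
  finally show ?thesis .
 next
  case False
  then obtain i where i: "j = i + m" by (metis le_add_diff_inverse2 not_less)
  have "s j <= (1 - \<delta>) * s i + A * t ^ i" unfolding i by (rule rec)
  also have "... <= (1 - \<delta>) * (?C * r ^ i) + A * r ^ i"
   using less[of i] i m \<delta> A r by (intro add_mono mult_left_mono power_mono) auto
  also have "... = ((1 - \<delta>) * ?C + A) * r ^ i" by (simp add: algebra_simps)
  also have "... <= (?C * r ^ m) * r ^ i"
  proof (intro mult_right_mono)
   have "(1 - \<delta>) * ?C + A <= ?C * (1 - \<delta> / 2)" using A \<delta> by (simp add: field_simps)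
   also have "... <= ?C * r ^ m" using A \<delta> r by (intro mult_left_mono) auto
   finally show "(1 - \<delta>) * ?C + A <= ?C * r ^ m" .
  qed (use r in auto)
  finally show ?thesis by (simp add: i power_add mult_ac)
 qed
qed

lemma ex_root_close:
 assumes "0 < \<delta>" "\<delta> <= (1::real)" "t < (1::real)" "0 <= t"
 shows "\<exists>r. 0 < r \<and> r < 1 \<and> t <= r \<and> 1 - \<delta> / 2 <= r ^ m"
proof -
 have "((%r::real. r ^ m) \<longlongrightarrow> 1 ^ m) (at_left 1)" by (intro tendsto_intros)
 then have 1: "\<forall>\<^sub>F r::real in at_left 1. 1 - \<delta> / 2 < r ^ m"
  using assms by (intro order_tendstoD) auto
 have "\<forall>\<^sub>F r::real in at_left 1. r \<in> {max t 0 <..< 1}" using assms by (intro eventually_at_left_real) auto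
 from eventually_happens[OF eventually_conj[OF 1 this]] show ?thesis
  by (auto intro: less_imp_le)
qed

text \<open>A record \<open>b\<close> of one batch comes with the next state. \<open>surv b\<close>
  is 1 if the batch misses the target, so that pending phantoms stay pending; \<open>c0\<close> and
  \<open>c1\<close> are the number and age of the new ones, and \<open>per\<close> is the age
  gained. \<open>W\<close> is a Lyapunov function for missing the target, and \<open>contr\<close>
  is a Doeblin contraction of the state over \<open>m\<close> batches.\<close>

locale affine_memory =
 fixes H :: "'p::metric_space set" and seg :: "'p => 's::finite => ('b \<times> 's) pmf" and Bs :: "'b set"
  and surv c0 c1 :: "'b => real" and per Cb Lp \<theta> \<delta> Wmin :: real and W :: "'s => real" and m :: nat
 assumes finB: "finite Bs"
  and supp: "p \<in> H ==> set_pmf (seg p x) \<subseteq> Bs \<times> UNIV"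
  and seg_lip: "p \<in> H ==> p' \<in> H ==> \<bar>pmf (seg p x) z - pmf (seg p' x) z\<bar> <= Lp * dist p p'"
  and Lp: "0 <= Lp"
  and surv: "surv b = 0 \<or> surv b = 1"
  and c_bound: "b \<in> Bs ==> \<bar>c0 b\<bar> <= Cb" "b \<in> Bs ==> \<bar>c1 b\<bar> <= Cb" and Cb: "0 <= Cb" and per: "0 <= per"
  and W: "0 < Wmin" "Wmin <= W x" "W x <= 1" and \<theta>: "0 < \<theta>" "\<theta> < 1"
  and drift: "p \<in> H ==> seg_exp (seg p x) (%b x'. surv b * W x') <= \<theta> * W x"
  and m: "1 <= m" and \<delta>: "0 < \<delta>" "\<delta> <= 1"
  and contr: "p \<in> H ==> (\<And>x x'. \<bar>f x - f x'\<bar> <= \<sigma>) ==>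
   \<bar>((%g x. seg_exp (seg p x) (%_ x'. g x')) ^^ m) f x
    - ((%g x. seg_exp (seg p x) (%_ x'. g x')) ^^ m) f x'\<bar> <= (1 - \<delta>) * \<sigma>"
begin

lemma finite_seg: "p \<in> H ==> finite (set_pmf (seg p x))"
 using supp[of p x] finB by (auto intro: finite_subset)

lemma seg_in: "p \<in> H ==> z \<in> set_pmf (seg p x) ==> fst z \<in> Bs"
 using supp by fastforce

lemma seg_exp_sum:
 "p \<in> H ==> seg_exp (seg p x) F = (\<Sum>z\<in>Bs \<times> UNIV. pmf (seg p x) z * F (fst z) (snd z))"
 unfolding seg_exp_def by (rule expectation_finite_sum) (use finB supp in auto)

lemma seg_exp_mono:
 "p \<in> H ==> (\<And>b x'. b \<in> Bs ==> F b x' <= G b x') ==> seg_exp (seg p x) F <= seg_exp (seg p x) G"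
 unfolding seg_exp_def by (rule expectation_mono_finite) (auto simp: finite_seg seg_in)

lemma seg_exp_abs:
 "p \<in> H ==> (\<And>b x'. b \<in> Bs ==> \<bar>F b x'\<bar> <= G b x') ==> \<bar>seg_exp (seg p x) F\<bar> <= seg_exp (seg p x) G"
 unfolding seg_exp_def by (rule expectation_abs_le_finite) (auto simp: finite_seg seg_in)

lemma seg_exp_const [simp]: "seg_exp q (%_ _. c) = c"
 by (simp add: seg_exp_def)

lemma seg_exp_cmult [simp]: "seg_exp q (%b x. c * F b x) = c * seg_exp q F"
 by (simp add: seg_exp_def)

lemma seg_exp_add:
 "p \<in> H ==> seg_exp (seg p x) (%b x'. F b x' + G b x') = seg_exp (seg p x) F + seg_exp (seg p x) G"
 unfolding seg_exp_def by (rule expectation_add_finite) (rule finite_seg)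

lemma seg_exp_diff:
 "p \<in> H ==> seg_exp (seg p x) (%b x'. F b x' - G b x') = seg_exp (seg p x) F - seg_exp (seg p x) G"
 unfolding seg_exp_def by (rule expectation_diff_finite) (rule finite_seg)

lemma seg_exp_bound:
 "p \<in> H ==> (\<And>b x'. b \<in> Bs ==> \<bar>F b x'\<bar> <= c) ==> \<bar>seg_exp (seg p x) F\<bar> <= c"
 using seg_exp_abs[of p F "%_ _. c" x] by simp

definition cardA :: real where "cardA = real (card (Bs \<times> (UNIV :: 's set)))"

lemma seg_exp_lip:
 assumes p: "p \<in> H" "p' \<in> H" and F: "\<And>b x'. b \<in> Bs ==> \<bar>F b x'\<bar> <= c"
 shows "\<bar>seg_exp (seg p x) F - seg_exp (seg p' x) F\<bar> <= cardA * Lp * dist p p' * c"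
proof -
 have "seg_exp (seg p x) F - seg_exp (seg p' x) F =
   (\<Sum>z\<in>Bs \<times> UNIV. (pmf (seg p x) z - pmf (seg p' x) z) * F (fst z) (snd z))"
  by (simp add: seg_exp_sum p sum_subtractf algebra_simps)
 also have "\<bar>...\<bar> <= (\<Sum>z\<in>Bs \<times> (UNIV :: 's set). (Lp * dist p p') * c)"
 proof (intro order_trans[OF sum_abs] sum_mono)
  fix z :: "'b \<times> 's" assume "z \<in> Bs \<times> UNIV"
  then show "\<bar>(pmf (seg p x) z - pmf (seg p' x) z) * F (fst z) (snd z)\<bar> <= Lp * dist p p' * c"
   unfolding abs_mult using Lp by (intro mult_mono seg_lip p F) auto
 qed
 finally show ?thesis by (simp add: cardA_def mult_ac)
qed

type_synonym 't aff = "(real ^ 't) \<times> (real ^ 't) \<times> (real ^ 't)"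

text \<open>An element \<open>(v\<^sub>0, v\<^sub>1, v\<^sub>2)\<close> represents the function \<open>v\<^sub>0 x + v\<^sub>1 x * r\<^sub>0 + v\<^sub>2 x * r\<^sub>1\<close> of the state and its memory.\<close>

definition aff_eval :: "'s aff => 's => real => real => real" where
 "aff_eval v x r0 r1 = fst v $ x + fst (snd v) $ x * r0 + snd (snd v) $ x * r1"

text \<open>Each surviving phantom ages by \<open>per\<close>, so the total age gains
  \<open>per\<close> times the number: the age alone would not be Markov, the pair with the number
  is.\<close>

definition upd0 :: "'b => real => real" where "upd0 b r0 = surv b * r0 + c0 b"
definition upd1 :: "'b => real => real => real" where "upd1 b r0 r1 = surv b * (r1 + per * r0) + c1 b"

definition U :: "'p => 's aff => 's aff" where
 "U p v =
  ((\<chi> x. seg_exp (seg p x) (%b x'. fst v $ x' + fst (snd v) $ x' * c0 b + snd (snd v) $ x' * c1 b)),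
   (\<chi> x. seg_exp (seg p x) (%b x'. surv b * (fst (snd v) $ x' + per * snd (snd v) $ x'))),
   (\<chi> x. seg_exp (seg p x) (%b x'. surv b * snd (snd v) $ x')))"

lemma U_component:
 "fst (U p v) $ x = seg_exp (seg p x) (%b x'. fst v $ x' + fst (snd v) $ x' * c0 b + snd (snd v) $ x' * c1 b)"
 "fst (snd (U p v)) $ x = seg_exp (seg p x) (%b x'. surv b * (fst (snd v) $ x' + per * snd (snd v) $ x'))"
 "snd (snd (U p v)) $ x = seg_exp (seg p x) (%b x'. surv b * snd (snd v) $ x')"
 by (simp_all add: U_def)

definition aff_one :: "'s aff" where "aff_one = ((\<chi> x. 1), 0, 0)"

text \<open>The updates are affine in the memory, hence so is the conditional expectation of an
  affine function. The action on coefficients is triangular: age coefficient, then number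
  coefficient, then constant part, each fed only by itself and those before it.\<close>

lemma U_eval:
 assumes "p \<in> H"
 shows "aff_eval (U p v) x r0 r1 = seg_exp (seg p x) (%b x'. aff_eval v x' (upd0 b r0) (upd1 b r0 r1))"
 unfolding aff_eval_def U_def upd0_def upd1_def seg_exp_sum[OF assms]
 by (simp add: sum_distrib_left sum_distrib_right sum.distrib[symmetric] algebra_simps)

lemma aff_components:
 fixes v :: "'s aff"
 shows "\<bar>fst v $ x\<bar> <= norm v" "\<bar>fst (snd v) $ x\<bar> <= norm v" "\<bar>snd (snd v) $ x\<bar> <= norm v"
proof -
 have n: "norm (fst v) <= norm v" "norm (snd v) <= norm v" "norm (fst (snd v)) <= norm (snd v)"
   "norm (snd (snd v)) <= norm (snd v)"
  by (metis norm_fst_le norm_snd_le prod.collapse)+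
 show "\<bar>fst v $ x\<bar> <= norm v" using n component_le_norm_cart[of "fst v" x] by linarith
 show "\<bar>fst (snd v) $ x\<bar> <= norm v" using n component_le_norm_cart[of "fst (snd v)" x] by linarith
 show "\<bar>snd (snd v) $ x\<bar> <= norm v" using n component_le_norm_cart[of "snd (snd v)" x] by linarith
qed

lemma norm_aff_le:
 assumes "\<And>x. \<bar>fst v $ x\<bar> <= a" "\<And>x. \<bar>fst (snd v) $ x\<bar> <= b" "\<And>x. \<bar>snd (snd v) $ x\<bar> <= c"
 shows "norm (v :: 's aff) <= real CARD('s) * (a + b + c)"
proof -
 have "norm v <= norm (fst v) + (norm (fst (snd v)) + norm (snd (snd v)))"
  using norm_Pair_le[of "fst v" "snd v"] norm_Pair_le[of "fst (snd v)" "snd (snd v)"] by simp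
 also have "... <= real CARD('s) * a + (real CARD('s) * b + real CARD('s) * c)"
  by (intro add_mono norm_vec_lambda_le[of "%x. fst v $ x" a, unfolded vec_lambda_eta]
   norm_vec_lambda_le[of "%x. fst (snd v) $ x" b, unfolded vec_lambda_eta]
   norm_vec_lambda_le[of "%x. snd (snd v) $ x" c, unfolded vec_lambda_eta] assms)
 finally show ?thesis by (simp add: algebra_simps)
qed

lemma aff_eval_bound: "\<bar>aff_eval v x r0 r1\<bar> <= norm v * (1 + \<bar>r0\<bar> + \<bar>r1\<bar>)"
proof -
 have "\<bar>aff_eval v x r0 r1\<bar> <= \<bar>fst v $ x\<bar> + \<bar>fst (snd v) $ x\<bar> * \<bar>r0\<bar> + \<bar>snd (snd v) $ x\<bar> * \<bar>r1\<bar>"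
  unfolding aff_eval_def abs_mult[symmetric] by linarith
 also have "... <= norm v + norm v * \<bar>r0\<bar> + norm v * \<bar>r1\<bar>"
  by (intro add_mono mult_right_mono aff_components) auto
 finally show ?thesis by (simp add: algebra_simps)
qed

lemma U_integrand_bounds:
 fixes v :: "'s aff"
 assumes "b \<in> Bs"
 shows "\<bar>fst v $ x' + fst (snd v) $ x' * c0 b + snd (snd v) $ x' * c1 b\<bar> <= (1 + 2 * Cb) * norm v"
  and "\<bar>surv b * (fst (snd v) $ x' + per * snd (snd v) $ x')\<bar> <= (1 + per) * norm v"
  and "\<bar>surv b * snd (snd v) $ x'\<bar> <= norm v"
proof -
 have "\<bar>fst (snd v) $ x' * c0 b\<bar> <= norm v * Cb"
  unfolding abs_mult by (intro mult_mono aff_components c_bound assms) auto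
 moreover have "\<bar>snd (snd v) $ x' * c1 b\<bar> <= norm v * Cb"
  unfolding abs_mult by (intro mult_mono aff_components c_bound assms) auto
 ultimately
 show "\<bar>fst v $ x' + fst (snd v) $ x' * c0 b + snd (snd v) $ x' * c1 b\<bar> <= (1 + 2 * Cb) * norm v"
  using aff_components(1)[of v x'] by (simp add: algebra_simps)
 have "\<bar>per * snd (snd v) $ x'\<bar> <= per * norm v"
  unfolding abs_mult using per aff_components(3)[of v x'] by (simp add: mult_left_mono)
 then have "\<bar>fst (snd v) $ x' + per * snd (snd v) $ x'\<bar> <= (1 + per) * norm v"
  using aff_components(2)[of v x'] by (simp add: algebra_simps)
 moreover have "0 <= (1 + per) * norm v" using per by simp
 ultimately show "\<bar>surv b * (fst (snd v) $ x' + per * snd (snd v) $ x')\<bar> <= (1 + per) * norm v"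
  using surv[of b] by auto
 show "\<bar>surv b * snd (snd v) $ x'\<bar> <= norm v" using surv[of b] aff_components(3)[of v x'] by auto
qed

definition KU :: real where "KU = real CARD('s) * ((1 + 2 * Cb) + (1 + per) + 1)"

lemma KU: "1 <= KU"
proof -
 have "1 * 1 <= real CARD('s) * ((1 + 2 * Cb) + (1 + per) + 1)"
  using Cb per by (intro mult_mono) (auto simp: Suc_leI)
 then show ?thesis by (simp add: KU_def)
qed

lemma U_bound: "p \<in> H ==> norm (U p v) <= KU * norm v"
proof -
 assume p: "p \<in> H"
 have "norm (U p v) <= real CARD('s) * ((1 + 2 * Cb) * norm v + (1 + per) * norm v + norm v)"
  by (rule norm_aff_le) (auto simp: U_component intro!: seg_exp_bound p U_integrand_bounds)
 then show ?thesis by (simp add: KU_def algebra_simps)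
qed

lemma U_lip:
 assumes p: "p \<in> H" "p' \<in> H"
 shows "norm (U p v - U p' v) <= (KU * cardA * Lp) * dist p p' * norm v"
proof -
 have "norm (U p v - U p' v) <= real CARD('s) * (cardA * Lp * dist p p' * ((1 + 2 * Cb) * norm v)
   + cardA * Lp * dist p p' * ((1 + per) * norm v) + cardA * Lp * dist p p' * norm v)"
  by (rule norm_aff_le) (auto simp: U_component intro!: seg_exp_lip p U_integrand_bounds)
 then show ?thesis by (simp add: KU_def algebra_simps)
qed

lemma U_linear:
 assumes p: "p \<in> H"
 shows "linear (U p)"
proof (rule linearI)
 show "U p (v + w) = U p v + U p w" for v w
  unfolding U_def seg_exp_sum[OF p]
  by (simp add: vec_eq_iff prod_eq_iff sum.distrib[symmetric] algebra_simps)
 show "U p (c *\<^sub>R v) = c *\<^sub>R U p v" for c v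
  unfolding U_def seg_exp_sum[OF p]
  by (simp add: vec_eq_iff prod_eq_iff sum_distrib_left algebra_simps)
qed

lemma U_aff_one: "p \<in> H ==> U p aff_one = aff_one"
 by (simp add: U_def aff_one_def vec_eq_iff zero_vec_def)

abbreviation T :: "'p => ('s => real) => 's => real" where
 "T p \<equiv> %g x. seg_exp (seg p x) (%_ x'. g x')"

text \<open>\<open>wt\<close> weighs the age coefficient so heavily that the coupling
  \<open>per\<close> costs no more than the factor \<open>1 + per / wt\<close>; its value keeps
  \<open>(1 + per / wt) * \<theta>\<close> below the midpoint \<open>\<theta>'\<close> of
  \<open>\<theta>\<close> and 1.\<close>

definition \<theta>' where "\<theta>' = (1 + \<theta>) / 2"
definition wt where "wt = 1 + 2 * per / (1 - \<theta>)"

lemma wt: "1 <= wt" "(1 + per / wt) * \<theta> <= \<theta>'" "0 < \<theta>'" "\<theta>' < 1"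
proof -
 show 1: "1 <= wt" using per \<theta> by (simp add: wt_def)
 have "wt * ((1 - \<theta>) / 2) = (1 - \<theta>) / 2 + per"
  using \<theta> by (simp add: wt_def distrib_right)
 then have "per <= wt * ((1 - \<theta>) / 2)" using \<theta> by simp
 then have "per / wt <= (1 - \<theta>) / 2" using 1 by (simp add: field_simps)
 then have "per / wt * \<theta> <= (1 - \<theta>) / 2 * 1" using \<theta> per 1 by (intro mult_mono) auto
 then show "(1 + per / wt) * \<theta> <= \<theta>'" by (simp add: \<theta>'_def algebra_simps)
 show "0 < \<theta>'" "\<theta>' < 1" using \<theta> by (auto simp: \<theta>'_def)
qed

text \<open>Both memory coefficients carry the factor \<open>surv b\<close>, so the drift inequality
  contracts their sum, weighted by \<open>wt\<close> and measured relative to \<open>W\<close>.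
  Dividing by \<open>Wmin\<close> makes the bound valid at the start.\<close>

lemma memory_decay:
 assumes p: "p \<in> H"
 shows "\<bar>fst (snd ((U p ^^ n) v)) $ x\<bar> + wt * \<bar>snd (snd ((U p ^^ n) v)) $ x\<bar>
  <= W x * (\<theta>' ^ n * ((1 + wt) * norm v / Wmin))"
proof (induction n arbitrary: x)
 case 0
 have "\<bar>fst (snd v) $ x\<bar> + wt * \<bar>snd (snd v) $ x\<bar> <= norm v + wt * norm v"
  using wt by (intro add_mono mult_left_mono aff_components) auto
 also have "... = Wmin * ((1 + wt) * norm v / Wmin)" using W(1) by (simp add: field_simps)
 also have "... <= W x * ((1 + wt) * norm v / Wmin)" using W wt by (intro mult_right_mono) auto
 finally show ?case by simp
next
 case (Suc n)
 let ?u = "(U p ^^ n) v" and ?c = "\<theta>' ^ n * ((1 + wt) * norm v / Wmin)"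
 have c: "0 <= ?c" using wt W by auto
 let ?F = "%b x'. surv b * (fst (snd ?u) $ x' + per * snd (snd ?u) $ x')"
 let ?G = "%b x'. surv b * snd (snd ?u) $ x'"
 have "\<bar>seg_exp (seg p x) ?F\<bar> + wt * \<bar>seg_exp (seg p x) ?G\<bar>
   <= seg_exp (seg p x) (%b x'. \<bar>?F b x'\<bar>) + wt * seg_exp (seg p x) (%b x'. \<bar>?G b x'\<bar>)"
  using wt by (intro add_mono mult_left_mono seg_exp_abs p) auto
 also have "... = seg_exp (seg p x) (%b x'. \<bar>?F b x'\<bar> + wt * \<bar>?G b x'\<bar>)"
  by (simp add: seg_exp_add p)
 also have "... <= seg_exp (seg p x) (%b x'. ((1 + per / wt) * ?c) * (surv b * W x'))"
 proof (rule seg_exp_mono[OF p])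
  fix b x'
  have "\<bar>fst (snd ?u) $ x' + per * snd (snd ?u) $ x'\<bar> + wt * \<bar>snd (snd ?u) $ x'\<bar>
    <= \<bar>fst (snd ?u) $ x'\<bar> + per * \<bar>snd (snd ?u) $ x'\<bar> + wt * \<bar>snd (snd ?u) $ x'\<bar>"
   using abs_triangle_ineq[of "fst (snd ?u) $ x'" "per * snd (snd ?u) $ x'"] per by (simp add: abs_mult)
  also have "... <= (1 + per / wt) * (\<bar>fst (snd ?u) $ x'\<bar> + wt * \<bar>snd (snd ?u) $ x'\<bar>)"
   using wt per by (simp add: field_simps)
  also have "... <= (1 + per / wt) * (W x' * ?c)" using wt per Suc by (intro mult_left_mono) auto
  finally show "\<bar>?F b x'\<bar> + wt * \<bar>?G b x'\<bar> <= ((1 + per / wt) * ?c) * (surv b * W x')"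
   using surv[of b] by (auto simp: mult_ac)
 qed
 also have "... = ((1 + per / wt) * ?c) * seg_exp (seg p x) (%b x'. surv b * W x')"
  by (rule seg_exp_cmult)
 also have "... <= ((1 + per / wt) * ?c) * (\<theta> * W x)"
  using per wt W(1) by (intro mult_left_mono drift p mult_nonneg_nonneg add_nonneg_nonneg divide_nonneg_nonneg) auto
 also have "... = ((1 + per / wt) * \<theta>) * (?c * W x)" by simp
 also have "... <= \<theta>' * (?c * W x)"
  using W(1) W(2)[of x] by (intro mult_right_mono wt mult_nonneg_nonneg[OF c]) auto
 finally show ?case by (simp add: U_component mult_ac)
qed

lemma T_bound: "p \<in> H ==> (\<And>x. \<bar>f x\<bar> <= c) ==> \<bar>(T p ^^ j) f x\<bar> <= c"
 by (induction j arbitrary: x) (auto intro: seg_exp_bound)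

text \<open>The constant part is moved by the state kernel alone, apart from what the memory
  coefficients feed into it through \<open>c0\<close> and \<open>c1\<close>. By
  \<open>memory_decay\<close> each of the \<open>j\<close> steps feeds at most \<open>Cb\<close>
  times the bound at time \<open>n\<close>.\<close>

lemma const_part_step:
 assumes p: "p \<in> H"
 shows "\<bar>fst ((U p ^^ (n + j)) v) $ x - (T p ^^ j) (($) (fst ((U p ^^ n) v))) x\<bar>
  <= real j * (Cb * (\<theta>' ^ n * ((1 + wt) * norm v / Wmin)))"
proof (induction j arbitrary: x)
 case (Suc j)
 let ?u = "(U p ^^ (n + j)) v" and ?f = "($) (fst ((U p ^^ n) v))"
 let ?c = "\<theta>' ^ n * ((1 + wt) * norm v / Wmin)"
 have c: "0 <= ?c" using wt W by auto
 have "fst ((U p ^^ (n + Suc j)) v) $ x - (T p ^^ Suc j) ?f x =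
  seg_exp (seg p x) (%b x'. (fst ?u $ x' - (T p ^^ j) ?f x') + (fst (snd ?u) $ x' * c0 b + snd (snd ?u) $ x' * c1 b))"
  by (simp add: U_component seg_exp_add[OF p] seg_exp_diff[OF p])
 also have "\<bar>...\<bar> <= real j * (Cb * ?c) + Cb * ?c"
 proof (rule seg_exp_bound[OF p])
  fix b x' assume b: "b \<in> Bs"
  have "\<bar>fst (snd ?u) $ x' * c0 b + snd (snd ?u) $ x' * c1 b\<bar>
    <= \<bar>fst (snd ?u) $ x'\<bar> * \<bar>c0 b\<bar> + \<bar>snd (snd ?u) $ x'\<bar> * \<bar>c1 b\<bar>"
   using abs_triangle_ineq[of "fst (snd ?u) $ x' * c0 b" "snd (snd ?u) $ x' * c1 b"] by (simp add: abs_mult)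
  also have "... <= \<bar>fst (snd ?u) $ x'\<bar> * Cb + (wt * \<bar>snd (snd ?u) $ x'\<bar>) * Cb"
  proof (intro add_mono mult_mono c_bound b)
   show "\<bar>snd (snd ?u) $ x'\<bar> <= wt * \<bar>snd (snd ?u) $ x'\<bar>"
    using mult_right_mono[OF wt(1), of "\<bar>snd (snd ?u) $ x'\<bar>"] by simp
   show "0 <= wt * \<bar>snd (snd ?u) $ x'\<bar>" using wt(1) by simp
  qed simp_all
  also have "... = (\<bar>fst (snd ?u) $ x'\<bar> + wt * \<bar>snd (snd ?u) $ x'\<bar>) * Cb" by (simp add: algebra_simps)
  also have "... <= (W x' * (\<theta>' ^ (n + j) * ((1 + wt) * norm v / Wmin))) * Cb"
   by (intro mult_right_mono memory_decay p Cb)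
  also have "... <= (1 * ?c) * Cb"
  proof (rule mult_right_mono[OF mult_mono Cb])
   show "\<theta>' ^ (n + j) * ((1 + wt) * norm v / Wmin) <= ?c"
    using wt W by (intro mult_right_mono power_decreasing) auto
  qed (use W wt in auto)
  finally have "\<bar>fst (snd ?u) $ x' * c0 b + snd (snd ?u) $ x' * c1 b\<bar> <= Cb * ?c" by (simp add: mult_ac)
  with Suc[of x'] show "\<bar>(fst ?u $ x' - (T p ^^ j) ?f x') + (fst (snd ?u) $ x' * c0 b + snd (snd ?u) $ x' * c1 b)\<bar>
    <= real j * (Cb * ?c) + Cb * ?c" by linarith
 qed
 finally show ?case unfolding of_nat_Suc distrib_right by linarith
qed simp

definition osc :: "('s => real) => real" where
 "osc f = Max ((%(x, x'). \<bar>f x - f x'\<bar>) ` UNIV)"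

lemma osc: "\<bar>f x - f x'\<bar> <= osc f"
 unfolding osc_def by (rule Max_ge) (auto intro: image_eqI[of _ _ "(x, x')"])

lemma osc_le: "(\<And>x x'. \<bar>f x - f x'\<bar> <= c) ==> osc f <= c"
 unfolding osc_def by (subst Max_le_iff) auto

text \<open>Over \<open>m\<close> batches the state kernel shrinks the oscillation by
  \<open>1 - \<delta>\<close>, while the feed from the memory decays like
  \<open>\<theta>' ^ n\<close>; \<open>geometric_recursion_bound\<close> merges the two
  rates.\<close>

lemma const_part_decay:
 "\<exists>C r. 0 <= C \<and> 0 < r \<and> r < 1 \<and> \<theta>' <= r \<and>
  (\<forall>p\<in>H. \<forall>v n. osc (($) (fst ((U p ^^ n) v))) <= C * r ^ n * norm v)"
proof -
 obtain r where r: "0 < r" "r < 1" "\<theta>' <= r" "1 - \<delta> / 2 <= r ^ m"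
  using ex_root_close[of \<delta> \<theta>' m] \<delta> wt by auto
 let ?k = "Cb * ((1 + wt) / Wmin)"
 have k: "0 <= ?k" using Cb wt W by auto
 \<comment> \<open>An oscillation compares two states, hence twice the error
   \<open>real m * ?k\<close>; the leading \<open>2\<close> bounds the oscillation of the first
   iterates without memory.\<close>
 define A where "A = 2 + 2 * real m * ?k"
 have A: "0 <= A" unfolding A_def by (intro add_nonneg_nonneg mult_nonneg_nonneg k) auto
 have "osc (($) (fst ((U p ^^ n) v))) <= ((2 / \<delta> + 2) * A) * r ^ n * norm v" if p: "p \<in> H" for p v n
 proof -
  let ?s = "%n. osc (($) (fst ((U p ^^ n) v)))"
  have "?s n <= (2 / \<delta> + 2) * (A * norm v) * r ^ n"
  proof (rule geometric_recursion_bound[where t = \<theta>' and m = m and \<delta> = \<delta>])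
   show "?s (j + m) <= (1 - \<delta>) * ?s j + A * norm v * \<theta>' ^ j" for j
   proof (rule osc_le)
    fix x x'
    let ?f = "($) (fst ((U p ^^ j) v))" and ?g = "fst ((U p ^^ (j + m)) v)"
    have 1: "\<bar>?g $ x - (T p ^^ m) ?f x\<bar> <= real m * (?k * (\<theta>' ^ j * norm v))" for x
     using const_part_step[OF p, of j m v x] by (simp add: mult_ac)
    have 2: "\<bar>(T p ^^ m) ?f x - (T p ^^ m) ?f x'\<bar> <= (1 - \<delta>) * ?s j"
     by (rule contr[OF p]) (rule osc)
    have "2 * (real m * (?k * (\<theta>' ^ j * norm v))) <= A * norm v * \<theta>' ^ j"
     using wt by (simp add: A_def algebra_simps)
    with 1[of x] 1[of x'] 2 show "\<bar>?g $ x - ?g $ x'\<bar> <= (1 - \<delta>) * ?s j + A * norm v * \<theta>' ^ j"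
     by linarith
   qed
   show "?s j <= A * norm v" if j: "j < m" for j
   proof (rule osc_le)
    fix x x'
    let ?f = "($) (fst v)" and ?g = "fst ((U p ^^ j) v)"
    have 1: "\<bar>?g $ x - (T p ^^ j) ?f x\<bar> <= real m * (?k * norm v)" for x
    proof -
     have "\<bar>?g $ x - (T p ^^ j) ?f x\<bar> <= real j * (?k * norm v)"
      using const_part_step[OF p, of 0 j v x] by (simp add: mult_ac)
     also have "... <= real m * (?k * norm v)"
      using j by (intro mult_right_mono mult_nonneg_nonneg k norm_ge_zero) simp
     finally show ?thesis .
    qed
    have 2: "\<bar>(T p ^^ j) ?f x\<bar> <= norm v" for x by (rule T_bound[OF p]) (rule aff_components)
    show "\<bar>?g $ x - ?g $ x'\<bar> <= A * norm v"
     using 1[of x] 1[of x'] 2[of x] 2[of x'] unfolding A_def ring_distribs by linarith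
   qed
   show "0 <= A * norm v" using A by simp
  qed (use m \<delta> r wt in auto)
  then show ?thesis by (simp add: mult_ac)
 qed
 moreover have "0 <= (2 / \<delta> + 2) * A" using \<delta> A by simp
 ultimately show ?thesis using r by blast
qed

text \<open>Small oscillation makes the constant part nearly equal to its value at one arbitrary
  state, and the memory coefficients are small themselves.\<close>

lemma geometric_ergodicity:
 "\<exists>C r. 0 <= C \<and> 0 < r \<and> r < 1 \<and>
  (\<forall>p\<in>H. \<forall>v n. \<exists>c. norm ((U p ^^ n) v - c *\<^sub>R aff_one) <= C * r ^ n * norm v)"
proof -
 obtain C r where C: "0 <= C" "0 < r" "r < 1" "\<theta>' <= r"
   "\<And>p v n. p \<in> H ==> osc (($) (fst ((U p ^^ n) v))) <= C * r ^ n * norm v"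
  using const_part_decay by blast
 let ?k = "(1 + wt) / Wmin"
 have k: "0 <= ?k" using wt W by auto
 let ?C = "real CARD('s) * (C + ?k + ?k)"
 have "norm ((U p ^^ n) v - fst ((U p ^^ n) v) $ undefined *\<^sub>R aff_one) <= ?C * r ^ n * norm v"
  if p: "p \<in> H" for p v n
 proof -
  let ?u = "(U p ^^ n) v"
  have mem: "\<bar>fst (snd ?u) $ x\<bar> + wt * \<bar>snd (snd ?u) $ x\<bar> <= ?k * (r ^ n * norm v)" for x
  proof -
   have "\<bar>fst (snd ?u) $ x\<bar> + wt * \<bar>snd (snd ?u) $ x\<bar> <= W x * (\<theta>' ^ n * ((1 + wt) * norm v / Wmin))"
    by (rule memory_decay[OF p])
   also have "... <= 1 * (r ^ n * ((1 + wt) * norm v / Wmin))"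
    using W wt C by (intro mult_mono power_mono) auto
   finally show ?thesis by (simp add: mult_ac)
  qed
  have m1: "\<bar>fst (snd ?u) $ x\<bar> <= ?k * (r ^ n * norm v)" for x
   using mem[of x] wt by (smt (verit) mult_nonneg_nonneg abs_ge_zero)
  have m2: "\<bar>snd (snd ?u) $ x\<bar> <= ?k * (r ^ n * norm v)" for x
  proof -
   have "1 * \<bar>snd (snd ?u) $ x\<bar> <= wt * \<bar>snd (snd ?u) $ x\<bar>" using wt by (intro mult_right_mono) auto
   then show ?thesis using mem[of x] by linarith
  qed
  have "norm (?u - fst ?u $ undefined *\<^sub>R aff_one) \<le>
    real CARD('s) * (C * r ^ n * norm v + ?k * (r ^ n * norm v) + ?k * (r ^ n * norm v))"
   by (rule norm_aff_le)
    (use m1 m2 order_trans[OF osc C(5)[OF p]] in \<open>auto simp: aff_one_def\<close>)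
  then show ?thesis by (simp add: algebra_simps)
 qed
 moreover have "0 <= ?C" by (intro mult_nonneg_nonneg add_nonneg_nonneg C k) simp
 ultimately show ?thesis using C by blast
qed

text \<open>The sublocale below needs the constant and the rate as terms, so a witness of the
  existential statement is fixed by choice.\<close>

definition geo_rate :: "real \<times> real => bool" where
 "geo_rate z \<longleftrightarrow> 0 <= fst z \<and> 0 < snd z \<and> snd z < 1 \<and>
  (\<forall>p\<in>H. \<forall>v n. \<exists>c. norm ((U p ^^ n) v - c *\<^sub>R aff_one) <= fst z * snd z ^ n * norm v)"

definition geo_C :: real where "geo_C = fst (SOME z. geo_rate z)"
definition geo_r :: real where "geo_r = snd (SOME z. geo_rate z)"

lemma geo: "0 <= geo_C" "0 < geo_r" "geo_r < 1"
  "p \<in> H ==> \<exists>c. norm ((U p ^^ n) v - c *\<^sub>R aff_one) <= geo_C * geo_r ^ n * norm v"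
proof -
 have "\<exists>z. geo_rate z" using geometric_ergodicity unfolding geo_rate_def by simp
 then have "geo_rate (SOME z. geo_rate z)" by (rule someI_ex)
 then show "0 <= geo_C" "0 < geo_r" "geo_r < 1"
  "p \<in> H ==> \<exists>c. norm ((U p ^^ n) v - c *\<^sub>R aff_one) <= geo_C * geo_r ^ n * norm v"
  unfolding geo_rate_def geo_C_def geo_r_def by blast+
qed

sublocale ergodic_family H U aff_one "%v. fst v $ undefined" KU "KU * cardA * Lp" geo_C geo_r
proof (rule ergodic_family.intro)
 show "linear (%v::'s aff. fst v $ undefined)" by (rule linearI) auto
 show "0 <= KU * cardA * Lp" using KU Lp by (simp add: cardA_def)
 show "fst aff_one $ (undefined::'s) = 1" by (simp add: aff_one_def)
 show "linear (U p)" if "p \<in> H" for p by (rule U_linear[OF that])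
 show "norm (U p v) <= KU * norm v" if "p \<in> H" for p v by (rule U_bound[OF that])
 show "norm (U p v - U p' v) <= KU * cardA * Lp * dist p p' * norm v" if "p \<in> H" "p' \<in> H" for p p' v
  by (rule U_lip[OF that])
 show "U p aff_one = aff_one" if "p \<in> H" for p by (rule U_aff_one[OF that])
 show "\<bar>fst v $ undefined\<bar> <= norm v" for v :: "'s aff" by (rule aff_components)
 show "\<exists>c. norm ((U p ^^ n) v - c *\<^sub>R aff_one) <= geo_C * geo_r ^ n * norm v" if "p \<in> H" for p n v
  by (rule geo(4)[OF that])
qed (rule KU geo(1-3))+

end

section \<open>Histories driven by the batch kernel: moments, frozen limits and averaging\<close>

context affine_memory
begin

text \<open>\<open>'o\<close> is the whole past; the next batch depends on it only through the
  parameter \<open>a n\<close> and the current state. The memory updates are demanded along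
  histories of positive probability, with an arbitrary record from \<open>Bs\<close>
  appended.\<close>

definition process ::
  "(nat => ('o \<times> 's) pmf) => (nat => 'o => 'p) => (nat => 'o => 'b => 'o)
   => (nat => 'o => real) => (nat => 'o => real) => bool" where
 "process J a ext R0 R1 \<longleftrightarrow>
   (\<forall>n. finite (set_pmf (J n))) \<and>
   (\<forall>n. J (Suc n) = bind_pmf (J n) (%z. map_pmf (%y. (ext n (fst z) (fst y), snd y)) (seg (a n (fst z)) (snd z)))) \<and>
   (\<forall>n. \<forall>z\<in>set_pmf (J n). a n (fst z) \<in> H) \<and>
   (\<forall>z\<in>set_pmf (J 0). R0 0 (fst z) = 0 \<and> R1 0 (fst z) = 0) \<and>
   (\<forall>n. \<forall>z\<in>set_pmf (J n). \<forall>b\<in>Bs. R0 (Suc n) (ext n (fst z) b) = upd0 b (R0 n (fst z)) \<and>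
    R1 (Suc n) (ext n (fst z) b) = upd1 b (R0 n (fst z)) (R1 n (fst z)))"

lemma processD:
 assumes "process J a ext R0 R1"
 shows "finite (set_pmf (J n))"
  and "J (Suc n) = bind_pmf (J n) (%z. map_pmf (%y. (ext n (fst z) (fst y), snd y)) (seg (a n (fst z)) (snd z)))"
  and "z \<in> set_pmf (J n) ==> a n (fst z) \<in> H"
  and "z \<in> set_pmf (J 0) ==> R0 0 (fst z) = 0" "z \<in> set_pmf (J 0) ==> R1 0 (fst z) = 0"
  and "z \<in> set_pmf (J n) ==> b \<in> Bs ==> R0 (Suc n) (ext n (fst z) b) = upd0 b (R0 n (fst z))"
  and "z \<in> set_pmf (J n) ==> b \<in> Bs ==> R1 (Suc n) (ext n (fst z) b) = upd1 b (R0 n (fst z)) (R1 n (fst z))"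
 using assms unfolding process_def by blast+

lemma process_step:
 fixes F :: "'o \<times> 's => real"
 assumes P: "process J a ext R0 R1"
 shows "expect (J (Suc n)) F = expect (J n)
  (%z. seg_exp (seg (a n (fst z)) (snd z)) (%b x'. F (ext n (fst z) b, x')))"
 unfolding processD(2)[OF P]
 by (subst expectation_bind_finite)
   (auto simp: seg_exp_def processD(1)[OF P] finite_seg processD(3)[OF P])

lemma process_support:
 assumes P: "process J a ext R0 R1" and z: "z \<in> set_pmf (J n)"
  and y: "y \<in> set_pmf (seg (a n (fst z)) (snd z))"
 shows "(ext n (fst z) (fst y), snd y) \<in> set_pmf (J (Suc n))"
 unfolding processD(2)[OF P] using z y by force

lemma seg_exp_bound_support:
 assumes "p \<in> H" "\<And>y. y \<in> set_pmf (seg p x) ==> \<bar>F (fst y) (snd y)\<bar> <= c"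
 shows "\<bar>seg_exp (seg p x) F\<bar> <= c"
 unfolding seg_exp_def
 using expectation_abs_le_finite[OF finite_seg[OF assms(1)], of x "%z. F (fst z) (snd z)" "%_. c"] assms(2)
 by simp

text \<open>\<open>W\<close> times the square of \<open>\<bar>r1\<bar> + w * \<bar>r0\<bar>\<close>
  obeys an affine recursion with factor \<open>\<theta>' < 1\<close>. The constant is chosen before
  the process, so the bound also holds when the parameter changes from batch to batch.\<close>

lemma memory_second_moment:
 "\<exists>C\<ge>0. \<forall>(J :: nat => ('o \<times> 's) pmf) a ext R0 R1. process J a ext R0 R1 -->
   (\<forall>n. expect (J n) (%z. (R0 n (fst z))\<^sup>2 + (R1 n (fst z))\<^sup>2) <= C)"
proof -
 \<comment> \<open>Two factors \<open>1 + s\<close> come from squaring the loss in the age coupling,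
   the third from Young's inequality; \<open>s\<close> is so small that the drift survives all
   three.\<close>
 have "((%s. (1 + s) ^ 3 * \<theta>) \<longlongrightarrow> (1 + 0) ^ 3 * \<theta>) (at_right 0)" by (intro tendsto_intros)
 then have "\<forall>\<^sub>F s in at_right 0. (1 + s) ^ 3 * \<theta> < \<theta>'"
  by (rule order_tendstoD) (use \<theta> in \<open>simp add: \<theta>'_def\<close>)
 moreover have "\<forall>\<^sub>F s::real in at_right 0. s > 0" by (rule eventually_at_right_less)
 ultimately have "\<forall>\<^sub>F s in at_right 0. (1 + s) ^ 3 * \<theta> < \<theta>' \<and> s > 0" by (rule eventually_conj)
 then obtain s where s: "(1 + s) ^ 3 * \<theta> < \<theta>'" "s > 0"
  using eventually_happens by fastforce
 \<comment> \<open>Makes \<open>per <= s * w\<close>, so that feeding the number into the age costs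
   only a factor \<open>1 + s\<close>.\<close>
 define w where "w = 1 + per / s"
 have w: "1 <= w" "per <= s * w" using s per by (auto simp: w_def field_simps)
 define c where "c = (1 + w) * Cb"
 have c: "0 <= c" using w Cb by (simp add: c_def)
 define D where "D = (1 + 1 / s) * c\<^sup>2"
 have D: "0 <= D" using s by (simp add: D_def)
 let ?C = "D / (1 - \<theta>') / Wmin"
 have young: "(x + y)\<^sup>2 <= (1 + s) * x\<^sup>2 + (1 + 1 / s) * y\<^sup>2" for x y :: real
 proof -
  have "0 <= (s * x - y)\<^sup>2 / s" using s by simp
  also have "... = s * x\<^sup>2 - 2 * x * y + y\<^sup>2 / s" using s by (simp add: power2_eq_square field_simps)
  finally show ?thesis by (simp add: power2_eq_square algebra_simps)
 qed
 define q where "q r0 r1 = \<bar>r1\<bar> + w * \<bar>r0\<bar>" for r0 r1 :: real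
 have q0: "0 <= q r0 r1" for r0 r1 using w by (simp add: q_def)
 have step: "(q (upd0 b r0) (upd1 b r0 r1))\<^sup>2 <= ((1 + s) ^ 3 * (q r0 r1)\<^sup>2) * surv b + D"
  if b: "b \<in> Bs" for b r0 r1
 proof -
  have "q (upd0 b r0) (upd1 b r0 r1) <= surv b * (\<bar>r1\<bar> + (per + w) * \<bar>r0\<bar>) + c"
  proof -
   have "\<bar>upd1 b r0 r1\<bar> <= surv b * (\<bar>r1\<bar> + per * \<bar>r0\<bar>) + Cb"
    unfolding upd1_def using surv[of b] c_bound(2)[OF b] per
     abs_triangle_ineq[of "r1 + per * r0" "c1 b"] abs_triangle_ineq[of r1 "per * r0"]
    by (auto simp: abs_mult)
   moreover have "\<bar>upd0 b r0\<bar> <= surv b * \<bar>r0\<bar> + Cb"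
    unfolding upd0_def using surv[of b] c_bound(1)[OF b] by auto
   then have "w * \<bar>upd0 b r0\<bar> <= w * (surv b * \<bar>r0\<bar> + Cb)" using w by (intro mult_left_mono) auto
   ultimately show ?thesis by (simp add: q_def c_def algebra_simps)
  qed
  also have "surv b * (\<bar>r1\<bar> + (per + w) * \<bar>r0\<bar>) <= surv b * ((1 + s) * q r0 r1)"
  proof (rule mult_left_mono)
   have "(per + w) * \<bar>r0\<bar> <= (s * w + w) * \<bar>r0\<bar>" using w by (intro mult_right_mono) auto
   moreover have "\<bar>r1\<bar> <= (1 + s) * \<bar>r1\<bar>" using s by (simp add: algebra_simps)
   ultimately show "\<bar>r1\<bar> + (per + w) * \<bar>r0\<bar> <= (1 + s) * q r0 r1" by (simp add: q_def algebra_simps)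
  qed (use surv[of b] in auto)
  finally have "q (upd0 b r0) (upd1 b r0 r1) <= surv b * ((1 + s) * q r0 r1) + c" by simp
  then have "(q (upd0 b r0) (upd1 b r0 r1))\<^sup>2 <= (surv b * ((1 + s) * q r0 r1) + c)\<^sup>2"
   by (intro power_mono q0)
  also have "... <= (1 + s) * (surv b * ((1 + s) * q r0 r1))\<^sup>2 + D"
   unfolding D_def by (rule young)
  also have "... = ((1 + s) ^ 3 * (q r0 r1)\<^sup>2) * surv b + D"
   using surv[of b] by (auto simp: power2_eq_square power3_eq_cube algebra_simps)
  finally show ?thesis .
 qed
 show ?thesis
 proof (intro exI[of _ ?C] conjI allI impI)
  show "0 <= ?C" using D wt W by simp
  fix J :: "nat => ('o \<times> 's) pmf" and a ext R0 R1 n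
  assume P: "process J a ext R0 R1"
  let ?q = "%n z. (q (R0 n (fst z)) (R1 n (fst z)))\<^sup>2"
  let ?E = "%n. expect (J n) (%z. W (snd z) * ?q n z)"
  have rec: "?E (Suc n) <= \<theta>' * ?E n + D" for n
  proof -
   have "?E (Suc n) = expect (J n)
     (%z. seg_exp (seg (a n (fst z)) (snd z)) (%b x'. W x' * ?q (Suc n) (ext n (fst z) b, x')))"
    by (subst process_step[OF P]) simp
   also have "... <= expect (J n) (%z. \<theta>' * (W (snd z) * ?q n z) + D)"
   proof (rule expectation_mono_finite[OF processD(1)[OF P]])
    fix z assume z: "z \<in> set_pmf (J n)"
    have p: "a n (fst z) \<in> H" by (rule processD(3)[OF P z])
    have "seg_exp (seg (a n (fst z)) (snd z)) (%b x'. W x' * ?q (Suc n) (ext n (fst z) b, x'))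
      <= seg_exp (seg (a n (fst z)) (snd z)) (%b x'. ((1 + s) ^ 3 * ?q n z) * (surv b * W x') + D)"
    proof (rule seg_exp_mono[OF p])
     fix b x' assume b: "b \<in> Bs"
     have "W x' * ?q (Suc n) (ext n (fst z) b, x') <= W x' * (((1 + s) ^ 3 * ?q n z) * surv b + D)"
      using W(1) W(2)[of x'] step[OF b] processD(6,7)[OF P z b] by (intro mult_left_mono) auto
     also have "... <= ((1 + s) ^ 3 * ?q n z) * (surv b * W x') + D"
      using W(3)[of x'] D mult_right_mono[OF W(3)[of x'] D] by (simp add: algebra_simps)
     finally show "W x' * ?q (Suc n) (ext n (fst z) b, x') <= ((1 + s) ^ 3 * ?q n z) * (surv b * W x') + D" .
    qed
    also have "... = ((1 + s) ^ 3 * ?q n z) * seg_exp (seg (a n (fst z)) (snd z)) (%b x'. surv b * W x') + D"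
     by (simp only: seg_exp_add[OF p] seg_exp_cmult seg_exp_const)
    also have "... <= ((1 + s) ^ 3 * ?q n z) * (\<theta> * W (snd z)) + D"
     using s by (intro add_right_mono mult_left_mono drift p) auto
    also have "... = ((1 + s) ^ 3 * \<theta>) * (W (snd z) * ?q n z) + D" by simp
    also have "... <= \<theta>' * (W (snd z) * ?q n z) + D"
     using s W(1) W(2)[of "snd z"] by (intro add_right_mono mult_right_mono) auto
    finally show "seg_exp (seg (a n (fst z)) (snd z)) (%b x'. W x' * ?q (Suc n) (ext n (fst z) b, x'))
      <= \<theta>' * (W (snd z) * ?q n z) + D" .
   qed
   also have "... = \<theta>' * ?E n + D"
    by (simp add: expectation_add_finite[OF processD(1)[OF P]])
   finally show ?thesis .
  qed
  have En: "?E n <= D / (1 - \<theta>')" for n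
  proof (induction n)
   case 0
   have "?E 0 = expect (J 0) (%z. 0)"
    by (rule expectation_cong_pmf) (simp add: processD(4,5)[OF P] q_def)
   then show ?case using D wt by simp
  next
   case (Suc n)
   have "?E (Suc n) <= \<theta>' * (D / (1 - \<theta>')) + D"
    using rec[of n] mult_left_mono[OF Suc, of \<theta>'] wt by linarith
   also have "... = D / (1 - \<theta>')" using wt by (simp add: field_simps)
   finally show ?case .
  qed
  have "expect (J n) (%z. (R0 n (fst z))\<^sup>2 + (R1 n (fst z))\<^sup>2)
    <= expect (J n) (%z. (1 / Wmin) * (W (snd z) * ?q n z))"
  proof (rule expectation_mono_finite[OF processD(1)[OF P]])
   fix z :: "'o \<times> 's"
   let ?r0 = "R0 n (fst z)" and ?r1 = "R1 n (fst z)"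
   have "\<bar>?r0\<bar> <= w * \<bar>?r0\<bar>" using mult_right_mono[OF w(1), of "\<bar>?r0\<bar>"] by simp
   then have "(\<bar>?r1\<bar> + \<bar>?r0\<bar>)\<^sup>2 <= ?q n z" unfolding q_def by (intro power_mono) auto
   moreover have "0 <= 2 * \<bar>?r1\<bar> * \<bar>?r0\<bar>" by simp
   ultimately have 1: "?r0\<^sup>2 + ?r1\<^sup>2 <= ?q n z"
    unfolding power2_sum power2_abs by linarith
   have "1 * ?q n z <= (W (snd z) / Wmin) * ?q n z"
    using W(1) W(2)[of "snd z"] by (intro mult_right_mono) auto
   with 1 show "?r0\<^sup>2 + ?r1\<^sup>2 <= (1 / Wmin) * (W (snd z) * ?q n z)" by simp
  qed
  also have "... = (1 / Wmin) * ?E n" by simp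
  also have "... <= (1 / Wmin) * (D / (1 - \<theta>'))" using W(1) by (intro mult_left_mono En) auto
  finally show "expect (J n) (%z. (R0 n (fst z))\<^sup>2 + (R1 n (fst z))\<^sup>2) <= ?C"
   by (simp add: mult.commute)
 qed
qed

text \<open>Integrates out the batch but keeps the memory before it, so that a functional of both
  becomes a vector on which \<open>U\<close> acts. The result depends on \<open>p\<close> through
  the batch law, a second source of variation in \<open>batch_mean\<close>.\<close>

definition batch_vec :: "('b => real) => ('b => real) => ('b => real) => 'p => 's aff" where
 "batch_vec A B0 B1 p = ((\<chi> x. seg_exp (seg p x) (%b _. A b)), (\<chi> x. seg_exp (seg p x) (%b _. B0 b)),
   (\<chi> x. seg_exp (seg p x) (%b _. B1 b)))"

definition batch_mean :: "('b => real) => ('b => real) => ('b => real) => 'p => real" where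
 "batch_mean A B0 B1 p = erg_mean p (batch_vec A B0 B1 p)"

lemma batch_vec_eval:
 assumes "p \<in> H"
 shows "aff_eval (batch_vec A B0 B1 p) x r0 r1 = seg_exp (seg p x) (%b _. A b + B0 b * r0 + B1 b * r1)"
 unfolding aff_eval_def batch_vec_def seg_exp_sum[OF assms]
 by (simp add: sum_distrib_left sum_distrib_right sum.distrib[symmetric] algebra_simps)

lemma batch_vec_bounds:
 fixes A B0 B1 :: "'b => real"
 shows "\<exists>Q\<ge>0. \<forall>p\<in>H. norm (batch_vec A B0 B1 p) <= Q \<and>
  (\<forall>p'\<in>H. norm (batch_vec A B0 B1 p - batch_vec A B0 B1 p') <= Q * dist p p')"
proof -
 define M where "M = (\<Sum>b\<in>Bs. \<bar>A b\<bar> + \<bar>B0 b\<bar> + \<bar>B1 b\<bar>)"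
 have M: "\<bar>A b\<bar> <= M" "\<bar>B0 b\<bar> <= M" "\<bar>B1 b\<bar> <= M" if "b \<in> Bs" for b
  using member_le_sum[OF that, of "%b. \<bar>A b\<bar> + \<bar>B0 b\<bar> + \<bar>B1 b\<bar>"] finB unfolding M_def
  by (smt (verit) abs_ge_zero)+
 have M0: "0 <= M" unfolding M_def by (intro sum_nonneg) auto
 let ?Q = "real CARD('s) * (3 * M) * (1 + cardA * Lp)"
 have cl: "0 <= cardA * Lp" using Lp by (simp add: cardA_def)
 show ?thesis
 proof (intro exI[of _ ?Q] conjI ballI)
  show "0 <= ?Q" using M0 cl by simp
  fix p assume p: "p \<in> H"
  have "norm (batch_vec A B0 B1 p) <= real CARD('s) * (M + M + M)"
   by (rule norm_aff_le) (auto simp: batch_vec_def intro!: seg_exp_bound p M)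
  also have "... = real CARD('s) * (3 * M) * 1" by simp
  also have "... <= ?Q" using M0 cl by (intro mult_left_mono) auto
  finally show "norm (batch_vec A B0 B1 p) <= ?Q" .
  fix p' assume p': "p' \<in> H"
  have "norm (batch_vec A B0 B1 p - batch_vec A B0 B1 p') \<le>
    real CARD('s) * (cardA * Lp * dist p p' * M + cardA * Lp * dist p p' * M + cardA * Lp * dist p p' * M)"
   by (rule norm_aff_le) (auto simp: batch_vec_def intro!: seg_exp_lip p p' M)
  also have "... = real CARD('s) * (3 * M) * (cardA * Lp) * dist p p'" by (simp add: algebra_simps)
  also have "... <= ?Q * dist p p'" using M0 cl by (intro mult_right_mono mult_left_mono) auto
  finally show "norm (batch_vec A B0 B1 p - batch_vec A B0 B1 p') <= ?Q * dist p p'" .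
 qed
qed

lemma batch_mean_lipschitz:
 "\<exists>Q\<ge>0. \<forall>p\<in>H. \<bar>batch_mean A B0 B1 p\<bar> <= Q \<and>
  (\<forall>p'\<in>H. \<bar>batch_mean A B0 B1 p - batch_mean A B0 B1 p'\<bar> <= Q * dist p p')"
proof -
 obtain Q where Q: "0 <= Q" "\<And>p. p \<in> H ==> norm (batch_vec A B0 B1 p) <= Q"
   "\<And>p p'. p \<in> H ==> p' \<in> H ==> norm (batch_vec A B0 B1 p - batch_vec A B0 B1 p') <= Q * dist p p'"
  using batch_vec_bounds[of A B0 B1] by blast
 show ?thesis
 proof (intro exI[of _ "(C2 + 1 + C5) * Q"] conjI ballI)
  show "0 <= (C2 + 1 + C5) * Q" using Q consts_nonneg by auto
  fix p assume p: "p \<in> H"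
  have "\<bar>batch_mean A B0 B1 p\<bar> <= (C2 + 1) * norm (batch_vec A B0 B1 p)"
   unfolding batch_mean_def by (rule erg_mean_bound[OF p])
  also have "... <= (C2 + 1 + C5) * Q"
   using consts_nonneg Q p by (intro mult_mono) auto
  finally show "\<bar>batch_mean A B0 B1 p\<bar> <= (C2 + 1 + C5) * Q" .
  fix p' assume p': "p' \<in> H"
  have "\<bar>batch_mean A B0 B1 p - batch_mean A B0 B1 p'\<bar> \<le>
    C5 * dist p p' * norm (batch_vec A B0 B1 p) + (C2 + 1) * norm (batch_vec A B0 B1 p - batch_vec A B0 B1 p')"
   unfolding batch_mean_def by (rule erg_mean_lipschitz2[OF p p'])
  also have "... <= C5 * dist p p' * Q + (C2 + 1) * (Q * dist p p')"
   using consts_nonneg Q p p' by (intro add_mono mult_left_mono) auto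
  finally show "\<bar>batch_mean A B0 B1 p - batch_mean A B0 B1 p'\<bar> <= (C2 + 1 + C5) * Q * dist p p'"
   by (simp add: algebra_simps)
 qed
qed

text \<open>Shifting the \<open>n\<close> batches onto the test function leaves
  \<open>U p ^^ n\<close> evaluated at time 0, where the memory vanishes. The rate is uniform in the
  initial state, so every initial law gives the same limit.\<close>

lemma frozen_convergence:
 fixes J :: "nat => ('o \<times> 's) pmf"
 assumes P: "process J (%_ _. p) ext R0 R1"
 shows "(%n. expect (J n) (%z. seg_exp (seg p (snd z))
   (%b _. A b + B0 b * R0 n (fst z) + B1 b * R1 n (fst z)))) \<longlonglongrightarrow> batch_mean A B0 B1 p"
proof -
 obtain z0 where "z0 \<in> set_pmf (J 0)" using set_pmf_not_empty by fast
 then have p: "p \<in> H" using processD(3)[OF P] by blast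
 let ?v = "batch_vec A B0 B1 p"
 have iter: "expect (J n) (%z. aff_eval v (snd z) (R0 n (fst z)) (R1 n (fst z))) =
   expect (J 0) (%z. aff_eval ((U p ^^ n) v) (snd z) 0 0)" for n v
 proof (induction n arbitrary: v)
  case 0
  show ?case by (rule expectation_cong_pmf) (simp add: processD(4,5)[OF P])
 next
  case (Suc n)
  have "expect (J (Suc n)) (%z. aff_eval v (snd z) (R0 (Suc n) (fst z)) (R1 (Suc n) (fst z)))
   = expect (J n) (%z. aff_eval (U p v) (snd z) (R0 n (fst z)) (R1 n (fst z)))"
   unfolding process_step[OF P] fst_conv snd_conv
  proof (rule expectation_cong_pmf)
   fix z assume z: "z \<in> set_pmf (J n)"
   show "seg_exp (seg p (snd z)) (%b x'. aff_eval v x' (R0 (Suc n) (ext n (fst z) b)) (R1 (Suc n) (ext n (fst z) b)))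
     = aff_eval (U p v) (snd z) (R0 n (fst z)) (R1 n (fst z))"
    unfolding U_eval[OF p] seg_exp_def
    by (rule expectation_cong_pmf) (simp add: processD(6,7)[OF P z] seg_in[OF p])
  qed
  also have "... = expect (J 0) (%z. aff_eval ((U p ^^ n) (U p v)) (snd z) 0 0)"
   by (rule Suc)
  finally show ?case by (simp add: funpow_swap1)
 qed
 have rate: "\<bar>expect (J 0) (%z. aff_eval ((U p ^^ n) ?v) (snd z) 0 0) - batch_mean A B0 B1 p\<bar>
   <= C3 * norm ?v * geo_r ^ n" for n
 proof -
  have eq: "expect (J 0) (%z. aff_eval ((U p ^^ n) ?v) (snd z) 0 0) - batch_mean A B0 B1 p
   = expect (J 0) (%z. aff_eval ((U p ^^ n) ?v) (snd z) 0 0 - batch_mean A B0 B1 p)"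
   by (simp add: expectation_diff_finite[OF processD(1)[OF P]])
  have "\<bar>expect (J 0) (%z. aff_eval ((U p ^^ n) ?v) (snd z) 0 0 - batch_mean A B0 B1 p)\<bar>
    <= expect (J 0) (%z. C3 * norm ?v * geo_r ^ n)"
  proof (rule expectation_abs_le_finite[OF processD(1)[OF P]])
   fix z :: "'o \<times> 's"
   have "aff_eval ((U p ^^ n) ?v) (snd z) 0 0 - batch_mean A B0 B1 p
     = fst ((U p ^^ n) ?v - erg_mean p ?v *\<^sub>R aff_one) $ snd z"
    by (simp add: aff_eval_def batch_mean_def aff_one_def)
   then show "\<bar>aff_eval ((U p ^^ n) ?v) (snd z) 0 0 - batch_mean A B0 B1 p\<bar> <= C3 * norm ?v * geo_r ^ n"
    using order_trans[OF aff_components(1) funpow_rate[OF p, of n ?v]] by (simp add: mult_ac)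
  qed
  then show ?thesis unfolding eq expectation_const .
 qed
 have dec: "(%n. C3 * norm ?v * geo_r ^ n) \<longlonglongrightarrow> 0"
  using geo by (intro tendsto_mult_right_zero LIMSEQ_realpow_zero) auto
 have "(%n. expect (J 0) (%z. aff_eval ((U p ^^ n) ?v) (snd z) 0 0)
   - batch_mean A B0 B1 p) \<longlonglongrightarrow> 0"
  by (rule Lim_null_comparison[OF always_eventually[OF allI] dec]) (unfold real_norm_def, rule rate)
 then have "(%n. expect (J 0) (%z. aff_eval ((U p ^^ n) ?v) (snd z) 0 0)) \<longlonglongrightarrow> batch_mean A B0 B1 p"
  by (rule LIM_zero_cancel)
 then show ?thesis unfolding iter[symmetric] batch_vec_eval[OF p] .
qed

text \<open>
 With the finite Poisson sum \<open>v = \<Sum>i<q. U\<^sup>i u\<close> one has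
 \<open>u = v - U v + U\<^sup>q u\<close>, the last term being close to the ergodic mean, and \<open>v - U v\<close> telescopes along
 the trajectory up to errors proportional to the increments of the parameter and the weight.
\<close>

lemma averaging:
 fixes A B0 B1 :: "'b => real" and D \<eta> :: real
 assumes D: "0 <= D" and \<eta>: "0 < \<eta>"
 shows "\<exists>Q\<ge>0. \<forall>(J :: nat => ('o \<times> 's) pmf) a ext R0 R1 d V ep h.
   process J a ext R0 R1 --> 0 <= ep -->
   (\<forall>n\<le>h. \<forall>z\<in>set_pmf (J n). \<bar>d n (fst z)\<bar> <= D \<and> 0 <= V n (fst z)) -->
   (\<forall>n\<le>h. expect (J n) (%z. (V n (fst z))\<^sup>2) <= D) -->
   (\<forall>n<h. \<forall>z\<in>set_pmf (J n). \<forall>b\<in>Bs. \<bar>d (Suc n) (ext n (fst z) b) - d n (fst z)\<bar> <= ep * D * V n (fst z) \<and>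
    dist (a (Suc n) (ext n (fst z) b)) (a n (fst z)) <= ep * D * V n (fst z)) -->
   (\<forall>n\<le>h. \<bar>\<Sum>k<n. expect (J k) (%z. d k (fst z) *
    (seg_exp (seg (a k (fst z)) (snd z)) (%b _. A b + B0 b * R0 k (fst z) + B1 b * R1 k (fst z))
     - batch_mean A B0 B1 (a k (fst z))))\<bar> <= Q + real n * (\<eta> + Q * ep))"
proof -
 obtain Q where Q: "0 <= Q" "\<And>p. p \<in> H ==> norm (batch_vec A B0 B1 p) <= Q"
   "\<And>p p'. p \<in> H ==> p' \<in> H ==> norm (batch_vec A B0 B1 p - batch_vec A B0 B1 p') <= Q * dist p p'"
  using batch_vec_bounds[of A B0 B1] by blast
 obtain Cm where Cm: "0 <= Cm" "\<And>(J :: nat => ('o \<times> 's) pmf) a ext R0 R1 n. process J a ext R0 R1 ==>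
   expect (J n) (%z. (R0 n (fst z))\<^sup>2 + (R1 n (fst z))\<^sup>2) <= Cm"
  using memory_second_moment by blast
 define mom where "mom = 2 + Cm"
 have mom: "0 <= mom" using Cm by (simp add: mom_def)
 \<comment> \<open>The length \<open>q\<close> of the Poisson sum is fixed by the accuracy \<eta>
   before \<open>ep\<close> is known; \<open>Mq\<close> and \<open>Lq\<close> grow with
   \<open>q\<close> but stay constant as \<open>ep\<close> tends to 0.\<close>
 have "(%q. D * (C3 * Q * mom) * geo_r ^ q) \<longlonglongrightarrow> 0"
  using geo by (intro tendsto_mult_right_zero LIMSEQ_realpow_zero) auto
 then have "\<forall>\<^sub>F q in sequentially. D * (C3 * Q * mom) * geo_r ^ q < \<eta>" by (rule order_tendstoD) (rule \<eta>)
 then obtain q where q: "D * (C3 * Q * mom) * geo_r ^ q < \<eta>"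
  using eventually_happens trivial_limit_sequentially by blast
 let ?u = "batch_vec A B0 B1"
 define v where "v p = (\<Sum>i<q. (U p ^^ i) (?u p))" for p
 define Mq where "Mq = real q * (C4 * Q)"
 define Lq where "Lq = real q * (C5 * Q + C4 * Q)"
 have Mq: "0 <= Mq" and Lq: "0 <= Lq" using Q consts_nonneg by (auto simp: Mq_def Lq_def)
 have v_bound: "norm (v p) <= Mq" if p: "p \<in> H" for p
 proof -
  have "norm (v p) <= (\<Sum>i<q. C4 * Q)" unfolding v_def
  proof (intro order_trans[OF norm_sum] sum_mono)
   show "norm ((U p ^^ i) (?u p)) <= C4 * Q" for i
    using funpow_bound[OF p, of i "?u p"] mult_left_mono[OF Q(2)[OF p], of C4] consts_nonneg by linarith
  qed
  then show ?thesis by (simp add: Mq_def)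
 qed
 have v_lip: "norm (v p - v p') <= Lq * dist p p'" if p: "p \<in> H" "p' \<in> H" for p p'
 proof -
  have "norm (v p - v p') <= (\<Sum>i<q. (C5 * Q + C4 * Q) * dist p p')"
   unfolding v_def sum_subtractf[symmetric]
  proof (intro order_trans[OF norm_sum] sum_mono)
   fix i
   have eq: "(U p ^^ i) (?u p) - (U p' ^^ i) (?u p') =
     ((U p ^^ i) (?u p) - (U p' ^^ i) (?u p)) + (U p' ^^ i) (?u p - ?u p')"
    by (simp add: linear_diff[OF linear_funpow[OF U_linear[OF p(2)]]])
   have "norm ((U p ^^ i) (?u p) - (U p' ^^ i) (?u p'))
     <= C5 * dist p p' * norm (?u p) + C4 * norm (?u p - ?u p')"
    unfolding eq using norm_triangle_ineq[of "(U p ^^ i) (?u p) - (U p' ^^ i) (?u p)" "(U p' ^^ i) (?u p - ?u p')"]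
     funpow_lipschitz[OF p, of i "?u p"] funpow_bound[OF p(2), of i "?u p - ?u p'"] by linarith
   also have "... <= C5 * dist p p' * Q + C4 * (Q * dist p p')"
    using consts_nonneg Q p by (intro add_mono mult_left_mono) auto
   finally show "norm ((U p ^^ i) (?u p) - (U p' ^^ i) (?u p')) <= (C5 * Q + C4 * Q) * dist p p'"
    by (simp add: algebra_simps)
  qed
  then show ?thesis by (simp add: Lq_def algebra_simps)
 qed
 have poisson: "?u p = v p - U p (v p) + (U p ^^ q) (?u p)" if p: "p \<in> H" for p
 proof -
  have "U p (v p) = (\<Sum>i<q. (U p ^^ Suc i) (?u p))"
   unfolding v_def by (simp add: linear_sum[OF U_linear[OF p]])
  then have "v p - U p (v p) = (\<Sum>i<q. (U p ^^ i) (?u p) - (U p ^^ Suc i) (?u p))"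
   by (simp only: v_def sum_subtractf)
  also have "... = (U p ^^ 0) (?u p) - (U p ^^ q) (?u p)" by (rule sum_lessThan_telescope')
  finally show ?thesis by simp
 qed
 have aff_add: "aff_eval (x + y) s r0 r1 = aff_eval x s r0 r1 + aff_eval y s r0 r1"
  and aff_diff: "aff_eval (x - y) s r0 r1 = aff_eval x s r0 r1 - aff_eval y s r0 r1" for x y s r0 r1
  by (simp_all add: aff_eval_def algebra_simps)
 \<comment> \<open>Cost of one increment: the modulus of \<open>f\<close> in weight and parameter,
   times a moment bound, with slack, for \<open>V\<close> and the memory after the batch.\<close>
 define K1 where "K1 = (D * Mq + D * D * Lq) * (D + 3 * (1 + 2 * (((1 + per) + 2 * Cb + 1)\<^sup>2 * (1 + Cm))))"
 define Kt where "Kt = 2 * (D * Mq * mom) + \<bar>K1\<bar>"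
 show ?thesis
 proof (intro exI[of _ Kt] conjI allI impI)
  show "0 <= Kt" using D Mq mom by (simp add: Kt_def)
  fix J :: "nat => ('o \<times> 's) pmf" and a ext R0 R1 d V ep h n
  assume P: "process J a ext R0 R1" and ep: "0 <= ep"
   and dV: "\<forall>n\<le>h. \<forall>z\<in>set_pmf (J n). \<bar>d n (fst z)\<bar> <= D \<and> 0 <= V n (fst z)"
   and V2: "\<forall>n\<le>h. expect (J n) (%z. (V n (fst z))\<^sup>2) <= D"
   and inc: "\<forall>n<h. \<forall>z\<in>set_pmf (J n). \<forall>b\<in>Bs. \<bar>d (Suc n) (ext n (fst z) b) - d n (fst z)\<bar> <= ep * D * V n (fst z) \<and>
    dist (a (Suc n) (ext n (fst z) b)) (a n (fst z)) <= ep * D * V n (fst z)" and nh: "n <= h"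
  note fin = processD(1)[OF P]
  let ?E = "%k. expect (J k)"
  let ?R = "%k z. 1 + \<bar>R0 k (fst z)\<bar> + \<bar>R1 k (fst z)\<bar>"
  have R_mom: "?E k (?R k) <= mom" for k
  proof -
   have "?E k (?R k) <= ?E k (%z. 2 + ((R0 k (fst z))\<^sup>2 + (R1 k (fst z))\<^sup>2))"
   proof (rule expectation_mono_finite[OF fin])
    fix z :: "'o \<times> 's"
    have "2 * \<bar>x\<bar> <= 1 + x\<^sup>2" for x :: real
     using zero_le_power2[of "\<bar>x\<bar> - 1"] by (simp add: power2_diff)
    from this[of "R0 k (fst z)"] this[of "R1 k (fst z)"]
    show "?R k z <= 2 + ((R0 k (fst z))\<^sup>2 + (R1 k (fst z))\<^sup>2)"
     using zero_le_power2[of "R0 k (fst z)"] zero_le_power2[of "R1 k (fst z)"] by linarith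
   qed
   also have "... <= mom" using Cm(2)[OF P, of k] by (simp add: expectation_add_finite[OF fin] mom_def)
   finally show ?thesis .
  qed
  define f where "f k z = d k (fst z) * aff_eval (v (a k (fst z))) (snd z) (R0 k (fst z)) (R1 k (fst z))" for k z
  define g where "g k z = d k (fst z) * (seg_exp (seg (a k (fst z)) (snd z)) (%b _. A b + B0 b * R0 k (fst z) + B1 b * R1 k (fst z))
     - batch_mean A B0 B1 (a k (fst z)))" for k z
  have f_bound: "\<bar>?E k (f k)\<bar> <= D * Mq * mom" if kh: "k <= h" for k
  proof -
   have "\<bar>?E k (f k)\<bar> <= ?E k (%z. (D * Mq) * ?R k z)"
   proof (rule expectation_abs_le_finite[OF fin])
    fix z assume z: "z \<in> set_pmf (J k)"
    have "\<bar>aff_eval (v (a k (fst z))) (snd z) (R0 k (fst z)) (R1 k (fst z))\<bar> <= Mq * ?R k z"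
     by (rule order_trans[OF aff_eval_bound mult_right_mono[OF v_bound]]) (auto simp: processD(3)[OF P z])
    then have "\<bar>f k z\<bar> <= D * (Mq * ?R k z)"
     unfolding f_def abs_mult using dV kh z D by (intro mult_mono) auto
    then show "\<bar>f k z\<bar> <= (D * Mq) * ?R k z" by simp
   qed
   also have "... = (D * Mq) * ?E k (?R k)" by simp
   also have "... <= D * Mq * mom" using D Mq by (intro mult_left_mono R_mom) auto
   finally show ?thesis .
  qed
  define cc where "cc = (1 + per) + 2 * Cb + 1"
  have cc: "1 <= cc" using per Cb by (simp add: cc_def)
  have step: "\<bar>?E k (g k) - (?E k (f k) - ?E (Suc k) (f (Suc k)))\<bar> <= \<eta> + Kt * ep" if kh: "k < h" for k
  proof -
   have eq: "?E k (g k) - (?E k (f k) - ?E (Suc k) (f (Suc k))) =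
    ?E k (%z. g k z - f k z + seg_exp (seg (a k (fst z)) (snd z)) (%b x'. f (Suc k) (ext k (fst z) b, x')))"
    by (simp add: process_step[OF P] expectation_add_finite[OF fin] expectation_diff_finite[OF fin])
   have "\<bar>?E k (%z. g k z - f k z + seg_exp (seg (a k (fst z)) (snd z)) (%b x'. f (Suc k) (ext k (fst z) b, x')))\<bar>
    <= ?E k (%z. (D * (C3 * Q) * geo_r ^ q) * ?R k z
     + (ep * (D * Mq + D * D * Lq)) * ((V k (fst z))\<^sup>2 + 3 * (cc\<^sup>2 * (1 + ((R0 k (fst z))\<^sup>2 + (R1 k (fst z))\<^sup>2)))))"
   proof (rule expectation_abs_le_finite[OF fin])
    fix z assume z: "z \<in> set_pmf (J k)"
    have p: "a k (fst z) \<in> H" by (rule processD(3)[OF P z])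
    let ?p = "a k (fst z)" and ?r0 = "R0 k (fst z)" and ?r1 = "R1 k (fst z)" and ?d = "d k (fst z)"
    let ?V = "V k (fst z)"
    have V0: "0 <= ?V" and dD: "\<bar>?d\<bar> <= D" using dV z kh by auto
    have e1: "seg_exp (seg ?p (snd z)) (%b _. A b + B0 b * ?r0 + B1 b * ?r1) - batch_mean A B0 B1 ?p
     = aff_eval (v ?p) (snd z) ?r0 ?r1 - aff_eval (U ?p (v ?p)) (snd z) ?r0 ?r1
      + aff_eval ((U ?p ^^ q) (?u ?p) - erg_mean ?p (?u ?p) *\<^sub>R aff_one) (snd z) ?r0 ?r1"
    proof -
     have "aff_eval (erg_mean ?p (?u ?p) *\<^sub>R aff_one) (snd z) ?r0 ?r1 = batch_mean A B0 B1 ?p"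
      by (simp add: aff_eval_def aff_one_def batch_mean_def)
     then show ?thesis
      unfolding batch_vec_eval[OF p, symmetric] by (subst poisson[OF p]) (simp add: aff_add aff_diff)
    qed
    have e2: "g k z - f k z + seg_exp (seg ?p (snd z)) (%b x'. f (Suc k) (ext k (fst z) b, x'))
     = ?d * aff_eval ((U ?p ^^ q) (?u ?p) - erg_mean ?p (?u ?p) *\<^sub>R aff_one) (snd z) ?r0 ?r1
      + seg_exp (seg ?p (snd z)) (%b x'. f (Suc k) (ext k (fst z) b, x')
        - ?d * aff_eval (v ?p) x' (upd0 b ?r0) (upd1 b ?r0 ?r1))"
     unfolding g_def e1 U_eval[OF p] seg_exp_diff[OF p] seg_exp_cmult
     by (simp add: f_def algebra_simps)
    have b1: "\<bar>?d * aff_eval ((U ?p ^^ q) (?u ?p) - erg_mean ?p (?u ?p) *\<^sub>R aff_one) (snd z) ?r0 ?r1\<bar>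
      <= (D * (C3 * Q) * geo_r ^ q) * ?R k z"
    proof -
     have "norm ((U ?p ^^ q) (?u ?p) - erg_mean ?p (?u ?p) *\<^sub>R aff_one) <= C3 * geo_r ^ q * Q"
      using funpow_rate[OF p, of q "?u ?p"] mult_left_mono[OF Q(2)[OF p], of "C3 * geo_r ^ q"] consts_nonneg geo
      by (smt (verit) mult_nonneg_nonneg zero_le_power)
     then have "\<bar>aff_eval ((U ?p ^^ q) (?u ?p) - erg_mean ?p (?u ?p) *\<^sub>R aff_one) (snd z) ?r0 ?r1\<bar>
       <= C3 * geo_r ^ q * Q * ?R k z"
      by (intro order_trans[OF aff_eval_bound] mult_right_mono) auto
     then have "\<bar>?d\<bar> * \<bar>aff_eval ((U ?p ^^ q) (?u ?p) - erg_mean ?p (?u ?p) *\<^sub>R aff_one) (snd z) ?r0 ?r1\<bar>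
       <= D * (C3 * geo_r ^ q * Q * ?R k z)"
      using dD D by (intro mult_mono) auto
     then show ?thesis by (simp add: abs_mult mult_ac)
    qed
    have b2: "\<bar>seg_exp (seg ?p (snd z)) (%b x'. f (Suc k) (ext k (fst z) b, x')
        - ?d * aff_eval (v ?p) x' (upd0 b ?r0) (upd1 b ?r0 ?r1))\<bar>
      <= (ep * (D * Mq + D * D * Lq)) * (?V\<^sup>2 + 3 * (cc\<^sup>2 * (1 + (?r0\<^sup>2 + ?r1\<^sup>2))))"
    proof (rule seg_exp_bound_support[OF p])
     fix y assume y: "y \<in> set_pmf (seg ?p (snd z))"
     define b where "b = fst y"
     define x' where "x' = snd y"
     have b: "b \<in> Bs" unfolding b_def by (rule seg_in[OF p y])
     let ?om = "ext k (fst z) b" and ?s0 = "upd0 b ?r0" and ?s1 = "upd1 b ?r0 ?r1"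
     have y': "(?om, x') \<in> set_pmf (J (Suc k))"
      unfolding b_def x'_def by (rule process_support[OF P z y])
     have p': "a (Suc k) ?om \<in> H" using processD(3)[OF P y'] by simp
     have dD': "\<bar>d (Suc k) ?om\<bar> <= D" using dV[rule_format, of "Suc k" "(?om, x')"] y' kh by simp
     have "\<bar>f (Suc k) (?om, x') - ?d * aff_eval (v ?p) x' ?s0 ?s1\<bar> \<le>
       (ep * (D * Mq + D * D * Lq)) * (?V\<^sup>2 + 3 * (cc\<^sup>2 * (1 + (?r0\<^sup>2 + ?r1\<^sup>2))))"
     proof -
      let ?p' = "a (Suc k) ?om" and ?d' = "d (Suc k) ?om"
      let ?S = "1 + \<bar>?s0\<bar> + \<bar>?s1\<bar>"
      have i1: "\<bar>?d' - ?d\<bar> <= ep * D * ?V" and i2: "dist ?p' ?p <= ep * D * ?V" using inc kh z b by auto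
      have eq: "f (Suc k) (?om, x') - ?d * aff_eval (v ?p) x' ?s0 ?s1 =
        ?d' * aff_eval (v ?p' - v ?p) x' ?s0 ?s1 + (?d' - ?d) * aff_eval (v ?p) x' ?s0 ?s1"
       by (simp add: f_def processD(6,7)[OF P z b] aff_diff algebra_simps)
      have "\<bar>?d' * aff_eval (v ?p' - v ?p) x' ?s0 ?s1 + (?d' - ?d) * aff_eval (v ?p) x' ?s0 ?s1\<bar>
       <= \<bar>?d'\<bar> * \<bar>aff_eval (v ?p' - v ?p) x' ?s0 ?s1\<bar> + \<bar>?d' - ?d\<bar> * \<bar>aff_eval (v ?p) x' ?s0 ?s1\<bar>"
       unfolding abs_mult[symmetric] by (rule abs_triangle_ineq)
      also have "... <= D * ((Lq * (ep * D * ?V)) * ?S) + (ep * D * ?V) * (Mq * ?S)"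
      proof (intro add_mono mult_mono dD' i1)
       have "norm (v ?p' - v ?p) <= Lq * (ep * D * ?V)"
        by (rule order_trans[OF v_lip[OF p' p] mult_left_mono[OF i2 Lq]])
       then show "\<bar>aff_eval (v ?p' - v ?p) x' ?s0 ?s1\<bar> <= (Lq * (ep * D * ?V)) * ?S"
        by (intro order_trans[OF aff_eval_bound] mult_right_mono) auto
       show "\<bar>aff_eval (v ?p) x' ?s0 ?s1\<bar> <= Mq * ?S"
        by (intro order_trans[OF aff_eval_bound] mult_right_mono v_bound p) auto
      qed (use D ep V0 in auto)
      also have "... = (ep * (D * Mq + D * D * Lq)) * (?V * ?S)" by (simp add: algebra_simps)
      also have "... <= (ep * (D * Mq + D * D * Lq)) * (?V\<^sup>2 + 3 * (cc\<^sup>2 * (1 + (?r0\<^sup>2 + ?r1\<^sup>2))))"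
      proof (rule mult_left_mono)
       have s0: "\<bar>?s0\<bar> <= \<bar>?r0\<bar> + Cb"
        unfolding upd0_def using surv[of b] c_bound(1)[OF b] by auto
       have s1: "\<bar>?s1\<bar> <= \<bar>?r1\<bar> + per * \<bar>?r0\<bar> + Cb"
       proof (cases "surv b = 0")
        case True
        then have "?s1 = c1 b" by (simp add: upd1_def)
        then show ?thesis
         using c_bound(2)[OF b] mult_nonneg_nonneg[OF per abs_ge_zero[of ?r0]] abs_ge_zero[of ?r1] by linarith
       next
        case False
        then have "?s1 = ?r1 + per * ?r0 + c1 b" using surv[of b] by (simp add: upd1_def)
        moreover have "\<bar>per * ?r0\<bar> = per * \<bar>?r0\<bar>" using per by (simp add: abs_mult)
        ultimately show ?thesis using c_bound(2)[OF b] by linarith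
       qed
       have "?S <= cc * (1 + \<bar>?r0\<bar> + \<bar>?r1\<bar>)"
       proof -
        have "0 <= (1 + per) * 1 + (1 + 2 * Cb) * \<bar>?r0\<bar> + (1 + per + 2 * Cb) * \<bar>?r1\<bar>"
         using per Cb by (intro add_nonneg_nonneg mult_nonneg_nonneg) auto
        then have "1 + (\<bar>?r0\<bar> + Cb) + (\<bar>?r1\<bar> + per * \<bar>?r0\<bar> + Cb) <= cc * (1 + \<bar>?r0\<bar> + \<bar>?r1\<bar>)"
         unfolding cc_def by (simp add: algebra_simps)
        then show ?thesis using s0 s1 by linarith
       qed
       then have "?S\<^sup>2 <= (cc * (1 + \<bar>?r0\<bar> + \<bar>?r1\<bar>))\<^sup>2" by (intro power_mono) auto
       also have "... = cc\<^sup>2 * (1 + \<bar>?r0\<bar> + \<bar>?r1\<bar>)\<^sup>2" by (rule power_mult_distrib)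
       also have "... <= cc\<^sup>2 * (3 * (1 + (?r0\<^sup>2 + ?r1\<^sup>2)))"
       proof (rule mult_left_mono)
        have "0 <= (1 - \<bar>?r0\<bar>)\<^sup>2 + (1 - \<bar>?r1\<bar>)\<^sup>2 + (\<bar>?r0\<bar> - \<bar>?r1\<bar>)\<^sup>2" by simp
        then show "(1 + \<bar>?r0\<bar> + \<bar>?r1\<bar>)\<^sup>2 <= 3 * (1 + (?r0\<^sup>2 + ?r1\<^sup>2))"
         by (simp add: power2_eq_square algebra_simps)
       qed simp
       finally have S2: "?S\<^sup>2 <= 3 * (cc\<^sup>2 * (1 + (?r0\<^sup>2 + ?r1\<^sup>2)))"
        by (simp only: mult.left_commute[of "cc\<^sup>2" 3])
       \<comment> \<open>Envelope and memory are controlled in mean square only, so their product is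
         split into squares.\<close>
       have "0 <= (?V - ?S)\<^sup>2" by simp
       then have "2 * (?V * ?S) <= ?V\<^sup>2 + ?S\<^sup>2" by (simp add: power2_eq_square algebra_simps)
       moreover have "0 <= ?V * ?S" using V0 by (intro mult_nonneg_nonneg) auto
       ultimately show "?V * ?S <= ?V\<^sup>2 + 3 * (cc\<^sup>2 * (1 + (?r0\<^sup>2 + ?r1\<^sup>2)))" using S2 by linarith
      qed (use ep D Mq Lq in auto)
      finally show ?thesis unfolding eq .
     qed
     then show "\<bar>f (Suc k) (ext k (fst z) (fst y), snd y) - ?d * aff_eval (v ?p) (snd y) (upd0 (fst y) ?r0) (upd1 (fst y) ?r0 ?r1)\<bar>
      <= (ep * (D * Mq + D * D * Lq)) * (?V\<^sup>2 + 3 * (cc\<^sup>2 * (1 + (?r0\<^sup>2 + ?r1\<^sup>2))))"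
      unfolding b_def x'_def .
    qed
    show "\<bar>g k z - f k z + seg_exp (seg ?p (snd z)) (%b x'. f (Suc k) (ext k (fst z) b, x'))\<bar> \<le>
      (D * (C3 * Q) * geo_r ^ q) * ?R k z
     + (ep * (D * Mq + D * D * Lq)) * (?V\<^sup>2 + 3 * (cc\<^sup>2 * (1 + (?r0\<^sup>2 + ?r1\<^sup>2))))"
     unfolding e2 by (rule order_trans[OF abs_triangle_ineq add_mono[OF b1 b2]])
   qed
   also have "... = (D * (C3 * Q) * geo_r ^ q) * ?E k (?R k)
     + (ep * (D * Mq + D * D * Lq)) * (?E k (%z. (V k (fst z))\<^sup>2)
       + 3 * (cc\<^sup>2 * (1 + ?E k (%z. (R0 k (fst z))\<^sup>2 + (R1 k (fst z))\<^sup>2))))"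
    by (simp add: expectation_add_finite[OF fin])
   also have "... <= (D * (C3 * Q) * geo_r ^ q) * mom
     + (ep * (D * Mq + D * D * Lq)) * (D + 3 * (cc\<^sup>2 * (1 + Cm)))"
    using D Q consts_nonneg geo ep Mq Lq V2[rule_format, of k] kh Cm(2)[OF P, of k]
    by (intro add_mono mult_left_mono R_mom) auto
   also have "... <= \<eta> + ep * K1"
   proof (intro add_mono)
    show "D * (C3 * Q) * geo_r ^ q * mom <= \<eta>" using q by (simp add: mult_ac)
    have "D + 3 * X <= D + 3 * (1 + 2 * X)" if "0 <= X" for X :: real using that by simp
    from this[of "cc\<^sup>2 * (1 + Cm)"] have "D + 3 * (cc\<^sup>2 * (1 + Cm)) <= D + 3 * (1 + 2 * (cc\<^sup>2 * (1 + Cm)))"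
     using Cm by simp
    then have "(ep * (D * Mq + D * D * Lq)) * (D + 3 * (cc\<^sup>2 * (1 + Cm)))
      <= (ep * (D * Mq + D * D * Lq)) * (D + 3 * (1 + 2 * (cc\<^sup>2 * (1 + Cm))))"
     using ep D Mq Lq by (intro mult_left_mono) auto
    then show "(ep * (D * Mq + D * D * Lq)) * (D + 3 * (cc\<^sup>2 * (1 + Cm))) <= ep * K1"
     unfolding K1_def cc_def by (simp add: mult.assoc)
   qed
   also have "... <= \<eta> + Kt * ep"
   proof -
    have "0 <= D * Mq * mom" using D Mq mom by simp
    then have "K1 <= Kt" unfolding Kt_def by linarith
    then show ?thesis using ep mult_left_mono[of K1 Kt ep] by (simp add: mult_ac)
   qed
   finally show ?thesis unfolding eq .
  qed
  have tel: "(\<Sum>k<n. ?E k (f k) - ?E (Suc k) (f (Suc k))) = ?E 0 (f 0) - ?E n (f n)"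
   by (rule sum_lessThan_telescope')
  have "\<bar>\<Sum>k<n. ?E k (g k)\<bar> <= \<bar>\<Sum>k<n. ?E k (g k) - (?E k (f k) - ?E (Suc k) (f (Suc k)))\<bar> + \<bar>?E 0 (f 0) - ?E n (f n)\<bar>"
   unfolding tel[symmetric] sum_subtractf[of "%k. ?E k (g k)"] by linarith
  also have "... <= (\<Sum>k<n. \<eta> + Kt * ep) + 2 * (D * Mq * mom)"
  proof (intro add_mono order_trans[OF sum_abs] sum_mono)
   show "\<bar>?E k (g k) - (?E k (f k) - ?E (Suc k) (f (Suc k)))\<bar> <= \<eta> + Kt * ep" if "k \<in> {..<n}" for k
    using that nh by (intro step) simp
   show "\<bar>?E 0 (f 0) - ?E n (f n)\<bar> <= 2 * (D * Mq * mom)" using f_bound[of 0] f_bound[of n] nh by simp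
  qed
  also have "... <= Kt + real n * (\<eta> + Kt * ep)" by (simp add: Kt_def)
  finally show "\<bar>\<Sum>k<n. ?E k (%z. d k (fst z) *
    (seg_exp (seg (a k (fst z)) (snd z)) (%b _. A b + B0 b * R0 k (fst z) + B1 b * R1 k (fst z))
     - batch_mean A B0 B1 (a k (fst z))))\<bar> <= Kt + real n * (\<eta> + Kt * ep)"
   unfolding g_def .
 qed
qed

end

section \<open>Reflected differential equations in a box\<close>

lemma clamp_inner:
 fixes a b v :: "'a::euclidean_space"
 assumes "\<And>i. i \<in> Basis ==> a \<bullet> i <= b \<bullet> i" "i \<in> Basis"
 shows "clamp a b v \<bullet> i = max (a \<bullet> i) (min (b \<bullet> i) (v \<bullet> i))"
proof -
 have "clamp a b v \<bullet> i = (if v \<bullet> i < a \<bullet> i then a \<bullet> i else if v \<bullet> i <= b \<bullet> i then v \<bullet> i else b \<bullet> i)"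
  using assms by (simp add: clamp_def inner_sum_left_Basis)
 then show ?thesis using assms(1)[OF assms(2)] by (auto simp: max_def min_def)
qed

text \<open>The box is a product of intervals, so the inequality characterising the projection holds
  coordinate by coordinate.\<close>

lemma clamp_variational:
 fixes a b v q :: "'a::euclidean_space"
 assumes ab: "\<And>i. i \<in> Basis ==> a \<bullet> i <= b \<bullet> i" and q: "q \<in> cbox a b"
 shows "(v - clamp a b v) \<bullet> (q - clamp a b v) <= 0"
proof -
 have "(v - clamp a b v) \<bullet> (q - clamp a b v)
   = (\<Sum>i\<in>Basis. (v \<bullet> i - clamp a b v \<bullet> i) * (q \<bullet> i - clamp a b v \<bullet> i))"
  by (subst euclidean_inner) (simp add: inner_diff_left)
 also have "... <= 0"
 proof (rule sum_nonpos)
  fix i :: 'a assume i: "i \<in> Basis"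
  have "a \<bullet> i <= q \<bullet> i" "q \<bullet> i <= b \<bullet> i" using q i by (auto simp: mem_box)
  then show "(v \<bullet> i - clamp a b v \<bullet> i) * (q \<bullet> i - clamp a b v \<bullet> i) <= 0"
   using clamp_inner[OF ab i, of v] by (auto simp: max_def min_def mult_le_0_iff)
 qed
 finally show ?thesis .
qed

text \<open>Combine the variational inequality with Cauchy-Schwarz. With \<open>q\<close> the point
  before a step, the overshoot removed by the projection is at most the length of the step.\<close>

lemma clamp_excess:
 fixes a b v q :: "'a::euclidean_space"
 assumes ab: "\<And>i. i \<in> Basis ==> a \<bullet> i <= b \<bullet> i" and q: "q \<in> cbox a b"
 shows "norm (v - clamp a b v) <= norm (v - q)"
proof -
 let ?c = "clamp a b v"
 have "(norm (v - ?c))\<^sup>2 = (v - ?c) \<bullet> (v - q) + (v - ?c) \<bullet> (q - ?c)"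
  by (simp add: power2_norm_eq_inner inner_diff_right)
 also have "... <= norm (v - ?c) * norm (v - q)"
  using clamp_variational[OF ab q, of v] norm_cauchy_schwarz[of "v - ?c" "v - q"] by linarith
 finally show ?thesis by (cases "v = ?c") (auto simp: power2_eq_square)
qed

lemma clamp_step:
 fixes a b :: "'a::euclidean_space"
 assumes "q \<in> cbox a b"
 shows "norm (clamp a b (q + w) - q) <= norm w"
 using dist_clamps_le_dist_args[of a b "q + w" q] assms
 by (simp add: dist_norm clamp_cancel_cbox box_ne_empty)

text \<open>One-dimensional minimal reflection: at an endpoint it cancels the part of the velocity
  \<open>w\<close> that points out of the interval.\<close>

definition refl1 :: "real => real => real => real => real" where
 "refl1 l u y w = (if y = l then max 0 (- w) else if y = u then - max 0 w else 0)"

section \<open>The projected Euler scheme in a box and its dyadic limit\<close>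

locale box_euler =
 fixes a b :: "'a::euclidean_space" and F :: "'a => 'a" and L M T :: real and x0 :: 'a
 assumes ab: "i \<in> Basis ==> a \<bullet> i < b \<bullet> i"
  and lipF: "x \<in> cbox a b ==> y \<in> cbox a b ==> norm (F x - F y) <= L * norm (x - y)"
  and bdF: "x \<in> cbox a b ==> norm (F x) <= M"
  and L: "0 <= L" and M: "0 < M" and T: "0 < T" and x0: "x0 \<in> cbox a b"
begin

lemma ab': "i \<in> Basis ==> a \<bullet> i <= b \<bullet> i" using ab by (simp add: less_imp_le)

primrec euler :: "real => nat => 'a" where
 "euler h 0 = x0"
| "euler h (Suc n) = clamp a b (euler h n + h *\<^sub>R F (euler h n))"

lemma clamp_in: "clamp a b v \<in> cbox a b"
 using clamp_in_interval[of a b v] ab' by auto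

lemma euler_in: "euler h n \<in> cbox a b"
 by (cases n) (auto simp: x0 clamp_in)

lemma euler_step: "0 <= h ==> norm (euler h (Suc n) - euler h n) <= h * M"
 using clamp_step[OF euler_in, of h n "h *\<^sub>R F (euler h n)"] mult_left_mono[OF bdF[OF euler_in, of h n], of h]
 by simp

lemma euler_lip: "0 <= h ==> m <= n ==> norm (euler h n - euler h m) <= real (n - m) * (h * M)"
proof (induction n)
 case (Suc n)
 show ?case
 proof (cases "m <= n")
  case True
  have "norm (euler h (Suc n) - euler h m) <= norm (euler h (Suc n) - euler h n) + norm (euler h n - euler h m)"
   using norm_triangle_ineq[of "euler h (Suc n) - euler h n" "euler h n - euler h m"] by simp
  also have "... <= h * M + real (n - m) * (h * M)" using Suc True euler_step[of h n] by (intro add_mono) auto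
  also have "... = real (Suc n - m) * (h * M)" using True by (simp add: Suc_diff_le algebra_simps)
  finally show ?thesis .
 next
  case False
  then have "m = Suc n" using Suc by auto
  then show ?thesis by simp
 qed
qed simp

definition diam where "diam = norm (b - a)"

lemma diam: "x \<in> cbox a b ==> y \<in> cbox a b ==> norm (x - y) <= diam"
 unfolding diam_def dist_norm[symmetric]
proof -
 assume xy: "x \<in> cbox a b" "y \<in> cbox a b"
 show "dist x y <= dist b a" unfolding dist_norm
 proof (rule norm_le_componentwise)
  fix i :: 'a assume i: "i \<in> Basis"
  then show "\<bar>(x - y) \<bullet> i\<bar> <= \<bar>(b - a) \<bullet> i\<bar>" using xy ab'[OF i] by (force simp: mem_box inner_diff_left)
 qed
qed

text \<open>Gathers the second-order terms in the comparison of one full step with two half steps,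
  \<open>M ^ 2 / 2\<close> being the part due to the intermediate projection; distances are bounded
  by \<open>diam\<close> and the step by \<open>T\<close>.\<close>

definition Ce where "Ce = 4 * L * M * diam + 2 * (L * M * (diam + 2 * T * M)) + M\<^sup>2 / 2"

lemma Ce: "0 <= Ce" using L M T by (simp add: Ce_def diam_def)

text \<open>One step of size \<open>h\<close> against two steps of size \<open>h / 2\<close>: the projection terms have a sign by the
 variational inequality, except for the one at the intermediate point, which is of order \<open>h\<^sup>2\<close>.\<close>

lemma halving_step:
 assumes x: "x \<in> cbox a b" and y: "y \<in> cbox a b" and h: "0 <= h" "h <= T"
  and x': "x' = clamp a b (x + h *\<^sub>R F x)" and z: "z = clamp a b (y + (h / 2) *\<^sub>R F y)"
  and y': "y' = clamp a b (z + (h / 2) *\<^sub>R F z)"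
 shows "(norm (y' - x'))\<^sup>2 <= (1 + 2 * L * h) * (norm (y - x))\<^sup>2 + Ce * h\<^sup>2"
proof -
 define n where "n = x + h *\<^sub>R F x - x'"
 define n1 where "n1 = y + (h / 2) *\<^sub>R F y - z"
 define n2 where "n2 = z + (h / 2) *\<^sub>R F z - y'"
 have inn: "x' \<in> cbox a b" "z \<in> cbox a b" "y' \<in> cbox a b" by (simp_all add: x' y' z clamp_in)
 have hF: "norm (h *\<^sub>R F v) <= h * M" "norm ((h / 2) *\<^sub>R F v) <= h / 2 * M" if "v \<in> cbox a b" for v
  using h bdF[OF that] by (auto intro!: mult_left_mono)
 have sx: "norm (x' - x) <= h * M" using clamp_step[OF x, of "h *\<^sub>R F x"] hF(1)[OF x] by (simp add: x')
 have sz: "norm (z - y) <= h / 2 * M" using clamp_step[OF y, of "(h / 2) *\<^sub>R F y"] hF(2)[OF y] by (simp only: z)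
 have sy: "norm (y' - z) <= h / 2 * M"
  using clamp_step[OF inn(2), of "(h / 2) *\<^sub>R F z"] hF(2)[OF inn(2)] by (simp only: y')
 have n1: "norm n1 <= h / 2 * M"
  using clamp_excess[OF ab' y, of "y + (h / 2) *\<^sub>R F y"] hF(2)[OF y] unfolding n1_def z by simp
 have v1: "n \<bullet> (y' - x') <= 0" unfolding n_def x' by (rule clamp_variational[OF ab' inn(3)])
 have v2: "n2 \<bullet> (x' - y') <= 0" unfolding n2_def y' by (rule clamp_variational[OF ab' inn(1)])
 have v3: "n1 \<bullet> (x' - z) <= 0" unfolding n1_def z by (rule clamp_variational[OF ab' inn(1)])
 have v4: "n1 \<bullet> (z - y') <= (h / 2 * M) * (h / 2 * M)"
 proof -
  have "n1 \<bullet> (z - y') <= norm n1 * norm (z - y')" by (rule norm_cauchy_schwarz)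
  also have "... <= (h / 2 * M) * (h / 2 * M)"
   using n1 sy h M by (intro mult_mono) (auto simp: norm_minus_commute)
  finally show ?thesis .
 qed
 let ?D = "y - x" and ?E = "y' - x'" and ?d = "norm (y - x)"
 let ?g = "(h / 2) *\<^sub>R (F y - F x) + (h / 2) *\<^sub>R (F z - F x)"
 have half: "h *\<^sub>R F x = (h / 2) *\<^sub>R F x + (h / 2) *\<^sub>R F x" by (simp flip: scaleR_left.add)
 have dE: "?E - ?D = ?g - n1 - n2 + n"
  unfolding n_def n1_def n2_def half by (simp add: algebra_simps)
 have En: "norm ?E <= ?d + 2 * h * M"
 proof -
  have e: "?E = ?D + ((y' - z) + (z - y)) - (x' - x)" by simp
  have "norm ?E <= ?d + (norm (y' - z) + norm (z - y)) + norm (x' - x)"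
   unfolding e using norm_triangle_ineq4[of "?D + ((y' - z) + (z - y))" "x' - x"]
    norm_triangle_ineq[of ?D "(y' - z) + (z - y)"] norm_triangle_ineq[of "y' - z" "z - y"] by linarith
  then show ?thesis using sx sy sz by (simp add: algebra_simps)
 qed
 have gn: "norm ?g <= h * L * ?d + h\<^sup>2 * L * M"
 proof -
  have "norm (F y - F x) <= L * ?d" by (rule lipF[OF y x])
  moreover have "norm (F z - F x) <= L * (?d + h * M)"
  proof -
   have "norm (F z - F x) <= L * norm (z - x)" by (rule lipF[OF inn(2) x])
   also have "... <= L * (?d + h * M)"
   proof (rule mult_left_mono[OF _ L])
    have "norm (z - x) <= norm (z - y) + ?d" using norm_triangle_ineq[of "z - y" "y - x"] by simp
    also have "h / 2 * M <= h * M" using h M by (intro mult_right_mono) auto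
    ultimately show "norm (z - x) <= ?d + h * M" using sz by linarith
   qed
   finally show ?thesis .
  qed
  ultimately have "norm ?g <= h / 2 * (L * ?d) + h / 2 * (L * (?d + h * M))"
   using h by (intro order_trans[OF norm_triangle_ineq] add_mono) (auto intro!: mult_left_mono)
  also have "... = h * L * ?d + h\<^sup>2 * L * M / 2" by (simp add: power2_eq_square algebra_simps)
  also have "... <= h * L * ?d + h\<^sup>2 * L * M" using L M by simp
  finally show ?thesis .
 qed
 have gE: "?g \<bullet> ?E <= h * L * ?d\<^sup>2 + h\<^sup>2 * (2 * L * M * diam + L * M * (diam + 2 * T * M))"
 proof -
  have "?g \<bullet> ?E <= (h * L * ?d + h\<^sup>2 * L * M) * (?d + 2 * h * M)"
   using gn En h L M by (intro order_trans[OF norm_cauchy_schwarz] mult_mono) auto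
  also have "... = h * L * ?d\<^sup>2 + h\<^sup>2 * (2 * L * M * ?d + L * M * (?d + 2 * h * M))"
   by (simp add: power2_eq_square algebra_simps)
  also have "... <= h * L * ?d\<^sup>2 + h\<^sup>2 * (2 * L * M * diam + L * M * (diam + 2 * T * M))"
   using diam[OF y x] h L M by (intro add_left_mono mult_left_mono add_mono mult_right_mono) auto
  finally show ?thesis .
 qed
 have "(norm ?E)\<^sup>2 = (norm ?D)\<^sup>2 + 2 * ((?E - ?D) \<bullet> ?E) - (norm (?E - ?D))\<^sup>2"
  by (simp add: power2_norm_eq_inner inner_diff_left inner_diff_right inner_commute)
 also have "... <= ?d\<^sup>2 + 2 * ((?E - ?D) \<bullet> ?E)" by simp
 also have "(?E - ?D) \<bullet> ?E = ?g \<bullet> ?E + n1 \<bullet> (x' - z) + n1 \<bullet> (z - y') + n2 \<bullet> (x' - y') + n \<bullet> (y' - x')"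
  unfolding dE by (simp add: inner_diff_left inner_diff_right inner_add_left)
 also have "... <= h * L * ?d\<^sup>2 + h\<^sup>2 * (2 * L * M * diam + L * M * (diam + 2 * T * M)) + (h / 2 * M) * (h / 2 * M)"
  using gE v1 v2 v3 v4 by linarith
 finally have "(norm ?E)\<^sup>2 <= ?d\<^sup>2 + 2 * (h * L * ?d\<^sup>2 + h\<^sup>2 * (2 * L * M * diam + L * M * (diam + 2 * T * M)) + (h / 2 * M) * (h / 2 * M))"
  by simp
 also have "... = (1 + 2 * L * h) * ?d\<^sup>2 + h\<^sup>2 * (4 * L * M * diam + 2 * (L * M * (diam + 2 * T * M)) + M\<^sup>2 / 2)"
  by (simp add: power2_eq_square algebra_simps)
 finally show ?thesis by (simp add: Ce_def mult.commute)
qed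

text \<open>At most \<open>T / h\<close> steps each add \<open>Ce * h ^ 2\<close> to the squared
  distance and amplify it by \<open>exp (2 * L * h)\<close>. The squared distance is thus of order
  \<open>h\<close>, the distance only of order \<open>sqrt h\<close>.\<close>

lemma halving_error:
 assumes h: "0 < h" "real n * h <= T" "h <= T"
 shows "(norm (euler (h / 2) (2 * n) - euler h n))\<^sup>2 <= Ce * T * exp (2 * L * T) * h"
proof -
 have "(norm (euler (h / 2) (2 * n) - euler h n))\<^sup>2 <= real n * (Ce * h\<^sup>2) * exp (2 * L * h * real n)" for n
 proof (induction n)
  case (Suc n)
  let ?e = "%n. (norm (euler (h / 2) (2 * n) - euler h n))\<^sup>2"
  have "?e (Suc n) <= (1 + 2 * L * h) * ?e n + Ce * h\<^sup>2"
   by (rule halving_step[OF euler_in euler_in _ h(3) _ refl]) (use h in auto)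
  also have "... <= exp (2 * L * h) * (real n * (Ce * h\<^sup>2) * exp (2 * L * h * real n)) + Ce * h\<^sup>2 * exp (2 * L * h * real (Suc n))"
  proof (rule add_mono[OF mult_mono[OF _ Suc]])
   show "1 + 2 * L * h <= exp (2 * L * h)" by (rule exp_ge_add_one_self)
   have "Ce * h\<^sup>2 * 1 <= Ce * h\<^sup>2 * exp (2 * L * h * real (Suc n))"
    using Ce L h by (intro mult_left_mono) auto
   then show "Ce * h\<^sup>2 <= Ce * h\<^sup>2 * exp (2 * L * h * real (Suc n))" by simp
  qed auto
  also have "... = real (Suc n) * (Ce * h\<^sup>2) * exp (2 * L * h * real (Suc n))"
  proof -
   have "exp (2 * L * h * real (Suc n)) = exp (2 * L * h) * exp (2 * L * h * real n)"
    by (simp add: exp_add[symmetric] algebra_simps)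
   then show ?thesis by (simp add: algebra_simps)
  qed
  finally show ?case .
 qed simp
 also have "real n * (Ce * h\<^sup>2) * exp (2 * L * h * real n) = (Ce * h) * (real n * h) * exp (2 * L * (real n * h))"
  by (simp add: power2_eq_square algebra_simps)
 also have "... <= (Ce * h) * T * exp (2 * L * T)"
  using Ce h L T mult_left_mono[OF h(2) L] by (intro mult_mono mult_left_mono) auto
 finally show ?thesis by (simp add: mult_ac)
qed

definition step where "step k = T / 2 ^ k"
definition path where "path k t = euler (step k) (nat \<lfloor>t / step k\<rfloor>)"
definition sol where "sol t = lim (%k. path k t)"
text \<open>Halving the step halves a squared error of order \<open>h\<close>, which explains
  \<open>rp\<close>; the summand \<open>T * M\<close> pays for the extra half step that rounding may
  produce.\<close>

definition Cp where "Cp = sqrt (Ce * T * exp (2 * L * T) * T) + T * M"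
definition rp :: real where "rp = sqrt (1 / 2)"

lemma rp: "0 < rp" "rp < 1" by (auto simp: rp_def real_sqrt_lt_1_iff)

lemma step: "0 < step k" "step k <= T" "step (Suc k) = step k / 2" "step k = T * (1/2) ^ k"
 using T by (auto simp: step_def power_divide field_simps)

text \<open>The floor of a doubled number exceeds twice the floor by at most 1, so after
  \<open>halving_error\<close> at most one half step of length \<open>step k / 2 * M\<close>
  remains.\<close>

lemma path_increment:
 assumes t: "t \<in> {0..T}"
 shows "norm (path (Suc k) t - path k t) <= Cp * rp ^ k"
proof -
 let ?h = "step k" and ?n = "nat \<lfloor>t / step k\<rfloor>" and ?m = "nat \<lfloor>t / step (Suc k)\<rfloor>"
 note h = step(1,2)[of k]
 have q0: "0 <= t / ?h" using t h by auto
 have st: "t / step (Suc k) = 2 * (t / ?h)" by (simp add: step(3))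
 have m: "2 * ?n <= ?m" "?m <= 2 * ?n + 1"
 proof -
  have "2 * \<lfloor>t / ?h\<rfloor> <= \<lfloor>2 * (t / ?h)\<rfloor>" "\<lfloor>2 * (t / ?h)\<rfloor> <= 2 * \<lfloor>t / ?h\<rfloor> + 1" by linarith+
  moreover have "0 <= \<lfloor>t / ?h\<rfloor>" using q0 by simp
  ultimately show "2 * ?n <= ?m" "?m <= 2 * ?n + 1" unfolding st by linarith+
 qed
 have nh: "real ?n * ?h <= T"
 proof -
  have "real ?n <= t / ?h" using q0 by (simp add: of_nat_floor)
  then show ?thesis using h t by (simp add: pos_le_divide_eq)
 qed
 have "(norm (euler (?h / 2) (2 * ?n) - euler ?h ?n))\<^sup>2 <= Ce * T * exp (2 * L * T) * ?h"
  by (rule halving_error[OF h(1) nh h(2)])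
 then have "norm (euler (?h / 2) (2 * ?n) - euler ?h ?n) <= sqrt (Ce * T * exp (2 * L * T) * ?h)"
  by (simp add: real_le_rsqrt)
 also have "... = sqrt (Ce * T * exp (2 * L * T) * T) * rp ^ k"
  by (simp add: step(4) rp_def real_sqrt_mult real_sqrt_power real_sqrt_divide power_divide)
 finally have 1: "norm (euler (?h / 2) (2 * ?n) - euler ?h ?n) <= sqrt (Ce * T * exp (2 * L * T) * T) * rp ^ k" .
 have "norm (euler (?h / 2) ?m - euler (?h / 2) (2 * ?n)) <= real (?m - 2 * ?n) * (?h / 2 * M)"
  using h m by (intro euler_lip) auto
 also have "... <= 1 * (?h * M)" using m h M by (intro mult_mono) auto
 also have "... <= T * M * rp ^ k"
 proof -
  have "1/2 <= rp" unfolding rp_def by (rule real_le_rsqrt) (simp add: power2_eq_square)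
  then have "(1/2::real) ^ k <= rp ^ k" by (intro power_mono) auto
  then show ?thesis using T M by (simp add: step(4) mult_left_mono)
 qed
 finally have 2: "norm (euler (?h / 2) ?m - euler (?h / 2) (2 * ?n)) <= T * M * rp ^ k" .
 have "path (Suc k) t - path k t = (euler (?h / 2) ?m - euler (?h / 2) (2 * ?n)) + (euler (?h / 2) (2 * ?n) - euler ?h ?n)"
  by (simp add: path_def step(3))
 then have "norm (path (Suc k) t - path k t) <= T * M * rp ^ k + sqrt (Ce * T * exp (2 * L * T) * T) * rp ^ k"
  using 1 2 norm_triangle_ineq[of "euler (?h / 2) ?m - euler (?h / 2) (2 * ?n)"] by (smt (verit))
 then show ?thesis by (simp add: Cp_def algebra_simps)
qed

lemma path_limit:
 assumes "t \<in> {0..T}"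
 shows "(%k. path k t) \<longlonglongrightarrow> sol t" "norm (path k t - sol t) <= Cp / (1 - rp) * rp ^ k"
 unfolding sol_def using geometric_increments_limit[OF path_increment[OF assms] rp] by blast+

lemma sol_in: "t \<in> {0..T} ==> sol t \<in> cbox a b"
 by (rule closed_sequentially[OF closed_cbox _ path_limit(1)]) (auto simp: path_def euler_in)

lemma sol_0: "sol 0 = x0"
proof -
 have "(%k. path k 0) \<longlonglongrightarrow> sol 0" by (rule path_limit) (use T in auto)
 then show ?thesis by (simp add: path_def LIMSEQ_const_iff)
qed

lemma step_lim: "step \<longlonglongrightarrow> 0"
 unfolding step(4)[abs_def] by (intro tendsto_mult_right_zero LIMSEQ_realpow_zero) auto

lemma floor_step: "0 <= t ==> real (nat \<lfloor>t / step k\<rfloor>) * step k <= t \<and> t < real (nat \<lfloor>t / step k\<rfloor>) * step k + step k"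
proof -
 assume t: "0 <= t"
 have "real (nat \<lfloor>t / step k\<rfloor>) = of_int \<lfloor>t / step k\<rfloor>" using t step(1)[of k] by simp
 moreover have "of_int \<lfloor>t / step k\<rfloor> <= t / step k" "t / step k < of_int \<lfloor>t / step k\<rfloor> + 1" by linarith+
 ultimately have "real (nat \<lfloor>t / step k\<rfloor>) <= t / step k" "t / step k < real (nat \<lfloor>t / step k\<rfloor>) + 1" by linarith+
 then have "real (nat \<lfloor>t / step k\<rfloor>) * step k <= t" "t < (real (nat \<lfloor>t / step k\<rfloor>) + 1) * step k"
  by (simp_all only: pos_le_divide_eq[OF step(1)] pos_divide_less_eq[OF step(1)])
 then show ?thesis by (simp only: distrib_right mult_1)
qed

lemma sol_lip:
 assumes st: "s \<in> {0..T}" "t \<in> {0..T}"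
 shows "norm (sol t - sol s) <= M * \<bar>t - s\<bar>"
proof -
 have *: "norm (sol t - sol s) <= M * (t - s)" if st: "s \<in> {0..T}" "t \<in> {0..T}" "s <= t" for s t
 proof -
  have b: "norm (path k t - path k s) <= M * (t - s + step k)" for k
  proof -
   let ?n = "%t. nat \<lfloor>t / step k\<rfloor>"
   have le: "?n s <= ?n t" using st step(1)[of k] by (intro nat_mono floor_mono divide_right_mono) auto
   have "norm (path k t - path k s) <= real (?n t - ?n s) * (step k * M)"
    unfolding path_def using step(1)[of k] le by (intro euler_lip) auto
   also have "... = (real (?n t) * step k - real (?n s) * step k) * M" using le by (simp add: algebra_simps of_nat_diff)
   also have "... <= (t - s + step k) * M"
    using floor_step[of t k] floor_step[of s k] st M by (intro mult_right_mono) auto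
   finally show ?thesis by (simp add: mult.commute)
  qed
  have 1: "(%k. norm (path k t - path k s)) \<longlonglongrightarrow> norm (sol t - sol s)"
   by (intro tendsto_intros path_limit st)
  have 2: "(%k. M * (t - s + step k)) \<longlonglongrightarrow> M * (t - s + 0)" by (intro tendsto_intros step_lim)
  show ?thesis using LIMSEQ_le[OF 1 2] b by auto
 qed
 show ?thesis
 proof (cases "s <= t")
  case True then show ?thesis using *[of s t] st by auto
 next
  case False then show ?thesis using *[of t s] st by (auto simp: norm_minus_commute)
 qed
qed

text \<open>If the face towards which \<open>\<sigma>\<close> points is at least one step away, the
  projection can act only at the opposite face, where it pushes in direction
  \<open>\<sigma>\<close>. Hence an inequality, whose two signs together give equality away from
  both faces.\<close>

lemma euler_coordinate_step:
 assumes i: "i \<in> Basis" and \<sigma>: "\<sigma> = 1 \<or> \<sigma> = - 1" and h: "0 <= h" "h * M <= \<eta>"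
  and marg: "\<sigma> = 1 ==> euler h n \<bullet> i <= b \<bullet> i - \<eta>" "\<sigma> = - 1 ==> a \<bullet> i + \<eta> <= euler h n \<bullet> i"
 shows "h * (\<sigma> * (F (euler h n) \<bullet> i)) <= \<sigma> * (euler h (Suc n) \<bullet> i - euler h n \<bullet> i)"
proof -
 have "\<bar>F (euler h n) \<bullet> i\<bar> <= M" using Basis_le_norm[OF i] bdF[OF euler_in] by (rule order_trans)
 then have "\<bar>h * (F (euler h n) \<bullet> i)\<bar> <= \<eta>"
  using h mult_left_mono[of "\<bar>F (euler h n) \<bullet> i\<bar>" M h] by (simp add: abs_mult)
 then show ?thesis using \<sigma> marg
  by (auto simp: clamp_inner[OF ab' i] inner_add_left max_def min_def)
qed

text \<open>One-sided slope bounds, unlike derivatives, pass to the limit of the Euler paths. With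
  both signs they are the input for the integral equation of the limit.\<close>

lemma sol_slope:
 assumes i: "i \<in> Basis" and \<sigma>: "\<sigma> = 1 \<or> \<sigma> = - 1" and st: "0 <= s" "s < t" "t <= T" and \<eta>: "0 < \<eta>"
  and marg: "\<And>\<tau>. \<sigma> = 1 ==> \<tau> \<in> {s..t} ==> sol \<tau> \<bullet> i <= b \<bullet> i - \<eta>"
   "\<And>\<tau>. \<sigma> = - 1 ==> \<tau> \<in> {s..t} ==> a \<bullet> i + \<eta> <= sol \<tau> \<bullet> i"
  and low: "\<And>\<tau>. \<tau> \<in> {s..t} ==> m <= \<sigma> * (F (sol \<tau>) \<bullet> i)"
 shows "m * (t - s) <= \<sigma> * (sol t \<bullet> i - sol s \<bullet> i)"
proof -
 define \<rho> where "\<rho> k = Cp / (1 - rp) * rp ^ k" for k :: nat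
 have \<rho>: "\<rho> \<longlonglongrightarrow> 0" unfolding \<rho>_def[abs_def] using rp by (intro tendsto_mult_right_zero LIMSEQ_realpow_zero) auto
 have ev1: "\<forall>\<^sub>F k in sequentially. \<rho> k < \<eta> / 2" using \<rho> \<eta> by (intro order_tendstoD) auto
 have "(%k. step k * M) \<longlonglongrightarrow> 0" using tendsto_mult_left_zero[OF step_lim] .
 then have ev2: "\<forall>\<^sub>F k in sequentially. step k * M < \<eta> / 2" using \<eta> by (intro order_tendstoD) auto
 let ?n = "%k t. nat \<lfloor>t / step k\<rfloor>"
 have main: "(real (?n k t) * step k - real (?n k s) * step k) * (m - L * \<rho> k) <= \<sigma> * (path k t \<bullet> i - path k s \<bullet> i)"
  if k: "\<rho> k < \<eta> / 2" "step k * M < \<eta> / 2" for k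
 proof -
  have h: "0 < step k" by (rule step)
  have le: "?n k s <= ?n k t" using st h by (intro nat_mono floor_mono divide_right_mono) auto
  \<comment> \<open>Only the first node may lie before \<open>s\<close>; it is the value of
    \<open>path k\<close> at \<open>s\<close> and is compared there. All others sit at a grid time
    inside the interval.\<close>
  have node: "\<exists>\<tau>\<in>{s..t}. norm (euler (step k) n - sol \<tau>) <= \<rho> k" if n: "?n k s <= n" "n < ?n k t" for n
  proof (cases "n = ?n k s")
   case True
   have "norm (path k s - sol s) <= \<rho> k" unfolding \<rho>_def by (rule path_limit) (use st in auto)
   then show ?thesis using True st unfolding path_def by (intro bexI[of _ s]) auto
  next
   case False
   then have "real (?n k s) + 1 <= real n" using n by linarith
   then have "(real (?n k s) + 1) * step k <= real n * step k" using h by (intro mult_right_mono) auto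
   then have "real (?n k s) * step k + step k <= real n * step k" by (simp only: distrib_right mult_1)
   then have 1: "s <= real n * step k" using floor_step[OF st(1), of k] by linarith
   have "real n * step k <= real (?n k t) * step k" using n h by (intro mult_right_mono) auto
   then have 2: "real n * step k <= t" using floor_step[of t k] st by linarith
   have "norm (path k (real n * step k) - sol (real n * step k)) <= \<rho> k" unfolding \<rho>_def
    by (rule path_limit) (use 1 2 st in auto)
   then show ?thesis using 1 2 h by (intro bexI[of _ "real n * step k"]) (auto simp: path_def)
  qed
  have inc: "step k * (m - L * \<rho> k) <= \<sigma> * (euler (step k) (Suc n) \<bullet> i - euler (step k) n \<bullet> i)"
   if n: "?n k s <= n" "n < ?n k t" for n
  proof -
   obtain \<tau> where \<tau>: "\<tau> \<in> {s..t}" "norm (euler (step k) n - sol \<tau>) <= \<rho> k" using node[OF n] by blast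
   have solin: "sol \<tau> \<in> cbox a b" using \<tau> st by (intro sol_in) auto
   have d: "\<bar>euler (step k) n \<bullet> i - sol \<tau> \<bullet> i\<bar> <= \<rho> k"
    using Basis_le_norm[OF i, of "euler (step k) n - sol \<tau>"] \<tau> by (simp add: inner_diff_left)
   have "norm (F (euler (step k) n) - F (sol \<tau>)) <= L * \<rho> k"
    using lipF[OF euler_in solin, of "step k" n] mult_left_mono[OF \<tau>(2) L] by linarith
   then have dF: "\<bar>F (euler (step k) n) \<bullet> i - F (sol \<tau>) \<bullet> i\<bar> <= L * \<rho> k"
    using Basis_le_norm[OF i, of "F (euler (step k) n) - F (sol \<tau>)"] by (simp add: inner_diff_left)
   have "step k * (\<sigma> * (F (euler (step k) n) \<bullet> i)) <= \<sigma> * (euler (step k) (Suc n) \<bullet> i - euler (step k) n \<bullet> i)"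
   proof (rule euler_coordinate_step[OF i \<sigma>, of _ "\<eta> / 2"])
    show "\<sigma> = 1 ==> euler (step k) n \<bullet> i <= b \<bullet> i - \<eta> / 2" using marg(1)[OF _ \<tau>(1)] d k by simp
    show "\<sigma> = - 1 ==> a \<bullet> i + \<eta> / 2 <= euler (step k) n \<bullet> i" using marg(2)[OF _ \<tau>(1)] d k by simp
   qed (use h k in auto)
   moreover have "m - L * \<rho> k <= \<sigma> * (F (euler (step k) n) \<bullet> i)" using low[OF \<tau>(1)] dF \<sigma> by auto
   then have "step k * (m - L * \<rho> k) <= step k * (\<sigma> * (F (euler (step k) n) \<bullet> i))"
    using h by (intro mult_left_mono) auto
   ultimately show ?thesis by linarith
  qed
  have "real j * (step k * (m - L * \<rho> k)) <= \<sigma> * (euler (step k) (?n k s + j) \<bullet> i - euler (step k) (?n k s) \<bullet> i)"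
   if "?n k s + j <= ?n k t" for j using that
  proof (induction j)
   case (Suc j)
   have "\<sigma> * (euler (step k) (?n k s + Suc j) \<bullet> i - euler (step k) (?n k s) \<bullet> i) =
     \<sigma> * (euler (step k) (Suc (?n k s + j)) \<bullet> i - euler (step k) (?n k s + j) \<bullet> i) +
     \<sigma> * (euler (step k) (?n k s + j) \<bullet> i - euler (step k) (?n k s) \<bullet> i)"
    by (simp only: add_Suc_right right_diff_distrib)
   also have "... \<ge> step k * (m - L * \<rho> k) + real j * (step k * (m - L * \<rho> k))"
    using Suc by (intro add_mono inc) auto
   finally show ?case by (simp only: of_nat_Suc distrib_right mult_1)
  qed simp
  from this[of "?n k t - ?n k s"] show ?thesis using le by (simp add: path_def of_nat_diff algebra_simps)
 qed
 have floor_lim: "(%k. real (?n k t) * step k) \<longlonglongrightarrow> t" if "0 <= t" for t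
 proof (rule real_tendsto_sandwich)
  show "\<forall>\<^sub>F k in sequentially. t - step k <= real (?n k t) * step k"
   using floor_step[OF that] by (intro always_eventually allI) (smt (verit))
  show "\<forall>\<^sub>F k in sequentially. real (?n k t) * step k <= t"
   using floor_step[OF that] by (intro always_eventually allI) auto
  show "(%k. t - step k) \<longlonglongrightarrow> t" using tendsto_diff[OF tendsto_const step_lim, of t] by simp
 qed auto
 have 1: "(%k. (real (?n k t) * step k - real (?n k s) * step k) * (m - L * \<rho> k)) \<longlonglongrightarrow> (t - s) * (m - L * 0)"
  using st by (intro tendsto_intros floor_lim \<rho>) auto
 have 2: "(%k. \<sigma> * (path k t \<bullet> i - path k s \<bullet> i)) \<longlonglongrightarrow> \<sigma> * (sol t \<bullet> i - sol s \<bullet> i)"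
  using st by (intro tendsto_intros path_limit) auto
 have "(t - s) * (m - L * 0) <= \<sigma> * (sol t \<bullet> i - sol s \<bullet> i)"
 proof (rule tendsto_le[OF trivial_limit_sequentially 2 1])
  show "\<forall>\<^sub>F k in sequentially. (real (?n k t) * step k - real (?n k s) * step k) * (m - L * \<rho> k)
   <= \<sigma> * (path k t \<bullet> i - path k s \<bullet> i)"
   using eventually_conj[OF ev1 ev2] by eventually_elim (use main in auto)
 qed
 then show ?thesis by (simp add: mult.commute)
qed

end


text \<open>The weights \<open>plateau l u n\<close> vanish at \<open>l\<close> and \<open>u\<close> and increase to the indicator of the open interval.\<close>

definition plateau :: "real => real => nat => real => real" where
 "plateau l u n y = 1 - (1 - 4 * (y - l) * (u - y) / (u - l)\<^sup>2) ^ Suc n"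

lemma plateau_range:
 fixes l u y :: real
 assumes "l < u" "y \<in> {l..u}"
 shows "0 <= 1 - 4 * (y - l) * (u - y) / (u - l)\<^sup>2" "1 - 4 * (y - l) * (u - y) / (u - l)\<^sup>2 <= 1"
  and "y \<in> {l<..<u} ==> 1 - 4 * (y - l) * (u - y) / (u - l)\<^sup>2 < 1"
proof -
 have "0 <= ((y - l) - (u - y))\<^sup>2" by simp
 also have "... = (u - l)\<^sup>2 - 4 * (y - l) * (u - y)" by (simp add: power2_eq_square algebra_simps)
 finally have "4 * (y - l) * (u - y) <= (u - l)\<^sup>2" by simp
 then show "0 <= 1 - 4 * (y - l) * (u - y) / (u - l)\<^sup>2" using assms by (simp add: pos_divide_le_eq)
 show "1 - 4 * (y - l) * (u - y) / (u - l)\<^sup>2 <= 1" using assms by simp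
 show "1 - 4 * (y - l) * (u - y) / (u - l)\<^sup>2 < 1" if "y \<in> {l<..<u}" using assms that by simp
qed

lemma plateau_bounds: "l < u ==> y \<in> {l..u} ==> 0 <= plateau l u n y \<and> plateau l u n y <= 1"
 unfolding plateau_def using plateau_range(1,2)[of l u y] by (auto simp del: power_Suc intro: power_le_one)

lemma plateau_end: "l < u ==> y = l \<or> y = u ==> plateau l u n y = 0"
 by (auto simp: plateau_def)

lemma plateau_continuous: "l < u ==> continuous_on A (plateau l u n)"
 unfolding plateau_def by (intro continuous_intros) auto

lemma plateau_limit:
 assumes "l < u" "y \<in> {l..u}"
 shows "(%n. plateau l u n y) \<longlonglongrightarrow> indicator {l<..<u} y"
proof (cases "y \<in> {l<..<u}")
 case True
 have "(%n. 1 - (1 - 4 * (y - l) * (u - y) / (u - l)\<^sup>2) ^ Suc n) \<longlonglongrightarrow> 1 - 0"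
  using plateau_range[OF assms] True by (intro tendsto_intros LIMSEQ_Suc LIMSEQ_realpow_zero) auto
 then show ?thesis using True by (simp add: plateau_def)
next
 case False
 then have "plateau l u n y = 0" for n using assms by (intro plateau_end) auto
 then show ?thesis using False by simp
qed

text \<open>Inside the interval the two slope bounds force the derivative \<open>w\<close>, while at
  an endpoint \<open>f\<close> need not be differentiable. Composing with a primitive of
  \<open>plateau l u n\<close>, whose derivative vanishes at \<open>l\<close> and \<open>u\<close>,
  neutralises these points; letting \<open>n\<close> grow gives the integral of \<open>w\<close>
  over the times spent inside. At an endpoint \<open>w\<close> points outwards or vanishes, so that
  adding \<open>refl1\<close> makes it 0 there.\<close>

lemma reflected_path_integral:
 fixes f w :: "real => real"
 assumes lu: "l < u" and T: "0 < T" and rng: "\<And>t. t \<in> {0..T} ==> f t \<in> {l..u}"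
  and lip: "\<And>s t. s \<in> {0..T} ==> t \<in> {0..T} ==> \<bar>f t - f s\<bar> <= M * \<bar>t - s\<bar>"
  and w: "continuous_on {0..T} w"
  and up: "\<And>s t \<eta> m. 0 <= s ==> s < t ==> t <= T ==> 0 < \<eta> ==>
   (\<And>\<tau>. \<tau> \<in> {s..t} ==> f \<tau> <= u - \<eta> \<and> m <= w \<tau>) ==> m * (t - s) <= f t - f s"
  and dn: "\<And>s t \<eta> m. 0 <= s ==> s < t ==> t <= T ==> 0 < \<eta> ==>
   (\<And>\<tau>. \<tau> \<in> {s..t} ==> l + \<eta> <= f \<tau> \<and> w \<tau> <= m) ==> f t - f s <= m * (t - s)"
  and t: "t \<in> {0..T}"
 shows "((%s. w s + refl1 l u (f s) (w s)) has_integral (f t - f 0)) {0..t}"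
proof -
 have M: "0 <= M" using lip[of 0 T] T by (simp add: zero_le_mult_iff) (smt (verit) abs_ge_zero mult_neg_pos)
 have contf: "continuous_on {0..T} f"
  unfolding continuous_on_iff
 proof (intro ballI allI impI)
  fix x e :: real assume x: "x \<in> {0..T}" and e: "0 < e"
  show "\<exists>d>0. \<forall>x'\<in>{0..T}. dist x' x < d --> dist (f x') (f x) < e"
  proof (intro exI[of _ "e / (M + 1)"] conjI ballI impI)
   show "0 < e / (M + 1)" using e M by simp
   fix x' assume x': "x' \<in> {0..T}" and d: "dist x' x < e / (M + 1)"
   have "\<bar>f x' - f x\<bar> <= M * \<bar>x' - x\<bar>" by (rule lip[OF x x'])
   also have "... <= (M + 1) * \<bar>x' - x\<bar>" by (intro mult_right_mono) auto
   also have "... < (M + 1) * (e / (M + 1))" using d M by (intro mult_strict_left_mono) (auto simp: dist_real_def)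
   also have "... = e" using M by simp
   finally show "dist (f x') (f x) < e" by (simp add: dist_real_def)
  qed
 qed
 have wnear: "\<exists>d>0. \<forall>x'\<in>{0..T}. \<bar>x' - x\<bar> < d --> \<bar>w x' - w x\<bar> < e" if "x \<in> {0..T}" "0 < e" for x e
  using w that unfolding continuous_on_iff by (simp add: dist_real_def)
 have fnear: "\<exists>d>0. \<forall>x'\<in>{0..T}. \<bar>x' - x\<bar> < d --> \<bar>f x' - f x\<bar> < e" if "x \<in> {0..T}" "0 < e" for x e
  using contf that unfolding continuous_on_iff by (simp add: dist_real_def)
 \<comment> \<open>If \<open>w\<close> were positive at \<open>l\<close>, then \<open>up\<close> on
   a short interval ending at \<open>s\<close> would put an earlier value of \<open>f\<close> below
   \<open>l\<close>; looking back requires \<open>0 < s\<close>.\<close>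
 have low: "w s <= 0" if s: "s \<in> {0..T}" "0 < s" "f s = l" for s
 proof (rule ccontr)
  assume "\<not> w s <= 0"
  then have ws: "0 < w s" by simp
  obtain d1 where d1: "0 < d1" "\<And>x'. x' \<in> {0..T} ==> \<bar>x' - s\<bar> < d1 ==> \<bar>w x' - w s\<bar> < w s / 2"
   using wnear[OF s(1), of "w s / 2"] ws by auto
  obtain d2 where d2: "0 < d2" "\<And>x'. x' \<in> {0..T} ==> \<bar>x' - s\<bar> < d2 ==> \<bar>f x' - f s\<bar> < (u - l) / 2"
   using fnear[OF s(1), of "(u - l) / 2"] lu by auto
  define s' where "s' = max (s / 2) (s - min d1 d2 / 2)"
  have s': "0 <= s'" "s' < s" "s - d1 < s'" "s - d2 < s'" using s d1 d2 by (auto simp: s'_def)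
  have "w s / 2 * (s - s') <= f s - f s'"
  proof (rule up[of s' s "(u - l) / 2"])
   fix \<tau> assume "\<tau> \<in> {s'..s}"
   then have \<tau>: "\<tau> \<in> {0..T}" "\<bar>\<tau> - s\<bar> < d1" "\<bar>\<tau> - s\<bar> < d2" using s' s by auto
   show "f \<tau> <= u - (u - l) / 2 \<and> w s / 2 <= w \<tau>"
    using d1(2)[OF \<tau>(1,2)] d2(2)[OF \<tau>(1,3)] s(3) by (auto simp: field_simps abs_if split: if_splits)
  qed (use s s' lu in auto)
  moreover have "0 < w s / 2 * (s - s')" using ws s' by simp
  moreover have "l <= f s'" using rng[of s'] s s' by auto
  ultimately show False using s(3) by linarith
 qed
 have high: "0 <= w s" if s: "s \<in> {0..T}" "0 < s" "f s = u" for s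
 proof (rule ccontr)
  assume "\<not> 0 <= w s"
  then have ws: "w s < 0" by simp
  obtain d1 where d1: "0 < d1" "\<And>x'. x' \<in> {0..T} ==> \<bar>x' - s\<bar> < d1 ==> \<bar>w x' - w s\<bar> < - w s / 2"
   using wnear[OF s(1), of "- w s / 2"] ws by auto
  obtain d2 where d2: "0 < d2" "\<And>x'. x' \<in> {0..T} ==> \<bar>x' - s\<bar> < d2 ==> \<bar>f x' - f s\<bar> < (u - l) / 2"
   using fnear[OF s(1), of "(u - l) / 2"] lu by auto
  define s' where "s' = max (s / 2) (s - min d1 d2 / 2)"
  have s': "0 <= s'" "s' < s" "s - d1 < s'" "s - d2 < s'" using s d1 d2 by (auto simp: s'_def)
  have "f s - f s' <= w s / 2 * (s - s')"
  proof (rule dn[of s' s "(u - l) / 2"])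
   fix \<tau> assume "\<tau> \<in> {s'..s}"
   then have \<tau>: "\<tau> \<in> {0..T}" "\<bar>\<tau> - s\<bar> < d1" "\<bar>\<tau> - s\<bar> < d2" using s' s by auto
   show "l + (u - l) / 2 <= f \<tau> \<and> w \<tau> <= w s / 2"
    using d1(2)[OF \<tau>(1,2)] d2(2)[OF \<tau>(1,3)] s(3) by (auto simp: field_simps abs_if split: if_splits)
  qed (use s s' lu in auto)
  moreover have "w s / 2 * (s - s') < 0" using ws s' by (simp add: mult_neg_pos)
  moreover have "f s' <= u" using rng[of s'] s s' by auto
  ultimately show False using s(3) by linarith
 qed
 have der: "(f has_vector_derivative w x) (at x within {0..T})" if x: "x \<in> {0..T}" "l < f x" "f x < u" for x
  unfolding has_vector_derivative_def has_derivative_within_alt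
 proof (intro conjI allI impI bounded_linear_scaleR_left)
  fix e :: real assume e: "0 < e"
  define \<eta> where "\<eta> = min (f x - l) (u - f x) / 2"
  have \<eta>: "0 < \<eta>" "l + 2 * \<eta> <= f x" "f x <= u - 2 * \<eta>" using x by (auto simp: \<eta>_def min_def field_simps)
  obtain d1 where d1: "0 < d1" "\<And>x'. x' \<in> {0..T} ==> \<bar>x' - x\<bar> < d1 ==> \<bar>w x' - w x\<bar> < e"
   using wnear[OF x(1) e] by auto
  obtain d2 where d2: "0 < d2" "\<And>x'. x' \<in> {0..T} ==> \<bar>x' - x\<bar> < d2 ==> \<bar>f x' - f x\<bar> < \<eta>"
   using fnear[OF x(1) \<eta>(1)] by auto
  have key: "\<bar>f q - f p - (q - p) * w x\<bar> <= e * (q - p)"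
   if pq: "p \<in> {0..T}" "q \<in> {0..T}" "p < q" "\<bar>p - x\<bar> < min d1 d2" "\<bar>q - x\<bar> < min d1 d2" for p q
  proof -
   have nr: "\<tau> \<in> {0..T}" "\<bar>\<tau> - x\<bar> < d1" "\<bar>\<tau> - x\<bar> < d2" if "\<tau> \<in> {p..q}" for \<tau> using that pq by auto
   have "(w x - e) * (q - p) <= f q - f p"
   proof (rule up[of p q \<eta>])
    fix \<tau> assume \<tau>: "\<tau> \<in> {p..q}"
    show "f \<tau> <= u - \<eta> \<and> w x - e <= w \<tau>"
     using d1(2)[OF nr(1,2)[OF \<tau>]] d2(2)[OF nr(1,3)[OF \<tau>]] \<eta> by linarith
   qed (use pq \<eta> in auto)
   moreover have "f q - f p <= (w x + e) * (q - p)"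
   proof (rule dn[of p q \<eta>])
    fix \<tau> assume \<tau>: "\<tau> \<in> {p..q}"
    show "l + \<eta> <= f \<tau> \<and> w \<tau> <= w x + e"
     using d1(2)[OF nr(1,2)[OF \<tau>]] d2(2)[OF nr(1,3)[OF \<tau>]] \<eta> by linarith
   qed (use pq \<eta> in auto)
   ultimately show ?thesis by (simp add: abs_le_iff algebra_simps)
  qed
  show "\<exists>d>0. \<forall>y\<in>{0..T}. norm (y - x) < d --> norm (f y - f x - (y - x) *\<^sub>R w x) <= e * norm (y - x)"
  proof (intro exI[of _ "min d1 d2"] conjI ballI impI)
   show "0 < min d1 d2" using d1 d2 by simp
   fix y assume y: "y \<in> {0..T}" "norm (y - x) < min d1 d2"
   consider "y = x" | "x < y" | "y < x" by linarith
   then show "norm (f y - f x - (y - x) *\<^sub>R w x) <= e * norm (y - x)"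
   proof cases
    case 2
    then show ?thesis using key[of x y] x y d1 d2 by simp
   next
    case 3
    have "f y - f x - (y - x) * w x = - (f x - f y - (x - y) * w x)" by (simp add: algebra_simps)
    then show ?thesis using key[of y x] 3 x y d1 d2 by (simp add: abs_minus_commute)
   qed simp
  qed
 qed
 define \<phi> where "\<phi> n y = integral {l..y} (plateau l u n)" for n y
 have phi_der: "(\<phi> n has_vector_derivative plateau l u n y) (at y within {l..u})" if "y \<in> {l..u}" for n y
  unfolding \<phi>_def by (rule integral_has_vector_derivative) (use that lu plateau_continuous in auto)
 \<comment> \<open>At an endpoint the derivative of \<open>\<phi> n\<close> is 0 and
   \<open>f\<close> is Lipschitz, so the composition has derivative 0 whether or not
   \<open>f\<close> has one.\<close>
 have comp_der: "((%s. \<phi> n (f s)) has_vector_derivative plateau l u n (f x) * w x) (at x within {0..T})"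
  if x: "x \<in> {0..T}" for n x
 proof (cases "l < f x \<and> f x < u")
  case True
  have "(\<phi> n has_vector_derivative plateau l u n (f x)) (at (f x) within f ` {0..T})"
   by (rule has_vector_derivative_within_subset[OF phi_der]) (use rng x in auto)
  from vector_diff_chain_within[OF der[OF x] this] True show ?thesis
   by (simp add: o_def mult.commute)
 next
  case False
  then have fe: "f x = l \<or> f x = u" using rng[OF x] by auto
  have p0: "plateau l u n (f x) = 0" by (rule plateau_end[OF lu fe])
  have "((%s. \<phi> n (f s)) has_vector_derivative 0) (at x within {0..T})"
   unfolding has_vector_derivative_def has_derivative_within_alt
  proof (intro conjI allI impI bounded_linear_scaleR_left)
   fix e :: real assume e: "0 < e"
   have e': "0 < e / (M + 1)" using e M by simp
   have "(\<phi> n has_derivative (%y. y *\<^sub>R 0)) (at (f x) within {l..u})"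
    using phi_der[OF rng[OF x], of n] unfolding has_vector_derivative_def p0 .
   then obtain d where d: "0 < d" "\<And>y. y \<in> {l..u} ==> \<bar>y - f x\<bar> < d ==> \<bar>\<phi> n y - \<phi> n (f x)\<bar> <= e / (M + 1) * \<bar>y - f x\<bar>"
    unfolding has_derivative_within_alt using e' by (auto simp: real_norm_def)
   obtain d2 where d2: "0 < d2" "\<And>x'. x' \<in> {0..T} ==> \<bar>x' - x\<bar> < d2 ==> \<bar>f x' - f x\<bar> < d"
    using fnear[OF x d(1)] by auto
   show "\<exists>d>0. \<forall>y\<in>{0..T}. norm (y - x) < d --> norm (\<phi> n (f y) - \<phi> n (f x) - (y - x) *\<^sub>R 0) <= e * norm (y - x)"
   proof (intro exI[of _ d2] conjI ballI impI d2)
    fix y assume y: "y \<in> {0..T}" "norm (y - x) < d2"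
    have "\<bar>\<phi> n (f y) - \<phi> n (f x)\<bar> <= e / (M + 1) * \<bar>f y - f x\<bar>"
     using d(2)[OF rng[OF y(1)]] d2(2)[OF y(1)] y(2) by simp
    also have "... <= e / (M + 1) * (M * \<bar>y - x\<bar>)" using e' by (intro mult_left_mono lip x y) auto
    also have "... <= e / (M + 1) * ((M + 1) * \<bar>y - x\<bar>)" using e' by (intro mult_left_mono mult_right_mono) auto
    also have "... = e * \<bar>y - x\<bar>" using M by simp
    finally show "norm (\<phi> n (f y) - \<phi> n (f x) - (y - x) *\<^sub>R 0) <= e * norm (y - x)" by simp
   qed
  qed
  then show ?thesis by (simp add: p0)
 qed
 have ftc: "((%s. plateau l u n (f s) * w s) has_integral (\<phi> n (f t) - \<phi> n (f 0))) {0..t}" for n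
 proof (rule fundamental_theorem_of_calculus)
  show "0 <= t" using t by simp
  fix x assume "x \<in> {0..t}"
  then show "((%s. \<phi> n (f s)) has_vector_derivative plateau l u n (f x) * w x) (at x within {0..t})"
   using t by (intro has_vector_derivative_within_subset[OF comp_der]) auto
 qed
 let ?S = "{0..t}"
 have absw: "(%s. \<bar>w s\<bar>) integrable_on ?S"
  by (intro integrable_continuous_interval continuous_intros continuous_on_subset[OF w]) (use t in auto)
 have dom: "(%s. indicator {l<..<u} (f s) * w s) integrable_on ?S"
   "(%n. integral ?S (%s. plateau l u n (f s) * w s)) \<longlonglongrightarrow> integral ?S (%s. indicator {l<..<u} (f s) * w s)"
 proof -
  have b: "norm (plateau l u n (f s) * w s) <= \<bar>w s\<bar>" if "s \<in> ?S" for n s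
   using plateau_bounds[OF lu rng[of s], of n] that t by (auto simp: abs_mult intro!: mult_left_le_one_le)
  have lim: "(%n. plateau l u n (f s) * w s) \<longlonglongrightarrow> indicator {l<..<u} (f s) * w s" if "s \<in> ?S" for s
   by (intro tendsto_intros plateau_limit lu rng) (use that t in auto)
  show "(%s. indicator {l<..<u} (f s) * w s) integrable_on ?S"
   by (rule dominated_convergence(1)[OF _ absw b lim]) (use ftc in \<open>auto intro: has_integral_integrable\<close>)
  show "(%n. integral ?S (%s. plateau l u n (f s) * w s)) \<longlonglongrightarrow> integral ?S (%s. indicator {l<..<u} (f s) * w s)"
   by (rule dominated_convergence(2)[OF _ absw b lim]) (use ftc in \<open>auto intro: has_integral_integrable\<close>)
 qed
 have phi_lim: "(%n. \<phi> n y) \<longlonglongrightarrow> y - l" if y: "y \<in> {l..u}" for y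
 proof -
  have b: "norm (plateau l u n s) <= 1" if "s \<in> {l..y}" for n s
   using plateau_bounds[OF lu, of s n] that y by auto
  have lim: "(%n. plateau l u n s) \<longlonglongrightarrow> indicator {l<..<u} s" if "s \<in> {l..y}" for s
   by (intro plateau_limit lu) (use that y in auto)
  have int: "plateau l u n integrable_on {l..y}" for n
   by (intro integrable_continuous_interval plateau_continuous lu)
  have "(%n. \<phi> n y) \<longlonglongrightarrow> integral {l..y} (indicator {l<..<u})"
   unfolding \<phi>_def by (rule dominated_convergence(2)[OF int _ b lim]) auto
  moreover have "integral {l..y} (indicator {l<..<u}) = integral {l..y} (%_. 1 :: real)"
   by (rule integral_spike[of "{l, u}"]) (use y in \<open>auto simp: indicator_def\<close>)
  ultimately show ?thesis using y by simp
 qed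
 have "(%n. \<phi> n (f t) - \<phi> n (f 0)) \<longlonglongrightarrow> (f t - l) - (f 0 - l)"
  by (intro tendsto_diff phi_lim rng) (use t in auto)
 then have "(%n. integral ?S (%s. plateau l u n (f s) * w s)) \<longlonglongrightarrow> f t - f 0"
  using integral_unique[OF ftc] by simp
 then have "integral ?S (%s. indicator {l<..<u} (f s) * w s) = f t - f 0"
  using LIMSEQ_unique[OF dom(2)] by blast
 then have "((%s. indicator {l<..<u} (f s) * w s) has_integral (f t - f 0)) ?S"
  using integrable_integral[OF dom(1)] by simp
 then show ?thesis
 \<comment> \<open>The sign conditions \<open>low\<close> and \<open>high\<close> look back in time
   and exclude time 0; a single point does not affect the integral.\<close>
 proof (rule has_integral_spike[of "{0}", rotated 2])
  fix s assume s: "s \<in> ?S - {0}"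
  then have s': "s \<in> {0..T}" "0 < s" using t by auto
  consider "f s = l" | "f s = u" | "l < f s" "f s < u" using rng[OF s'(1)] by fastforce
  then show "w s + refl1 l u (f s) (w s) = indicator {l<..<u} (f s) * w s"
   using low[OF s'] high[OF s'] lu by cases (auto simp: refl1_def)
 qed simp
qed

context box_euler
begin

lemma sol_continuous: "continuous_on {0..T} sol"
 unfolding continuous_on_iff
proof (intro ballI allI impI)
 fix x e :: real assume x: "x \<in> {0..T}" and e: "0 < e"
 show "\<exists>d>0. \<forall>x'\<in>{0..T}. dist x' x < d --> dist (sol x') (sol x) < e"
 proof (intro exI[of _ "e / M"] conjI ballI impI)
  show "0 < e / M" using e M by simp
  fix x' assume x': "x' \<in> {0..T}" and d: "dist x' x < e / M"
  have "dist (sol x') (sol x) <= M * dist x' x" using sol_lip[OF x x'] by (simp add: dist_norm)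
  also have "... < M * (e / M)" using d M by (intro mult_strict_left_mono) auto
  finally show "dist (sol x') (sol x) < e" using M by simp
 qed
qed

lemma F_sol_continuous: "continuous_on {0..T} (%t. F (sol t))"
proof -
 have "continuous_on (cbox a b) F"
  unfolding continuous_on_iff
 proof (intro ballI allI impI)
  fix x and e :: real assume x: "x \<in> cbox a b" and e: "0 < e"
  show "\<exists>d>0. \<forall>x'\<in>cbox a b. dist x' x < d --> dist (F x') (F x) < e"
  proof (intro exI[of _ "e / (L + 1)"] conjI ballI impI)
   show "0 < e / (L + 1)" using e L by simp
   fix x' assume x': "x' \<in> cbox a b" and d: "dist x' x < e / (L + 1)"
   have "dist (F x') (F x) <= L * dist x' x" using lipF[OF x' x] by (simp add: dist_norm)
   also have "... <= (L + 1) * dist x' x" by (intro mult_right_mono) auto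
   also have "... < (L + 1) * (e / (L + 1))" using d L by (intro mult_strict_left_mono) auto
   finally show "dist (F x') (F x) < e" using L by simp
  qed
 qed
 from this sol_continuous show ?thesis by (rule continuous_on_compose2) (use sol_in in blast)
qed

lemma sol_integral:
 assumes i: "i \<in> Basis" and t: "t \<in> {0..T}"
 shows "((%s. F (sol s) \<bullet> i + refl1 (a \<bullet> i) (b \<bullet> i) (sol s \<bullet> i) (F (sol s) \<bullet> i)) has_integral
  (sol t \<bullet> i - sol 0 \<bullet> i)) {0..t}"
proof (rule reflected_path_integral[where T = T and M = M and f = "%s. sol s \<bullet> i" and w = "%s. F (sol s) \<bullet> i"])
 show "a \<bullet> i < b \<bullet> i" by (rule ab[OF i])
 show "sol t \<bullet> i \<in> {a \<bullet> i..b \<bullet> i}" if "t \<in> {0..T}" for t using sol_in[OF that] i by (auto simp: mem_box)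
 show "\<bar>sol t \<bullet> i - sol s \<bullet> i\<bar> <= M * \<bar>t - s\<bar>" if "s \<in> {0..T}" "t \<in> {0..T}" for s t
  using order_trans[OF Basis_le_norm[OF i] sol_lip[OF that]] by (simp add: inner_diff_left)
 show "continuous_on {0..T} (%s. F (sol s) \<bullet> i)" by (intro continuous_intros F_sol_continuous)
 show "m * (t - s) <= sol t \<bullet> i - sol s \<bullet> i"
  if "0 <= s" "s < t" "t <= T" "0 < \<eta>" "\<And>\<tau>. \<tau> \<in> {s..t} ==> sol \<tau> \<bullet> i <= b \<bullet> i - \<eta> \<and> m <= F (sol \<tau>) \<bullet> i" for s t \<eta> m
  using sol_slope[OF i, of 1 s t \<eta> m] that by auto
 show "sol t \<bullet> i - sol s \<bullet> i <= m * (t - s)"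
  if "0 <= s" "s < t" "t <= T" "0 < \<eta>" "\<And>\<tau>. \<tau> \<in> {s..t} ==> a \<bullet> i + \<eta> <= sol \<tau> \<bullet> i \<and> F (sol \<tau>) \<bullet> i <= m" for s t \<eta> m
  using sol_slope[OF i, of "-1" s t \<eta> "- m"] that by auto
qed (use T t in auto)

end

section \<open>Bounded Lipschitz functions\<close>

text \<open>One constant serves as bound and as modulus, which makes the class closed under products
  and, with a positive lower bound on the divisor, under quotients. On the box all one-step laws are
  built from \<open>sin\<close> and \<open>cos\<close> in this way.\<close>

definition bounded_lipschitz :: "'p::metric_space set => ('p => real) => bool" where
 "bounded_lipschitz S f \<longleftrightarrow> (\<exists>Q\<ge>0. \<forall>p\<in>S. \<bar>f p\<bar> <= Q \<and> (\<forall>q\<in>S. \<bar>f p - f q\<bar> <= Q * dist p q))"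

lemma bounded_lipschitzI:
 assumes "0 <= B" "0 <= L" "\<And>p. p \<in> S ==> \<bar>f p\<bar> <= B"
  "\<And>p q. p \<in> S ==> q \<in> S ==> \<bar>f p - f q\<bar> <= L * dist p q"
 shows "bounded_lipschitz S f"
 unfolding bounded_lipschitz_def
proof (intro exI[of _ "max B L"] conjI ballI)
 show "0 <= max B L" using assms by auto
 fix p q assume p: "p \<in> S" and q: "q \<in> S"
 show "\<bar>f p\<bar> <= max B L" using assms(3)[OF p] by auto
 have "L * dist p q <= max B L * dist p q" by (intro mult_right_mono) auto
 then show "\<bar>f p - f q\<bar> <= max B L * dist p q" using assms(4)[OF p q] by linarith
qed

lemma bounded_lipschitzE:
 assumes "bounded_lipschitz S f"
 obtains Q where "0 <= Q" "\<And>p. p \<in> S ==> \<bar>f p\<bar> <= Q" "\<And>p q. p \<in> S ==> q \<in> S ==> \<bar>f p - f q\<bar> <= Q * dist p q"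
 using assms unfolding bounded_lipschitz_def by blast

lemma bounded_lipschitz_const: "bounded_lipschitz S (%_. c)"
 by (rule bounded_lipschitzI[of "\<bar>c\<bar>" 0]) auto

lemma bounded_lipschitz_cong:
 "(\<And>p. p \<in> S ==> f p = g p) ==> bounded_lipschitz S g ==> bounded_lipschitz S f"
 unfolding bounded_lipschitz_def by simp

lemma bounded_lipschitz_if:
 "(c ==> bounded_lipschitz S f) ==> (\<not> c ==> bounded_lipschitz S g) ==>
  bounded_lipschitz S (%p. if c then f p else g p)"
 by (cases c) auto

lemma bounded_lipschitz_add:
 assumes "bounded_lipschitz S f" "bounded_lipschitz S g"
 shows "bounded_lipschitz S (%p. f p + g p)"
proof -
 obtain Q where Q: "0 <= Q" "\<And>p. p \<in> S ==> \<bar>f p\<bar> <= Q" "\<And>p q. p \<in> S ==> q \<in> S ==> \<bar>f p - f q\<bar> <= Q * dist p q"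
  using assms(1) by (rule bounded_lipschitzE) blast
 obtain R where R: "0 <= R" "\<And>p. p \<in> S ==> \<bar>g p\<bar> <= R" "\<And>p q. p \<in> S ==> q \<in> S ==> \<bar>g p - g q\<bar> <= R * dist p q"
  using assms(2) by (rule bounded_lipschitzE) blast
 show ?thesis
 proof (rule bounded_lipschitzI[of "Q + R" "Q + R"])
  fix p q assume p: "p \<in> S" and q: "q \<in> S"
  show "\<bar>f p + g p\<bar> <= Q + R" using Q(2)[OF p] R(2)[OF p] by linarith
  show "\<bar>f p + g p - (f q + g q)\<bar> <= (Q + R) * dist p q"
   using Q(3)[OF p q] R(3)[OF p q] unfolding distrib_right by linarith
 qed (use Q R in auto)
qed

lemma bounded_lipschitz_mult:
 assumes "bounded_lipschitz S f" "bounded_lipschitz S g"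
 shows "bounded_lipschitz S (%p. f p * g p)"
proof -
 obtain Q where Q: "0 <= Q" "\<And>p. p \<in> S ==> \<bar>f p\<bar> <= Q" "\<And>p q. p \<in> S ==> q \<in> S ==> \<bar>f p - f q\<bar> <= Q * dist p q"
  using assms(1) by (rule bounded_lipschitzE) blast
 obtain R where R: "0 <= R" "\<And>p. p \<in> S ==> \<bar>g p\<bar> <= R" "\<And>p q. p \<in> S ==> q \<in> S ==> \<bar>g p - g q\<bar> <= R * dist p q"
  using assms(2) by (rule bounded_lipschitzE) blast
 show ?thesis
 proof (rule bounded_lipschitzI[of "Q * R" "Q * R + Q * R"])
  fix p q assume p: "p \<in> S" and q: "q \<in> S"
  show "\<bar>f p * g p\<bar> <= Q * R" unfolding abs_mult using Q R p by (intro mult_mono) auto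
  have e: "f p * g p - f q * g q = f p * (g p - g q) + (f p - f q) * g q" by (simp add: algebra_simps)
  have "\<bar>f p * (g p - g q)\<bar> <= Q * (R * dist p q)" unfolding abs_mult using Q R p q by (intro mult_mono) auto
  moreover have "\<bar>(f p - f q) * g q\<bar> <= (Q * dist p q) * R" unfolding abs_mult using Q R p q by (intro mult_mono) auto
  ultimately show "\<bar>f p * g p - f q * g q\<bar> <= (Q * R + Q * R) * dist p q"
   unfolding e by (simp add: algebra_simps)
 qed (use Q R in auto)
qed

lemma bounded_lipschitz_sum:
 "(\<And>i. i \<in> I ==> bounded_lipschitz S (f i)) ==> bounded_lipschitz S (%p. \<Sum>i\<in>I. f i p)"
 by (induction I rule: infinite_finite_induct) (auto intro: bounded_lipschitz_add bounded_lipschitz_const)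

lemma bounded_lipschitz_prod:
 "(\<And>i. i \<in> I ==> bounded_lipschitz S (f i)) ==> bounded_lipschitz S (%p. \<Prod>i\<in>I. f i p)"
 by (induction I rule: infinite_finite_induct) (auto intro: bounded_lipschitz_mult bounded_lipschitz_const)

lemma bounded_lipschitz_power: "bounded_lipschitz S f ==> bounded_lipschitz S (%p. f p ^ n)"
 by (induction n) (auto intro: bounded_lipschitz_mult bounded_lipschitz_const)

lemma bounded_lipschitz_uminus: "bounded_lipschitz S f ==> bounded_lipschitz S (%p. - f p)"
 using bounded_lipschitz_mult[OF bounded_lipschitz_const[of S "-1"]] by simp

lemma bounded_lipschitz_divide:
 assumes f: "bounded_lipschitz S f" and g: "bounded_lipschitz S g"
  and c: "0 < c" "\<And>p. p \<in> S ==> c <= g p"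
 shows "bounded_lipschitz S (%p. f p / g p)"
proof -
 obtain R where R: "0 <= R" "\<And>p q. p \<in> S ==> q \<in> S ==> \<bar>g p - g q\<bar> <= R * dist p q"
  using g by (rule bounded_lipschitzE) blast
 have "bounded_lipschitz S (%p. 1 / g p)"
 proof (rule bounded_lipschitzI[of "1 / c" "R / (c * c)"])
  fix p q assume p: "p \<in> S" and q: "q \<in> S"
  have gp: "0 < g p" "c <= g p" "0 < g q" "c <= g q" using c p q by (auto intro: less_le_trans)
  show "\<bar>1 / g p\<bar> <= 1 / c" using gp c by (simp add: frac_le)
  have "\<bar>1 / g p - 1 / g q\<bar> = \<bar>g p - g q\<bar> / (g p * g q)"
   using gp by (simp add: field_simps abs_minus_commute)
  also have "... <= (R * dist p q) / (c * c)"
   by (intro frac_le mult_mono) (use gp c(1) R p q in \<open>auto intro: less_imp_le\<close>)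
  finally show "\<bar>1 / g p - 1 / g q\<bar> <= R / (c * c) * dist p q" by simp
 qed (use c R in auto)
 from bounded_lipschitz_mult[OF f this] show ?thesis by simp
qed

lemma abs_sin_diff_le: "\<bar>sin x - sin y\<bar> <= \<bar>x - y :: real\<bar>"
proof -
 have "sin x - sin y = 2 * sin ((x - y) / 2) * cos ((x + y) / 2)" by (rule sin_diff_sin)
 then have "\<bar>sin x - sin y\<bar> = 2 * \<bar>sin ((x - y) / 2)\<bar> * \<bar>cos ((x + y) / 2)\<bar>" by (simp add: abs_mult)
 also have "... <= 2 * \<bar>(x - y) / 2\<bar> * 1"
  by (intro mult_mono mult_left_mono abs_sin_x_le_abs_x abs_cos_le_one) auto
 finally show ?thesis by simp
qed

lemma bounded_lipschitz_sin_coord: "bounded_lipschitz S (%\<alpha> :: real ^ 'k. sin (\<alpha> $ e))"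
proof (rule bounded_lipschitzI[of 1 1])
 fix p q :: "real ^ 'k"
 have "\<bar>sin (p $ e) - sin (q $ e)\<bar> <= \<bar>(p - q) $ e\<bar>" using abs_sin_diff_le[of "p $ e" "q $ e"] by simp
 also have "... <= dist p q" unfolding dist_norm by (rule component_le_norm_cart)
 finally show "\<bar>sin (p $ e) - sin (q $ e)\<bar> <= 1 * dist p q" by simp
qed auto

lemma bounded_lipschitz_cos_coord: "bounded_lipschitz S (%\<alpha> :: real ^ 'k. cos (\<alpha> $ e))"
proof (rule bounded_lipschitzI[of 1 1])
 fix p q :: "real ^ 'k"
 have "\<bar>cos (p $ e) - cos (q $ e)\<bar> = \<bar>sin (pi / 2 - p $ e) - sin (pi / 2 - q $ e)\<bar>"
  by (simp add: sin_cos_eq[symmetric] cos_sin_eq)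
 also have "... <= \<bar>(p - q) $ e\<bar>"
  using abs_sin_diff_le[of "pi / 2 - p $ e" "pi / 2 - q $ e"] by (simp add: abs_minus_commute)
 also have "... <= dist p q" unfolding dist_norm by (rule component_le_norm_cart)
 finally show "\<bar>cos (p $ e) - cos (q $ e)\<bar> <= 1 * dist p q" by simp
qed auto

section \<open>Additive sets of natural numbers and primitive relations\<close>

text \<open>Let \<open>d\<close> be the least positive difference of two elements \<open>x\<close>
  and \<open>x + d\<close>. If some element were \<open>y = q * d + r\<close> with \<open>r\<close>
  strictly between 0 and \<open>d\<close>, then \<open>y + (q + 1) * x\<close> and
  \<open>(q + 1) * (x + d)\<close> would differ by \<open>d - r\<close>; so \<open>d\<close> divides
  everything and is 1. From \<open>x * x + x\<close> on, \<open>n = q * x + r\<close> satisfies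
  \<open>r <= q\<close> and equals \<open>(q - r) * x + r * (x + 1)\<close>.\<close>

lemma additive_set_cofinite:
 fixes S :: "nat set"
 assumes add: "\<And>x y. x \<in> S ==> y \<in> S ==> x + y \<in> S" and g: "Gcd S = 1"
 shows "\<exists>n0. \<forall>n\<ge>n0. n \<in> S"
proof -
 have mult: "k * x \<in> S" if "x \<in> S" "0 < k" for x k
  using that(2) by (induction k rule: nat_induct_non_zero) (auto simp: that(1) add)
 define D where "D = {d. 0 < d \<and> (\<exists>x\<in>S. x + d \<in> S)}"
 obtain s where s: "s \<in> S" "0 < s"
  using g by (metis Gcd_0_iff One_nat_def gr0I n_not_Suc_n subset_singletonD subsetI singletonI zero_neq_one)
 have "s \<in> D" using s add by (auto simp: D_def)
 define d where "d = (LEAST d. d \<in> D)"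
 have d: "d \<in> D" unfolding d_def using \<open>s \<in> D\<close> by (rule LeastI)
 have dmin: "d <= d'" if "d' \<in> D" for d' unfolding d_def using that by (rule Least_le)
 obtain x where x: "x \<in> S" "x + d \<in> S" "0 < d" using d by (auto simp: D_def)
 have dvd: "d dvd y" if y: "y \<in> S" for y
 proof (rule ccontr)
  assume nd: "\<not> d dvd y"
  define q where "q = y div d"
  define r where "r = y mod d"
  have r: "0 < r" "r < d" "y = q * d + r" using nd x(3) by (auto simp: r_def q_def dvd_eq_mod_eq_0)
  have 1: "y + (q + 1) * x \<in> S" using y mult[OF x(1), of "q + 1"] add by simp
  have "(q + 1) * (x + d) \<in> S" by (rule mult[OF x(2)]) simp
  moreover have "(q + 1) * (x + d) = (y + (q + 1) * x) + (d - r)" using r by (simp add: algebra_simps)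
  ultimately have "(y + (q + 1) * x) + (d - r) \<in> S" by (simp only:)
  note 1 this
  moreover have "0 < d - r" using r by simp
  ultimately have "d - r \<in> D" unfolding D_def by blast
  then show False using dmin[of "d - r"] r by simp
 qed
 have "d dvd Gcd S" by (rule Gcd_greatest) (rule dvd)
 then have d1: "d = 1" using g by simp
 show ?thesis
 proof (intro exI[of _ "x * x + x"] allI impI)
  fix n assume n: "x * x + x <= n"
  show "n \<in> S"
  proof (cases "x = 0")
   case True
   then show ?thesis using mult[of 1 n] x d1 n by (cases "n = 0") auto
  next
   case False
   define q where "q = n div x"
   define r where "r = n mod x"
   have r: "r < x" "n = q * x + r" using False by (auto simp: q_def r_def)
   have qx: "x + 1 <= q"
   proof -
    have "(x + 1) * x <= n" using n by (simp add: algebra_simps)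
    then show ?thesis using False by (simp add: q_def less_eq_div_iff_mult_less_eq)
   qed
   have a: "(q - r) * x \<in> S" using r qx by (intro mult x) auto
   show ?thesis
   proof (cases "r = 0")
    case True then show ?thesis using a r by simp
   next
    case False
    have "r * (x + d) \<in> S" using False by (intro mult x) auto
    then have "(q - r) * x + r * (x + d) \<in> S" using a by (rule add[rotated])
    moreover have "(q - r) * x + r * (x + d) = n"
     using r qx d1 by (simp add: diff_mult_distrib algebra_simps)
    ultimately show ?thesis by simp
   qed
  qed
 qed
qed

text \<open>Loops at \<open>x\<close> exist for all large lengths by the preceding lemma, and a
  fixed path from \<open>x\<close> to \<open>y\<close> extends them; finiteness makes the threshold
  common.\<close>

lemma primitive_relation:
 fixes R :: "('s::finite \<times> 's) set"
 assumes irr: "\<And>x y. \<exists>n. (x, y) \<in> R ^^ n" and aper: "\<And>x. Gcd {n. 0 < n \<and> (x, x) \<in> R ^^ n} = 1"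
 shows "\<exists>n0. \<forall>n\<ge>n0. \<forall>x y. (x, y) \<in> R ^^ n"
proof -
 have comp: "(x, z) \<in> R ^^ (m + n)" if "(x, y) \<in> R ^^ m" "(y, z) \<in> R ^^ n" for x y z m n
  using that by (auto simp: relpow_add)
 have "\<exists>n0. \<forall>n\<ge>n0. (x, y) \<in> R ^^ n" for x y
 proof -
  let ?S = "{n. 0 < n \<and> (x, x) \<in> R ^^ n}"
  have "\<exists>n0. \<forall>n\<ge>n0. n \<in> ?S" by (rule additive_set_cofinite) (use comp aper in auto)
  then obtain n0 where n0: "\<And>n. n \<ge> n0 ==> (x, x) \<in> R ^^ n" by auto
  obtain j where j: "(x, y) \<in> R ^^ j" using irr by blast
  have "(x, y) \<in> R ^^ n" if "n \<ge> n0 + j" for n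
   using comp[OF n0[of "n - j"] j] that by simp
  then show ?thesis by blast
 qed
 then obtain f where f: "\<And>x y n. n \<ge> f x y ==> (x, y) \<in> R ^^ n" by metis
 define n0 where "n0 = Max (range (%(x, y). f x y))"
 have "f x y <= n0" for x y unfolding n0_def by (rule Max_ge) auto
 then show ?thesis using f order_trans by blast
qed

section \<open>Laws of one batch\<close>

type_synonym ('s, 'k) mark = "('s \<times> nat) \<times> ('k => nat)"

definition mark_law :: "('s, 'k::finite) ctrl_chain => real ^ 'k => 's => ('s, 'k) mark pmf" where
 "mark_law M \<alpha> x = bind_pmf (action_law M \<alpha> x) (%u. map_pmf (Pair (x, u)) (phantom_law M \<alpha> u))"

text \<open>The step starts from a state that is already drawn and ends by drawing the next one.
  Thus the state alone, without an action, links consecutive steps, and a change of parameter acts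
  on actions and phantoms only.\<close>

definition step_law :: "('s, 'k::finite) ctrl_chain => real ^ 'k => 's => (('s, 'k) mark \<times> 's) pmf" where
 "step_law M \<alpha> x = bind_pmf (mark_law M \<alpha> x) (%m. map_pmf (Pair m) (trans_law M (fst (fst m)) (snd (fst m))))"

primrec seg_law :: "('s, 'k::finite) ctrl_chain => real ^ 'k => nat => 's => (('s, 'k) mark list \<times> 's) pmf" where
 "seg_law M \<alpha> 0 x = return_pmf ([], x)"
| "seg_law M \<alpha> (Suc j) x =
   bind_pmf (seg_law M \<alpha> j x) (%y. map_pmf (%z. (fst y @ [fst z], snd z)) (step_law M \<alpha> (snd y)))"

text \<open>A finite set that carries the one-step laws of all parameters in the box, so that finite
  sums over it have a common index set.\<close>

definition marks :: "('s, 'k) ctrl_chain => ('s, 'k) mark set" where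
 "marks M = {m. snd (fst m) <= top_act M (fst (fst m)) \<and> (\<forall>e. snd m e <= top_act M (fst (coord M e)))}"

lemma finite_marks: "finite (marks (M :: ('s::finite, 'k::finite) ctrl_chain))"
proof (rule finite_subset)
 let ?K = "\<Sum>x\<in>UNIV. top_act M x"
 have K: "top_act M x <= ?K" for x by (rule member_le_sum) auto
 show "marks M \<subseteq> (UNIV \<times> {..?K}) \<times> (PiE UNIV (%_. {..?K}))"
  using K unfolding marks_def by (fastforce simp: PiE_def intro: order_trans)
 show "finite ((UNIV \<times> {..?K}) \<times> (PiE (UNIV :: 'k set) (%_. {..?K})) :: ('s, 'k) mark set)"
  by (intro finite_cartesian_product finite_PiE) auto
qed

definition seg_marks :: "('s, 'k) ctrl_chain => nat => ('s, 'k) mark list set" where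
 "seg_marks M j = {l. set l \<subseteq> marks M \<and> length l = j}"

lemma finite_seg_marks: "finite (seg_marks (M :: ('s::finite, 'k::finite) ctrl_chain) j)"
 unfolding seg_marks_def by (rule finite_lists_length_eq[OF finite_marks])

locale ctrl_box =
 fixes M :: "('s::finite, 'k::finite) ctrl_chain" and \<mu> :: real
 assumes wf: "wf_ctrl_chain M" and \<mu>: "0 < \<mu>" "\<mu> < pi / 4"
begin

abbreviation H :: "(real ^ 'k) set" where "H \<equiv> param_box \<mu>"

lemma top1: "1 <= top_act M x" using wf by (simp add: wf_ctrl_chain_def)

lemma box_open: "\<alpha> \<in> H ==> \<alpha> \<in> open_params"
proof -
 assume "\<alpha> \<in> H"
 then have "\<mu> <= \<alpha> $ e \<and> \<alpha> $ e <= pi / 2 - \<mu>" for e by (simp add: param_box_def)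
 then have "0 < \<alpha> $ e \<and> \<alpha> $ e < pi / 2" for e using \<mu>(1) by (smt (verit))
 then show "\<alpha> \<in> open_params" by (simp add: open_params_def)
qed

lemma sin_lower: "\<alpha> \<in> H ==> sin \<mu> <= sin (\<alpha> $ e)" and cos_lower: "\<alpha> \<in> H ==> sin \<mu> <= cos (\<alpha> $ e)"
proof -
 assume a: "\<alpha> \<in> H"
 then have b: "\<mu> <= \<alpha> $ e" "\<alpha> $ e <= pi / 2 - \<mu>" by (auto simp: param_box_def)
 show "sin \<mu> <= sin (\<alpha> $ e)" using b \<mu> by (intro sin_monotone_2pi_le) auto
 have "cos (pi / 2 - \<mu>) <= cos (\<alpha> $ e)" using b \<mu> by (intro cos_monotone_0_pi_le) auto
 then show "sin \<mu> <= cos (\<alpha> $ e)" by (simp add: cos_sin_eq)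
qed

lemma sin_mu: "0 < sin \<mu>" "sin \<mu> <= 1"
 using \<mu> by (auto intro!: sin_gt_zero)

lemma bl_sin: "bounded_lipschitz H (%\<alpha>. (sin (par M \<alpha> x q))\<^sup>2)"
 unfolding par_def by (intro bounded_lipschitz_power bounded_lipschitz_sin_coord)

lemma bl_cos: "bounded_lipschitz H (%\<alpha>. (cos (par M \<alpha> x q))\<^sup>2)"
 unfolding par_def by (intro bounded_lipschitz_power bounded_lipschitz_cos_coord)

lemma bl_theta: "bounded_lipschitz H (%\<alpha>. theta M \<alpha> x u)"
 unfolding theta_def
 by (intro bounded_lipschitz_if bl_cos bl_sin bounded_lipschitz_mult bounded_lipschitz_prod bounded_lipschitz_const)

lemma prod_sin_lower: "\<alpha> \<in> H ==> (sin \<mu> ^ 2) ^ q <= (\<Prod>m=1..q. (sin (par M \<alpha> x m))\<^sup>2)"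
proof -
 assume a: "\<alpha> \<in> H"
 have "(\<Prod>m=1..q. (sin \<mu>)\<^sup>2) <= (\<Prod>m=1..q. (sin (par M \<alpha> x m))\<^sup>2)"
  unfolding par_def using sin_lower[OF a] sin_mu by (intro prod_mono) (auto intro!: power_mono)
 then show ?thesis by simp
qed

lemma bl_phantom: "bounded_lipschitz H (%\<alpha>. phantom_prob M \<alpha> x q u)"
proof (cases "q <= u \<and> u <= top_act M x")
 case True
 have "bounded_lipschitz H (%\<alpha>. theta M \<alpha> x u / (\<Prod>m=1..q. (sin (par M \<alpha> x m))\<^sup>2))"
  using sin_mu by (intro bounded_lipschitz_divide[where c = "(sin \<mu> ^ 2) ^ q"] bl_theta bounded_lipschitz_prod bl_sin prod_sin_lower) auto
 then show ?thesis using True by (simp add: phantom_prob_def)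
next
 case False
 then show ?thesis by (auto simp: phantom_prob_def intro: bounded_lipschitz_const)
qed

definition phantom_comp :: "real ^ 'k => nat => 'k => nat pmf" where
 "phantom_comp \<alpha> u e = (case coord M e of (i, p) =>
    if p < top_act M i then embed_pmf (phantom_prob M \<alpha> i p)
    else return_pmf (top_act M i * of_bool (u = top_act M i - 1)
            + (top_act M i - 1) * of_bool (u = top_act M i)))"

lemma phantom_law_alt: "phantom_law M \<alpha> u = Pi_pmf UNIV 0 (phantom_comp \<alpha> u)"
 unfolding phantom_law_def phantom_comp_def ..

lemma bl_phantom_comp: "bounded_lipschitz H (%\<alpha>. pmf (phantom_comp \<alpha> u e) v)"
proof (cases "coord M e")
 case (Pair i p)
 show ?thesis
 proof (cases "p < top_act M i")
  case True
  show ?thesis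
   by (rule bounded_lipschitz_cong[OF _ bl_phantom[of i p v]])
     (use True Pair box_open pmf_phantom_law_component[OF wf] in \<open>simp add: phantom_comp_def\<close>)
 next
  case False
  then show ?thesis using Pair by (simp add: phantom_comp_def bounded_lipschitz_const)
 qed
qed

lemma bl_phantom_law: "bounded_lipschitz H (%\<alpha>. pmf (phantom_law M \<alpha> u) w)"
proof -
 have "pmf (phantom_law M \<alpha> u) w = (\<Prod>e\<in>UNIV. pmf (phantom_comp \<alpha> u e) (w e))" for \<alpha>
  unfolding phantom_law_alt by (subst pmf_Pi) auto
 then show ?thesis by (simp add: bounded_lipschitz_prod bl_phantom_comp)
qed

lemma action_support: "u \<in> set_pmf (action_law M \<alpha> x) ==> u <= top_act M x"
 unfolding set_pmf_iff pmf_action_law[OF wf] theta_def by (auto split: if_splits)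

lemma finite_action: "finite (set_pmf (action_law M \<alpha> x))"
 by (rule finite_subset[of _ "{..top_act M x}"]) (auto dest: action_support)

lemma phantom_comp_support:
 assumes "\<alpha> \<in> H" "v \<in> set_pmf (phantom_comp \<alpha> u e)"
 shows "v <= top_act M (fst (coord M e))"
proof (cases "coord M e")
 case (Pair i p)
 show ?thesis
 proof (cases "p < top_act M i")
  case True
  then have "phantom_prob M \<alpha> i p v \<noteq> 0"
   using assms Pair box_open pmf_phantom_law_component[OF wf, of \<alpha> p i v] by (simp add: phantom_comp_def set_pmf_iff)
  then show ?thesis using Pair by (auto simp: phantom_prob_def split: if_splits)
 next
  case False
  then show ?thesis using assms Pair top1[of i] by (auto simp: phantom_comp_def of_bool_def)
 qed
qed

lemma phantom_support:
 assumes "\<alpha> \<in> H" "w \<in> set_pmf (phantom_law M \<alpha> u)"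
 shows "w e <= top_act M (fst (coord M e))"
proof (rule phantom_comp_support[OF assms(1)])
 show "w e \<in> set_pmf (phantom_comp \<alpha> u e)"
  using assms(2) unfolding phantom_law_alt by (subst (asm) set_Pi_pmf) (auto simp: PiE_dflt_def)
qed

lemma mark_support: "\<alpha> \<in> H ==> m \<in> set_pmf (mark_law M \<alpha> x) ==> m \<in> marks M \<and> fst (fst m) = x"
 unfolding mark_law_def marks_def by (auto dest: action_support phantom_support)

lemma finite_mark: "\<alpha> \<in> H ==> finite (set_pmf (mark_law M \<alpha> x))"
 by (rule finite_subset[OF _ finite_marks[of M]]) (use mark_support in blast)

lemma finite_phantom: "\<alpha> \<in> H ==> finite (set_pmf (phantom_law M \<alpha> u))"
proof (rule finite_subset)
 assume a: "\<alpha> \<in> H"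
 let ?K = "\<Sum>x\<in>UNIV. top_act M x"
 have K: "top_act M x <= ?K" for x by (rule member_le_sum) auto
 show "set_pmf (phantom_law M \<alpha> u) \<subseteq> PiE UNIV (%_. {..?K})"
  using phantom_support[OF a] K by (fastforce simp: PiE_def intro: order_trans)
 show "finite (PiE (UNIV :: 'k set) (%_. {..?K}))" by (intro finite_PiE) auto
qed

lemma finite_step: "\<alpha> \<in> H ==> finite (set_pmf (step_law M \<alpha> x))"
 unfolding step_law_def by (intro finite_set_bind_pmf finite_mark) auto

lemma step_support: "\<alpha> \<in> H ==> z \<in> set_pmf (step_law M \<alpha> x) ==> fst z \<in> marks M"
 unfolding step_law_def using mark_support by fastforce

lemma finite_seg_law: "\<alpha> \<in> H ==> finite (set_pmf (seg_law M \<alpha> j x))"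
 by (induction j) (auto intro!: finite_set_bind_pmf finite_step)

lemma seg_support: "\<alpha> \<in> H ==> set_pmf (seg_law M \<alpha> j x) \<subseteq> seg_marks M j \<times> UNIV"
proof (induction j)
 case (Suc j)
 then show ?case using step_support[OF Suc(2)] by (fastforce simp: seg_marks_def)
qed (auto simp: seg_marks_def)

lemma bl_mark: "bounded_lipschitz H (%\<alpha>. pmf (mark_law M \<alpha> x) m)"
proof -
 have "pmf (mark_law M \<alpha> x) m = (if fst (fst m) = x
   then theta M \<alpha> x (snd (fst m)) * pmf (phantom_law M \<alpha> (snd (fst m))) (snd m) else 0)" for \<alpha>
 proof -
  have "pmf (mark_law M \<alpha> x) m = (\<Sum>u\<in>{..top_act M x} \<union> {snd (fst m)}. theta M \<alpha> x u * pmf (map_pmf (Pair (x, u)) (phantom_law M \<alpha> u)) m)"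
   unfolding mark_law_def pmf_bind
   by (subst expectation_finite_sum[of "{..top_act M x} \<union> {snd (fst m)}"])
     (auto dest: action_support simp: pmf_action_law[OF wf])
  also have "... = (\<Sum>u\<in>{..top_act M x} \<union> {snd (fst m)}. if u = snd (fst m) then
    (if fst (fst m) = x then theta M \<alpha> x (snd (fst m)) * pmf (phantom_law M \<alpha> (snd (fst m))) (snd m) else 0) else 0)"
  proof (intro sum.cong refl)
   fix u
   have "pmf (map_pmf (Pair (x, u)) (phantom_law M \<alpha> u)) m =
     (if fst m = (x, u) then pmf (phantom_law M \<alpha> u) (snd m) else 0)"
   proof (cases "fst m = (x, u)")
    case True
    then have "m = Pair (x, u) (snd m)" by (metis prod.collapse)
    moreover have "inj (Pair (x, u) :: ('k => nat) => _)" by (auto simp: inj_def)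
    ultimately show ?thesis using pmf_map_inj'[of "Pair (x, u)"] True by metis
   next
    case False
    then show ?thesis by (auto simp: pmf_eq_0_set_pmf)
   qed
   then show "theta M \<alpha> x u * pmf (map_pmf (Pair (x, u)) (phantom_law M \<alpha> u)) m = (if u = snd (fst m) then
    (if fst (fst m) = x then theta M \<alpha> x (snd (fst m)) * pmf (phantom_law M \<alpha> (snd (fst m))) (snd m) else 0) else 0)"
    by (cases m; cases "fst m") auto
  qed
  finally show ?thesis by simp
 qed
 then show ?thesis by (simp only:) (intro bounded_lipschitz_if bounded_lipschitz_mult bl_theta bl_phantom_law bounded_lipschitz_const)
qed

lemma bl_step: "bounded_lipschitz H (%\<alpha>. pmf (step_law M \<alpha> x) z)"
proof (rule bounded_lipschitz_cong)
 fix \<alpha> assume "\<alpha> \<in> H"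
 then show "pmf (step_law M \<alpha> x) z = (\<Sum>m\<in>marks M. pmf (mark_law M \<alpha> x) m *
   pmf (map_pmf (Pair m) (trans_law M (fst (fst m)) (snd (fst m)))) z)"
  unfolding step_law_def pmf_bind
  by (intro expectation_finite_sum finite_marks) (use mark_support in blast)
qed (intro bounded_lipschitz_sum bounded_lipschitz_mult bl_mark bounded_lipschitz_const)

lemma bl_map_step: "bounded_lipschitz H (%\<alpha>. pmf (map_pmf f (step_law M \<alpha> x)) z)"
proof (rule bounded_lipschitz_cong)
 fix \<alpha> assume a: "\<alpha> \<in> H"
 show "pmf (map_pmf f (step_law M \<alpha> x)) z = (\<Sum>y\<in>marks M \<times> UNIV. pmf (step_law M \<alpha> x) y * pmf (return_pmf (f y)) z)"
  unfolding map_pmf_def pmf_bind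
  by (intro expectation_finite_sum) (use step_support[OF a] finite_marks[of M] in auto)
qed (intro bounded_lipschitz_sum bounded_lipschitz_mult bl_step bounded_lipschitz_const)

lemma bl_seg: "bounded_lipschitz H (%\<alpha>. pmf (seg_law M \<alpha> j x) z)"
proof (induction j arbitrary: z)
 case (Suc j)
 show ?case
 proof (rule bounded_lipschitz_cong)
  fix \<alpha> assume a: "\<alpha> \<in> H"
  show "pmf (seg_law M \<alpha> (Suc j) x) z = (\<Sum>y\<in>seg_marks M j \<times> UNIV. pmf (seg_law M \<alpha> j x) y *
   pmf (map_pmf (%z. (fst y @ [fst z], snd z)) (step_law M \<alpha> (snd y))) z)"
   unfolding seg_law.simps pmf_bind
   by (intro expectation_finite_sum) (use seg_support[OF a] finite_seg_marks[of M] in auto)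
 qed (intro bounded_lipschitz_sum bounded_lipschitz_mult Suc bl_map_step)
qed (simp add: bounded_lipschitz_const)

lemma seg_lipschitz:
 "\<exists>L\<ge>0. \<forall>\<alpha>\<in>H. \<forall>\<alpha>'\<in>H. \<forall>x z. \<bar>pmf (seg_law M \<alpha> j x) z - pmf (seg_law M \<alpha>' j x) z\<bar> <= L * dist \<alpha> \<alpha>'"
proof -
 have "\<forall>y. \<exists>Q\<ge>0. \<forall>\<alpha>\<in>H. \<forall>\<alpha>'\<in>H. \<bar>pmf (seg_law M \<alpha> j (fst y)) (snd y) - pmf (seg_law M \<alpha>' j (fst y)) (snd y)\<bar> <= Q * dist \<alpha> \<alpha>'"
  using bl_seg unfolding bounded_lipschitz_def by metis
 then obtain Q where Q: "\<And>y. 0 <= Q y" "\<And>y \<alpha> \<alpha>'. \<alpha> \<in> H ==> \<alpha>' \<in> H ==>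
   \<bar>pmf (seg_law M \<alpha> j (fst y)) (snd y) - pmf (seg_law M \<alpha>' j (fst y)) (snd y)\<bar> <= Q y * dist \<alpha> \<alpha>'"
  by metis
 let ?A = "UNIV \<times> (seg_marks M j \<times> UNIV) :: ('s \<times> (('s, 'k) mark list \<times> 's)) set"
 have fin: "finite ?A" using finite_seg_marks[of M] by auto
 show ?thesis
 proof (intro exI[of _ "\<Sum>y\<in>?A. Q y"] conjI ballI allI)
  show "0 <= (\<Sum>y\<in>?A. Q y)" by (intro sum_nonneg Q)
  fix \<alpha> \<alpha>' :: "real ^ 'k" and x :: 's and z :: "('s, 'k) mark list \<times> 's" assume a: "\<alpha> \<in> H" "\<alpha>' \<in> H"
  show "\<bar>pmf (seg_law M \<alpha> j x) z - pmf (seg_law M \<alpha>' j x) z\<bar> <= (\<Sum>y\<in>?A. Q y) * dist \<alpha> \<alpha>'"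
  proof (cases "z \<in> seg_marks M j \<times> UNIV")
   case True
   then have "Q (x, z) <= (\<Sum>y\<in>?A. Q y)" by (intro member_le_sum Q fin) auto
   then have "Q (x, z) * dist \<alpha> \<alpha>' <= (\<Sum>y\<in>?A. Q y) * dist \<alpha> \<alpha>'" by (intro mult_right_mono) auto
   then show ?thesis using Q(2)[OF a, of "(x, z)"] by simp
  next
   case False
   then have "pmf (seg_law M \<alpha> j x) z = 0" "pmf (seg_law M \<alpha>' j x) z = 0"
    using seg_support[OF a(1), of j x] seg_support[OF a(2), of j x] by (blast intro: pmf_eq_0_set_pmf[THEN iffD2])+
   then show ?thesis using Q(1) by (auto intro!: sum_nonneg mult_nonneg_nonneg)
  qed
 qed
qed


section \<open>Drift towards a target and the minorization\<close>

text \<open>On the box every action has positive probability, so this is the positivity pattern of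
  the state kernel for all parameters there at once.\<close>

definition rel :: "('s \<times> 's) set" where
 "rel = {(x, x'). \<exists>u\<le>top_act M x. 0 < pmf (trans_law M x u) x'}"

text \<open>Each action probability is a product of at most \<open>?K + 1\<close> squares of sines
  and cosines, and on the box each of them is at least \<open>(sin \<mu>) ^ 2\<close>.\<close>

lemma theta_lower: "\<exists>c>0. \<forall>\<alpha>\<in>H. \<forall>x u. u <= top_act M x --> c <= theta M \<alpha> x u"
proof -
 let ?K = "\<Sum>x\<in>UNIV. top_act M x"
 have K: "top_act M x <= ?K" for x by (rule member_le_sum) auto
 let ?s = "(sin \<mu>)\<^sup>2"
 have s: "0 < ?s" "?s <= 1" using sin_mu by (auto intro: power_le_one)
 show ?thesis
 proof (intro exI[of _ "?s * ?s ^ ?K"] conjI ballI allI impI)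
  show "0 < ?s * ?s ^ ?K" using s by simp
  fix \<alpha> x u assume a: "\<alpha> \<in> H" and u: "u <= top_act M x"
  have pr: "?s ^ ?K <= (\<Prod>m=1..u. (sin (par M \<alpha> x m))\<^sup>2)"
   by (rule order_trans[OF power_decreasing prod_sin_lower[OF a]]) (use s K[of x] u in auto)
  have c: "?s <= (cos (par M \<alpha> x m))\<^sup>2" for m
   unfolding par_def using cos_lower[OF a] sin_mu by (intro power_mono) auto
  have 1: "?s * ?s ^ ?K <= (cos (par M \<alpha> x (u + 1)))\<^sup>2 * (\<Prod>m=1..u. (sin (par M \<alpha> x m))\<^sup>2)"
   using s by (intro mult_mono c pr) (auto intro: order_trans[OF _ c])
  have 2: "?s * ?s ^ ?K <= ?s" using s by (simp add: mult_left_le power_le_one)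
  have 3: "?s * ?s ^ ?K <= ?s ^ ?K" using s by (simp add: mult_left_le_one_le)
  have 4: "?s * ?s ^ ?K <= (cos (par M \<alpha> x 1))\<^sup>2" by (rule order_trans[OF 2 c])
  have 5: "?s * ?s ^ ?K <= (\<Prod>m=1..u. (sin (par M \<alpha> x m))\<^sup>2)" by (rule order_trans[OF 3 pr])
  show "?s * ?s ^ ?K <= theta M \<alpha> x u"
   unfolding theta_def using u by (simp only: if_split) (intro conjI impI 1 4 5; simp)
 qed
qed

lemma step_lower:
 "\<exists>c>0. c <= 1 \<and> (\<forall>\<alpha>\<in>H. \<forall>x u x'. u <= top_act M x --> 0 < pmf (trans_law M x u) x' -->
   c <= theta M \<alpha> x u * pmf (trans_law M x u) x')"
proof -
 obtain c where c: "0 < c" "\<And>\<alpha> x u. \<alpha> \<in> H ==> u <= top_act M x ==> c <= theta M \<alpha> x u"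
  using theta_lower by blast
 let ?A = "(%(x, u, x'). pmf (trans_law M x u) x') ` (UNIV \<times> {..(\<Sum>x\<in>UNIV. top_act M x)} \<times> UNIV)"
 let ?P = "{v \<in> insert 1 ?A. 0 < v}"
 have fin: "finite ?P" by auto
 define b where "b = Min ?P"
 have "(1 :: real) \<in> ?P" by simp
 then have "?P \<noteq> {}" by (metis empty_iff)
 then have "b \<in> ?P" unfolding b_def by (rule Min_in[OF fin])
 then have b: "0 < b" unfolding mem_Collect_eq by (rule conjunct2)
 have ble: "b <= pmf (trans_law M x u) x'" if "u <= top_act M x" "0 < pmf (trans_law M x u) x'" for x u x'
 proof -
  have "u <= (\<Sum>x\<in>UNIV. top_act M x)" using that(1) member_le_sum[of x UNIV "top_act M"] by simp
  then have "pmf (trans_law M x u) x' \<in> ?P" using that(2) by (auto intro!: image_eqI[of _ _ "(x, u, x')"])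
  then show ?thesis unfolding b_def by (rule Min_le[OF fin])
 qed
 show ?thesis
 proof (intro exI[of _ "min 1 (c * b)"] conjI ballI allI impI)
  fix \<alpha> x u x' assume "\<alpha> \<in> H" "u <= top_act M x" "0 < pmf (trans_law M x u) x'"
  then have "c * b <= theta M \<alpha> x u * pmf (trans_law M x u) x'"
   using b c ble by (intro mult_mono) (auto simp: theta_nonneg)
  then show "min 1 (c * b) <= theta M \<alpha> x u * pmf (trans_law M x u) x'" by simp
 qed (use b c in auto)
qed

lemma step_expectation:
 assumes a: "\<alpha> \<in> H"
 shows "expect (step_law M \<alpha> x) (%z. g (fst (fst z)) (snd z))
  = (\<Sum>u\<le>top_act M x. theta M \<alpha> x u * (\<Sum>x'\<in>UNIV. pmf (trans_law M x u) x' * g (x, u) x'))"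
proof -
 have "expect (step_law M \<alpha> x) (%z. g (fst (fst z)) (snd z))
  = expect (mark_law M \<alpha> x) (%m. expect (trans_law M (fst (fst m)) (snd (fst m))) (g (fst m)))"
  unfolding step_law_def by (subst expectation_bind_finite) (auto simp: finite_mark[OF a])
 also have "... = expect (action_law M \<alpha> x) (%u. expect (trans_law M x u) (g (x, u)))"
  unfolding mark_law_def by (subst expectation_bind_finite) (auto simp: finite_action finite_phantom[OF a])
 also have "... = (\<Sum>u\<le>top_act M x. theta M \<alpha> x u * expect (trans_law M x u) (g (x, u)))"
  by (subst expectation_finite_sum[of "{..top_act M x}"]) (auto dest: action_support simp: pmf_action_law[OF wf])
 also have "... = (\<Sum>u\<le>top_act M x. theta M \<alpha> x u * (\<Sum>x'\<in>UNIV. pmf (trans_law M x u) x' * g (x, u) x'))"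
  by (subst expectation_finite_sum[of UNIV]) auto
 finally show ?thesis .
qed

lemma step_expectation_lower:
 assumes a: "\<alpha> \<in> H" and g: "\<And>u x'. 0 <= g (x, u) x'" and u: "u <= top_act M x"
 shows "theta M \<alpha> x u * pmf (trans_law M x u) x' * g (x, u) x'
  <= expect (step_law M \<alpha> x) (%z. g (fst (fst z)) (snd z))"
proof -
 have "pmf (trans_law M x u) x' * g (x, u) x' <= (\<Sum>x'\<in>UNIV. pmf (trans_law M x u) x' * g (x, u) x')"
  by (rule member_le_sum) (auto intro: mult_nonneg_nonneg g)
 then have "theta M \<alpha> x u * (pmf (trans_law M x u) x' * g (x, u) x')
   <= theta M \<alpha> x u * (\<Sum>x'\<in>UNIV. pmf (trans_law M x u) x' * g (x, u) x')"
  by (rule mult_left_mono) (rule theta_nonneg)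
 also have "... <= (\<Sum>u\<le>top_act M x. theta M \<alpha> x u * (\<Sum>x'\<in>UNIV. pmf (trans_law M x u) x' * g (x, u) x'))"
  by (rule member_le_sum) (use u g in \<open>auto intro!: mult_nonneg_nonneg sum_nonneg theta_nonneg\<close>)
 finally show ?thesis unfolding step_expectation[OF a] by (simp add: mult.assoc)
qed

definition avoids :: "'s \<times> nat => ('s, 'k) mark list => real" where
 "avoids y l = of_bool (y \<notin> fst ` set l)"

text \<open>Take \<open>W x = 1 - s ^ (d x + 1)\<close> with \<open>d x\<close> the
  \<open>rel\<close>-distance to the state of the target. With probability at least
  \<open>c = 2 * s\<close> a step either decreases the distance or, at distance 0, hits the target,
  so 1 minus the surviving weight has expectation at least \<open>c * s ^ d x\<close>. This is twice
  the deficit \<open>s ^ (d x + 1)\<close> of \<open>W x\<close>, and the surplus turns into the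
  factor \<open>1 - t\<close>.\<close>

lemma target_drift:
 assumes reach: "\<And>x. \<exists>n. (x, fst y) \<in> rel ^^ n" and y: "snd y <= top_act M (fst y)"
 shows "\<exists>(W :: 's => real) \<theta>. 0 < \<theta> \<and> \<theta> < 1 \<and> (\<forall>x. 1 / 2 <= W x \<and> W x <= 1) \<and>
  (\<forall>\<alpha>\<in>H. \<forall>x. expect (step_law M \<alpha> x) (%z. of_bool (fst (fst z) \<noteq> y) * W (snd z)) <= \<theta> * W x)"
proof -
 obtain c where c: "0 < c" "c <= 1" "\<And>\<alpha> x u x'. \<alpha> \<in> H ==> u <= top_act M x ==> 0 < pmf (trans_law M x u) x' ==>
   c <= theta M \<alpha> x u * pmf (trans_law M x u) x'"
  using step_lower by blast
 define d where "d x = (LEAST n. (x, fst y) \<in> rel ^^ n)" for x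
 have d: "(x, fst y) \<in> rel ^^ d x" for x unfolding d_def using reach[of x] by (rule LeastI_ex)
 have d_le: "d x <= n" if "(x, fst y) \<in> rel ^^ n" for x n unfolding d_def using that by (rule Least_le)
 define s where "s = c / 2"
 have s: "0 < s" "s <= 1 / 2" using c by (auto simp: s_def)
 define W where "W x = 1 - s ^ (d x + 1)" for x
 define t where "t = s ^ (Max (range d) + 1)"
 have t: "0 < t" "t <= 1 / 2"
 proof -
  have "t <= s ^ 1" unfolding t_def using s by (intro power_decreasing) auto
  then show "t <= 1 / 2" using s by simp
 qed (use s in \<open>simp add: t_def\<close>)
 have tW: "t <= s ^ (d x + 1)" "s ^ (d x + 1) <= 1 / 2" for x
 proof -
  have "d x <= Max (range d)" by (rule Max_ge) auto
  then show "t <= s ^ (d x + 1)" unfolding t_def using s by (intro power_decreasing) auto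
  have "s ^ (d x + 1) <= s ^ 1" using s by (intro power_decreasing) auto
  then show "s ^ (d x + 1) <= 1 / 2" using s(2) unfolding power_one_right by linarith
 qed
 show ?thesis
 proof (intro exI[of _ W] exI[of _ "1 - t"] conjI allI ballI)
  show "0 < 1 - t" "1 - t < 1" using t by auto
  show "1 / 2 <= W x" "W x <= 1" for x using tW[of x] s by (auto simp: W_def)
  fix \<alpha> x assume a: "\<alpha> \<in> H"
  \<comment> \<open>The complement of the surviving weight is nonnegative, so its expectation is
    bounded below by one favourable transition.\<close>
  let ?g = "%v x'. 1 - of_bool (v \<noteq> y) * W x'"
  have W01: "0 <= W x'" "W x' <= 1" for x' using tW[of x'] s by (auto simp: W_def)
  have g0: "0 <= ?g v x'" for v x' using W01[of x'] by (cases "v = y") auto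
  have "2 * s ^ (d x + 1) <= expect (step_law M \<alpha> x) (%z. ?g (fst (fst z)) (snd z))"
  proof (cases "d x")
   case 0
   then have x: "x = fst y" using d[of x] by simp
   obtain x' where x': "0 < pmf (trans_law M x (snd y)) x'" by (metis pmf_positive_iff set_pmf_not_empty ex_in_conv)
   have "c <= theta M \<alpha> x (snd y) * pmf (trans_law M x (snd y)) x'" using c(3)[OF a _ x'] y x by simp
   also have "... = theta M \<alpha> x (snd y) * pmf (trans_law M x (snd y)) x' * ?g (x, snd y) x'" using x by simp
   also have "... <= expect (step_law M \<alpha> x) (%z. ?g (fst (fst z)) (snd z))"
    by (rule step_expectation_lower[OF a g0]) (use x y in simp)
   finally show ?thesis using 0 by (simp add: s_def)
  next
   case (Suc n)
   obtain x' where x': "(x, x') \<in> rel" "(x', fst y) \<in> rel ^^ n"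
    using d[of x] unfolding Suc by (meson relpow_Suc_D2)
   obtain u where u: "u <= top_act M x" "0 < pmf (trans_law M x u) x'" using x'(1) by (auto simp: rel_def)
   have "s ^ Suc n <= s ^ (d x' + 1)" using d_le[OF x'(2)] s by (intro power_decreasing) auto
   then have gW: "s ^ Suc n <= ?g (x, u) x'"
    using W01(1)[of x'] by (cases "(x, u) = y") (auto simp: W_def)
   have "c * s ^ Suc n <= (theta M \<alpha> x u * pmf (trans_law M x u) x') * ?g (x, u) x'"
    using c(1) s by (intro mult_mono c(3)[OF a u] gW) (auto intro: mult_nonneg_nonneg theta_nonneg)
   also have "... <= expect (step_law M \<alpha> x) (%z. ?g (fst (fst z)) (snd z))"
    by (rule step_expectation_lower[OF a g0 u(1)])
   finally show ?thesis using Suc by (simp add: s_def)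
  qed
  also have "... = 1 - expect (step_law M \<alpha> x) (%z. of_bool (fst (fst z) \<noteq> y) * W (snd z))"
   by (subst expectation_diff_finite[OF finite_step[OF a]]) simp
  finally have "expect (step_law M \<alpha> x) (%z. of_bool (fst (fst z) \<noteq> y) * W (snd z)) <= 1 - 2 * s ^ (d x + 1)"
   by linarith
  also have "... <= (1 - t) * W x"
  proof -
   have "0 <= (s ^ (d x + 1) - t) + t * s ^ (d x + 1)" using tW[of x] t s by (intro add_nonneg_nonneg) auto
   then show ?thesis by (simp add: W_def algebra_simps)
  qed
  finally show "expect (step_law M \<alpha> x) (%z. of_bool (fst (fst z) \<noteq> y) * W (snd z)) <= (1 - t) * W x" .
 qed
qed

lemma seg_exp_Suc:
 assumes a: "\<alpha> \<in> H"
 shows "seg_exp (seg_law M \<alpha> (Suc j) x) F = seg_exp (seg_law M \<alpha> j x)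
  (%l x'. expect (step_law M \<alpha> x') (%z. F (l @ [fst z]) (snd z)))"
 unfolding seg_exp_def seg_law.simps
 by (subst expectation_bind_finite) (auto simp: finite_seg_law[OF a] finite_step[OF a])

lemma seg_drift:
 assumes a: "\<alpha> \<in> H" and \<theta>: "0 < \<theta>" "\<theta> < 1" and W: "\<And>x. 0 <= W x"
  and drift: "\<And>x. expect (step_law M \<alpha> x) (%z. of_bool (fst (fst z) \<noteq> y) * W (snd z)) <= \<theta> * W x"
 shows "seg_exp (seg_law M \<alpha> j x) (%l x'. avoids y l * W x') <= \<theta> ^ j * W x"
proof (induction j)
 case (Suc j)
 have "seg_exp (seg_law M \<alpha> (Suc j) x) (%l x'. avoids y l * W x')
  = seg_exp (seg_law M \<alpha> j x) (%l x'. avoids y l *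
    expect (step_law M \<alpha> x') (%z. of_bool (fst (fst z) \<noteq> y) * W (snd z)))"
  unfolding seg_exp_Suc[OF a] avoids_def
  by (subst integral_mult_right_zero[symmetric]) (auto simp: of_bool_def intro!: arg_cong[of _ _ "seg_exp _"] ext Bochner_Integration.integral_cong)
 also have "... <= seg_exp (seg_law M \<alpha> j x) (%l x'. avoids y l * (\<theta> * W x'))"
  unfolding seg_exp_def by (intro expectation_mono_finite finite_seg_law a mult_left_mono drift) (auto simp: avoids_def)
 also have "... = \<theta> * seg_exp (seg_law M \<alpha> j x) (%l x'. avoids y l * W x')"
  unfolding seg_exp_def by (subst integral_mult_right_zero[symmetric]) (simp add: mult_ac)
 also have "... <= \<theta> * (\<theta> ^ j * W x)" using \<theta> by (intro mult_left_mono Suc) auto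
 finally show ?case by simp
qed (simp add: seg_exp_def avoids_def)

definition step_op :: "real ^ 'k => ('s => real) => 's => real" where
 "step_op \<alpha> g x = expect (step_law M \<alpha> x) (%z. g (snd z))"

text \<open>The marks are recorded along the way while the state evolves by the one-step kernel;
  this carries the contraction of powers of \<open>step_op\<close> over to batches.\<close>

lemma seg_exp_step_op:
 assumes a: "\<alpha> \<in> H"
 shows "(%g x. seg_exp (seg_law M \<alpha> j x) (%_ x'. g x')) = step_op \<alpha> ^^ j"
proof (induction j)
 case (Suc j)
 show ?case
 proof (intro ext)
  fix g x
  have "seg_exp (seg_law M \<alpha> (Suc j) x) (%_ x'. g x') = seg_exp (seg_law M \<alpha> j x) (%_ x'. step_op \<alpha> g x')"
   unfolding seg_exp_Suc[OF a] step_op_def ..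
  also have "... = (step_op \<alpha> ^^ j) (step_op \<alpha> g) x" using fun_cong[OF fun_cong[OF Suc]] .
  finally show "seg_exp (seg_law M \<alpha> (Suc j) x) (%_ x'. g x') = (step_op \<alpha> ^^ Suc j) g x"
   by (simp add: funpow_swap1)
 qed
qed (simp add: seg_exp_def fun_eq_iff)

lemma step_op_linear: "\<alpha> \<in> H ==> (step_op \<alpha> ^^ n) (%x. c * f x + e) x = c * (step_op \<alpha> ^^ n) f x + e"
proof (induction n arbitrary: x)
 case (Suc n)
 have "(step_op \<alpha> ^^ Suc n) (%x. c * f x + e) x = step_op \<alpha> (%x. c * (step_op \<alpha> ^^ n) f x + e) x"
 proof -
  have "(step_op \<alpha> ^^ n) (%x. c * f x + e) = (%x. c * (step_op \<alpha> ^^ n) f x + e)"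
   using Suc by (intro ext) simp
  then show ?thesis by simp
 qed
 also have "... = c * step_op \<alpha> ((step_op \<alpha> ^^ n) f) x + e"
  unfolding step_op_def by (simp add: expectation_add_finite[OF finite_step[OF Suc(2)]])
 finally show ?case by simp
qed simp

text \<open>Follow a single path: each of its \<open>n\<close> transitions has probability at least
  \<open>c\<close>, and nothing else contributes negatively.\<close>

lemma step_op_lower:
 assumes a: "\<alpha> \<in> H" and c: "0 < c" "\<And>x u x'. u <= top_act M x ==> 0 < pmf (trans_law M x u) x' ==>
   c <= theta M \<alpha> x u * pmf (trans_law M x u) x'" and g: "\<And>x. 0 <= g x"
 shows "(x, x') \<in> rel ^^ n ==> c ^ n * g x' <= (step_op \<alpha> ^^ n) g x" "0 <= (step_op \<alpha> ^^ n) g x"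
proof -
 have nonneg: "0 <= (step_op \<alpha> ^^ n) g x" for n x
  by (induction n arbitrary: x) (auto simp: g step_op_def intro!: Bochner_Integration.integral_nonneg)
 show "0 <= (step_op \<alpha> ^^ n) g x" by (rule nonneg)
 show "(x, x') \<in> rel ^^ n ==> c ^ n * g x' <= (step_op \<alpha> ^^ n) g x"
 proof (induction n arbitrary: x)
  case (Suc n)
  obtain x1 where x1: "(x, x1) \<in> rel" "(x1, x') \<in> rel ^^ n" using Suc(2) by (meson relpow_Suc_D2)
  obtain u where u: "u <= top_act M x" "0 < pmf (trans_law M x u) x1" using x1(1) by (auto simp: rel_def)
  have "c * (c ^ n * g x') <= (theta M \<alpha> x u * pmf (trans_law M x u) x1) * (step_op \<alpha> ^^ n) g x1"
   using c g by (intro mult_mono c(2)[OF u] Suc x1) (auto intro: mult_nonneg_nonneg theta_nonneg)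
  also have "... <= step_op \<alpha> ((step_op \<alpha> ^^ n) g) x"
   unfolding step_op_def[of _ _ x] using step_expectation_lower[OF a _ u(1), of "%_. (step_op \<alpha> ^^ n) g"] nonneg by simp
  finally show ?case by (simp add: mult.assoc)
 qed simp
qed

text \<open>From every state the maximiser of \<open>f\<close> is reached with probability at least
  \<open>c ^ n\<close>, so all values of the iterate lie between
  \<open>lo + c ^ n * (hi - lo)\<close> and \<open>hi\<close>.\<close>

lemma step_op_contraction:
 assumes prim: "\<And>x x'. (x, x') \<in> rel ^^ n"
 shows "\<exists>\<delta>>0. \<delta> <= 1 \<and> (\<forall>\<alpha>\<in>H. \<forall>f \<sigma>. (\<forall>x x'. \<bar>f x - f x'\<bar> <= \<sigma>) -->
   (\<forall>x x'. \<bar>(step_op \<alpha> ^^ n) f x - (step_op \<alpha> ^^ n) f x'\<bar> <= (1 - \<delta>) * \<sigma>))"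
proof -
 obtain c where c: "0 < c" "c <= 1" "\<And>\<alpha> x u x'. \<alpha> \<in> H ==> u <= top_act M x ==> 0 < pmf (trans_law M x u) x' ==>
   c <= theta M \<alpha> x u * pmf (trans_law M x u) x'"
  using step_lower by blast
 show ?thesis
 proof (intro exI[of _ "c ^ n"] conjI ballI allI impI)
  show "0 < c ^ n" "c ^ n <= 1" using c by (auto intro: power_le_one)
  fix \<alpha> :: "real ^ 'k" and f :: "'s => real" and \<sigma> :: real and x x' :: 's
  assume a: "\<alpha> \<in> H" and \<sigma>: "\<forall>x x'. \<bar>f x - f x'\<bar> <= \<sigma>"
  define lo where "lo = Min (range f)"
  define hi where "hi = Max (range f)"
  have lohi: "lo <= f z" "f z <= hi" for z unfolding lo_def hi_def by (auto intro: Min_le Max_ge)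
  obtain xm where xm: "f xm = lo" unfolding lo_def using Min_in[of "range f"] by (auto simp: image_iff)
  obtain xM where xM: "f xM = hi" unfolding hi_def using Max_in[of "range f"] by (auto simp: image_iff)
  have hl: "hi - lo <= \<sigma>" using \<sigma>[rule_format, of xM xm] xm xM by linarith
  have up: "(step_op \<alpha> ^^ n) f z <= hi" for z
   using step_op_lower(2)[OF a c(1) c(3)[OF a], of "%x. (-1) * f x + hi" n z] lohi
   unfolding step_op_linear[OF a] by (simp add: le_diff_eq)
  have low: "lo + c ^ n * (hi - lo) <= (step_op \<alpha> ^^ n) f z" for z
   using step_op_lower(1)[OF a c(1) c(3)[OF a], of "%x. 1 * f x + (- lo)" z xM n] lohi prim
   unfolding step_op_linear[OF a] by (simp add: xM)
  have "\<bar>(step_op \<alpha> ^^ n) f x - (step_op \<alpha> ^^ n) f x'\<bar> <= (hi - lo) - c ^ n * (hi - lo)"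
   using up[of x] up[of x'] low[of x] low[of x'] by linarith
  also have "... = (1 - c ^ n) * (hi - lo)" by (simp add: algebra_simps)
  also have "... <= (1 - c ^ n) * \<sigma>" using c hl by (intro mult_left_mono) (auto intro: power_le_one)
  finally show "\<bar>(step_op \<alpha> ^^ n) f x - (step_op \<alpha> ^^ n) f x'\<bar> <= (1 - c ^ n) * \<sigma>" .
 qed
qed

lemma pair_kernel_rel:
 assumes "snd z <= top_act M (fst z)" "z' \<in> set_pmf (pair_kernel M \<alpha> z)"
 shows "(fst z, fst z') \<in> rel" "snd z' <= top_act M (fst z')"
 using assms unfolding pair_kernel_def rel_def by (auto simp: pmf_positive_iff dest: action_support)

lemma kernel_pow_rel:
 assumes "snd z <= top_act M (fst z)" "z' \<in> set_pmf (kernel_pow (pair_kernel M \<alpha>) n z)"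
 shows "(fst z, fst z') \<in> rel ^^ n \<and> snd z' <= top_act M (fst z')"
 using assms(2)
proof (induction n arbitrary: z')
 case (Suc n)
 then obtain y where y: "y \<in> set_pmf (kernel_pow (pair_kernel M \<alpha>) n z)" "z' \<in> set_pmf (pair_kernel M \<alpha> y)" by auto
 then show ?case using Suc.IH[OF y(1)] pair_kernel_rel[OF _ y(2)] by auto
qed (use assms(1) in simp)

text \<open>First components of pair trajectories are \<open>rel\<close>-paths. So connectivity
  transfers, and return times of the pair \<open>(x, 0)\<close> are return times of
  \<open>x\<close>, whose gcd then divides 1. As \<open>rel\<close> does not depend on the
  parameter, the result serves the whole box.\<close>

lemma rel_primitive:
 assumes a: "\<alpha> \<in> open_params" and irr: "irreducible_on (state_acts M) (pair_kernel M \<alpha>)"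
  and aper: "aperiodic_on (state_acts M) (pair_kernel M \<alpha>)"
 shows "\<exists>n. (x, x') \<in> rel ^^ n" "\<exists>n0. \<forall>n\<ge>n0. \<forall>x x'. (x, x') \<in> rel ^^ n"
proof -
 have E: "(x, 0) \<in> state_acts M" for x by (simp add: state_acts_def)
 have irr': "\<exists>n. (x, x') \<in> rel ^^ n" for x x'
 proof -
  obtain n where "0 < pmf (kernel_pow (pair_kernel M \<alpha>) n (x, 0)) (x', 0)"
   using irr E unfolding irreducible_on_def by blast
  then show ?thesis using kernel_pow_rel[of "(x, 0)" "(x', 0)" \<alpha> n] by (auto simp: pmf_positive_iff)
 qed
 then show "\<exists>n. (x, x') \<in> rel ^^ n" .
 show "\<exists>n0. \<forall>n\<ge>n0. \<forall>x x'. (x, x') \<in> rel ^^ n"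
 proof (rule primitive_relation[OF irr'])
  fix x
  let ?S = "{n. 0 < n \<and> 0 < pmf (kernel_pow (pair_kernel M \<alpha>) n (x, 0)) (x, 0)}"
  have "Gcd ?S = 1" using aper E unfolding aperiodic_on_def by blast
  moreover have "Gcd {n. 0 < n \<and> (x, x) \<in> rel ^^ n} dvd Gcd ?S"
   by (rule Gcd_greatest, rule Gcd_dvd) (use kernel_pow_rel[of "(x, 0)" "(x, 0)" \<alpha>] in \<open>auto simp: pmf_positive_iff\<close>)
  ultimately show "Gcd {n. 0 < n \<and> (x, x) \<in> rel ^^ n} = 1" by simp
 qed
qed

end

section \<open>The trajectory as a process of batches\<close>

definition next_law :: "('s, 'k::finite) ctrl_chain => 's pmf => nat => ('s, 'k) path => 's pmf" where
 "next_law M \<nu> k om = (if k = 0 then \<nu> else trans_law M (fst (Z om k)) (snd (Z om k)))"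

text \<open>Adds the state at time \<open>k + 1\<close>, drawn before its action. Given the
  parameter, it is all that the next batch needs to know of the past, also at \<open>k = 0\<close>,
  where it has law \<open>\<nu>\<close>.\<close>

definition joint_law ::
  "('s, 'k::finite) ctrl_chain => nat => 's pmf => (nat => ('s, 'k) path => real ^ 'k) => nat
   => (('s, 'k) path \<times> 's) pmf" where
 "joint_law M N \<nu> a k = bind_pmf (path_law M N \<nu> a k) (%om. map_pmf (Pair om) (next_law M \<nu> k om))"

definition append_path :: "('s, 'k) path => nat => ('s, 'k) mark list => ('s, 'k) path" where
 "append_path om k l = (%i. if k < i \<and> i <= k + length l then l ! (i - k - 1) else om i)"

lemma append_path_Nil [simp]: "append_path om k [] = om"
proof (rule ext)
 fix i
 have "\<not> (k < i \<and> i <= k + length ([] :: ('a, 'b) mark list))" by (simp add: not_le)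
 then show "append_path om k [] i = om i" unfolding append_path_def by (rule if_not_P)
qed

lemma append_path_snoc: "(append_path om k l)(Suc (k + length l) := m) = append_path om k (l @ [m])"
 by (rule ext) (auto simp: append_path_def nth_append)

lemma append_path_le: "i <= k ==> append_path om k l i = om i"
 by (simp add: append_path_def)

lemma append_path_nth: "1 <= i ==> i <= length l ==> append_path om k l (k + i) = l ! (i - 1)"
 by (simp add: append_path_def)

lemma joint_law_step:
 "joint_law M N \<nu> a (Suc k) = bind_pmf (joint_law M N \<nu> a k)
   (%z. map_pmf (%y. ((fst z)(Suc k := fst y), snd y)) (step_law M (a (k div N) (fst z)) (snd z)))"
 unfolding joint_law_def path_law.simps step_law_def mark_law_def
 by (simp add: bind_assoc_pmf bind_return_pmf map_pmf_def next_law_def)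

lemma path_law_joint: "path_law M N \<nu> a k = map_pmf fst (joint_law M N \<nu> a k)"
 by (simp add: joint_law_def map_bind_pmf map_pmf_comp bind_return_pmf')

lemma seg_length: "y \<in> set_pmf (seg_law M \<alpha> j x) ==> length (fst y) = j"
 by (induction j arbitrary: y) auto

definition adapted :: "nat => (nat => ('s, 'k) path => 'a) => bool" where
 "adapted N a \<longleftrightarrow> (\<forall>n om om'. (\<forall>i\<le>n * N. om i = om' i) --> a n om = a n om')"

lemma adaptedD: "adapted N a ==> (\<And>i. i <= n * N ==> om i = om' i) ==> a n om = a n om'"
 unfolding adapted_def by blast

text \<open>Within a batch the policy stays constant for two reasons:
  \<open>(n * N + j) div N = n\<close> as long as \<open>j < N\<close>, and an adapted
  \<open>a n\<close> does not see the marks appended after time \<open>n * N\<close>.\<close>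

lemma joint_law_batch_partial:
 assumes ad: "adapted N a" and N: "1 <= N"
 shows "j <= N ==> joint_law M N \<nu> a (n * N + j) = bind_pmf (joint_law M N \<nu> a (n * N))
   (%z. map_pmf (%y. (append_path (fst z) (n * N) (fst y), snd y)) (seg_law M (a n (fst z)) j (snd z)))"
proof (induction j)
 case 0
 show ?case by (simp add: bind_return_pmf')
next
 case (Suc j)
 have dv: "(n * N + j) div N = n" using Suc(2) N by (simp add: div_nat_eqI algebra_simps)
 have "joint_law M N \<nu> a (n * N + Suc j) = bind_pmf (joint_law M N \<nu> a (n * N + j))
   (%z. map_pmf (%y. ((fst z)(Suc (n * N + j) := fst y), snd y)) (step_law M (a n (fst z)) (snd z)))"
  by (simp only: add_Suc_right joint_law_step dv)
 also have "... = bind_pmf (joint_law M N \<nu> a (n * N)) (%z. bind_pmf (seg_law M (a n (fst z)) j (snd z))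
   (%y. map_pmf (%v. ((append_path (fst z) (n * N) (fst y))(Suc (n * N + j) := fst v), snd v))
    (step_law M (a n (append_path (fst z) (n * N) (fst y))) (snd y))))"
  using Suc by (simp add: bind_assoc_pmf bind_map_pmf)
 also have "... = bind_pmf (joint_law M N \<nu> a (n * N)) (%z. bind_pmf (seg_law M (a n (fst z)) j (snd z))
   (%y. map_pmf (%v. (append_path (fst z) (n * N) (fst y @ [fst v]), snd v)) (step_law M (a n (fst z)) (snd y))))"
 proof (intro bind_pmf_cong refl)
  fix z y assume y: "y \<in> set_pmf (seg_law M (a n (fst z)) j (snd z))"
  have "a n (append_path (fst z) (n * N) (fst y)) = a n (fst z)"
   by (rule adaptedD[OF ad]) (rule append_path_le)
  then show "map_pmf (%v. ((append_path (fst z) (n * N) (fst y))(Suc (n * N + j) := fst v), snd v))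
    (step_law M (a n (append_path (fst z) (n * N) (fst y))) (snd y)) =
    map_pmf (%v. (append_path (fst z) (n * N) (fst y @ [fst v]), snd v)) (step_law M (a n (fst z)) (snd y))"
   by (simp only: append_path_snoc[of _ _ "fst y", unfolded seg_length[OF y]])
 qed
 also have "... = bind_pmf (joint_law M N \<nu> a (n * N))
   (%z. map_pmf (%y. (append_path (fst z) (n * N) (fst y), snd y)) (seg_law M (a n (fst z)) (Suc j) (snd z)))"
  by (simp add: map_bind_pmf map_pmf_comp)
 finally show ?case .
qed

lemma joint_law_batch:
 assumes "adapted N a" "1 <= N"
 shows "joint_law M N \<nu> a (Suc n * N) = bind_pmf (joint_law M N \<nu> a (n * N))
   (%z. map_pmf (%y. (append_path (fst z) (n * N) (fst y), snd y)) (seg_law M (a n (fst z)) N (snd z)))"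
 using joint_law_batch_partial[OF assms, of N M \<nu> n] by (simp add: add.commute)

section \<open>Hitting times\<close>

text \<open>Decides from the path up to time \<open>j\<close> alone what \<open>hit_time\<close>
  expresses through the whole infinite path.\<close>

definition hit_by :: "('s, 'k) path => 's \<times> nat => nat => nat => bool" where
 "hit_by om y k j \<longleftrightarrow> (\<exists>i. k < i \<and> i <= j \<and> Z om i = y)"

text \<open>The default \<open>j\<close> matches the truncation in \<open>end_time\<close>.\<close>

definition stop_time :: "('s, 'k) path => 's \<times> nat => nat => nat => nat" where
 "stop_time om y k j = (if hit_by om y k j then (LEAST i. k < i \<and> Z om i = y) else j)"

lemma stop_time_eq:
 assumes "k < t" "t <= j" "Z om t = y" "\<And>i. k < i ==> i < t ==> Z om i \<noteq> y"
 shows "hit_by om y k j" "stop_time om y k j = t"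
proof -
 show h: "hit_by om y k j" using assms unfolding hit_by_def by blast
 have "(LEAST i. k < i \<and> Z om i = y) = t" by (rule Least_equality) (use assms in \<open>auto simp: not_less[symmetric]\<close>)
 then show "stop_time om y k j = t" using h by (simp add: stop_time_def)
qed

lemma hit_by_obtain:
 assumes "hit_by om y k j"
 obtains t where "k < t" "t <= j" "Z om t = y" "\<And>i. k < i ==> i < t ==> Z om i \<noteq> y"
proof -
 let ?P = "%i. k < i \<and> Z om i = y"
 obtain i where i: "?P i" "i <= j" using assms unfolding hit_by_def by blast
 have P: "?P (LEAST i. ?P i)" by (rule LeastI[of ?P, OF i(1)])
 have "(LEAST i. ?P i) <= i" by (rule Least_le) (rule i(1))
 then have le: "(LEAST i. ?P i) <= j" using i(2) by simp
 have no: "Z om i' \<noteq> y" if "k < i'" "i' < (LEAST i. ?P i)" for i'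
  using not_less_Least[OF that(2)] that(1) by blast
 show thesis by (rule that[OF conjunct1[OF P] le conjunct2[OF P] no])
qed

lemma hit_time_eq:
 assumes "k < t" "Z om t = phantom_pair M om e k" "\<And>i. k < i ==> i < t ==> Z om i \<noteq> phantom_pair M om e k"
 shows "hit_time M om e k = enat (t - k)"
 unfolding hit_time_def
proof (rule antisym)
 show "(INF m\<in>{m. 0 < m \<and> Z om (k + m) = phantom_pair M om e k}. enat m) <= enat (t - k)"
  by (rule INF_lower) (use assms in auto)
 show "enat (t - k) <= (INF m\<in>{m. 0 < m \<and> Z om (k + m) = phantom_pair M om e k}. enat m)"
 proof (rule INF_greatest)
  fix m assume "m \<in> {m. 0 < m \<and> Z om (k + m) = phantom_pair M om e k}"
  then have "\<not> k + m < t" using assms(3)[of "k + m"] by auto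
  then show "enat (t - k) <= enat m" by simp
 qed
qed

lemma hit_time_gt:
 assumes "\<not> hit_by om (phantom_pair M om e k) k j" "k <= j"
 shows "enat j < enat k + hit_time M om e k"
proof -
 have "enat (Suc j - k) <= hit_time M om e k"
  unfolding hit_time_def
 proof (rule INF_greatest)
  fix m assume "m \<in> {m. 0 < m \<and> Z om (k + m) = phantom_pair M om e k}"
  then have "\<not> k + m <= j" using assms(1) unfolding hit_by_def by force
  then show "enat (Suc j - k) <= enat m" by simp
 qed
 then have "enat k + enat (Suc j - k) <= enat k + hit_time M om e k" by (rule add_left_mono)
 then have "enat (Suc j) <= enat k + hit_time M om e k" using assms(2) by simp
 then show ?thesis by (meson enat_ord_simps(2) lessI less_le_trans)
qed

lemma carried_eq:
 "carried M om e j = {k \<in> {1..j}. \<not> hit_by om (phantom_pair M om e k) k j}"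
proof -
 have "enat j < enat k + hit_time M om e k \<longleftrightarrow> \<not> hit_by om (phantom_pair M om e k) k j" if "k <= j" for k
 proof (cases "hit_by om (phantom_pair M om e k) k j")
  case True
  then obtain t where t: "k < t" "t <= j" "Z om t = phantom_pair M om e k" "\<And>i. k < i ==> i < t ==> Z om i \<noteq> phantom_pair M om e k"
   by (rule hit_by_obtain) blast
  then show ?thesis using True hit_time_eq[OF t(1,3,4)] by simp
 next
  case False
  then show ?thesis using hit_time_gt[OF False that] by simp
 qed
 then show ?thesis unfolding carried_def by auto
qed

lemma end_time_eq:
 assumes k: "k <= Suc n * N"
 shows "end_time M N n om e k = stop_time om (phantom_pair M om e k) k (Suc n * N)"
proof (cases "hit_by om (phantom_pair M om e k) k (Suc n * N)")
 case True
 then obtain t where t: "k < t" "t <= Suc n * N" "Z om t = phantom_pair M om e k" "\<And>i. k < i ==> i < t ==> Z om i \<noteq> phantom_pair M om e k"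
  by (rule hit_by_obtain) blast
 show ?thesis using hit_time_eq[OF t(1,3,4)] stop_time_eq(2)[of k t _ om "phantom_pair M om e k", OF t] t(1,2)
  by (simp add: end_time_def min_def)
next
 case False
 have "min (enat k + hit_time M om e k) (enat (Suc n * N)) = enat (Suc n * N)"
  by (rule min_absorb2[OF less_imp_le[OF hit_time_gt[OF False k]]])
 then show ?thesis using False unfolding end_time_def stop_time_def by simp
qed

text \<open>A visit that has not occurred by \<open>n * N\<close> but has by
  \<open>Suc n * N\<close> falls in batch \<open>n\<close>, so the indicator in the estimator
  becomes a finite-horizon condition.\<close>

lemma hit_in_batch_eq:
 assumes k: "k <= Suc n * N" and late: "\<not> hit_by om (phantom_pair M om e k) k (n * N)"
 shows "hit_in_batch M N n om e k = (if hit_by om (phantom_pair M om e k) k (Suc n * N)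
   then real (stop_time om (phantom_pair M om e k) k (Suc n * N)) - real k else 0)"
proof (cases "hit_by om (phantom_pair M om e k) k (Suc n * N)")
 case True
 then obtain t where t: "k < t" "t <= Suc n * N" "Z om t = phantom_pair M om e k" "\<And>i. k < i ==> i < t ==> Z om i \<noteq> phantom_pair M om e k"
  by (rule hit_by_obtain) blast
 have "n * N < t" using late t unfolding hit_by_def by (meson not_le)
 then have "t \<in> batch N n" using t by (simp add: batch_def)
 moreover have "enat k + hit_time M om e k = enat t" using hit_time_eq[OF t(1,3,4)] t by simp
 ultimately show ?thesis using hit_time_eq[OF t(1,3,4)] stop_time_eq[of k t _ om "phantom_pair M om e k", OF t] t
  by (simp add: hit_in_batch_def of_nat_diff)
next
 case False
 have "enat k + hit_time M om e k \<notin> enat ` batch N n"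
  using hit_time_gt[OF False k] by (auto simp: batch_def)
 then show ?thesis using False by (simp add: hit_in_batch_def)
qed

text \<open>A target missed up to time \<open>b\<close> looks the same when the search starts at
  \<open>b\<close>. This makes the remaining wait of a pending phantom independent of its starting
  time \<open>k\<close>.\<close>

lemma stop_time_later:
 assumes "k <= b" "\<not> hit_by om y k b"
 shows "hit_by om y k j \<longleftrightarrow> hit_by om y b j" "stop_time om y k j = stop_time om y b j"
proof -
 have no: "b < i" if i: "k < i" "Z om i = y" for i
 proof (rule ccontr)
  assume "\<not> b < i"
  then have "hit_by om y k b" using i unfolding hit_by_def by (intro exI[of _ i]) simp
  then show False using assms(2) by contradiction
 qed
 have eq: "(k < i \<and> Z om i = y) = (b < i \<and> Z om i = y)" for i using no[of i] assms(1) by auto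
 show h: "hit_by om y k j \<longleftrightarrow> hit_by om y b j"
  unfolding hit_by_def using eq by blast
 show "stop_time om y k j = stop_time om y b j" unfolding stop_time_def h eq by simp
qed

lemma hit_by_split:
 assumes "k <= b" "b <= j"
 shows "hit_by om y k j \<longleftrightarrow> hit_by om y k b \<or> hit_by om y b j"
proof
 assume "hit_by om y k j"
 then obtain i where "k < i" "i <= j" "Z om i = y" unfolding hit_by_def by blast
 moreover have "i <= b \<or> b < i" by linarith
 ultimately show "hit_by om y k b \<or> hit_by om y b j" unfolding hit_by_def by blast
next
 assume "hit_by om y k b \<or> hit_by om y b j"
 then show "hit_by om y k j"
 proof
  assume "hit_by om y k b"
  then obtain i where i: "k < i" "i <= b" "Z om i = y" unfolding hit_by_def by blast
  show ?thesis unfolding hit_by_def by (rule exI[of _ i]) (use i assms in simp)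
 next
  assume "hit_by om y b j"
  then obtain i where i: "b < i" "i <= j" "Z om i = y" unfolding hit_by_def by blast
  show ?thesis unfolding hit_by_def by (rule exI[of _ i]) (use i assms in simp)
 qed
qed

lemma hit_by_shift:
 assumes sh: "\<And>i. 1 <= i ==> i <= j ==> Z om (b + i) = Z om' i"
 shows "hit_by om y (b + k) (b + j) \<longleftrightarrow> hit_by om' y k j"
proof
 assume "hit_by om y (b + k) (b + j)"
 then obtain i where i: "b + k < i" "i <= b + j" "Z om i = y" unfolding hit_by_def by blast
 then have "Z om' (i - b) = y" using sh[of "i - b"] by simp
 then show "hit_by om' y k j" unfolding hit_by_def using i by (intro exI[of _ "i - b"]) auto
next
 assume "hit_by om' y k j"
 then obtain i where i: "k < i" "i <= j" "Z om' i = y" unfolding hit_by_def by blast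
 then show "hit_by om y (b + k) (b + j)" unfolding hit_by_def using sh[of i] by (intro exI[of _ "b + i"]) auto
qed

lemma stop_time_shift:
 assumes sh: "\<And>i. 1 <= i ==> i <= j ==> Z om (b + i) = Z om' i"
 shows "stop_time om y (b + k) (b + j) = b + stop_time om' y k j"
proof (cases "hit_by om' y k j")
 case True
 then obtain t where t: "k < t" "t <= j" "Z om' t = y" "\<And>i. k < i ==> i < t ==> Z om' i \<noteq> y"
  by (rule hit_by_obtain) blast
 have "stop_time om y (b + k) (b + j) = b + t"
 proof (rule stop_time_eq(2))
  show "Z om (b + t) = y" using sh[of t] t by simp
  fix i assume i: "b + k < i" "i < b + t"
  then show "Z om i \<noteq> y" using sh[of "i - b"] t(2) t(4)[of "i - b"] by auto
 qed (use t in auto)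
 then show ?thesis using stop_time_eq(2)[of k t _ om' y, OF t] by simp
next
 case False
 then show ?thesis using hit_by_shift[of j om b om' y k, OF sh] by (simp add: stop_time_def)
qed

lemma stop_time_le: "k <= j ==> k <= stop_time om y k j" "k <= j ==> stop_time om y k j <= j"
proof -
 assume k: "k <= j"
 have "k <= stop_time om y k j \<and> stop_time om y k j <= j"
 proof (cases "hit_by om y k j")
  case True
  then obtain t where t: "k < t" "t <= j" "Z om t = y" "\<And>i. k < i ==> i < t ==> Z om i \<noteq> y"
   by (rule hit_by_obtain) blast
  then show ?thesis using stop_time_eq(2)[of k t _ om y, OF t] by simp
 qed (use k in \<open>simp add: stop_time_def\<close>)
 then show "k <= stop_time om y k j" "stop_time om y k j <= j" by auto
qed

section \<open>Affine dependence of the gradient estimators on the carried phantoms\<close>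

text \<open>The estimator weighs old phantoms with the current parameter. Splitting off this factor
  leaves signs that are functions of the path alone, so memory accumulated under earlier parameters
  can be reused.\<close>

definition weight_factor :: "('s, 'k::finite) ctrl_chain => real ^ 'k => 'k => real" where
 "weight_factor M \<alpha> e = (if snd (coord M e) < top_act M (fst (coord M e)) then - tan (\<alpha> $ e)
   else - cos (\<alpha> $ e) * sin (\<alpha> $ e))"

definition weight_sign :: "('s, 'k) ctrl_chain => 'k => 's \<times> nat => real" where
 "weight_sign M e z = (case coord M e of (i, p) =>
   if p < top_act M i then of_bool (z = (i, p - 1)) else of_bool (z = (i, p - 1)) - of_bool (z = (i, p)))"

lemma K_weight_factor: "K_weight M \<alpha> om e k = weight_factor M \<alpha> e * weight_sign M e (Z om k)"
 by (simp add: K_weight_def weight_factor_def weight_sign_def split: prod.split)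

definition carried_to :: "('s, 'k) ctrl_chain => ('s, 'k) path => 'k => 's \<times> nat => nat => nat set" where
 "carried_to M om e y j = {k \<in> {1..j}. phantom_pair M om e k = y \<and> \<not> hit_by om y k j}"

definition mem0 :: "('s, 'k) ctrl_chain => nat => 'k => 's \<times> nat => nat => ('s, 'k) path => real" where
 "mem0 M N e y n om = (\<Sum>k\<in>carried_to M om e y (n * N). weight_sign M e (Z om k))"

definition mem1 :: "('s, 'k) ctrl_chain => nat => 'k => 's \<times> nat => nat => ('s, 'k) path => real" where
 "mem1 M N e y n om = (\<Sum>k\<in>carried_to M om e y (n * N). weight_sign M e (Z om k) * (real (n * N) - real k))"

definition own_part ::
  "('s, 'k) ctrl_chain => nat => ('s \<times> nat => real) => (('s \<times> nat) list => real) => 'k => nat => ('s, 'k) path => real" where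
 "own_part M N f \<Gamma> e n om = (\<Sum>k\<in>batch N n. weight_sign M e (Z om k) *
   (f (fst (coord M e), snd (Z om k)) - f (phantom_pair M om e k)
   + (\<Sum>j\<in>{k + 1..stop_time om (phantom_pair M om e k) k (Suc n * N)}. f (Z om j))
   - (if hit_by om (phantom_pair M om e k) k (Suc n * N)
     then real (stop_time om (phantom_pair M om e k) k (Suc n * N)) - real k else 0) * \<Gamma> (batch_obs N n om)))"

text \<open>The wait of a pending phantom is its age at the start of the batch plus the time from
  there to the visit. The second part is common to all phantoms with target \<open>y\<close> and
  enters here; the first multiplies \<open>carry1\<close>.\<close>

definition carry0 ::
  "nat => ('s \<times> nat => real) => (('s \<times> nat) list => real) => 's \<times> nat => nat => ('s, 'k) path => real" where
 "carry0 N f \<Gamma> y n om = (\<Sum>j\<in>{n * N + 1..stop_time om y (n * N) (Suc n * N)}. f (Z om j))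
   - (if hit_by om y (n * N) (Suc n * N) then real (stop_time om y (n * N) (Suc n * N)) - real (n * N) else 0)
    * \<Gamma> (batch_obs N n om)"

definition carry1 :: "nat => (('s \<times> nat) list => real) => 's \<times> nat => nat => ('s, 'k) path => real" where
 "carry1 N \<Gamma> y n om = - (if hit_by om y (n * N) (Suc n * N) then \<Gamma> (batch_obs N n om) else 0)"

definition targets :: "('s, 'k) ctrl_chain => 'k => ('s \<times> nat) set" where
 "targets M e = {fst (coord M e)} \<times> {..top_act M (fst (coord M e))}"

lemma finite_targets [simp]: "finite (targets M e)" by (simp add: targets_def)

lemma targets_nonempty: "targets M e \<noteq> {}" by (auto simp: targets_def)

text \<open>Group the carried phantoms by target: within a group the starting times enter only
  through the signed number and the signed total age. The assumption \<open>ok\<close> keeps all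
  targets in the finite set \<open>targets M e\<close>.\<close>

lemma grad_est_affine:
 assumes ok: "\<And>k. 1 <= k ==> k <= n * N ==> om k \<in> marks M"
 shows "grad_est M N f \<Gamma> \<alpha> n om $ e = 2 / real N * weight_factor M \<alpha> e * (own_part M N f \<Gamma> e n om
   + (\<Sum>y\<in>targets M e. carry0 N f \<Gamma> y n om * mem0 M N e y n om + carry1 N \<Gamma> y n om * mem1 M N e y n om))"
proof -
 let ?w = "weight_factor M \<alpha> e" and ?C = "carried M om e (n * N)" and ?pp = "phantom_pair M om e"
 let ?G = "\<Gamma> (batch_obs N n om)"
 have own: "(\<Sum>k\<in>batch N n. K_weight M \<alpha> om e k *
     (f (fst (coord M e), snd (Z om k)) - f (?pp k)
     + (\<Sum>j\<in>{k + 1..end_time M N n om e k}. f (Z om j))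
     - hit_in_batch M N n om e k * ?G)) = ?w * own_part M N f \<Gamma> e n om"
  unfolding own_part_def sum_distrib_left
 proof (intro sum.cong refl)
  fix k assume k: "k \<in> batch N n"
  then have k': "k <= Suc n * N" "n * N < k" by (auto simp: batch_def)
  have "\<not> hit_by om (?pp k) k (n * N)" using k'(2) by (auto simp: hit_by_def)
  then show "K_weight M \<alpha> om e k * (f (fst (coord M e), snd (Z om k)) - f (?pp k)
     + (\<Sum>j\<in>{k + 1..end_time M N n om e k}. f (Z om j)) - hit_in_batch M N n om e k * ?G) =
    ?w * (weight_sign M e (Z om k) * (f (fst (coord M e), snd (Z om k)) - f (?pp k)
   + (\<Sum>j\<in>{k + 1..stop_time om (?pp k) k (Suc n * N)}. f (Z om j))
   - (if hit_by om (?pp k) k (Suc n * N) then real (stop_time om (?pp k) k (Suc n * N)) - real k else 0) * ?G))"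
   unfolding K_weight_factor end_time_eq[OF k'(1)] by (subst hit_in_batch_eq[OF k'(1)]) simp_all
 qed
 have carried_term: "(\<Sum>j\<in>{n * N + 1..end_time M N n om e k}. f (Z om j)) - hit_in_batch M N n om e k * ?G
   = carry0 N f \<Gamma> (?pp k) n om + carry1 N \<Gamma> (?pp k) n om * (real (n * N) - real k)" if k: "k \<in> ?C" for k
 proof -
  have k': "1 <= k" "k <= n * N" "\<not> hit_by om (?pp k) k (n * N)" "k <= Suc n * N" using k by (auto simp: carried_eq)
  show ?thesis
   unfolding end_time_eq[OF k'(4)] hit_in_batch_eq[OF k'(4,3)] stop_time_later[OF k'(2,3)] carry0_def carry1_def
   by (simp add: algebra_simps)
 qed
 have C_in: "?pp k \<in> targets M e" if "k \<in> ?C" for k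
  using that ok[of k] by (auto simp: carried_eq targets_def phantom_pair_def marks_def)
 have fibre: "{k \<in> ?C. ?pp k = y} = carried_to M om e y (n * N)" for y
  by (auto simp: carried_eq carried_to_def)
 have "(\<Sum>k\<in>?C. K_weight M \<alpha> om e k * ((\<Sum>j\<in>{n * N + 1..end_time M N n om e k}. f (Z om j))
     - hit_in_batch M N n om e k * ?G))
   = (\<Sum>k\<in>?C. ?w * (weight_sign M e (Z om k) * (carry0 N f \<Gamma> (?pp k) n om + carry1 N \<Gamma> (?pp k) n om * (real (n * N) - real k))))"
  by (intro sum.cong refl) (simp only: carried_term K_weight_factor mult.assoc)
 also have "... = ?w * (\<Sum>k\<in>?C. weight_sign M e (Z om k) * (carry0 N f \<Gamma> (?pp k) n om + carry1 N \<Gamma> (?pp k) n om * (real (n * N) - real k)))"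
  by (rule sum_distrib_left[symmetric])
 also have "(\<Sum>k\<in>?C. weight_sign M e (Z om k) * (carry0 N f \<Gamma> (?pp k) n om + carry1 N \<Gamma> (?pp k) n om * (real (n * N) - real k)))
   = (\<Sum>y\<in>targets M e. \<Sum>k\<in>{k \<in> ?C. ?pp k = y}. weight_sign M e (Z om k) * (carry0 N f \<Gamma> (?pp k) n om + carry1 N \<Gamma> (?pp k) n om * (real (n * N) - real k)))"
  by (rule sum.group[symmetric]) (use C_in in \<open>auto simp: carried_eq\<close>)
 also have "... = (\<Sum>y\<in>targets M e. carry0 N f \<Gamma> y n om * mem0 M N e y n om + carry1 N \<Gamma> y n om * mem1 M N e y n om)"
 proof (intro sum.cong refl)
  fix y
  have "(\<Sum>k\<in>{k \<in> ?C. ?pp k = y}. weight_sign M e (Z om k) * (carry0 N f \<Gamma> (?pp k) n om + carry1 N \<Gamma> (?pp k) n om * (real (n * N) - real k)))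
   = (\<Sum>k\<in>{k \<in> ?C. ?pp k = y}. carry0 N f \<Gamma> y n om * weight_sign M e (Z om k) + carry1 N \<Gamma> y n om * (weight_sign M e (Z om k) * (real (n * N) - real k)))"
   by (intro sum.cong refl) (auto simp: algebra_simps)
  then show "(\<Sum>k\<in>{k \<in> ?C. ?pp k = y}. weight_sign M e (Z om k) * (carry0 N f \<Gamma> (?pp k) n om + carry1 N \<Gamma> (?pp k) n om * (real (n * N) - real k)))
   = carry0 N f \<Gamma> y n om * mem0 M N e y n om + carry1 N \<Gamma> y n om * mem1 M N e y n om"
   unfolding fibre mem0_def mem1_def by (simp only: sum.distrib sum_distrib_left)
 qed
 finally show ?thesis unfolding grad_est_def vec_lambda_beta own by (simp only: distrib_left mult.assoc)
qed

text \<open>Places the record at times \<open>1..N\<close> of a dummy path, so that functionals of a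
  batch, and the memory created by it, become functions of a list.\<close>

definition base_path :: "('s, 'k) mark list => ('s, 'k) path" where
 "base_path l = append_path (%_. undefined) 0 l"

lemma base_path_shift:
 "1 <= i ==> i <= length l ==> append_path om b l (b + i) = base_path l i"
 unfolding base_path_def using append_path_nth[of i l om b] append_path_nth[of i l _ 0] by simp

lemma batch_obs_append:
 assumes "length l = N"
 shows "batch_obs N n (append_path om (n * N) l) = map fst l"
proof (rule nth_equalityI)
 show len: "length (batch_obs N n (append_path om (n * N) l)) = length (map fst l)"
  using assms by (simp add: batch_obs_def)
 fix i assume "i < length (batch_obs N n (append_path om (n * N) l))"
 then have i: "i < N" by (simp add: batch_obs_def del: upt_Suc)
 then show "batch_obs N n (append_path om (n * N) l) ! i = map fst l ! i"
  using append_path_nth[of "Suc i" l om "n * N"] assms unfolding batch_obs_def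
  by (simp add: nth_append del: upt_Suc)
qed

lemma batch_obs_base: "length l = N ==> batch_obs N 0 (base_path l) = map fst l"
 using batch_obs_append[of l N 0] by (simp add: base_path_def)

lemma sum_shift_atLeastAtMost:
 fixes g :: "nat => real"
 shows "(\<Sum>j\<in>{b + m..b + n}. g j) = (\<Sum>j\<in>{m..n}. g (b + j))"
 using sum.shift_bounds_cl_nat_ivl[of g m b n] by (simp add: add.commute)

lemma carry_append:
 assumes l: "length l = N"
 shows "carry0 N f \<Gamma> y n (append_path om (n * N) l) = carry0 N f \<Gamma> y 0 (base_path l)"
  and "carry1 N \<Gamma> y n (append_path om (n * N) l) = carry1 N \<Gamma> y 0 (base_path l)"
proof -
 let ?om = "append_path om (n * N) l" and ?om' = "base_path l"
 have sh: "Z ?om (n * N + i) = Z ?om' i" if "1 <= i" "i <= N" for i using base_path_shift[of i l] that l by simp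
 have h: "hit_by ?om y (n * N) (Suc n * N) \<longleftrightarrow> hit_by ?om' y 0 N"
  using hit_by_shift[of N ?om "n * N" ?om' y 0] sh by (simp add: add.commute)
 have s: "stop_time ?om y (n * N) (Suc n * N) = n * N + stop_time ?om' y 0 N"
  using stop_time_shift[of N ?om "n * N" ?om' y 0] sh by (simp add: add.commute)
 have le: "stop_time ?om' y 0 N <= N" by (rule stop_time_le) simp
 have sum: "(\<Sum>j\<in>{n * N + 1..n * N + stop_time ?om' y 0 N}. f (Z ?om j)) = (\<Sum>j\<in>{1..stop_time ?om' y 0 N}. f (Z ?om' j))"
  unfolding sum_shift_atLeastAtMost by (intro sum.cong refl) (use sh le in auto)
 show "carry0 N f \<Gamma> y n ?om = carry0 N f \<Gamma> y 0 ?om'"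
  unfolding carry0_def h s sum batch_obs_append[OF l] batch_obs_base[OF l] by simp
 show "carry1 N \<Gamma> y n ?om = carry1 N \<Gamma> y 0 ?om'"
  unfolding carry1_def h batch_obs_append[OF l] batch_obs_base[OF l] by simp
qed

lemma own_append:
 assumes l: "length l = N"
 shows "own_part M N f \<Gamma> e n (append_path om (n * N) l) = own_part M N f \<Gamma> e 0 (base_path l)"
proof -
 let ?om = "append_path om (n * N) l" and ?om' = "base_path l"
 let ?b = "n * N"
 have sh0: "?om (?b + i) = ?om' i" if "1 <= i" "i <= N" for i using base_path_shift[of i l] that l by simp
 then have sh: "Z ?om (?b + i) = Z ?om' i" if "1 <= i" "i <= N" for i using that by simp
 have bt: "batch N n = {?b + 1..?b + N}" "batch N 0 = {1..N}" by (auto simp: batch_def)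
 have bN: "Suc n * N = ?b + N" "Suc 0 * N = N" by auto
 show ?thesis
  unfolding own_part_def bt bN sum_shift_atLeastAtMost batch_obs_append[OF l] batch_obs_base[OF l]
 proof (intro sum.cong refl)
  fix k assume k: "k \<in> {1..N}"
  then have k': "1 <= k" "k <= N" by auto
  have pp: "phantom_pair M ?om e (?b + k) = phantom_pair M ?om' e k"
   by (simp add: phantom_pair_def sh0[OF k'])
  let ?y = "phantom_pair M ?om' e k"
  have h: "hit_by ?om ?y (?b + k) (?b + N) \<longleftrightarrow> hit_by ?om' ?y k N" by (rule hit_by_shift) (rule sh)
  have s: "stop_time ?om ?y (?b + k) (?b + N) = ?b + stop_time ?om' ?y k N" by (rule stop_time_shift) (rule sh)
  have le: "stop_time ?om' ?y k N <= N" by (rule stop_time_le) (rule k')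
  have sum: "(\<Sum>j\<in>{?b + k + 1..?b + stop_time ?om' ?y k N}. f (Z ?om j)) = (\<Sum>j\<in>{k + 1..stop_time ?om' ?y k N}. f (Z ?om' j))"
   unfolding add.assoc sum_shift_atLeastAtMost by (intro sum.cong refl) (use sh le in auto)
  show "weight_sign M e (Z ?om (?b + k)) * (f (fst (coord M e), snd (Z ?om (?b + k))) - f (phantom_pair M ?om e (?b + k))
   + (\<Sum>j\<in>{?b + k + 1..stop_time ?om (phantom_pair M ?om e (?b + k)) (?b + k) (?b + N)}. f (Z ?om j))
   - (if hit_by ?om (phantom_pair M ?om e (?b + k)) (?b + k) (?b + N)
     then real (stop_time ?om (phantom_pair M ?om e (?b + k)) (?b + k) (?b + N)) - real (?b + k) else 0) * \<Gamma> (map fst l))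
   = weight_sign M e (Z ?om' k) * (f (fst (coord M e), snd (Z ?om' k)) - f (phantom_pair M ?om' e k)
   + (\<Sum>j\<in>{k + 1..stop_time ?om' (phantom_pair M ?om' e k) k N}. f (Z ?om' j))
   - (if hit_by ?om' (phantom_pair M ?om' e k) k N
     then real (stop_time ?om' (phantom_pair M ?om' e k) k N) - real k else 0) * \<Gamma> (map fst l))"
   unfolding pp h s sum sh[OF k'] by simp
 qed
qed

lemma carried_to_append:
 assumes l: "length l = N"
 shows "carried_to M (append_path om (n * N) l) e y (Suc n * N) =
  (if y \<in> fst ` set l then {} else carried_to M om e y (n * N)) \<union> (+) (n * N) ` carried_to M (base_path l) e y N"
proof -
 let ?om = "append_path om (n * N) l" and ?om' = "base_path l"
 let ?b = "n * N"
 have sh0: "?om (?b + i) = ?om' i" if "1 <= i" "i <= N" for i using base_path_shift[of i l] that l by simp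
 then have sh: "Z ?om (?b + i) = Z ?om' i" if "1 <= i" "i <= N" for i using that by simp
 have old: "?om i = om i" if "i <= ?b" for i using that by (rule append_path_le)
 have hl: "hit_by ?om y ?b (?b + N) \<longleftrightarrow> y \<in> fst ` set l"
 proof -
  have "hit_by ?om y ?b (?b + N) \<longleftrightarrow> hit_by ?om' y 0 N" using hit_by_shift[of N ?om ?b ?om' y 0] sh by simp
  also have "... \<longleftrightarrow> (\<exists>i<N. fst (l ! i) = y)"
  proof
   assume "hit_by ?om' y 0 N"
   then obtain i where "0 < i" "i <= N" "Z ?om' i = y" unfolding hit_by_def by blast
   then show "\<exists>i<N. fst (l ! i) = y" using l append_path_nth[of i l _ 0]
    by (intro exI[of _ "i - 1"]) (auto simp: base_path_def)
  next
   assume "\<exists>i<N. fst (l ! i) = y"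
   then obtain i where "i < N" "fst (l ! i) = y" by blast
   then show "hit_by ?om' y 0 N" using l append_path_nth[of "Suc i" l _ 0]
    unfolding hit_by_def by (intro exI[of _ "Suc i"]) (auto simp: base_path_def)
  qed
  also have "... \<longleftrightarrow> (\<exists>m\<in>set l. fst m = y)" using l by (metis in_set_conv_nth)
  also have "... \<longleftrightarrow> y \<in> fst ` set l" by blast
  finally show ?thesis .
 qed
 have split: "hit_by ?om y k (?b + N) \<longleftrightarrow> hit_by om y k ?b \<or> y \<in> fst ` set l" if k: "k <= ?b" for k
 proof -
  have "hit_by ?om y k (?b + N) \<longleftrightarrow> hit_by ?om y k ?b \<or> hit_by ?om y ?b (?b + N)"
   by (rule hit_by_split[OF k]) simp
  moreover have "hit_by ?om y k ?b \<longleftrightarrow> hit_by om y k ?b"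
   unfolding hit_by_def by (rule ex_cong1) (auto simp: old)
  ultimately show ?thesis using hl by simp
 qed
 have A: "k \<in> carried_to M ?om e y (?b + N) \<longleftrightarrow> k \<in> (if y \<in> fst ` set l then {} else carried_to M om e y ?b)"
  if k: "k <= ?b" for k
  using split[OF k] k old[OF k] by (auto simp: carried_to_def phantom_pair_def)
 have B: "?b + k \<in> carried_to M ?om e y (?b + N) \<longleftrightarrow> k \<in> carried_to M ?om' e y N" if k: "1 <= k" for k
 proof (cases "k <= N")
  case True
  then show ?thesis using k hit_by_shift[of N ?om ?b ?om' y k] sh sh0[OF k True]
   by (auto simp: carried_to_def phantom_pair_def)
 qed (auto simp: carried_to_def)
 show ?thesis
 proof (intro set_eqI)
  fix k
  show "k \<in> carried_to M ?om e y (Suc n * N) \<longleftrightarrow>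
   k \<in> (if y \<in> fst ` set l then {} else carried_to M om e y ?b) \<union> (+) ?b ` carried_to M ?om' e y N"
  proof (cases "k <= ?b")
   case True
   then have "k \<notin> (+) ?b ` carried_to M ?om' e y N" by (auto simp: carried_to_def)
   then show ?thesis using A[OF True] by (simp add: add.commute)
  next
   case False
   then obtain i where i: "k = ?b + i" "1 <= i" by (metis add.commute less_iff_Suc_add not_le le_add2 plus_1_eq_Suc add.assoc)
   have "k \<notin> (if y \<in> fst ` set l then {} else carried_to M om e y ?b)" using False by (auto simp: carried_to_def)
   then show ?thesis using B[OF i(2)] i(1) by (auto simp: add.commute)
  qed
 qed
qed

text \<open>By \<open>carried_to_append\<close> the pending set splits into old survivors, which age
  by \<open>N\<close>, and newcomers. These are the updates \<open>upd0\<close> and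
  \<open>upd1\<close>, with \<open>c0\<close> and \<open>c1\<close> the memory left by the batch
  alone.\<close>

lemma mem_append:
 assumes l: "length l = N"
 shows "mem0 M N e y (Suc n) (append_path om (n * N) l) = of_bool (y \<notin> fst ` set l) * mem0 M N e y n om + mem0 M N e y 1 (base_path l)"
  and "mem1 M N e y (Suc n) (append_path om (n * N) l) =
   of_bool (y \<notin> fst ` set l) * (mem1 M N e y n om + real N * mem0 M N e y n om) + mem1 M N e y 1 (base_path l)"
proof -
 let ?om = "append_path om (n * N) l" and ?om' = "base_path l"
 let ?b = "n * N"
 let ?A = "if y \<in> fst ` set l then {} else carried_to M om e y ?b" and ?B = "carried_to M ?om' e y N"
 have sh: "?om (?b + i) = ?om' i" if "1 <= i" "i <= N" for i using base_path_shift[of i l] that l by simp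
 have fin: "finite ?A" "finite ((+) ?b ` ?B)" by (auto simp: carried_to_def)
 have disj: "?A \<inter> (+) ?b ` ?B = {}" by (auto simp: carried_to_def)
 have sums: "(\<Sum>k\<in>carried_to M ?om e y (Suc n * N). g k) = (\<Sum>k\<in>?A. g k) + (\<Sum>k\<in>?B. g (?b + k))" for g :: "nat => real"
  unfolding carried_to_append[OF l] by (subst sum.union_disjoint[OF fin disj]) (simp add: sum.reindex)
 have old: "Z ?om k = Z om k" if "k \<in> ?A" for k
 proof -
  have "k <= ?b" using that by (auto simp: carried_to_def split: if_splits)
  then show ?thesis by (simp add: append_path_le)
 qed
 have new: "Z ?om (?b + k) = Z ?om' k" if "k \<in> ?B" for k using that sh by (auto simp: carried_to_def)
 have "(\<Sum>k\<in>?A. weight_sign M e (Z ?om k)) = of_bool (y \<notin> fst ` set l) * mem0 M N e y n om"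
  using old by (auto simp: mem0_def)
 moreover have "(\<Sum>k\<in>?B. weight_sign M e (Z ?om (?b + k))) = mem0 M N e y 1 ?om'"
  using new by (simp add: mem0_def)
 ultimately show "mem0 M N e y (Suc n) ?om = of_bool (y \<notin> fst ` set l) * mem0 M N e y n om + mem0 M N e y 1 ?om'"
  unfolding mem0_def[of M N e y "Suc n"] sums by simp
 have "(\<Sum>k\<in>?A. weight_sign M e (Z ?om k) * (real (Suc n * N) - real k))
   = of_bool (y \<notin> fst ` set l) * (mem1 M N e y n om + real N * mem0 M N e y n om)"
 proof (cases "y \<in> fst ` set l")
  case False
  have "(\<Sum>k\<in>?A. weight_sign M e (Z ?om k) * (real (Suc n * N) - real k))
    = (\<Sum>k\<in>carried_to M om e y ?b. weight_sign M e (Z om k) * (real ?b - real k) + real N * weight_sign M e (Z om k))"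
   using False old by (intro sum.cong) (auto simp: algebra_simps)
  then show ?thesis using False by (simp add: mem0_def mem1_def sum.distrib sum_distrib_left)
 qed simp
 moreover have "(\<Sum>k\<in>?B. weight_sign M e (Z ?om (?b + k)) * (real (Suc n * N) - real (?b + k))) = mem1 M N e y 1 ?om'"
  using new by (simp add: mem1_def)
 ultimately show "mem1 M N e y (Suc n) ?om =
   of_bool (y \<notin> fst ` set l) * (mem1 M N e y n om + real N * mem0 M N e y n om) + mem1 M N e y 1 ?om'"
  unfolding mem1_def[of M N e y "Suc n"] sums by simp
qed

section \<open>The controlled process as an affine memory chain, target by target\<close>

locale ctrl_batches = ctrl_box M \<mu> for M :: "('s::finite, 'k::finite) ctrl_chain" and \<mu> :: real +
 fixes N :: nat
 assumes N: "1 <= N"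
  and ergodic: "\<alpha> \<in> open_params ==> irreducible_on (state_acts M) (pair_kernel M \<alpha>)"
   "\<alpha> \<in> open_params ==> aperiodic_on (state_acts M) (pair_kernel M \<alpha>)"
begin

abbreviation joint :: "'s pmf => (nat => ('s, 'k) path => real ^ 'k) => nat => (('s, 'k) path \<times> 's) pmf" where
 "joint \<nu> a n \<equiv> joint_law M N \<nu> a (n * N)"

abbreviation ext :: "nat => ('s, 'k) path => ('s, 'k) mark list => ('s, 'k) path" where
 "ext n om l \<equiv> append_path om (n * N) l"

abbreviation Bs :: "('s, 'k) mark list set" where "Bs \<equiv> seg_marks M N"

abbreviation seg :: "real ^ 'k => 's => (('s, 'k) mark list \<times> 's) pmf" where "seg \<alpha> \<equiv> seg_law M \<alpha> N"

definition policy :: "(nat => ('s, 'k) path => real ^ 'k) => bool" where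
 "policy a \<longleftrightarrow> adapted N a \<and> (\<forall>n om. a n om \<in> H)"

lemma policyD: "policy a ==> adapted N a" "policy a ==> a n om \<in> H"
 by (auto simp: policy_def)

lemma policy_const: "\<alpha> \<in> H ==> policy (%_ _. \<alpha>)"
 by (auto simp: policy_def adapted_def)

lemma H_nonempty: "(\<chi> e. pi / 4) \<in> H"
 using \<mu> by (simp add: param_box_def)

lemma joint_step:
 assumes "policy a"
 shows "joint \<nu> a (Suc n) = bind_pmf (joint \<nu> a n) (%z. map_pmf (%y. (ext n (fst z) (fst y), snd y)) (seg (a n (fst z)) (snd z)))"
 by (rule joint_law_batch[OF policyD(1)[OF assms] N])

lemma finite_joint: "policy a ==> finite (set_pmf (joint \<nu> a n))"
proof (induction n)
 case 0
 then show ?case by (auto simp: joint_law_def)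
next
 case (Suc n)
 then show ?case unfolding joint_step[OF Suc(2)]
  by (intro finite_set_bind_pmf) (auto simp: finite_seg_law policyD(2))
qed

lemma joint_marks:
 assumes a: "policy a"
 shows "z \<in> set_pmf (joint \<nu> a n) ==> 1 <= i ==> i <= n * N ==> fst z i \<in> marks M"
proof (induction n arbitrary: z i)
 case (Suc n)
 obtain y v where y: "y \<in> set_pmf (joint \<nu> a n)" "v \<in> set_pmf (seg (a n (fst y)) (snd y))" "z = (ext n (fst y) (fst v), snd v)"
  using Suc(2) unfolding joint_step[OF a] by auto
 have "v \<in> Bs \<times> UNIV"
  using seg_support[OF policyD(2)[OF a, of n "fst y"], of N "snd y"] y(2) by blast
 then have v: "set (fst v) \<subseteq> marks M" "length (fst v) = N"
  by (auto simp: seg_marks_def mem_Times_iff)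
 show ?case
 proof (cases "i <= n * N")
  case True
  then show ?thesis using Suc.IH[OF y(1) Suc(3) True] y(3) by (simp add: append_path_le)
 next
  case False
  then have "fst z i = fst v ! (i - n * N - 1)" using Suc(4) v(2) y(3) by (simp add: append_path_def)
  moreover have "i - n * N - 1 < length (fst v)" using False Suc(4) v(2) by simp
  ultimately show ?thesis using v(1) nth_mem by fastforce
 qed
qed simp

lemma joint_expectation_step:
 fixes F :: "('s, 'k) path \<times> 's => real"
 assumes a: "policy a"
 shows "expect (joint \<nu> a (Suc n)) F = expect (joint \<nu> a n)
  (%z. seg_exp (seg (a n (fst z)) (snd z)) (%l x'. F (ext n (fst z) l, x')))"
 unfolding joint_step[OF a]
 by (subst expectation_bind_finite) (auto simp: seg_exp_def finite_joint[OF a] finite_seg_law policyD(2)[OF a])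

lemma targets_act: "y \<in> targets M e ==> snd y <= top_act M (fst y)"
 by (auto simp: targets_def)

text \<open>The state kernel of a batch is the \<open>N\<close>-th power of the one-step kernel, so
  the exponent of the contraction is rounded up to a multiple of \<open>N\<close>; the one-step
  drift factor \<open>\<theta>\<close> is at least \<open>\<theta> ^ N\<close> and can be kept.
  \<open>1 / 2\<close> is the lower bound of \<open>W\<close> from
  \<open>target_drift\<close>.\<close>

lemma affine_memory_target:
 assumes y: "y \<in> targets M e"
 shows "\<exists>Cb Lp \<theta> \<delta> W m. affine_memory H seg Bs (avoids y) (%l. mem0 M N e y 1 (base_path l))
  (%l. mem1 M N e y 1 (base_path l)) (real N) Cb Lp \<theta> \<delta> (1 / 2) W m"
proof -
 note erg = ergodic[OF box_open[OF H_nonempty]]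
 note prim = rel_primitive[OF box_open[OF H_nonempty] erg]
 obtain Lp where Lp: "0 <= Lp" "\<And>\<alpha> \<alpha>' x z. \<alpha> \<in> H ==> \<alpha>' \<in> H ==> \<bar>pmf (seg \<alpha> x) z - pmf (seg \<alpha>' x) z\<bar> <= Lp * dist \<alpha> \<alpha>'"
  using seg_lipschitz[of N] by blast
 obtain W :: "'s => real" and \<theta> where W: "0 < \<theta>" "\<theta> < 1" "\<And>x. 1 / 2 <= W x" "\<And>x. W x <= 1" and
  drift: "\<And>\<alpha> x. \<alpha> \<in> H ==> expect (step_law M \<alpha> x) (%z. of_bool (fst (fst z) \<noteq> y) * W (snd z)) <= \<theta> * W x"
  using target_drift[OF prim(1) targets_act[OF y]] by blast
 obtain n0 where n0: "\<And>n x x'. n0 <= n ==> (x, x') \<in> rel ^^ n" using prim(2) by blast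
 define m where "m = max 1 n0"
 have "n0 <= N * m" using N by (simp add: m_def) (metis One_nat_def max.cobounded2 mult_le_mono1 nat_mult_1 order_trans)
 then have "(x, x') \<in> rel ^^ (N * m)" for x x' by (rule n0)
 then obtain \<delta> where \<delta>: "0 < \<delta>" "\<delta> <= 1" "\<And>\<alpha> f \<sigma> x x'. \<alpha> \<in> H ==> (\<And>x x'. \<bar>f x - f x'\<bar> <= \<sigma>) ==>
   \<bar>(step_op \<alpha> ^^ (N * m)) f x - (step_op \<alpha> ^^ (N * m)) f x'\<bar> <= (1 - \<delta>) * \<sigma>"
  using step_op_contraction[of "N * m"] by blast
 define Cb where "Cb = (\<Sum>l\<in>Bs. \<bar>mem0 M N e y 1 (base_path l)\<bar> + \<bar>mem1 M N e y 1 (base_path l)\<bar>)"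
 have Cb: "\<bar>mem0 M N e y 1 (base_path l)\<bar> + \<bar>mem1 M N e y 1 (base_path l)\<bar> <= Cb" if "l \<in> Bs" for l
  unfolding Cb_def by (rule member_le_sum[OF that]) (auto simp: finite_seg_marks)
 show ?thesis
 proof (intro exI, rule affine_memory.intro)
  show "finite Bs" by (rule finite_seg_marks)
  show "set_pmf (seg p x) \<subseteq> Bs \<times> UNIV" if "p \<in> H" for p x by (rule seg_support[OF that])
  show "\<bar>pmf (seg p x) z - pmf (seg p' x) z\<bar> <= Lp * dist p p'" if "p \<in> H" "p' \<in> H" for p p' x z
   by (rule Lp(2)[OF that])
  show "0 <= Lp" by (rule Lp)
  show "avoids y b = 0 \<or> avoids y b = 1" for b by (simp add: avoids_def)
  show "\<bar>mem0 M N e y 1 (base_path l)\<bar> <= Cb" if "l \<in> Bs" for l using Cb[OF that] by linarith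
  show "\<bar>mem1 M N e y 1 (base_path l)\<bar> <= Cb" if "l \<in> Bs" for l using Cb[OF that] by linarith
  show "0 <= Cb" unfolding Cb_def by (intro sum_nonneg) auto
  show "0 <= real N" "(0::real) < 1 / 2" by simp_all
  show "1 / 2 <= W x" "W x <= 1" for x by (rule W)+
  show "0 < \<theta>" "\<theta> < 1" by (rule W)+
  show "seg_exp (seg p x) (%b x'. avoids y b * W x') <= \<theta> * W x" if p: "p \<in> H" for p x
  proof -
   have W0: "0 <= W x" for x using W(3)[of x] by simp
   have "seg_exp (seg p x) (%b x'. avoids y b * W x') <= \<theta> ^ N * W x"
    by (rule seg_drift[OF p W(1,2) W0 drift[OF p]])
   also have "... <= \<theta> ^ 1 * W x" using W(1,2) W0 N by (intro mult_right_mono power_decreasing) auto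
   finally show ?thesis by simp
  qed
  show "1 <= m" by (simp add: m_def)
  show "0 < \<delta>" "\<delta> <= 1" by (rule \<delta>)+
  show "\<bar>((%g x. seg_exp (seg p x) (%_ x'. g x')) ^^ m) f x - ((%g x. seg_exp (seg p x) (%_ x'. g x')) ^^ m) f x'\<bar> <= (1 - \<delta>) * \<sigma>"
   if p: "p \<in> H" and f: "\<And>x x'. \<bar>f x - f x'\<bar> <= \<sigma>" for p f \<sigma> x x'
   unfolding seg_exp_step_op[OF p] funpow_mult by (rule \<delta>(3)[OF p f])
 qed
qed

text \<open>Weight and parameter may move by \<open>ep\<close> times a random size \<open>V\<close>
  that is controlled in mean square only, as the unbounded estimator demands. The increments are
  bounded for every record in \<open>Bs\<close>, also for those of probability 0.\<close>

definition slow ::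
  "'s pmf => (nat => ('s, 'k) path => real ^ 'k) => (nat => ('s, 'k) path => real)
   => (nat => ('s, 'k) path => real) => real => real => nat => bool" where
 "slow \<nu> a d V D ep h \<longleftrightarrow> 0 <= ep \<and>
   (\<forall>n\<le>h. \<forall>z\<in>set_pmf (joint \<nu> a n). \<bar>d n (fst z)\<bar> <= D \<and> 0 <= V n (fst z)) \<and>
   (\<forall>n\<le>h. expect (joint \<nu> a n) (%z. (V n (fst z))\<^sup>2) <= D) \<and>
   (\<forall>n<h. \<forall>z\<in>set_pmf (joint \<nu> a n). \<forall>b\<in>Bs. \<bar>d (Suc n) (ext n (fst z) b) - d n (fst z)\<bar> <= ep * D * V n (fst z) \<and>
    dist (a (Suc n) (ext n (fst z) b)) (a n (fst z)) <= ep * D * V n (fst z))"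

text \<open>The constants of the memory chain exist only after \<open>y\<close> is given, so both
  consequences are drawn from one local interpretation. Their bounds are chosen before the policy
  and the initial law.\<close>

lemma core_single:
 assumes y: "y \<in> targets M e"
 shows memory_moment: "\<exists>C\<ge>0. \<forall>\<nu> a n. policy a -->
   expect (joint \<nu> a n) (%z. (mem0 M N e y n (fst z))\<^sup>2 + (mem1 M N e y n (fst z))\<^sup>2) <= C"
  and core_target: "\<exists>mean. bounded_lipschitz H mean \<and>
   (\<forall>\<alpha>\<in>H. \<forall>\<nu>. (%n. expect (joint \<nu> (%_ _. \<alpha>) n) (%z. seg_exp (seg \<alpha> (snd z))
    (%l _. A l + B0 l * mem0 M N e y n (fst z) + B1 l * mem1 M N e y n (fst z)))) \<longlonglongrightarrow> mean \<alpha>) \<and>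
   (\<forall>D \<eta>. 0 <= D --> 0 < \<eta> --> (\<exists>Q\<ge>0. \<forall>\<nu> a d V ep h. policy a --> slow \<nu> a d V D ep h -->
     (\<forall>n\<le>h. \<bar>\<Sum>k<n. expect (joint \<nu> a k) (%z. d k (fst z) *
      (seg_exp (seg (a k (fst z)) (snd z)) (%l _. A l + B0 l * mem0 M N e y k (fst z) + B1 l * mem1 M N e y k (fst z))
       - mean (a k (fst z))))\<bar> <= Q + real n * (\<eta> + Q * ep))))"
proof -
 obtain Cb Lp \<theta> \<delta> W m where am: "affine_memory H seg Bs (avoids y) (%l. mem0 M N e y 1 (base_path l))
  (%l. mem1 M N e y 1 (base_path l)) (real N) Cb Lp \<theta> \<delta> (1 / 2) W m"
  using affine_memory_target[OF y] by blast
 interpret A: affine_memory H seg Bs "avoids y" "%l. mem0 M N e y 1 (base_path l)"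
  "%l. mem1 M N e y 1 (base_path l)" "real N" Cb Lp \<theta> \<delta> "1 / 2" W m by (rule am)
 have proc: "A.process (joint \<nu> a) a ext (mem0 M N e y) (mem1 M N e y)" if a: "policy a" for \<nu> a
  unfolding A.process_def
 proof (intro conjI allI ballI)
  show "finite (set_pmf (joint \<nu> a n))" for n by (rule finite_joint[OF a])
  show "joint \<nu> a (Suc n) = bind_pmf (joint \<nu> a n) (%z. map_pmf (%y. (ext n (fst z) (fst y), snd y)) (seg (a n (fst z)) (snd z)))" for n
   by (rule joint_step[OF a])
  show "a n (fst z) \<in> H" for n z by (rule policyD(2)[OF a])
  show "mem0 M N e y 0 (fst z) = 0" "mem1 M N e y 0 (fst z) = 0" for z
   by (simp_all add: mem0_def mem1_def carried_to_def)
  fix n z b assume b: "b \<in> Bs"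
  then have l: "length b = N" by (simp add: seg_marks_def)
  show "mem0 M N e y (Suc n) (ext n (fst z) b) = A.upd0 b (mem0 M N e y n (fst z))"
   unfolding mem_append(1)[OF l] A.upd0_def avoids_def ..
  show "mem1 M N e y (Suc n) (ext n (fst z) b) = A.upd1 b (mem0 M N e y n (fst z)) (mem1 M N e y n (fst z))"
   unfolding mem_append(2)[OF l] A.upd1_def avoids_def ..
 qed
 show "\<exists>C\<ge>0. \<forall>\<nu> a n. policy a -->
   expect (joint \<nu> a n) (%z. (mem0 M N e y n (fst z))\<^sup>2 + (mem1 M N e y n (fst z))\<^sup>2) <= C"
 proof -
  obtain C where C: "0 <= C" "\<And>(J :: nat => (('s, 'k) path \<times> 's) pmf) a ext R0 R1 n. A.process J a ext R0 R1 ==>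
   expect (J n) (%z. (R0 n (fst z))\<^sup>2 + (R1 n (fst z))\<^sup>2) <= C"
   using A.memory_second_moment by blast
  show ?thesis by (intro exI[of _ C] conjI allI impI C(1) C(2)[OF proc])
 qed
 show "\<exists>mean. bounded_lipschitz H mean \<and>
   (\<forall>\<alpha>\<in>H. \<forall>\<nu>. (%n. expect (joint \<nu> (%_ _. \<alpha>) n) (%z. seg_exp (seg \<alpha> (snd z))
    (%l _. A l + B0 l * mem0 M N e y n (fst z) + B1 l * mem1 M N e y n (fst z)))) \<longlonglongrightarrow> mean \<alpha>) \<and>
   (\<forall>D \<eta>. 0 <= D --> 0 < \<eta> --> (\<exists>Q\<ge>0. \<forall>\<nu> a d V ep h. policy a --> slow \<nu> a d V D ep h -->
     (\<forall>n\<le>h. \<bar>\<Sum>k<n. expect (joint \<nu> a k) (%z. d k (fst z) *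
      (seg_exp (seg (a k (fst z)) (snd z)) (%l _. A l + B0 l * mem0 M N e y k (fst z) + B1 l * mem1 M N e y k (fst z))
       - mean (a k (fst z))))\<bar> <= Q + real n * (\<eta> + Q * ep))))"
 proof (intro exI[of _ "A.batch_mean A B0 B1"] conjI ballI allI impI)
  show "bounded_lipschitz H (A.batch_mean A B0 B1)"
   unfolding bounded_lipschitz_def by (rule A.batch_mean_lipschitz)
  show "(%n. expect (joint \<nu> (%_ _. \<alpha>) n) (%z. seg_exp (seg \<alpha> (snd z))
    (%l _. A l + B0 l * mem0 M N e y n (fst z) + B1 l * mem1 M N e y n (fst z)))) \<longlonglongrightarrow> A.batch_mean A B0 B1 \<alpha>"
   if "\<alpha> \<in> H" for \<alpha> \<nu>
   by (rule A.frozen_convergence[OF proc[OF policy_const[OF that]]])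
  fix D \<eta> :: real assume D: "0 <= D" and \<eta>: "0 < \<eta>"
  obtain Q where Q: "0 <= Q" and avg: "\<forall>(J :: nat => (('s, 'k) path \<times> 's) pmf) a ext R0 R1 d V ep h.
   A.process J a ext R0 R1 --> 0 <= ep -->
   (\<forall>n\<le>h. \<forall>z\<in>set_pmf (J n). \<bar>d n (fst z)\<bar> <= D \<and> 0 <= V n (fst z)) -->
   (\<forall>n\<le>h. expect (J n) (%z. (V n (fst z))\<^sup>2) <= D) -->
   (\<forall>n<h. \<forall>z\<in>set_pmf (J n). \<forall>b\<in>Bs. \<bar>d (Suc n) (ext n (fst z) b) - d n (fst z)\<bar> <= ep * D * V n (fst z) \<and>
    dist (a (Suc n) (ext n (fst z) b)) (a n (fst z)) <= ep * D * V n (fst z)) -->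
   (\<forall>n\<le>h. \<bar>\<Sum>k<n. expect (J k) (%z. d k (fst z) *
    (seg_exp (seg (a k (fst z)) (snd z)) (%b _. A b + B0 b * R0 k (fst z) + B1 b * R1 k (fst z))
     - A.batch_mean A B0 B1 (a k (fst z))))\<bar> <= Q + real n * (\<eta> + Q * ep))"
   by (rule exE[OF A.averaging[OF D \<eta>, of A B0 B1]]) (erule conjE, rule that)
  note avg' = avg[THEN spec, THEN spec, THEN spec, THEN spec, THEN spec, THEN spec, THEN spec, THEN spec, THEN spec,
   THEN mp, THEN mp, THEN mp, THEN mp, THEN mp, THEN spec, THEN mp]
  show "\<exists>Q\<ge>0. \<forall>\<nu> a d V ep h. policy a --> slow \<nu> a d V D ep h -->
     (\<forall>n\<le>h. \<bar>\<Sum>k<n. expect (joint \<nu> a k) (%z. d k (fst z) *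
      (seg_exp (seg (a k (fst z)) (snd z)) (%l _. A l + B0 l * mem0 M N e y k (fst z) + B1 l * mem1 M N e y k (fst z))
       - A.batch_mean A B0 B1 (a k (fst z))))\<bar> <= Q + real n * (\<eta> + Q * ep))"
  proof (intro exI[of _ Q] conjI allI impI Q)
   fix \<nu> a d V ep h n assume a: "policy a" and sl: "slow \<nu> a d V D ep h" and n: "n <= h"
   note sl' = sl[unfolded slow_def]
   show "\<bar>\<Sum>k<n. expect (joint \<nu> a k) (%z. d k (fst z) *
      (seg_exp (seg (a k (fst z)) (snd z)) (%l _. A l + B0 l * mem0 M N e y k (fst z) + B1 l * mem1 M N e y k (fst z))
       - A.batch_mean A B0 B1 (a k (fst z))))\<bar> <= Q + real n * (\<eta> + Q * ep)"
    using avg'[OF proc[OF a] conjunct1[OF sl'] sl'[THEN conjunct2, THEN conjunct1]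
     sl'[THEN conjunct2, THEN conjunct2, THEN conjunct1] sl'[THEN conjunct2, THEN conjunct2, THEN conjunct2] n] .
  qed
 qed
qed

definition batch_val ::
  "'k => (('s, 'k) mark list => real) => ('s \<times> nat => ('s, 'k) mark list => real)
   => ('s \<times> nat => ('s, 'k) mark list => real) => nat => ('s, 'k) path => ('s, 'k) mark list => real" where
 "batch_val e A B0 B1 n om l = A l + (\<Sum>y\<in>targets M e. B0 y l * mem0 M N e y n om + B1 y l * mem1 M N e y n om)"

text \<open>Interface that hides the target-wise memory chains. The constant \<open>Q\<close>
  precedes policy, initial law, weight and \<open>ep\<close>, which allows the limit
  \<open>ep\<close> to 0 with one and the same averaging bound.\<close>

definition ergodic_average ::
  "(nat => ('s, 'k) path => ('s, 'k) mark list => real) => (real ^ 'k => real) => bool" where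
 "ergodic_average G mean \<longleftrightarrow> bounded_lipschitz H mean \<and>
   (\<forall>\<alpha>\<in>H. \<forall>\<nu>. (%n. expect (joint \<nu> (%_ _. \<alpha>) n) (%z. seg_exp (seg \<alpha> (snd z))
    (%l _. G n (fst z) l))) \<longlonglongrightarrow> mean \<alpha>) \<and>
   (\<forall>D \<eta>. 0 <= D --> 0 < \<eta> --> (\<exists>Q\<ge>0. \<forall>\<nu> a d V ep h. policy a --> slow \<nu> a d V D ep h -->
     (\<forall>n\<le>h. \<bar>\<Sum>k<n. expect (joint \<nu> a k) (%z. d k (fst z) *
      (seg_exp (seg (a k (fst z)) (snd z)) (%l _. G k (fst z) l) - mean (a k (fst z))))\<bar> <= Q + real n * (\<eta> + Q * ep))))"

lemma seg_exp_sum_finite: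
 "\<alpha> \<in> H ==> seg_exp (seg \<alpha> x) (%l x'. \<Sum>i\<in>I. F i l x') = (\<Sum>i\<in>I. seg_exp (seg \<alpha> x) (F i))"
 unfolding seg_exp_def by (rule expectation_sum_finite) (rule finite_seg_law)

lemma ergodic_average_sum:
 assumes fin: "finite I" and G: "\<And>i. i \<in> I ==> ergodic_average (G i) (mean i)"
 shows "ergodic_average (%n om l. \<Sum>i\<in>I. G i n om l) (%\<alpha>. \<Sum>i\<in>I. mean i \<alpha>)"
 unfolding ergodic_average_def
proof (intro conjI ballI allI impI)
 show "bounded_lipschitz H (%\<alpha>. \<Sum>i\<in>I. mean i \<alpha>)"
  using G unfolding ergodic_average_def by (intro bounded_lipschitz_sum) blast
 show "(%n. expect (joint \<nu> (%_ _. \<alpha>) n) (%z. seg_exp (seg \<alpha> (snd z))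
    (%l _. \<Sum>i\<in>I. G i n (fst z) l))) \<longlonglongrightarrow> (\<Sum>i\<in>I. mean i \<alpha>)" if a: "\<alpha> \<in> H" for \<alpha> \<nu>
  unfolding seg_exp_sum_finite[OF a] expectation_sum_finite[OF finite_joint[OF policy_const[OF a]]]
  using G a unfolding ergodic_average_def by (intro tendsto_sum) blast
 fix D \<eta> :: real assume D: "0 <= D" and \<eta>: "0 < \<eta>"
 \<comment> \<open>Shares the accuracy among the summands; the \<open>+ 1\<close> keeps the divisor
   positive for an empty index set.\<close>
 define \<eta>' where "\<eta>' = \<eta> / (real (card I) + 1)"
 have \<eta>': "0 < \<eta>'" "real (card I) * \<eta>' <= \<eta>" using \<eta> by (auto simp: \<eta>'_def field_simps)
 have "\<forall>i\<in>I. \<exists>Q\<ge>0. \<forall>\<nu> a d V ep h. policy a --> slow \<nu> a d V D ep h -->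
     (\<forall>n\<le>h. \<bar>\<Sum>k<n. expect (joint \<nu> a k) (%z. d k (fst z) *
      (seg_exp (seg (a k (fst z)) (snd z)) (%l _. G i k (fst z) l) - mean i (a k (fst z))))\<bar> <= Q + real n * (\<eta>' + Q * ep))"
  using G D \<eta>'(1) unfolding ergodic_average_def by blast
 from bchoice[OF this] obtain Q where Q: "\<And>i. i \<in> I ==> 0 <= Q i" "\<And>i \<nu> a d V ep h n. i \<in> I ==> policy a ==> slow \<nu> a d V D ep h ==> n <= h ==>
     \<bar>\<Sum>k<n. expect (joint \<nu> a k) (%z. d k (fst z) *
      (seg_exp (seg (a k (fst z)) (snd z)) (%l _. G i k (fst z) l) - mean i (a k (fst z))))\<bar> <= Q i + real n * (\<eta>' + Q i * ep)"
  by blast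
 show "\<exists>Q\<ge>0. \<forall>\<nu> a d V ep h. policy a --> slow \<nu> a d V D ep h -->
     (\<forall>n\<le>h. \<bar>\<Sum>k<n. expect (joint \<nu> a k) (%z. d k (fst z) *
      (seg_exp (seg (a k (fst z)) (snd z)) (%l _. \<Sum>i\<in>I. G i k (fst z) l) - (\<Sum>i\<in>I. mean i (a k (fst z)))))\<bar> <= Q + real n * (\<eta> + Q * ep))"
 proof (intro exI[of _ "\<Sum>i\<in>I. Q i"] conjI allI impI)
  show "0 <= (\<Sum>i\<in>I. Q i)" by (intro sum_nonneg Q)
  fix \<nu> a d V ep h n assume a: "policy a" and sl: "slow \<nu> a d V D ep h" and n: "n <= h"
  have eq: "(\<Sum>k<n. expect (joint \<nu> a k) (%z. d k (fst z) *
      (seg_exp (seg (a k (fst z)) (snd z)) (%l _. \<Sum>i\<in>I. G i k (fst z) l) - (\<Sum>i\<in>I. mean i (a k (fst z))))))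
   = (\<Sum>i\<in>I. \<Sum>k<n. expect (joint \<nu> a k) (%z. d k (fst z) *
      (seg_exp (seg (a k (fst z)) (snd z)) (%l _. G i k (fst z) l) - mean i (a k (fst z)))))"
   unfolding seg_exp_sum_finite[OF policyD(2)[OF a]] sum_subtractf[symmetric] sum_distrib_left
    expectation_sum_finite[OF finite_joint[OF a]] by (rule sum.swap)
  have "\<bar>\<Sum>i\<in>I. \<Sum>k<n. expect (joint \<nu> a k) (%z. d k (fst z) *
      (seg_exp (seg (a k (fst z)) (snd z)) (%l _. G i k (fst z) l) - mean i (a k (fst z))))\<bar> <= (\<Sum>i\<in>I. Q i + real n * (\<eta>' + Q i * ep))"
   by (intro order_trans[OF sum_abs] sum_mono Q(2)[OF _ a sl n])
  also have "... = (\<Sum>i\<in>I. Q i) + real n * (real (card I) * \<eta>' + (\<Sum>i\<in>I. Q i) * ep)"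
   by (simp add: sum.distrib sum_distrib_left sum_distrib_right algebra_simps)
  also have "... <= (\<Sum>i\<in>I. Q i) + real n * (\<eta> + (\<Sum>i\<in>I. Q i) * ep)"
   using \<eta>' by (intro add_left_mono mult_left_mono add_right_mono) auto
  finally show "\<bar>\<Sum>k<n. expect (joint \<nu> a k) (%z. d k (fst z) *
      (seg_exp (seg (a k (fst z)) (snd z)) (%l _. \<Sum>i\<in>I. G i k (fst z) l) - (\<Sum>i\<in>I. mean i (a k (fst z)))))\<bar> <= (\<Sum>i\<in>I. Q i) + real n * (\<eta> + (\<Sum>i\<in>I. Q i) * ep)"
   unfolding eq .
 qed
qed

lemma ergodic_average_batch: "\<exists>mean. ergodic_average (batch_val e A B0 B1) mean"
proof -
 \<comment> \<open>Each summand may involve the memory of one target only, so the own part is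
   divided equally among the targets.\<close>
 define c where "c = real (card (targets M e))"
 have c: "0 < c" using targets_nonempty[of M e] by (simp add: c_def card_gt_0_iff)
 let ?G = "%y n om l. A l / c + B0 y l * mem0 M N e y n om + B1 y l * mem1 M N e y n om"
 have "\<forall>y\<in>targets M e. \<exists>mean. ergodic_average (?G y) mean"
  unfolding ergodic_average_def by (intro ballI) (rule core_target)
 from bchoice[OF this] obtain mean where "\<And>y. y \<in> targets M e ==> ergodic_average (?G y) (mean y)" by blast
 from ergodic_average_sum[OF finite_targets this]
 have "ergodic_average (%n om l. \<Sum>y\<in>targets M e. ?G y n om l) (%\<alpha>. \<Sum>y\<in>targets M e. mean y \<alpha>)" .
 moreover have "(%n om l. \<Sum>y\<in>targets M e. ?G y n om l) = batch_val e A B0 B1"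
  using c by (intro ext) (simp add: batch_val_def sum.distrib c_def targets_nonempty)
 ultimately show ?thesis by auto
qed

end

lemma expectation_vec_nth:
 fixes F :: "'a => real ^ 'n::finite"
 assumes "finite (set_pmf p)"
 shows "expect p F $ e = expect p (%om. F om $ e)"
 using integral_bounded_linear[OF bounded_linear_vec_nth[of e] integrable_measure_pmf_finite[OF assms, of F]] by simp

lemma mem_prefix:
 assumes "\<And>i. i <= n * N ==> om i = om' i"
 shows "mem0 M N e y n om = mem0 M N e y n om'" "mem1 M N e y n om = mem1 M N e y n om'"
proof -
 have h: "hit_by om y k (n * N) = hit_by om' y k (n * N)" for k
  unfolding hit_by_def by (rule ex_cong1) (auto simp: assms)
 have "carried_to M om e y (n * N) = carried_to M om' e y (n * N)"
  unfolding carried_to_def by (rule Collect_cong) (auto simp: assms h phantom_pair_def)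
 moreover have "Z om k = Z om' k" if "k \<in> carried_to M om' e y (n * N)" for k
  using that assms[of k] by (auto simp: carried_to_def)
 ultimately show "mem0 M N e y n om = mem0 M N e y n om'" "mem1 M N e y n om = mem1 M N e y n om'"
  unfolding mem0_def mem1_def by (simp_all cong: sum.cong)
qed

lemma stop_time_cong:
 assumes "\<And>i. i <= j ==> Z om i = Z om' i"
 shows "hit_by om y k j \<longleftrightarrow> hit_by om' y k j" "stop_time om y k j = stop_time om' y k j"
proof -
 show h: "hit_by om y k j \<longleftrightarrow> hit_by om' y k j" unfolding hit_by_def by (rule ex_cong1) (auto simp: assms)
 show "stop_time om y k j = stop_time om' y k j"
 proof (cases "hit_by om' y k j")
  case True
  then obtain t where t: "k < t" "t <= j" "Z om' t = y" "\<And>i. k < i ==> i < t ==> Z om' i \<noteq> y"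
   by (rule hit_by_obtain) blast
  have "stop_time om y k j = t"
  proof (rule stop_time_eq(2)[OF t(1,2)])
   show "Z om t = y" using assms t by simp
   fix i assume "k < i" "i < t"
   then show "Z om i \<noteq> y" using assms[of i] t(2) t(4)[of i] by simp
  qed
  then show ?thesis using stop_time_eq(2)[of k t _ om' y, OF t] by simp
 qed (simp add: stop_time_def h)
qed

lemma batch_obs_cong:
 "(\<And>i. i <= Suc n * N ==> om i = om' i) ==> batch_obs N n om = batch_obs N n om'"
 unfolding batch_obs_def by (rule map_cong) auto

text \<open>\<open>hit_time\<close> looks at the whole infinite path. Through
  \<open>end_time_eq\<close> and \<open>hit_in_batch_eq\<close> the estimator sees visits up to
  \<open>Suc n * N\<close> only, which makes the recursion for the parameter adapted.\<close>

lemma grad_est_cong: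
 assumes eq: "\<And>i. i <= Suc n * N ==> om i = om' i"
 shows "grad_est M N f \<Gamma> \<alpha> n om = grad_est M N f \<Gamma> \<alpha> n om'"
proof -
 have Zeq: "Z om i = Z om' i" if "i <= Suc n * N" for i using eq[OF that] by simp
 have obs: "batch_obs N n om = batch_obs N n om'" by (rule batch_obs_cong) (rule eq)
 have pp: "phantom_pair M om e k = phantom_pair M om' e k" if "k <= Suc n * N" for e k
  using eq[OF that] by (simp add: phantom_pair_def)
 have hit: "hit_by om y k (n * N) = hit_by om' y k (n * N)" for y k
  by (rule stop_time_cong(1)) (use Zeq in auto)
 have carr: "carried M om e (n * N) = carried M om' e (n * N)" for e
  unfolding carried_eq by (rule Collect_cong) (use pp hit in auto)
 have et: "end_time M N n om e k = end_time M N n om' e k" if k: "k <= Suc n * N" for e k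
  unfolding end_time_eq[OF k] pp[OF k] by (rule stop_time_cong(2)[OF Zeq])
 have hb: "hit_in_batch M N n om e k = hit_in_batch M N n om' e k"
  if k: "k <= Suc n * N" and late: "\<not> hit_by om (phantom_pair M om e k) k (n * N)" for e k
  using hit_in_batch_eq[OF k late] hit_in_batch_eq[OF k, of om' M e] late
   stop_time_cong[of "Suc n * N" om om' "phantom_pair M om e k" k, OF Zeq] by (simp add: pp[OF k] hit)
 have et_le: "end_time M N n om' e k <= Suc n * N" if k: "k <= Suc n * N" for e k
  unfolding end_time_eq[OF k] by (rule stop_time_le(2)[OF k])
 have kw: "K_weight M \<alpha> om e k = K_weight M \<alpha> om' e k" if "k <= Suc n * N" for e k
  unfolding K_weight_factor Zeq[OF that] ..
 have own: "(\<Sum>k\<in>batch N n. K_weight M \<alpha> om e k * (f (fst (coord M e), snd (Z om k)) - f (phantom_pair M om e k)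
     + (\<Sum>j\<in>{k + 1..end_time M N n om e k}. f (Z om j)) - hit_in_batch M N n om e k * \<Gamma> (batch_obs N n om)))
   = (\<Sum>k\<in>batch N n. K_weight M \<alpha> om' e k * (f (fst (coord M e), snd (Z om' k)) - f (phantom_pair M om' e k)
     + (\<Sum>j\<in>{k + 1..end_time M N n om' e k}. f (Z om' j)) - hit_in_batch M N n om' e k * \<Gamma> (batch_obs N n om')))" for e
 proof (intro sum.cong refl)
  fix k assume "k \<in> batch N n"
  then have k: "k <= Suc n * N" and k': "n * N < k" by (auto simp: batch_def)
  have nh: "\<not> hit_by om (phantom_pair M om e k) k (n * N)" using k' by (auto simp: hit_by_def)
  have "(\<Sum>j\<in>{k + 1..end_time M N n om' e k}. f (Z om j)) = (\<Sum>j\<in>{k + 1..end_time M N n om' e k}. f (Z om' j))"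
   using Zeq et_le[OF k, of e] by (intro sum.cong refl) auto
  then show "K_weight M \<alpha> om e k * (f (fst (coord M e), snd (Z om k)) - f (phantom_pair M om e k)
     + (\<Sum>j\<in>{k + 1..end_time M N n om e k}. f (Z om j)) - hit_in_batch M N n om e k * \<Gamma> (batch_obs N n om))
   = K_weight M \<alpha> om' e k * (f (fst (coord M e), snd (Z om' k)) - f (phantom_pair M om' e k)
     + (\<Sum>j\<in>{k + 1..end_time M N n om' e k}. f (Z om' j)) - hit_in_batch M N n om' e k * \<Gamma> (batch_obs N n om'))"
   unfolding et[OF k] hb[OF k nh] kw[OF k] obs Zeq[OF k] pp[OF k] by simp
 qed
 have old: "(\<Sum>k\<in>carried M om e (n * N). K_weight M \<alpha> om e k * ((\<Sum>j\<in>{n * N + 1..end_time M N n om e k}. f (Z om j))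
     - hit_in_batch M N n om e k * \<Gamma> (batch_obs N n om)))
   = (\<Sum>k\<in>carried M om' e (n * N). K_weight M \<alpha> om' e k * ((\<Sum>j\<in>{n * N + 1..end_time M N n om' e k}. f (Z om' j))
     - hit_in_batch M N n om' e k * \<Gamma> (batch_obs N n om')))" for e
  unfolding carr[symmetric]
 proof (intro sum.cong refl)
  fix k assume "k \<in> carried M om e (n * N)"
  then have k: "k <= Suc n * N" and nh: "\<not> hit_by om (phantom_pair M om e k) k (n * N)" by (auto simp: carried_eq)
  have "(\<Sum>j\<in>{n * N + 1..end_time M N n om' e k}. f (Z om j)) = (\<Sum>j\<in>{n * N + 1..end_time M N n om' e k}. f (Z om' j))"
   using Zeq et_le[OF k, of e] by (intro sum.cong refl) auto
  then show "K_weight M \<alpha> om e k * ((\<Sum>j\<in>{n * N + 1..end_time M N n om e k}. f (Z om j)) - hit_in_batch M N n om e k * \<Gamma> (batch_obs N n om))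
   = K_weight M \<alpha> om' e k * ((\<Sum>j\<in>{n * N + 1..end_time M N n om' e k}. f (Z om' j)) - hit_in_batch M N n om' e k * \<Gamma> (batch_obs N n om'))"
   unfolding et[OF k] hb[OF k nh] kw[OF k] obs by simp
 qed
 show ?thesis unfolding grad_est_def own old ..
qed

section \<open>Invariant averages and the covariance term\<close>

context ctrl_batches
begin

text \<open>The factor \<open>b\<close> covers two cases: the constant 1 gives the estimator itself,
  a component of \<open>Bhat\<close> the product that enters the covariance. The parameter-dependent
  weight is left out here and restored in \<open>drift_vec\<close>.\<close>

definition grad_val ::
  "(('s \<times> nat) list => real) => ('s \<times> nat => real) => (('s \<times> nat) list => real) => 'k
   => nat => ('s, 'k) path => ('s, 'k) mark list => real" where
 "grad_val b f \<Gamma> e = batch_val e (%l. b (map fst l) * own_part M N f \<Gamma> e 0 (base_path l))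
   (%y l. b (map fst l) * carry0 N f \<Gamma> y 0 (base_path l)) (%y l. b (map fst l) * carry1 N \<Gamma> y 0 (base_path l))"

lemma grad_val_scale: "grad_val b f \<Gamma> e n om l = b (map fst l) * grad_val (%_. 1) f \<Gamma> e n om l"
 by (simp add: grad_val_def batch_val_def distrib_left sum_distrib_left mult.assoc)

lemma grad_est_ext:
 assumes a: "policy a" and z: "z \<in> set_pmf (joint \<nu> a n)" and l: "l \<in> Bs"
 shows "grad_est M N f \<Gamma> \<alpha> n (ext n (fst z) l) $ e =
  2 / real N * weight_factor M \<alpha> e * grad_val (%_. 1) f \<Gamma> e n (fst z) l"
proof -
 have len: "length l = N" using l by (simp add: seg_marks_def)
 have ok: "ext n (fst z) l k \<in> marks M" if "1 <= k" "k <= n * N" for k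
  using joint_marks[OF a z that] that by (simp add: append_path_le)
 have m: "mem0 M N e y n (ext n (fst z) l) = mem0 M N e y n (fst z)"
  "mem1 M N e y n (ext n (fst z) l) = mem1 M N e y n (fst z)" for y
  by (rule mem_prefix, rule append_path_le, assumption)+
 have "grad_est M N f \<Gamma> \<alpha> n (ext n (fst z) l) $ e = 2 / real N * weight_factor M \<alpha> e * (own_part M N f \<Gamma> e n (ext n (fst z) l)
   + (\<Sum>y\<in>targets M e. carry0 N f \<Gamma> y n (ext n (fst z) l) * mem0 M N e y n (ext n (fst z) l)
     + carry1 N \<Gamma> y n (ext n (fst z) l) * mem1 M N e y n (ext n (fst z) l)))"
  by (rule grad_est_affine) (rule ok)
 then show ?thesis
  unfolding m own_append[OF len] carry_append[OF len] grad_val_def batch_val_def by simp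
qed

definition grad_mean ::
  "(('s \<times> nat) list => real) => ('s \<times> nat => real) => (('s \<times> nat) list => real) => 'k => real ^ 'k => real" where
 "grad_mean b f \<Gamma> e = (SOME mean. ergodic_average (grad_val b f \<Gamma> e) mean)"

lemma grad_mean: "ergodic_average (grad_val b f \<Gamma> e) (grad_mean b f \<Gamma> e)"
 unfolding grad_mean_def grad_val_def by (rule someI_ex[OF ergodic_average_batch])

definition obs_mean :: "(('s \<times> nat) list => real) => real ^ 'k => real" where
 "obs_mean b = (SOME mean. ergodic_average (%n om l. b (map fst l)) mean)"

lemma obs_mean: "ergodic_average (%n om l. b (map fst l)) (obs_mean b)"
proof -
 have "(%n om l. b (map fst l)) = batch_val undefined (%l. b (map fst l)) (%_ _. 0) (%_ _. 0)"
  by (intro ext) (simp add: batch_val_def)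
 then have "\<exists>mean. ergodic_average (%n om l. b (map fst l)) mean" using ergodic_average_batch by metis
 then show ?thesis unfolding obs_mean_def by (rule someI_ex)
qed

definition drift_vec ::
  "(('s \<times> nat) list => real) => ('s \<times> nat => real) => (('s \<times> nat) list => real) => real ^ 'k => real ^ 'k" where
 "drift_vec b f \<Gamma> \<alpha> = (\<chi> e. 2 / real N * weight_factor M \<alpha> e * grad_mean b f \<Gamma> e \<alpha>)"

lemma stat_exp_joint:
 fixes F :: "('s, 'k) path => real"
 assumes "\<alpha> \<in> H"
 shows "stat_exp M N \<alpha> n F = expect (joint (map_pmf fst (inv_dist M \<alpha>)) (%_ _. \<alpha>) n)
  (%z. seg_exp (seg \<alpha> (snd z)) (%l _. F (ext n (fst z) l)))"
 unfolding stat_exp_def path_law_joint integral_map_pmf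
 by (subst joint_expectation_step[OF policy_const[OF assms]]) simp

lemma stat_exp_nth:
 fixes F :: "('s, 'k) path => real ^ 'n::finite"
 assumes "\<alpha> \<in> H"
 shows "stat_exp M N \<alpha> n F $ e = stat_exp M N \<alpha> n (%om. F om $ e)"
 unfolding stat_exp_def path_law_joint
 by (rule expectation_vec_nth) (unfold set_map_pmf, intro finite_imageI finite_joint policy_const assms)

lemma stat_exp_grad_limit:
 assumes a: "\<alpha> \<in> H"
 shows "(%n. stat_exp M N \<alpha> n (%om. b (batch_obs N n om) *\<^sub>R grad_est M N f \<Gamma> \<alpha> n om)) \<longlonglongrightarrow> drift_vec b f \<Gamma> \<alpha>"
proof (rule vec_tendstoI)
 fix e
 let ?q = "map_pmf fst (inv_dist M \<alpha>)"
 let ?J = "joint ?q (%_ _. \<alpha>)"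
 have "stat_exp M N \<alpha> n (%om. b (batch_obs N n om) *\<^sub>R grad_est M N f \<Gamma> \<alpha> n om) $ e
   = 2 / real N * weight_factor M \<alpha> e * expect (?J n) (%z. seg_exp (seg \<alpha> (snd z)) (%l _. grad_val b f \<Gamma> e n (fst z) l))" for n
 proof -
  have "stat_exp M N \<alpha> n (%om. b (batch_obs N n om) *\<^sub>R grad_est M N f \<Gamma> \<alpha> n om) $ e
   = expect (?J n) (%z. seg_exp (seg \<alpha> (snd z))
     (%l _. b (batch_obs N n (ext n (fst z) l)) * grad_est M N f \<Gamma> \<alpha> n (ext n (fst z) l) $ e))"
   unfolding stat_exp_nth[OF a] stat_exp_joint[OF a] by simp
  also have "... = expect (?J n) (%z. 2 / real N * weight_factor M \<alpha> e * seg_exp (seg \<alpha> (snd z)) (%l _. grad_val b f \<Gamma> e n (fst z) l))"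
  proof (rule expectation_cong_pmf)
   fix z assume z: "z \<in> set_pmf (?J n)"
   have "seg_exp (seg \<alpha> (snd z)) (%l _. b (batch_obs N n (ext n (fst z) l)) * grad_est M N f \<Gamma> \<alpha> n (ext n (fst z) l) $ e)
    = seg_exp (seg \<alpha> (snd z)) (%l _. (2 / real N * weight_factor M \<alpha> e) * grad_val b f \<Gamma> e n (fst z) l)"
    unfolding seg_exp_def
   proof (rule expectation_cong_pmf)
    fix v assume "v \<in> set_pmf (seg \<alpha> (snd z))"
    then have "fst v \<in> Bs" using seg_support[OF a, of N "snd z"] by auto
    then show "b (batch_obs N n (ext n (fst z) (fst v))) * grad_est M N f \<Gamma> \<alpha> n (ext n (fst z) (fst v)) $ e
     = (2 / real N * weight_factor M \<alpha> e) * grad_val b f \<Gamma> e n (fst z) (fst v)"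
     using batch_obs_append[of "fst v" N n "fst z"]
     unfolding grad_est_ext[OF policy_const[OF a] z \<open>fst v \<in> Bs\<close>] grad_val_scale[of b]
     by (simp add: seg_marks_def)
   qed
   then show "seg_exp (seg \<alpha> (snd z)) (%l _. b (batch_obs N n (ext n (fst z) l)) * grad_est M N f \<Gamma> \<alpha> n (ext n (fst z) l) $ e)
    = 2 / real N * weight_factor M \<alpha> e * seg_exp (seg \<alpha> (snd z)) (%l _. grad_val b f \<Gamma> e n (fst z) l)"
    by (simp add: seg_exp_def)
  qed
  finally show ?thesis by simp
 qed
 moreover have "(%n. expect (?J n) (%z. seg_exp (seg \<alpha> (snd z)) (%l _. grad_val b f \<Gamma> e n (fst z) l))) \<longlonglongrightarrow> grad_mean b f \<Gamma> e \<alpha>"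
  using grad_mean[of b f \<Gamma> e] a unfolding ergodic_average_def by blast
 ultimately show "(%n. stat_exp M N \<alpha> n (%om. b (batch_obs N n om) *\<^sub>R grad_est M N f \<Gamma> \<alpha> n om) $ e) \<longlonglongrightarrow> drift_vec b f \<Gamma> \<alpha> $ e"
  unfolding drift_vec_def vec_lambda_beta by (simp only:) (intro tendsto_intros)
qed

lemma stat_exp_obs_limit:
 assumes a: "\<alpha> \<in> H"
 shows "(%n. stat_exp M N \<alpha> n (%om. b (batch_obs N n om))) \<longlonglongrightarrow> obs_mean b \<alpha>"
proof -
 let ?q = "map_pmf fst (inv_dist M \<alpha>)"
 let ?J = "joint ?q (%_ _. \<alpha>)"
 have "stat_exp M N \<alpha> n (%om. b (batch_obs N n om)) = expect (?J n) (%z. seg_exp (seg \<alpha> (snd z)) (%l _. b (map fst l)))" for n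
  unfolding stat_exp_joint[OF a]
 proof (rule expectation_cong_pmf)
  fix z
  show "seg_exp (seg \<alpha> (snd z)) (%l _. b (batch_obs N n (ext n (fst z) l))) = seg_exp (seg \<alpha> (snd z)) (%l _. b (map fst l))"
   unfolding seg_exp_def
  proof (rule expectation_cong_pmf)
   fix v assume "v \<in> set_pmf (seg \<alpha> (snd z))"
   then have "length (fst v) = N" by (rule seg_length)
   then show "b (batch_obs N n (ext n (fst z) (fst v))) = b (map fst (fst v))" by (simp add: batch_obs_append)
  qed
 qed
 then show ?thesis using obs_mean[of b] a unfolding ergodic_average_def by simp
qed

text \<open>The covariance is the mean of the product minus the product of the means, and each of
  these converges.\<close>

lemma stat_cov_limit:
 assumes a: "\<alpha> \<in> H"
 shows "(%n. stat_cov M N \<alpha> n (%om. b (batch_obs N n om)) (grad_est M N f \<Gamma> \<alpha> n))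
  \<longlonglongrightarrow> drift_vec b f \<Gamma> \<alpha> - obs_mean b \<alpha> *\<^sub>R drift_vec (%_. 1) f \<Gamma> \<alpha>"
proof -
 have fin: "finite (set_pmf (path_law M N (map_pmf fst (inv_dist M \<alpha>)) (%_ _. \<alpha>) (Suc n * N)))" for n
  unfolding path_law_joint set_map_pmf by (intro finite_imageI finite_joint policy_const a)
 have "stat_cov M N \<alpha> n (%om. b (batch_obs N n om)) (grad_est M N f \<Gamma> \<alpha> n) =
   stat_exp M N \<alpha> n (%om. b (batch_obs N n om) *\<^sub>R grad_est M N f \<Gamma> \<alpha> n om)
   - stat_exp M N \<alpha> n (%om. b (batch_obs N n om)) *\<^sub>R stat_exp M N \<alpha> n (grad_est M N f \<Gamma> \<alpha> n)" for n
 proof (rule vec_eq_iff[THEN iffD2], rule allI)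
  fix e
  let ?E = "expect (path_law M N (map_pmf fst (inv_dist M \<alpha>)) (%_ _. \<alpha>) (Suc n * N))"
  let ?F = "%om. b (batch_obs N n om)" and ?G = "%om. grad_est M N f \<Gamma> \<alpha> n om $ e"
  have eq: "(%om. (?F om - ?E ?F) * (?G om - ?E ?G)) = (%om. (?F om * ?G om - ?E ?G * ?F om) - (?E ?F * ?G om - ?E ?F * ?E ?G))"
   by (intro ext) (simp add: algebra_simps)
  have "?E (%om. (?F om - ?E ?F) * (?G om - ?E ?G)) = ?E (%om. ?F om * ?G om) - ?E ?F * ?E ?G"
   unfolding eq expectation_diff_finite[OF fin] by simp
  then show "stat_cov M N \<alpha> n (%om. b (batch_obs N n om)) (grad_est M N f \<Gamma> \<alpha> n) $ e =
   (stat_exp M N \<alpha> n (%om. b (batch_obs N n om) *\<^sub>R grad_est M N f \<Gamma> \<alpha> n om)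
   - stat_exp M N \<alpha> n (%om. b (batch_obs N n om)) *\<^sub>R stat_exp M N \<alpha> n (grad_est M N f \<Gamma> \<alpha> n)) $ e"
   unfolding stat_cov_def stat_exp_def vector_minus_component vector_scaleR_component expectation_vec_nth[OF fin] real_scaleR_def .
 qed
 moreover have "(%n. stat_exp M N \<alpha> n (grad_est M N f \<Gamma> \<alpha> n)) \<longlonglongrightarrow> drift_vec (%_. 1) f \<Gamma> \<alpha>"
  using stat_exp_grad_limit[OF a, of "%_. 1" f \<Gamma>] by simp
 ultimately show ?thesis
  using tendsto_diff[OF stat_exp_grad_limit[OF a, of b f \<Gamma>] tendsto_scaleR[OF stat_exp_obs_limit[OF a, of b]]] by simp
qed

lemma inv_grad_eq: "\<alpha> \<in> H ==> inv_grad M N f \<Gamma> \<alpha> = drift_vec (%_. 1) f \<Gamma> \<alpha>"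
 unfolding inv_grad_def using stat_exp_grad_limit[of \<alpha> "%_. 1" f \<Gamma>] by (intro limI) simp

lemma grad_convergent: "\<alpha> \<in> H ==> convergent (%n. stat_exp M N \<alpha> n (grad_est M N f \<Gamma> \<alpha> n))"
 using stat_exp_grad_limit[of \<alpha> "%_. 1" f \<Gamma>] by (intro convergentI) simp

lemma cov_sum_limit:
 "\<alpha> \<in> H ==> cov_sum M N \<beta> \<Gamma> Bhat \<alpha> \<longlonglongrightarrow> (\<Sum>l\<in>UNIV. drift_vec (%ob. Bhat ob $ l) (\<beta> l) (\<Gamma> l) \<alpha>
   - obs_mean (%ob. Bhat ob $ l) \<alpha> *\<^sub>R drift_vec (%_. 1) (\<beta> l) (\<Gamma> l) \<alpha>)"
 unfolding cov_sum_def[abs_def] by (intro tendsto_sum stat_cov_limit)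

lemma kappa_eq:
 "\<alpha> \<in> H ==> kappa M N \<rho> \<beta> \<Gamma> Bhat \<alpha> = \<rho> *\<^sub>R (\<Sum>l\<in>UNIV. drift_vec (%ob. Bhat ob $ l) (\<beta> l) (\<Gamma> l) \<alpha>
   - obs_mean (%ob. Bhat ob $ l) \<alpha> *\<^sub>R drift_vec (%_. 1) (\<beta> l) (\<Gamma> l) \<alpha>)"
 unfolding kappa_def using limI[OF cov_sum_limit[of \<alpha> \<beta> \<Gamma> Bhat]] by simp

text \<open>A sequence that is constant in \<open>n\<close> equals its limit; here unbiasedness
  identifies the averaged observation with \<open>B\<close>.\<close>

lemma unbiased_obs_mean:
 fixes Bhat :: "('s \<times> nat) list => real ^ 'l::finite"
 assumes a: "\<alpha> \<in> H" and u: "\<And>n. stat_exp M N \<alpha> n (%om. Bhat (batch_obs N n om)) = B"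
 shows "B $ l = obs_mean (%ob. Bhat ob $ l) \<alpha>"
proof -
 have "stat_exp M N \<alpha> n (%om. Bhat (batch_obs N n om) $ l) = B $ l" for n
  using stat_exp_nth[OF a, of n "%om. Bhat (batch_obs N n om)" l] u by simp
 then have "(%n. B $ l) \<longlonglongrightarrow> obs_mean (%ob. Bhat ob $ l) \<alpha>"
  using stat_exp_obs_limit[OF a, of "%ob. Bhat ob $ l"] by simp
 then show ?thesis by (simp add: LIMSEQ_const_iff)
qed

lemma bl_weight_factor: "bounded_lipschitz H (%\<alpha>. weight_factor M \<alpha> e)"
 unfolding weight_factor_def tan_def
 by (intro bounded_lipschitz_if bounded_lipschitz_uminus bounded_lipschitz_mult
   bounded_lipschitz_divide[where c = "sin \<mu>"] bounded_lipschitz_sin_coord bounded_lipschitz_cos_coord sin_mu cos_lower)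
  (use bounded_lipschitz_mult[OF bounded_lipschitz_uminus[OF bounded_lipschitz_cos_coord] bounded_lipschitz_sin_coord, of H e e] in simp_all)

lemma bl_grad_mean: "bounded_lipschitz H (grad_mean b f \<Gamma> e)"
 and bl_obs_mean: "bounded_lipschitz H (obs_mean b)"
 using grad_mean[of b f \<Gamma> e] obs_mean[of b] unfolding ergodic_average_def by blast+

lemma bl_drift_vec: "bounded_lipschitz H (%\<alpha>. drift_vec b f \<Gamma> \<alpha> $ e)"
 unfolding drift_vec_def vec_lambda_beta
 by (intro bounded_lipschitz_mult bounded_lipschitz_const bl_weight_factor bl_grad_mean)

end

section \<open>Reflection at the boundary of the box\<close>

definition box_reflection :: "real => real ^ 'k => real ^ 'k => real ^ 'k::finite" where
 "box_reflection \<mu> x w = (\<chi> e. refl1 \<mu> (pi / 2 - \<mu>) (x $ e) (w $ e))"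

lemma box_reflection_norm: "norm (box_reflection \<mu> x w) <= norm w"
 by (rule norm_le_componentwise_cart) (auto simp: box_reflection_def refl1_def)

text \<open>The conditions decouple over coordinates. A feasible correction must cancel the outward
  velocity at each active face, so every coordinate of a competitor is at least as large in modulus
  as that of the explicit reflection.\<close>

lemma minimal_reflection_box:
 fixes x :: "real ^ 'k::finite"
 assumes \<mu>: "\<mu> < pi / 4" and x: "x \<in> param_box \<mu>"
 shows "minimal_reflection (param_box \<mu>) x w (box_reflection \<mu> x w)"
 unfolding minimal_reflection_def is_arg_min_def
proof (intro conjI notI)
 let ?z = "box_reflection \<mu> x w"
 have lu: "\<mu> < pi / 2 - \<mu>" using \<mu> by simp
 have xr: "\<mu> <= x $ e" "x $ e <= pi / 2 - \<mu>" for e using x by (auto simp: param_box_def)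
 show "- ?z \<in> normal_cone (param_box \<mu>) x"
  unfolding normal_cone_def mem_Collect_eq
 proof (intro ballI)
  fix x' :: "real ^ 'k" assume x': "x' \<in> param_box \<mu>"
  have "- ?z $ e * ((x' - x) $ e) <= 0" for e
  proof -
   have "\<mu> <= x' $ e" "x' $ e <= pi / 2 - \<mu>" using x' by (auto simp: param_box_def)
   then show ?thesis
    using lu by (auto simp: box_reflection_def refl1_def mult_le_0_iff max_def)
  qed
  then show "inner (- ?z) (x' - x) <= 0"
   unfolding inner_vec_def by (intro sum_nonpos) simp
 qed
 show "w + ?z \<in> feasible_directions (param_box \<mu>) x"
 proof -
  let ?y = "w + ?z"
  have "\<exists>r>0. \<forall>s. 0 < s \<and> s <= r --> \<mu> <= x $ e + s * ?y $ e \<and> x $ e + s * ?y $ e <= pi / 2 - \<mu>" for e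
  proof -
   consider "x $ e = \<mu>" | "x $ e = pi / 2 - \<mu>" | "\<mu> < x $ e" "x $ e < pi / 2 - \<mu>" using xr[of e] by fastforce
   then show ?thesis
   proof cases
    case 1
    then have y: "0 <= ?y $ e" by (auto simp: box_reflection_def refl1_def)
    show ?thesis
    \<comment> \<open>\<open>pi / 2 - 2 * \<mu>\<close> is the width of the box; adding 1 keeps the
      divisor positive when the velocity is 0.\<close>
    proof (intro exI[of _ "(pi / 2 - 2 * \<mu>) / (?y $ e + 1)"] conjI allI impI)
     show "0 < (pi / 2 - 2 * \<mu>) / (?y $ e + 1)" using y \<mu> by simp
     fix s assume s: "0 < s \<and> s <= (pi / 2 - 2 * \<mu>) / (?y $ e + 1)"
     then have "s * (?y $ e + 1) <= pi / 2 - 2 * \<mu>" using y by (simp add: pos_le_divide_eq)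
     then have "s * ?y $ e + s <= pi / 2 - 2 * \<mu>" by (simp only: distrib_left mult_1_right)
     moreover have "0 <= s * ?y $ e" using s y by simp
     ultimately show "\<mu> <= x $ e + s * ?y $ e" "x $ e + s * ?y $ e <= pi / 2 - \<mu>" using s 1 by linarith+
    qed
   next
    case 2
    then have y: "?y $ e <= 0" using lu by (auto simp: box_reflection_def refl1_def)
    show ?thesis
    proof (intro exI[of _ "(pi / 2 - 2 * \<mu>) / (- ?y $ e + 1)"] conjI allI impI)
     show "0 < (pi / 2 - 2 * \<mu>) / (- ?y $ e + 1)" using y \<mu> by simp
     fix s assume s: "0 < s \<and> s <= (pi / 2 - 2 * \<mu>) / (- ?y $ e + 1)"
     then have "s * (- ?y $ e + 1) <= pi / 2 - 2 * \<mu>" using y by (simp add: pos_le_divide_eq)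
     then have "s * (- ?y $ e) + s <= pi / 2 - 2 * \<mu>" by (simp only: distrib_left mult_1_right)
     moreover have "s * ?y $ e <= 0" using s y by (simp add: mult_le_0_iff)
     moreover have "s * (- ?y $ e) = - (s * ?y $ e)" by (rule mult_minus_right)
     ultimately show "\<mu> <= x $ e + s * ?y $ e" "x $ e + s * ?y $ e <= pi / 2 - \<mu>" using s 2 by linarith+
    qed
   next
    case 3
    define g where "g = min (x $ e - \<mu>) (pi / 2 - \<mu> - x $ e)"
    have g: "0 < g" using 3 by (simp add: g_def)
    show ?thesis
    proof (intro exI[of _ "g / (\<bar>?y $ e\<bar> + 1)"] conjI allI impI)
     show "0 < g / (\<bar>?y $ e\<bar> + 1)" using g by simp
     fix s assume s: "0 < s \<and> s <= g / (\<bar>?y $ e\<bar> + 1)"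
     then have "s * (\<bar>?y $ e\<bar> + 1) <= g" by (simp add: pos_le_divide_eq)
     then have "s * \<bar>?y $ e\<bar> + s <= g" by (simp only: distrib_left mult_1_right)
     moreover have "\<bar>s * ?y $ e\<bar> = s * \<bar>?y $ e\<bar>" using s by (simp add: abs_mult)
     ultimately have "\<bar>s * ?y $ e\<bar> <= g" using s by linarith
     then show "\<mu> <= x $ e + s * ?y $ e" "x $ e + s * ?y $ e <= pi / 2 - \<mu>" by (auto simp: g_def)
    qed
   qed
  qed
  then obtain r where r: "\<And>e. 0 < r e" "\<And>e s. 0 < s ==> s <= r e ==> \<mu> <= x $ e + s * ?y $ e \<and> x $ e + s * ?y $ e <= pi / 2 - \<mu>"
   by metis
  define s where "s = Min (range r)"
  have s: "0 < s" "s <= r e" for e unfolding s_def using r(1) by (auto simp: Min_gr_iff)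
  have "x + s *\<^sub>R ?y \<in> param_box \<mu>" unfolding param_box_def mem_Collect_eq
  proof
   fix e
   show "\<mu> <= (x + s *\<^sub>R ?y) $ e \<and> (x + s *\<^sub>R ?y) $ e <= pi / 2 - \<mu>" using r(2)[OF s(1) s(2)[of e]] by simp
  qed
  then show ?thesis unfolding feasible_directions_def using s(1) by blast
 qed
 assume "\<exists>y. (- y \<in> normal_cone (param_box \<mu>) x \<and> w + y \<in> feasible_directions (param_box \<mu>) x) \<and> norm y < norm ?z"
 then obtain y r where y: "norm y < norm ?z" and r: "0 < r" "x + r *\<^sub>R (w + y) \<in> param_box \<mu>"
  unfolding feasible_directions_def by blast
 have "norm ?z <= norm y"
 proof (rule norm_le_componentwise_cart)
  fix e
  have b: "\<mu> <= x $ e + r * (w $ e + y $ e)" "x $ e + r * (w $ e + y $ e) <= pi / 2 - \<mu>"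
   using r(2) by (auto simp: param_box_def)
  have 1: "0 <= w $ e + y $ e" if "x $ e = \<mu>" using b(1) that r(1) by (simp add: zero_le_mult_iff)
  have 2: "w $ e + y $ e <= 0" if "x $ e = pi / 2 - \<mu>"
   using b(2) that r(1) by (simp add: mult_le_0_iff)
  show "norm (?z $ e) <= norm (y $ e)"
   using 1 2 by (auto simp: box_reflection_def refl1_def max_def)
 qed
 then show False using y by simp
qed

text \<open>A minimiser is no longer than the explicit reflection, and the latter consists of
  cancelled coordinates of the velocity.\<close>

lemma minimal_reflection_norm:
 assumes "\<mu> < pi / 4" "x \<in> param_box \<mu>" "minimal_reflection (param_box \<mu>) x w z"
 shows "norm z <= norm (w :: real ^ 'k::finite)"
proof -
 have "norm z <= norm (box_reflection \<mu> x w)"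
  using assms(3) minimal_reflection_box[OF assms(1,2), of w]
  unfolding minimal_reflection_def is_arg_min_def by (meson not_less)
 then show ?thesis using box_reflection_norm[of \<mu> x w] by simp
qed

lemma bounded_lipschitz_vec:
 fixes v :: "'p::metric_space => real ^ 'n::finite"
 assumes "\<And>e. bounded_lipschitz S (%p. v p $ e)"
 shows "\<exists>Q\<ge>0. \<forall>p\<in>S. norm (v p) <= Q \<and> (\<forall>q\<in>S. norm (v p - v q) <= Q * dist p q)"
proof -
 have "\<forall>e. \<exists>Q\<ge>0. \<forall>p\<in>S. \<bar>v p $ e\<bar> <= Q \<and> (\<forall>q\<in>S. \<bar>v p $ e - v q $ e\<bar> <= Q * dist p q)"
  using assms unfolding bounded_lipschitz_def by blast
 then obtain Q where Q: "\<And>e. 0 <= Q e" "\<And>e p. p \<in> S ==> \<bar>v p $ e\<bar> <= Q e"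
   "\<And>e p q. p \<in> S ==> q \<in> S ==> \<bar>v p $ e - v q $ e\<bar> <= Q e * dist p q" by metis
 show ?thesis
 proof (intro exI[of _ "\<Sum>e\<in>UNIV. Q e"] conjI ballI)
  show "0 <= (\<Sum>e\<in>UNIV. Q e)" by (intro sum_nonneg Q)
  fix p assume p: "p \<in> S"
  show "norm (v p) <= (\<Sum>e\<in>UNIV. Q e)"
   by (rule order_trans[OF norm_le_l1_cart]) (intro sum_mono Q p)
  fix q assume q: "q \<in> S"
  have "norm (v p - v q) <= (\<Sum>e\<in>UNIV. Q e * dist p q)"
   by (rule order_trans[OF norm_le_l1_cart]) (use Q(3)[OF p q] in \<open>auto intro!: sum_mono\<close>)
  then show "norm (v p - v q) <= (\<Sum>e\<in>UNIV. Q e) * dist p q" by (simp add: sum_distrib_right)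
 qed
qed

section \<open>The averaged dynamics\<close>

locale saddle = ctrl_batches M \<mu> N for M :: "('s::finite, 'k::finite) ctrl_chain" and \<mu> :: real and N :: nat +
 fixes c :: "'s \<times> nat => real" and \<beta> :: "'l::finite => 's \<times> nat => real" and \<gamma> :: "real ^ 'l"
  and Bhat :: "('s \<times> nat) list => real ^ 'l"
  and \<Gamma>c :: "('s \<times> nat) list => real" and \<Gamma>\<beta> :: "'l => ('s \<times> nat) list => real"
  and \<rho> T :: real and \<alpha>0 :: "real ^ 'k" and lam0 :: "real ^ 'l"
 assumes unbiased: "\<alpha> \<in> open_params ==> stat_exp M N \<alpha> n (%om. Bhat (batch_obs N n om)) = constraint_mean M \<beta> \<gamma> \<alpha>"
  and T: "0 < T" and \<alpha>0: "\<alpha>0 \<in> param_box \<mu>"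
begin

definition Bmean :: "real ^ 'k => real ^ 'l" where
 "Bmean \<alpha> = (\<chi> l. obs_mean (%ob. Bhat ob $ l) \<alpha>)"

text \<open>Averages the product of \<open>Bhat\<close> with the gradient estimator as a whole, so
  the covariance is already inside.\<close>

definition G0 :: "real ^ 'k => real ^ 'k" where
 "G0 \<alpha> = drift_vec (%_. 1) c \<Gamma>c \<alpha> + \<rho> *\<^sub>R (\<Sum>l\<in>UNIV. drift_vec (%ob. Bhat ob $ l) (\<beta> l) (\<Gamma>\<beta> l) \<alpha>)"

definition G1 :: "'l => real ^ 'k => real ^ 'k" where
 "G1 l = drift_vec (%_. 1) (\<beta> l) (\<Gamma>\<beta> l)"

definition G :: "real ^ 'k => real ^ 'l => real ^ 'k" where
 "G \<alpha> v = G0 \<alpha> + (\<Sum>l\<in>UNIV. v $ l *\<^sub>R G1 l \<alpha>)"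

lemma constraint_mean_eq: "\<alpha> \<in> H ==> constraint_mean M \<beta> \<gamma> \<alpha> = Bmean \<alpha>"
 unfolding Bmean_def vec_eq_iff vec_lambda_beta
 using unbiased_obs_mean[of \<alpha> Bhat] unbiased[OF box_open] by blast

abbreviation field :: "real ^ 'k => real ^ 'l => real ^ 'k" where
 "field \<alpha> v \<equiv> inv_grad M N c \<Gamma>c \<alpha>
    + (\<Sum>l\<in>UNIV. (v $ l + \<rho> * constraint_mean M \<beta> \<gamma> \<alpha> $ l) *\<^sub>R inv_grad M N (\<beta> l) (\<Gamma>\<beta> l) \<alpha>)
    + kappa M N \<rho> \<beta> \<Gamma>\<beta> Bhat \<alpha>"

text \<open>The limit of the covariance is the mean of the product minus \<open>B\<close> times
  \<open>h\<close>. The subtracted part cancels the term with \<open>\<rho> * B\<close> in the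
  field, leaving the average of the actual increments of the algorithm.\<close>

lemma field_eq:
 fixes v :: "real ^ 'l"
 assumes a: "\<alpha> \<in> H"
 shows "field \<alpha> v = G \<alpha> v"
proof -
 have "constraint_mean M \<beta> \<gamma> \<alpha> $ l = obs_mean (%ob. Bhat ob $ l) \<alpha>" for l
  by (simp add: constraint_mean_eq[OF a] Bmean_def)
 then show ?thesis
  unfolding inv_grad_eq[OF a] kappa_eq[OF a] G_def G0_def G1_def
  by (simp add: scaleR_add_left sum.distrib sum_subtractf scaleR_right_diff_distrib scaleR_sum_right)
qed

lemma G0_bl: "\<exists>Q\<ge>0. \<forall>p\<in>H. norm (G0 p) <= Q \<and> (\<forall>q\<in>H. norm (G0 p - G0 q) <= Q * dist p q)"
 unfolding G0_def
 by (rule bounded_lipschitz_vec) (simp, intro bounded_lipschitz_add bounded_lipschitz_mult bounded_lipschitz_const bounded_lipschitz_sum bl_drift_vec)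

lemma G1_bl: "\<exists>Q\<ge>0. \<forall>p\<in>H. norm (G1 l p) <= Q \<and> (\<forall>q\<in>H. norm (G1 l p - G1 l q) <= Q * dist p q)"
 unfolding G1_def by (rule bounded_lipschitz_vec) (rule bl_drift_vec)

lemma Bmean_bl: "\<exists>Q\<ge>0. \<forall>p\<in>H. norm (Bmean p) <= Q \<and> (\<forall>q\<in>H. norm (Bmean p - Bmean q) <= Q * dist p q)"
 unfolding Bmean_def by (rule bounded_lipschitz_vec) (unfold vec_lambda_beta, rule bl_obs_mean)

text \<open>The difference is arranged so that \<open>v\<close> multiplies the differences of
  \<open>G1\<close> while \<open>G1\<close> itself is multiplied by \<open>v - w\<close>; hence the
  bound \<open>R\<close> on \<open>v\<close> alone.\<close>

lemma G_bl:
 assumes R: "0 <= R"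
 shows "\<exists>Q\<ge>0. \<forall>p\<in>H. \<forall>v. norm v <= R --> norm (G p v) <= Q \<and>
  (\<forall>q\<in>H. \<forall>w. norm (G p v - G q w) <= Q * dist p q + Q * norm (v - w))"
proof -
 obtain Q0 where Q0: "0 <= Q0" "\<And>p. p \<in> H ==> norm (G0 p) <= Q0" "\<And>p q. p \<in> H ==> q \<in> H ==> norm (G0 p - G0 q) <= Q0 * dist p q"
  using G0_bl by blast
 have "\<forall>l. \<exists>Q\<ge>0. \<forall>p\<in>H. norm (G1 l p) <= Q \<and> (\<forall>q\<in>H. norm (G1 l p - G1 l q) <= Q * dist p q)"
  using G1_bl by blast
 then obtain Q1 where Q1: "\<And>l. 0 <= Q1 l" "\<And>l p. p \<in> H ==> norm (G1 l p) <= Q1 l"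
   "\<And>l p q. p \<in> H ==> q \<in> H ==> norm (G1 l p - G1 l q) <= Q1 l * dist p q" by metis
 let ?S = "\<Sum>l\<in>UNIV. Q1 l"
 have S: "0 <= ?S" by (intro sum_nonneg Q1)
 define Q where "Q = Q0 + R * ?S + ?S"
 have Q: "0 <= Q" "Q0 + R * ?S <= Q" "?S <= Q" using Q0 S R by (auto simp: Q_def)
 show ?thesis
 proof (intro exI[of _ Q] conjI ballI allI impI Q(1))
  fix p and v :: "real ^ 'l" assume p: "p \<in> H" and v: "norm v <= R"
  have vl: "\<bar>v $ l\<bar> <= R" for l using component_le_norm_cart[of v l] v by linarith
  have "norm (G p v) <= norm (G0 p) + (\<Sum>l\<in>UNIV. norm (v $ l *\<^sub>R G1 l p))"
   unfolding G_def by (rule order_trans[OF norm_triangle_ineq add_left_mono[OF norm_sum]])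
  also have "... <= Q0 + (\<Sum>l\<in>UNIV. R * Q1 l)"
   using R by (intro add_mono Q0 p sum_mono) (auto intro!: mult_mono vl Q1 p)
  also have "... <= Q" using Q by (simp add: sum_distrib_left)
  finally show "norm (G p v) <= Q" .
  fix q w assume q: "q \<in> H"
  have eq: "G p v - G q w = (G0 p - G0 q) + (\<Sum>l\<in>UNIV. v $ l *\<^sub>R (G1 l p - G1 l q) + (v $ l - w $ l) *\<^sub>R G1 l q)"
   by (simp add: G_def sum_subtractf sum.distrib algebra_simps)
  have "norm (G p v - G q w) <= norm (G0 p - G0 q) + (\<Sum>l\<in>UNIV. norm (v $ l *\<^sub>R (G1 l p - G1 l q) + (v $ l - w $ l) *\<^sub>R G1 l q))"
   unfolding eq by (rule order_trans[OF norm_triangle_ineq add_left_mono[OF norm_sum]])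
  also have "... <= Q0 * dist p q + (\<Sum>l\<in>UNIV. R * (Q1 l * dist p q) + norm (v - w) * Q1 l)"
  proof (intro add_mono Q0 p q sum_mono)
   fix l
   have "\<bar>v $ l - w $ l\<bar> <= norm (v - w)" using component_le_norm_cart[of "v - w" l] by simp
   then have "\<bar>v $ l - w $ l\<bar> * norm (G1 l q) <= norm (v - w) * Q1 l" by (intro mult_mono Q1 q) auto
   moreover have "\<bar>v $ l\<bar> * norm (G1 l p - G1 l q) <= R * (Q1 l * dist p q)" using R by (intro mult_mono vl Q1 p q) auto
   ultimately show "norm (v $ l *\<^sub>R (G1 l p - G1 l q) + (v $ l - w $ l) *\<^sub>R G1 l q) <= R * (Q1 l * dist p q) + norm (v - w) * Q1 l"
    by (intro order_trans[OF norm_triangle_ineq add_mono]) auto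
  qed
  also have "... = (Q0 + R * ?S) * dist p q + ?S * norm (v - w)"
   by (simp add: sum.distrib sum_distrib_left sum_distrib_right algebra_simps)
  also have "... <= Q * dist p q + Q * norm (v - w)" using Q by (intro add_mono mult_right_mono) auto
  finally show "norm (G p v - G q w) <= Q * dist p q + Q * norm (v - w)" .
 qed
qed

definition is_sol :: "(real => (real ^ 'k) \<times> (real ^ 'l)) => bool" where
 "is_sol x \<longleftrightarrow> x \<in> extensional {0..T} \<and> x 0 = (\<alpha>0, lam0) \<and>
   solves_truncated H T (%t. field (fst (x t)) (snd (x t))) (%t. fst (x t)) \<and>
   (\<forall>t\<in>{0..T}. ((%s. snd (x s)) has_vector_derivative constraint_mean M \<beta> \<gamma> (fst (x t))) (at t within {0..T}))"

lemma has_integral_vecI: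
 fixes f :: "real => real ^ 'n::finite"
 assumes "\<And>e. ((%s. f s $ e) has_integral (y $ e)) S"
 shows "(f has_integral y) S"
proof (subst has_integral_componentwise_iff, intro ballI)
 fix b :: "real ^ 'n" assume "b \<in> Basis"
 then obtain e where b: "b = axis e 1" by (auto simp: Basis_vec_def)
 show "((%s. f s \<bullet> b) has_integral (y \<bullet> b)) S" using assms[of e] by (simp add: b inner_axis)
qed

text \<open>The Euler construction lives in a bounded box, but the multipliers range over the whole
  space. They are confined to a cube too large to be left within time \<open>T\<close>, so the
  reflection in these coordinates never acts.\<close>

lemma solution_exists: "\<exists>x. is_sol x"
proof -
 obtain Qb where Qb: "0 <= Qb" "\<And>p. p \<in> H ==> norm (Bmean p) <= Qb" "\<And>p q. p \<in> H ==> q \<in> H ==> norm (Bmean p - Bmean q) <= Qb * dist p q"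
  using Bmean_bl by blast
 \<comment> \<open>Starting norm plus the largest possible drift over time \<open>T\<close>, plus 1
   to stay strictly inside.\<close>
 define R where "R = norm lam0 + T * Qb + 1"
 have R: "0 < R" "\<bar>lam0 $ l\<bar> <= R" for l
  using T Qb component_le_norm_cart[of lam0 l] norm_ge_zero[of lam0] unfolding R_def
  by (smt (verit) mult_nonneg_nonneg)+
 define R' where "R' = real CARD('l) * R"
 have R': "0 <= R'" using R by (simp add: R'_def)
 obtain Q where Q: "0 <= Q" "\<And>p v. p \<in> H ==> norm v <= R' ==> norm (G p v) <= Q"
   "\<And>p v q w. p \<in> H ==> norm v <= R' ==> q \<in> H ==> norm (G p v - G q w) <= Q * dist p q + Q * norm (v - w)"
  using G_bl[OF R'] by blast
 define la ub :: "(real ^ 'k) \<times> (real ^ 'l)" where "la = (\<chi> e. \<mu>, \<chi> l. - R)" and "ub = (\<chi> e. pi / 2 - \<mu>, \<chi> l. R)"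
 define F :: "(real ^ 'k) \<times> (real ^ 'l) => (real ^ 'k) \<times> (real ^ 'l)" where "F y = (- G (fst y) (snd y), Bmean (fst y))" for y
 have box: "y \<in> cbox la ub \<longleftrightarrow> fst y \<in> H \<and> (\<forall>l. \<bar>snd y $ l\<bar> <= R)" for y
  unfolding la_def ub_def cbox_Pair_eq
  by (cases y) (auto simp: mem_box_cart param_box_def abs_le_iff minus_le_iff)
 have box_norm: "norm (snd y) <= R'" if "y \<in> cbox la ub" for y
  using norm_vec_lambda_le[of "%l. snd y $ l" R] that by (simp add: box R'_def)
 define L where "L = 3 * Q + Qb"
 define Mb where "Mb = Q + Qb + 1"
 have nd: "dist (fst x) (fst y) <= norm (x - y)" "norm (snd x - snd y) <= norm (x - y)" for x y :: "(real ^ 'k) \<times> (real ^ 'l)"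
  using norm_fst_le[of "fst (x - y)" "snd (x - y)"] norm_snd_le[of "snd (x - y)" "fst (x - y)"]
  unfolding prod.collapse by (simp_all add: dist_norm)
 interpret E: box_euler la ub F L Mb T "(\<alpha>0, lam0)"
 proof
  show "la \<bullet> i < ub \<bullet> i" if "i \<in> Basis" for i
   using that \<mu> R(1) by (auto simp: Basis_prod_def la_def ub_def Basis_vec_def inner_axis)
  show "norm (F x - F y) <= L * norm (x - y)" if "x \<in> cbox la ub" "y \<in> cbox la ub" for x y
  proof -
   have x: "fst x \<in> H" and y: "fst y \<in> H" using that by (auto simp: box)
   have "norm (F x - F y) <= norm (G (fst x) (snd x) - G (fst y) (snd y)) + norm (Bmean (fst x) - Bmean (fst y))"
    unfolding F_def diff_Pair by (rule order_trans[OF norm_Pair_le]) (simp add: norm_minus_commute)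
   also have "... <= (Q * dist (fst x) (fst y) + Q * norm (snd x - snd y)) + Qb * dist (fst x) (fst y)"
    by (intro add_mono Q(3) Qb(3) x y box_norm that)
   also have "... <= (Q * norm (x - y) + Q * norm (x - y)) + Qb * norm (x - y)"
    using Q(1) Qb(1) by (intro add_mono mult_left_mono nd)
   also have "... <= L * norm (x - y)" using Q(1) by (simp add: L_def algebra_simps)
   finally show ?thesis .
  qed
  show "norm (F x) <= Mb" if "x \<in> cbox la ub" for x
  proof -
   have x: "fst x \<in> H" using that by (auto simp: box)
   have "norm (F x) <= norm (G (fst x) (snd x)) + norm (Bmean (fst x))"
    unfolding F_def by (rule order_trans[OF norm_Pair_le]) simp
   also have "... <= Q + Qb" by (intro add_mono Q(2) Qb(2) x box_norm that)
   finally show ?thesis by (simp add: Mb_def)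
  qed
  show "0 <= L" "0 < Mb" using Q Qb by (auto simp: L_def Mb_def)
  show "(\<alpha>0, lam0) \<in> cbox la ub" using \<alpha>0 R(2) by (simp add: box)
 qed (rule T)
 let ?s = E.sol
 have in_box: "fst (?s t) \<in> H" if "t \<in> {0..T}" for t using E.sol_in[OF that] by (simp add: box)
 have basis: "((axis e 1, 0) :: (real ^ 'k) \<times> (real ^ 'l)) \<in> Basis" "((0, axis l 1) :: (real ^ 'k) \<times> (real ^ 'l)) \<in> Basis" for e l
  by (auto simp: Basis_prod_def Basis_vec_def)
 define x where "x = restrict ?s {0..T}"
 have xs: "x t = ?s t" if "t \<in> {0..T}" for t using that by (simp add: x_def)
 have field: "field (fst (x t)) (snd (x t)) = G (fst (?s t)) (snd (?s t))" if t: "t \<in> {0..T}" for t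
  unfolding xs[OF t] by (rule field_eq[OF in_box[OF t]])
 define z where "z t = box_reflection \<mu> (fst (?s t)) (- G (fst (?s t)) (snd (?s t)))" for t
 have int1: "((%s. - G (fst (?s s)) (snd (?s s)) + z s) has_integral (fst (?s t) - fst (?s 0))) {0..t}" if t: "t \<in> {0..T}" for t
 proof (rule has_integral_vecI)
  fix e
  show "((%s. (- G (fst (?s s)) (snd (?s s)) + z s) $ e) has_integral (fst (?s t) - fst (?s 0)) $ e) {0..t}"
   using E.sol_integral[OF basis(1)[of e] t]
   by (simp add: F_def inner_prod_def inner_axis la_def ub_def z_def box_reflection_def)
 qed
 have snd0: "snd (?s 0) = lam0" by (simp add: E.sol_0)
 have int2': "((%s. Bmean (fst (?s s)) $ l + refl1 (- R) R (snd (?s s) $ l) (Bmean (fst (?s s)) $ l)) has_integral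
   (snd (?s t) $ l - lam0 $ l)) {0..t}" if t: "t \<in> {0..T}" for t l
  using E.sol_integral[OF basis(2)[of l] t] snd0
  by (simp add: F_def inner_prod_def inner_axis la_def ub_def)
 have Bl: "\<bar>Bmean (fst (?s s)) $ l\<bar> <= Qb" if "s \<in> {0..T}" for s l
  using component_le_norm_cart[of "Bmean (fst (?s s))" l] Qb(2)[OF in_box[OF that]] by linarith
 \<comment> \<open>Reflection can only cancel velocity, so even the reflected multiplier moves at
   speed at most \<open>Qb\<close> in each coordinate.\<close>
 have strict: "\<bar>snd (?s t) $ l\<bar> < R" if t: "t \<in> {0..T}" for t l
 proof -
  have "norm (snd (?s t) $ l - lam0 $ l) <= Qb * measure lborel (cbox 0 t)"
  proof (rule has_integral_bound[OF Qb(1)])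
   show "((%s. Bmean (fst (?s s)) $ l + refl1 (- R) R (snd (?s s) $ l) (Bmean (fst (?s s)) $ l)) has_integral (snd (?s t) $ l - lam0 $ l)) (cbox 0 t)"
    using int2'[OF t] by (simp add: cbox_interval)
   fix s assume "s \<in> cbox 0 t"
   then have "s \<in> {0..T}" using t by (auto simp: cbox_interval)
   then show "norm (Bmean (fst (?s s)) $ l + refl1 (- R) R (snd (?s s) $ l) (Bmean (fst (?s s)) $ l)) <= Qb"
    using Bl[of s l] Qb(1) by (auto simp: refl1_def max_def)
  qed
  also have "... <= T * Qb" using t Qb(1) by (simp add: mult.commute mult_left_mono)
  finally show ?thesis using component_le_norm_cart[of lam0 l] unfolding R_def real_norm_def by linarith
 qed
 have int2: "((%s. Bmean (fst (?s s))) has_integral (snd (?s t) - lam0)) {0..t}" if t: "t \<in> {0..T}" for t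
 proof (rule has_integral_vecI)
  fix l
  have "((%s. Bmean (fst (?s s)) $ l) has_integral (snd (?s t) $ l - lam0 $ l)) {0..t}"
  proof (rule has_integral_eq[OF _ int2'[OF t]])
   fix s assume "s \<in> {0..t}"
   then have "s \<in> {0..T}" using t by auto
   from strict[OF this, of l] show "Bmean (fst (?s s)) $ l + refl1 (- R) R (snd (?s s) $ l) (Bmean (fst (?s s)) $ l) = Bmean (fst (?s s)) $ l"
    by (auto simp: refl1_def)
  qed
  then show "((%s. Bmean (fst (?s s)) $ l) has_integral (snd (?s t) - lam0) $ l) {0..t}" by simp
 qed
 have contB: "continuous_on {0..T} (%s. Bmean (fst (?s s)))"
  using continuous_on_snd[OF E.F_sol_continuous] by (simp add: F_def)
 have "is_sol x"
  unfolding is_sol_def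
 proof (intro conjI ballI)
  show "x \<in> extensional {0..T}" by (simp add: x_def)
  show "x 0 = (\<alpha>0, lam0)" using T by (simp add: x_def E.sol_0)
  show "solves_truncated H T (%t. field (fst (x t)) (snd (x t))) (%t. fst (x t))"
   unfolding solves_truncated_def
  proof (intro exI[of _ z] ballI conjI)
   fix t assume t: "t \<in> {0..T}"
   show "fst (x t) \<in> H" using in_box[OF t] by (simp add: xs[OF t])
   show "minimal_reflection H (fst (x t)) (- (field (fst (x t)) (snd (x t)))) (z t)"
    unfolding field[OF t] unfolding xs[OF t] z_def by (rule minimal_reflection_box[OF \<mu>(2) in_box[OF t]])
   have 0: "(0::real) \<in> {0..T}" using T by simp
   show "((%s. - (field (fst (x s)) (snd (x s))) + z s) has_integral (fst (x t) - fst (x 0))) {0..t}"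
    unfolding xs[OF t] xs[OF 0]
   proof (rule has_integral_eq[OF _ int1[OF t]])
    fix s assume "s \<in> {0..t}"
    then have s: "s \<in> {0..T}" using t by auto
    show "- G (fst (?s s)) (snd (?s s)) + z s = - (field (fst (x s)) (snd (x s))) + z s"
     unfolding field[OF s] ..
   qed
  qed
  fix t assume t: "t \<in> {0..T}"
  have "((%u. integral {0..u} (%s. Bmean (fst (?s s))) + lam0) has_vector_derivative Bmean (fst (?s t)) + 0) (at t within {0..T})"
   by (intro has_vector_derivative_add integral_has_vector_derivative contB t has_vector_derivative_const)
  then have "((%u. integral {0..u} (%s. Bmean (fst (?s s))) + lam0) has_vector_derivative Bmean (fst (?s t))) (at t within {0..T})" by simp
  then have "((%s. snd (x s)) has_vector_derivative Bmean (fst (?s t))) (at t within {0..T})"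
  proof (rule has_vector_derivative_transform[OF t, rotated])
   fix u assume u: "u \<in> {0..T}"
   show "snd (x u) = integral {0..u} (%s. Bmean (fst (?s s))) + lam0"
    using integral_unique[OF int2[OF u]] by (simp add: xs[OF u])
  qed
  then show "((%s. snd (x s)) has_vector_derivative constraint_mean M \<beta> \<gamma> (fst (x t))) (at t within {0..T})"
   using constraint_mean_eq[OF in_box[OF t]] by (simp add: xs[OF t])
 qed
 then show ?thesis by blast
qed

end

section \<open>Estimates for the algorithm\<close>

lemma param_box_cbox: "param_box \<mu> = cbox (\<chi> e. \<mu>) (\<chi> e. pi / 2 - \<mu> :: real ^ 'k::finite)"
 by (auto simp: param_box_def mem_box_cart)

lemma closed_param_box: "closed (param_box \<mu> :: (real ^ 'k::finite) set)"
 and convex_param_box: "convex (param_box \<mu> :: (real ^ 'k::finite) set)"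
 and bounded_param_box: "bounded (param_box \<mu> :: (real ^ 'k::finite) set)"
 unfolding param_box_cbox by (rule closed_cbox, rule convex_box, rule bounded_cbox)

lemma sum_square_le:
 fixes f :: "'i => real"
 assumes "finite I"
 shows "(\<Sum>i\<in>I. f i)\<^sup>2 <= real (card I) * (\<Sum>i\<in>I. (f i)\<^sup>2)"
 using Cauchy_Schwarz_ineq_sum[of "%_. 1" f I] by simp

locale scheme = saddle M \<mu> N c \<beta> \<gamma> Bhat \<Gamma>c \<Gamma>\<beta> \<rho> T \<alpha>0 lam0
 for M :: "('s::finite, 'k::finite) ctrl_chain" and \<mu> :: real and N :: nat
  and c :: "'s \<times> nat => real" and \<beta> :: "'l::finite => 's \<times> nat => real" and \<gamma> :: "real ^ 'l"
  and Bhat :: "('s \<times> nat) list => real ^ 'l"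
  and \<Gamma>c :: "('s \<times> nat) list => real" and \<Gamma>\<beta> :: "'l => ('s \<times> nat) list => real"
  and \<rho> T :: real and \<alpha>0 :: "real ^ 'k" and lam0 :: "real ^ 'l" +
 fixes \<nu> :: "'s pmf" and a :: "real => nat => ('s, 'k) path => real ^ 'k"
  and lam :: "real => nat => ('s, 'k) path => real ^ 'l"
 assumes a_0: "0 < ep ==> a ep 0 om = \<alpha>0"
  and a_Suc: "0 < ep ==> a ep (Suc n) om = closest_point (param_box \<mu>)
     (a ep n om - ep *\<^sub>R (grad_est M N c \<Gamma>c (a ep n om) n om
       + (\<Sum>l\<in>UNIV. (lam ep n om $ l + \<rho> * Bhat (batch_obs N n om) $ l)
              *\<^sub>R grad_est M N (\<beta> l) (\<Gamma>\<beta> l) (a ep n om) n om)))"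
  and lam_0: "0 < ep ==> lam ep 0 om = lam0"
  and lam_Suc: "0 < ep ==> lam ep (Suc n) om = lam ep n om + ep *\<^sub>R Bhat (batch_obs N n om)"
begin

abbreviation J :: "real => nat => (('s, 'k) path \<times> 's) pmf" where "J ep \<equiv> joint \<nu> (a ep)"

definition horizon :: "real => nat" where "horizon ep = nat \<lfloor>T / ep\<rfloor>"

lemma horizon: "0 < ep ==> n <= horizon ep ==> real n * ep <= T"
proof -
 assume e: "0 < ep" and n: "n <= horizon ep"
 have "real n <= T / ep" using n e T unfolding horizon_def by (metis floor_of_nat le_floor_iff le_nat_iff of_int_of_nat_eq zero_le_divide_iff less_imp_le zero_le_floor)
 then show ?thesis using e by (simp add: pos_le_divide_eq)
qed

definition grad_tot :: "real => nat => ('s, 'k) path => real ^ 'k" where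
 "grad_tot ep n om = grad_est M N c \<Gamma>c (a ep n om) n om
   + (\<Sum>l\<in>UNIV. (lam ep n om $ l + \<rho> * Bhat (batch_obs N n om) $ l) *\<^sub>R grad_est M N (\<beta> l) (\<Gamma>\<beta> l) (a ep n om) n om)"

lemma a_step: "0 < ep ==> a ep (Suc n) om = closest_point H (a ep n om - ep *\<^sub>R grad_tot ep n om)"
 unfolding grad_tot_def by (rule a_Suc)

lemma H_ne: "H \<noteq> {}" using \<alpha>0 by blast

lemma a_in: "0 < ep ==> a ep n om \<in> H"
 using closest_point_in_set[OF closed_param_box H_ne] by (cases n) (simp_all add: a_0 \<alpha>0 a_step)

lemma scheme_cong:
 assumes e: "0 < ep"
 shows "(\<And>i. i <= n * N ==> om i = om' i) ==> a ep n om = a ep n om' \<and> lam ep n om = lam ep n om'"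
proof (induction n)
 case 0
 then show ?case by (simp add: a_0[OF e] lam_0[OF e])
next
 case (Suc n)
 have IH: "a ep n om = a ep n om'" "lam ep n om = lam ep n om'" using Suc by auto
 have ob: "batch_obs N n om = batch_obs N n om'" by (rule batch_obs_cong) (rule Suc(2))
 have gr: "grad_est M N f \<Gamma> \<alpha> n om = grad_est M N f \<Gamma> \<alpha> n om'" for f \<Gamma> \<alpha> by (rule grad_est_cong) (rule Suc(2))
 show ?case unfolding a_Suc[OF e] lam_Suc[OF e] IH ob gr by simp
qed

lemma a_policy: "0 < ep ==> policy (a ep)"
 unfolding policy_def adapted_def using scheme_cong a_in by blast

lemma scheme_ext:
 assumes "0 < ep"
 shows "a ep n (ext n om l) = a ep n om" "lam ep n (ext n om l) = lam ep n om"
 using scheme_cong[OF assms, of n "ext n om l" om] append_path_le[of _ "n * N" om l] by auto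

lemma Bs_bound: "\<exists>C\<ge>0. \<forall>l\<in>Bs. norm (F l :: 'e::real_normed_vector) <= C"
proof (intro exI conjI ballI)
 show "0 <= (\<Sum>l\<in>Bs. norm (F l))" by (intro sum_nonneg) simp
 show "norm (F l) <= (\<Sum>l\<in>Bs. norm (F l))" if "l \<in> Bs" for l
  by (rule member_le_sum[OF that]) (auto simp: finite_seg_marks)
qed

lemma obs_ext: "l \<in> Bs ==> batch_obs N n (ext n om l) = map fst l"
 by (rule batch_obs_append) (simp add: seg_marks_def)

lemma lam_ext: "0 < ep ==> l \<in> Bs ==> lam ep (Suc n) (ext n om l) = lam ep n om + ep *\<^sub>R Bhat (map fst l)"
 by (simp add: lam_Suc scheme_ext obs_ext)

lemma joint_Suc_cases:
 assumes e: "0 < ep" and z: "z \<in> set_pmf (J ep (Suc n))"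
 obtains y l where "y \<in> set_pmf (J ep n)" "l \<in> Bs" "fst z = ext n (fst y) l"
proof -
 obtain y v where y: "y \<in> set_pmf (J ep n)" "v \<in> set_pmf (seg (a ep n (fst y)) (snd y))" "z = (ext n (fst y) (fst v), snd v)"
  using z unfolding joint_step[OF a_policy[OF e]] by auto
 have "v \<in> Bs \<times> UNIV" using seg_support[OF a_in[OF e, of n "fst y"], of N "snd y"] y(2) by blast
 then show ?thesis using that[OF y(1), of "fst v"] y(3) by (auto simp: mem_Times_iff)
qed

lemma Bhat_bound: "\<exists>C\<ge>0. \<forall>l\<in>Bs. norm (Bhat (map fst l)) <= C" by (rule Bs_bound)

definition Bmax :: real where "Bmax = (SOME C. 0 <= C \<and> (\<forall>l\<in>Bs. norm (Bhat (map fst l)) <= C))"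

lemma Bmax: "0 <= Bmax" "l \<in> Bs ==> norm (Bhat (map fst l)) <= Bmax"
 using someI_ex[OF Bhat_bound] unfolding Bmax_def by blast+

definition Lmax :: real where "Lmax = norm lam0 + T * Bmax"

lemma Lmax: "0 <= Lmax" using T Bmax(1) by (simp add: Lmax_def)

lemma lam_bound:
 assumes e: "0 < ep" and n: "n <= horizon ep" and z: "z \<in> set_pmf (J ep n)"
 shows "norm (lam ep n (fst z)) <= Lmax"
proof -
 have "norm (lam ep n (fst z)) <= norm lam0 + (real n * ep) * Bmax" using z
 proof (induction n arbitrary: z)
  case (Suc n)
  obtain y l where y: "y \<in> set_pmf (J ep n)" and l: "l \<in> Bs" and z: "fst z = ext n (fst y) l" by (rule joint_Suc_cases[OF e Suc(2)])
  have "norm (lam ep (Suc n) (fst z)) <= norm (lam ep n (fst y)) + ep * norm (Bhat (map fst l))"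
   unfolding z lam_ext[OF e l] using e norm_triangle_ineq[of "lam ep n (fst y)" "ep *\<^sub>R Bhat (map fst l)"] by simp
  also have "... <= (norm lam0 + (real n * ep) * Bmax) + ep * Bmax"
   using e by (intro add_mono Suc.IH[OF y] mult_left_mono Bmax(2) l) simp
  also have "... = norm lam0 + (real (Suc n) * ep) * Bmax" by (simp add: algebra_simps)
  finally show ?case .
 qed (simp add: lam_0[OF e])
 also have "... <= Lmax" unfolding Lmax_def using horizon[OF e n] Bmax(1) by (intro add_left_mono mult_right_mono)
 finally show ?thesis .
qed

text \<open>One envelope for the memories of all coordinates and targets; the summand 1 lets it
  absorb bounded terms as well.\<close>

definition V :: "nat => ('s, 'k) path => real" where
 "V n om = 1 + (\<Sum>e\<in>UNIV. \<Sum>y\<in>targets M e. \<bar>mem0 M N e y n om\<bar> + \<bar>mem1 M N e y n om\<bar>)"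

lemma V_ge: "1 <= V n om" "(\<Sum>y\<in>targets M e. \<bar>mem0 M N e y n om\<bar> + \<bar>mem1 M N e y n om\<bar>) <= V n om - 1"
proof -
 show "1 <= V n om" unfolding V_def by (simp add: sum_nonneg)
 have "(\<Sum>y\<in>targets M e. \<bar>mem0 M N e y n om\<bar> + \<bar>mem1 M N e y n om\<bar>) <= (\<Sum>e\<in>UNIV. \<Sum>y\<in>targets M e. \<bar>mem0 M N e y n om\<bar> + \<bar>mem1 M N e y n om\<bar>)"
  by (rule member_le_sum[where f = "%e. \<Sum>y\<in>targets M e. \<bar>mem0 M N e y n om\<bar> + \<bar>mem1 M N e y n om\<bar>"]) (auto intro: sum_nonneg)
 then show "(\<Sum>y\<in>targets M e. \<bar>mem0 M N e y n om\<bar> + \<bar>mem1 M N e y n om\<bar>) <= V n om - 1" by (simp add: V_def)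
qed

text \<open>\<open>memory_moment\<close> holds for all policies with one constant per coordinate and
  target, hence uniformly in \<open>ep\<close> and \<open>n\<close>.\<close>

lemma V_moment: "\<exists>C\<ge>0. \<forall>ep n. 0 < ep --> expect (J ep n) (%z. (V n (fst z))\<^sup>2) <= C"
proof -
 let ?I = "SIGMA e:UNIV. targets M e"
 let ?m = "%i n om. (mem0 M N (fst i) (snd i) n om)\<^sup>2 + (mem1 M N (fst i) (snd i) n om)\<^sup>2"
 have fin: "finite ?I" by auto
 define bd where "bd = (%i C. 0 <= C \<and> (\<forall>\<nu> a n. policy a --> expect (joint \<nu> a n) (%z. ?m i n (fst z)) <= C))"
 have "\<forall>i\<in>?I. \<exists>C. bd i C"
 proof
  fix i assume "i \<in> ?I"
  then have "snd i \<in> targets M (fst i)" by auto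
  from memory_moment[OF this] show "\<exists>C. bd i C" unfolding bd_def .
 qed
 from bchoice[OF this] obtain C where C0: "\<forall>i\<in>?I. bd i (C i)" ..
 have C: "0 <= C i" if "i \<in> ?I" for i using bspec[OF C0 that, unfolded bd_def, THEN conjunct1] .
 have C': "expect (joint \<nu> a n) (%z. ?m i n (fst z)) <= C i" if i: "i \<in> ?I" and a: "policy a" for i \<nu> a n
  using bspec[OF C0 i, unfolded bd_def, THEN conjunct2, THEN spec, THEN spec, THEN spec, THEN mp, OF a] .
 define q where "q = real (card ?I)"
 have q: "0 <= q" unfolding q_def by (rule of_nat_0_le_iff)
 \<comment> \<open>A factor 2 from the square of 1 plus the sum, the number \<open>q\<close> of
   terms from Cauchy-Schwarz, and another 2 from the square of the two memory variables in a
   term.\<close>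
 define c1 where "c1 = 4 * q"
 have c1: "0 <= c1" using q by (simp add: c1_def)
 have Vsq: "(V n om)\<^sup>2 <= 2 + c1 * (\<Sum>i\<in>?I. ?m i n om)" for n om
 proof -
  let ?t = "%i. \<bar>mem0 M N (fst i) (snd i) n om\<bar> + \<bar>mem1 M N (fst i) (snd i) n om\<bar>"
  have V: "V n om = 1 + (\<Sum>i\<in>?I. ?t i)"
   unfolding V_def by (subst sum.Sigma) (auto simp: case_prod_unfold)
  have sq: "(x + y)\<^sup>2 <= 2 * x\<^sup>2 + 2 * y\<^sup>2" for x y :: real
   using sum_squares_bound[of x y] by (simp add: power2_sum)
  have "(\<Sum>i\<in>?I. ?t i)\<^sup>2 <= q * (\<Sum>i\<in>?I. (?t i)\<^sup>2)" unfolding q_def by (rule sum_square_le[OF fin])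
  also have "... <= q * (\<Sum>i\<in>?I. 2 * ?m i n om)"
  proof (intro mult_left_mono sum_mono)
   fix i show "(?t i)\<^sup>2 <= 2 * ?m i n om"
    using sq[of "\<bar>mem0 M N (fst i) (snd i) n om\<bar>" "\<bar>mem1 M N (fst i) (snd i) n om\<bar>"] by simp
  qed (rule q)
  also have "... = 2 * q * (\<Sum>i\<in>?I. ?m i n om)" unfolding sum_distrib_left[symmetric] by simp
  finally have S: "(\<Sum>i\<in>?I. ?t i)\<^sup>2 <= 2 * q * (\<Sum>i\<in>?I. ?m i n om)" .
  have "(V n om)\<^sup>2 <= 2 * 1\<^sup>2 + 2 * (\<Sum>i\<in>?I. ?t i)\<^sup>2" unfolding V by (rule sq)
  moreover have "v <= 2 + c1 * t" if "v <= 2 * 1\<^sup>2 + 2 * u" "u <= 2 * q * t" for u v t :: real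
   using that unfolding c1_def by simp
  ultimately show ?thesis using S by blast
 qed
 show ?thesis
 proof (intro exI[of _ "2 + c1 * (\<Sum>i\<in>?I. C i)"] conjI allI impI)
  show "0 <= 2 + c1 * (\<Sum>i\<in>?I. C i)" using c1 C by (intro add_nonneg_nonneg mult_nonneg_nonneg sum_nonneg) auto
  fix ep :: real and n assume e: "0 < ep"
  note fin = finite_joint[OF a_policy[OF e], of \<nu> n]
  have "expect (J ep n) (%z. (V n (fst z))\<^sup>2) <= expect (J ep n) (%z. 2 + c1 * (\<Sum>i\<in>?I. ?m i n (fst z)))"
   by (rule expectation_mono_finite[OF fin Vsq])
  also have "... = 2 + c1 * (\<Sum>i\<in>?I. expect (J ep n) (%z. ?m i n (fst z)))"
   unfolding expectation_add_finite[OF fin] integral_mult_right_zero expectation_sum_finite[OF fin] by simp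
  also have "... <= 2 + c1 * (\<Sum>i\<in>?I. C i)" using c1 by (intro add_left_mono mult_left_mono sum_mono C' a_policy e)
  finally show "expect (J ep n) (%z. (V n (fst z))\<^sup>2) <= 2 + c1 * (\<Sum>i\<in>?I. C i)" .
 qed
qed

text \<open>Records come from a finite set, so the coefficients are bounded and only the memory can
  be large.\<close>

lemma grad_val_bound: "\<exists>C\<ge>0. \<forall>n om. \<forall>l\<in>Bs. \<bar>grad_val b f \<Gamma> e n om l\<bar> <= C * V n om"
proof -
 define A :: "('s, 'k) mark list => real" where "A = (%l. b (map fst l) * own_part M N f \<Gamma> e 0 (base_path l))"
 define B0 :: "'s \<times> nat => ('s, 'k) mark list => real" where "B0 = (%y l. b (map fst l) * carry0 N f \<Gamma> y 0 (base_path l))"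
 define B1 :: "'s \<times> nat => ('s, 'k) mark list => real" where "B1 = (%y l. b (map fst l) * carry1 N \<Gamma> y 0 (base_path l))"
 obtain CA where CA: "0 <= CA" "\<And>l. l \<in> Bs ==> \<bar>A l\<bar> <= CA" using Bs_bound[of A] by auto
 have "\<forall>y. \<exists>C\<ge>0. \<forall>l\<in>Bs. norm (\<bar>B0 y l\<bar> + \<bar>B1 y l\<bar>) <= C" by (intro allI Bs_bound)
 then obtain CB where CB: "\<And>y. 0 <= CB y" "\<And>y l. l \<in> Bs ==> norm (\<bar>B0 y l\<bar> + \<bar>B1 y l\<bar>) <= CB y" by metis
 define S where "S = (\<Sum>y\<in>targets M e. CB y)"
 have S: "0 <= S" "\<And>y. y \<in> targets M e ==> CB y <= S"
  unfolding S_def by (intro sum_nonneg CB, rule member_le_sum) (auto simp: CB)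
 show ?thesis
 proof (intro exI[of _ "CA + S"] conjI allI ballI)
  show "0 <= CA + S" using CA S by simp
  fix n and om :: "('s, 'k) path" and l assume l: "l \<in> Bs"
  have t: "\<bar>B0 y l * mem0 M N e y n om + B1 y l * mem1 M N e y n om\<bar> <= S * (\<bar>mem0 M N e y n om\<bar> + \<bar>mem1 M N e y n om\<bar>)" if y: "y \<in> targets M e" for y
  proof -
   have b: "\<bar>B0 y l\<bar> <= S" "\<bar>B1 y l\<bar> <= S" using CB(2)[OF l, of y] S(2)[OF y] by auto
   have "\<bar>B0 y l\<bar> * \<bar>mem0 M N e y n om\<bar> <= S * \<bar>mem0 M N e y n om\<bar>" "\<bar>B1 y l\<bar> * \<bar>mem1 M N e y n om\<bar> <= S * \<bar>mem1 M N e y n om\<bar>"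
    using b by (intro mult_right_mono; simp)+
   then show ?thesis unfolding distrib_left
    using abs_triangle_ineq[of "B0 y l * mem0 M N e y n om" "B1 y l * mem1 M N e y n om"] by (simp add: abs_mult)
  qed
  have "\<bar>grad_val b f \<Gamma> e n om l\<bar> <= \<bar>A l\<bar> + (\<Sum>y\<in>targets M e. \<bar>B0 y l * mem0 M N e y n om + B1 y l * mem1 M N e y n om\<bar>)"
   unfolding grad_val_def batch_val_def A_def[symmetric] B0_def[symmetric] B1_def[symmetric]
   by (rule order_trans[OF abs_triangle_ineq add_left_mono[OF sum_abs]])
  also have "... <= CA + (\<Sum>y\<in>targets M e. S * (\<bar>mem0 M N e y n om\<bar> + \<bar>mem1 M N e y n om\<bar>))"
   by (intro add_mono CA(2) l sum_mono t)
  also have "... <= CA * 1 + S * (V n om - 1)" unfolding sum_distrib_left[symmetric] using V_ge(2)[of e n om] S(1) by (simp add: mult_left_mono)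
  also have "... <= CA * V n om + S * V n om" using V_ge(1)[of n om] CA S by (intro add_mono mult_left_mono) auto
  finally show "\<bar>grad_val b f \<Gamma> e n om l\<bar> <= (CA + S) * V n om" by (simp add: distrib_right)
 qed
qed

lemma grad_tot_ext:
 assumes e: "0 < ep" and z: "z \<in> set_pmf (J ep n)" and l: "l \<in> Bs"
 shows "grad_tot ep n (ext n (fst z) l) $ i = 2 / real N * weight_factor M (a ep n (fst z)) i *
  (grad_val (%_. 1) c \<Gamma>c i n (fst z) l
   + (\<Sum>j\<in>UNIV. (lam ep n (fst z) $ j + \<rho> * Bhat (map fst l) $ j) * grad_val (%_. 1) (\<beta> j) (\<Gamma>\<beta> j) i n (fst z) l))"
 unfolding grad_tot_def scheme_ext[OF e] obs_ext[OF l] vector_add_component sum_component vector_scaleR_component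
  grad_est_ext[OF a_policy[OF e] z l]
 by (simp add: sum_distrib_left distrib_left mult.left_commute)

lemma weight_factor_bound: "\<exists>C\<ge>0. \<forall>\<alpha>\<in>H. \<forall>i. \<bar>weight_factor M \<alpha> i\<bar> <= C"
proof -
 have "\<forall>i. \<exists>Q\<ge>0. \<forall>\<alpha>\<in>H. \<bar>weight_factor M \<alpha> i\<bar> <= Q"
  using bl_weight_factor unfolding bounded_lipschitz_def by blast
 then obtain Q where Q: "\<And>i. 0 <= Q i" "\<And>i \<alpha>. \<alpha> \<in> H ==> \<bar>weight_factor M \<alpha> i\<bar> <= Q i" by metis
 have "Q i <= (\<Sum>i\<in>UNIV. Q i)" for i by (rule member_le_sum) (auto simp: Q)
 then have "\<bar>weight_factor M \<alpha> i\<bar> <= (\<Sum>i\<in>UNIV. Q i)" if "\<alpha> \<in> H" for \<alpha> i using Q(2)[OF that, of i] order_trans by blast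
 then show ?thesis using Q(1) by (intro exI[of _ "\<Sum>i\<in>UNIV. Q i"]) (simp add: sum_nonneg)
qed

lemma grad_tot_bound:
 "\<exists>C\<ge>0. \<forall>ep n z l. 0 < ep --> n <= horizon ep --> z \<in> set_pmf (J ep n) --> l \<in> Bs -->
   norm (grad_tot ep n (ext n (fst z) l)) <= C * V n (fst z)"
proof -
 obtain W where W: "0 <= W" "\<And>\<alpha> i. \<alpha> \<in> H ==> \<bar>weight_factor M \<alpha> i\<bar> <= W" using weight_factor_bound by blast
 have "\<forall>i. \<exists>C\<ge>0. \<forall>n om. \<forall>l\<in>Bs. \<bar>grad_val (%_. 1) c \<Gamma>c i n om l\<bar> <= C * V n om" by (intro allI grad_val_bound)
 then obtain C0 where C0: "\<And>i. 0 <= C0 i" "\<And>i n om l. l \<in> Bs ==> \<bar>grad_val (%_. 1) c \<Gamma>c i n om l\<bar> <= C0 i * V n om" by metis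
 have "\<forall>i j. \<exists>C\<ge>0. \<forall>n om. \<forall>l\<in>Bs. \<bar>grad_val (%_. 1) (\<beta> j) (\<Gamma>\<beta> j) i n om l\<bar> <= C * V n om" by (intro allI grad_val_bound)
 then obtain C1 where C1: "\<And>i j. 0 <= C1 i j" "\<And>i j n om l. l \<in> Bs ==> \<bar>grad_val (%_. 1) (\<beta> j) (\<Gamma>\<beta> j) i n om l\<bar> <= C1 i j * V n om" by metis
 define R where "R = Lmax + \<bar>\<rho>\<bar> * Bmax"
 have R: "0 <= R" using Lmax Bmax by (simp add: R_def)
 define Ci where "Ci i = 2 / real N * W * (C0 i + (\<Sum>j\<in>UNIV. R * C1 i j))" for i
 have Ci: "0 <= Ci i" for i unfolding Ci_def using W R C0 C1 by (intro mult_nonneg_nonneg add_nonneg_nonneg sum_nonneg) auto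
 show ?thesis
 proof (intro exI[of _ "\<Sum>i\<in>UNIV. Ci i"] conjI allI impI)
  show "0 <= (\<Sum>i\<in>UNIV. Ci i)" by (intro sum_nonneg Ci)
  fix ep :: real and n and z :: "('s, 'k) path \<times> 's" and l
  assume e: "0 < ep" and n: "n <= horizon ep" and z: "z \<in> set_pmf (J ep n)" and l: "l \<in> Bs"
  let ?V = "V n (fst z)"
  have V0: "0 <= ?V" using V_ge(1)[of n "fst z"] by simp
  have co: "\<bar>lam ep n (fst z) $ j + \<rho> * Bhat (map fst l) $ j\<bar> <= R" for j
  proof -
   have "\<bar>lam ep n (fst z) $ j\<bar> <= Lmax" using component_le_norm_cart[of "lam ep n (fst z)" j] lam_bound[OF e n z] by linarith
   moreover have "\<bar>Bhat (map fst l) $ j\<bar> <= Bmax" using component_le_norm_cart[of "Bhat (map fst l)" j] Bmax(2)[OF l] by linarith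
   then have "\<bar>\<rho>\<bar> * \<bar>Bhat (map fst l) $ j\<bar> <= \<bar>\<rho>\<bar> * Bmax" by (rule mult_left_mono) simp
   ultimately show ?thesis unfolding R_def using abs_triangle_ineq[of "lam ep n (fst z) $ j" "\<rho> * Bhat (map fst l) $ j"] by (simp add: abs_mult)
  qed
  have "\<bar>grad_tot ep n (ext n (fst z) l) $ i\<bar> <= Ci i * ?V" for i
  proof -
   let ?g = "grad_val (%_. 1) c \<Gamma>c i n (fst z) l" and ?h = "%j. grad_val (%_. 1) (\<beta> j) (\<Gamma>\<beta> j) i n (fst z) l"
   let ?c = "%j. lam ep n (fst z) $ j + \<rho> * Bhat (map fst l) $ j"
   have "\<bar>?g + (\<Sum>j\<in>UNIV. ?c j * ?h j)\<bar> <= \<bar>?g\<bar> + (\<Sum>j\<in>UNIV. \<bar>?c j * ?h j\<bar>)"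
    by (rule order_trans[OF abs_triangle_ineq add_left_mono[OF sum_abs]])
   also have "... <= C0 i * ?V + (\<Sum>j\<in>UNIV. R * (C1 i j * ?V))"
    unfolding abs_mult using R by (intro add_mono C0 l sum_mono mult_mono co C1) auto
   also have "... = (C0 i + (\<Sum>j\<in>UNIV. R * C1 i j)) * ?V" by (simp add: distrib_right sum_distrib_right mult.assoc)
   finally have b: "\<bar>?g + (\<Sum>j\<in>UNIV. ?c j * ?h j)\<bar> <= (C0 i + (\<Sum>j\<in>UNIV. R * C1 i j)) * ?V" .
   have "2 / real N * \<bar>weight_factor M (a ep n (fst z)) i\<bar> * \<bar>?g + (\<Sum>j\<in>UNIV. ?c j * ?h j)\<bar> <= 2 / real N * W * ((C0 i + (\<Sum>j\<in>UNIV. R * C1 i j)) * ?V)"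
    using W by (intro mult_mono b W(2) a_in[OF e] mult_left_mono mult_nonneg_nonneg) auto
   then show ?thesis unfolding grad_tot_ext[OF e z l] Ci_def by (simp add: abs_mult mult.assoc)
  qed
  then have "norm (grad_tot ep n (ext n (fst z) l)) <= (\<Sum>i\<in>UNIV. Ci i * ?V)"
   by (intro order_trans[OF norm_le_l1_cart] sum_mono)
  then show "norm (grad_tot ep n (ext n (fst z) l)) <= (\<Sum>i\<in>UNIV. Ci i) * ?V" by (simp add: sum_distrib_right)
 qed
qed

definition Gmax :: real where "Gmax = (SOME C. 0 <= C \<and> (\<forall>ep n z l. 0 < ep --> n <= horizon ep --> z \<in> set_pmf (J ep n) --> l \<in> Bs -->
   norm (grad_tot ep n (ext n (fst z) l)) <= C * V n (fst z)))"

lemma Gmax: "0 <= Gmax" "0 < ep ==> n <= horizon ep ==> z \<in> set_pmf (J ep n) ==> l \<in> Bs ==>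
   norm (grad_tot ep n (ext n (fst z) l)) <= Gmax * V n (fst z)"
 using someI_ex[OF grad_tot_bound] unfolding Gmax_def by blast+

definition Vmax :: real where "Vmax = (SOME C. 0 <= C \<and> (\<forall>ep n. 0 < ep --> expect (J ep n) (%z. (V n (fst z))\<^sup>2) <= C))"

lemma Vmax: "0 <= Vmax" "0 < ep ==> expect (J ep n) (%z. (V n (fst z))\<^sup>2) <= Vmax"
 using someI_ex[OF V_moment] unfolding Vmax_def by blast+

text \<open>The current parameter lies in the box and equals its own projection, so nonexpansiveness
  bounds the projected step by the unprojected one.\<close>

lemma a_move:
 assumes e: "0 < ep" and n: "n <= horizon ep" and z: "z \<in> set_pmf (J ep n)" and l: "l \<in> Bs"
 shows "dist (a ep (Suc n) (ext n (fst z) l)) (a ep n (fst z)) <= ep * (Gmax * V n (fst z))"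
proof -
 let ?g = "grad_tot ep n (ext n (fst z) l)"
 have "dist (a ep (Suc n) (ext n (fst z) l)) (a ep n (fst z)) =
  dist (closest_point H (a ep n (fst z) - ep *\<^sub>R ?g)) (closest_point H (a ep n (fst z)))"
  unfolding a_step[OF e] scheme_ext[OF e] closest_point_self[OF a_in[OF e]] ..
 also have "... <= dist (a ep n (fst z) - ep *\<^sub>R ?g) (a ep n (fst z))"
  by (rule closest_point_lipschitz[OF convex_param_box closed_param_box H_ne])
 also have "... = ep * norm ?g" using e by (simp add: dist_norm)
 also have "... <= ep * (Gmax * V n (fst z))" using e by (intro mult_left_mono Gmax(2) n z l) auto
 finally show ?thesis .
qed

end

text \<open>The bound \<open>K * (1 + c) ^ n\<close> solves the recursion with equality.\<close>

lemma discrete_gronwall: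
 fixes e :: "nat => real"
 assumes c: "0 <= c" and e: "\<And>n. n <= h ==> e n <= K + c * (\<Sum>k<n. e k)"
 shows "n <= h ==> e n <= K * (1 + c) ^ n"
proof (induction n rule: less_induct)
 case (less n)
 have "(\<Sum>k<n. e k) <= (\<Sum>k<n. K * (1 + c) ^ k)" using less by (intro sum_mono) auto
 then have "e n <= K + c * (\<Sum>k<n. K * (1 + c) ^ k)"
  using e[OF less(2)] c mult_left_mono by (smt (verit))
 also have "... = K * (1 + c) ^ n"
  by (induction n) (auto simp: algebra_simps)
 finally show ?case .
qed

section \<open>Slowly varying weights and vanishing sums of centred batch functionals\<close>

context scheme
begin

text \<open>The bound at \<open>Suc n\<close> does not follow from the one along the support: the
  appended record is any element of \<open>Bs\<close>, possibly of probability 0. The product rule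
  in \<open>slowly_mult\<close> relies on it.\<close>

definition slow_by :: "(real => nat => ('s, 'k) path => real) => real => bool" where
 "slow_by d D \<longleftrightarrow> 0 <= D \<and> (\<forall>ep n z. 0 < ep --> ep <= 1 --> n <= horizon ep --> z \<in> set_pmf (J ep n) -->
   \<bar>d ep n (fst z)\<bar> <= D \<and> (n < horizon ep --> (\<forall>b\<in>Bs. \<bar>d ep (Suc n) (ext n (fst z) b)\<bar> <= D \<and>
    \<bar>d ep (Suc n) (ext n (fst z) b) - d ep n (fst z)\<bar> <= ep * D * V n (fst z))))"

definition slowly :: "(real => nat => ('s, 'k) path => real) => bool" where
 "slowly d \<longleftrightarrow> (\<exists>D. slow_by d D)"

lemma slowlyI:
 assumes "0 <= D" "\<And>ep n z. 0 < ep ==> ep <= 1 ==> n <= horizon ep ==> z \<in> set_pmf (J ep n) ==> \<bar>d ep n (fst z)\<bar> <= D"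
  "\<And>ep n z b. 0 < ep ==> ep <= 1 ==> n < horizon ep ==> z \<in> set_pmf (J ep n) ==> b \<in> Bs ==> \<bar>d ep (Suc n) (ext n (fst z) b)\<bar> <= D"
  "\<And>ep n z b. 0 < ep ==> ep <= 1 ==> n < horizon ep ==> z \<in> set_pmf (J ep n) ==> b \<in> Bs ==>
   \<bar>d ep (Suc n) (ext n (fst z) b) - d ep n (fst z)\<bar> <= ep * D * V n (fst z)"
 shows "slowly d"
 unfolding slowly_def slow_by_def by (intro exI[of _ D] conjI allI impI ballI assms)

lemma slow_byD:
 assumes "slow_by d D"
 shows "0 <= D" "\<And>ep n z. 0 < ep ==> ep <= 1 ==> n <= horizon ep ==> z \<in> set_pmf (J ep n) ==> \<bar>d ep n (fst z)\<bar> <= D"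
  "\<And>ep n z b. 0 < ep ==> ep <= 1 ==> n < horizon ep ==> z \<in> set_pmf (J ep n) ==> b \<in> Bs ==> \<bar>d ep (Suc n) (ext n (fst z) b)\<bar> <= D"
  "\<And>ep n z b. 0 < ep ==> ep <= 1 ==> n < horizon ep ==> z \<in> set_pmf (J ep n) ==> b \<in> Bs ==>
   \<bar>d ep (Suc n) (ext n (fst z) b) - d ep n (fst z)\<bar> <= ep * D * V n (fst z)"
proof -
 note D = assms[unfolded slow_by_def]
 note D' = D[THEN conjunct2, THEN spec, THEN spec, THEN spec, THEN mp, THEN mp, THEN mp, THEN mp]
 show "0 <= D" using D by (rule conjunct1)
 show "\<bar>d ep n (fst z)\<bar> <= D" if "0 < ep" "ep <= 1" "n <= horizon ep" "z \<in> set_pmf (J ep n)" for ep n z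
  using D'[OF that] by (rule conjunct1)
 show "\<bar>d ep (Suc n) (ext n (fst z) b)\<bar> <= D" if "0 < ep" "ep <= 1" "n < horizon ep" "z \<in> set_pmf (J ep n)" "b \<in> Bs" for ep n z b
  using D'[OF that(1,2) less_imp_le[OF that(3)] that(4), THEN conjunct2, THEN mp, OF that(3), THEN bspec, OF that(5)] by (rule conjunct1)
 show "\<bar>d ep (Suc n) (ext n (fst z) b) - d ep n (fst z)\<bar> <= ep * D * V n (fst z)" if "0 < ep" "ep <= 1" "n < horizon ep" "z \<in> set_pmf (J ep n)" "b \<in> Bs" for ep n z b
  using D'[OF that(1,2) less_imp_le[OF that(3)] that(4), THEN conjunct2, THEN mp, OF that(3), THEN bspec, OF that(5)] by (rule conjunct2)
qed

lemma V0: "0 <= V n om" using V_ge(1)[of n om] by linarith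

lemma slowly_const: "slowly (%_ _ _. r)"
 by (rule slowlyI[of "\<bar>r\<bar>"]) (auto intro!: mult_nonneg_nonneg simp: V0)

lemma slowly_mult:
 assumes "slowly d" "slowly d'"
 shows "slowly (%ep n om. d ep n om * d' ep n om)"
proof -
 obtain D where "slow_by d D" using assms(1) unfolding slowly_def ..
 note D = slow_byD[OF this]
 obtain D' where "slow_by d' D'" using assms(2) unfolding slowly_def ..
 note D' = slow_byD[OF this]
 have DD: "0 <= D * D'" using D(1) D'(1) by simp
 have le: "D * D' <= 2 * (D * D')" using DD by linarith
 show ?thesis
 proof (rule slowlyI[of "2 * (D * D')"])
  show "0 <= 2 * (D * D')" using DD by simp
  show "\<bar>d ep n (fst z) * d' ep n (fst z)\<bar> <= 2 * (D * D')"
   if "0 < ep" "ep <= 1" "n <= horizon ep" "z \<in> set_pmf (J ep n)" for ep n z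
   unfolding abs_mult using D(1) by (intro order_trans[OF mult_mono le] D(2) D'(2) that) auto
  fix ep :: real and n and z :: "('s, 'k) path \<times> 's" and b
  assume t: "0 < ep" "ep <= 1" "n < horizon ep" "z \<in> set_pmf (J ep n)" "b \<in> Bs"
  show "\<bar>d ep (Suc n) (ext n (fst z) b) * d' ep (Suc n) (ext n (fst z) b)\<bar> <= 2 * (D * D')"
   unfolding abs_mult using D(1) by (intro order_trans[OF mult_mono le] D(3) D'(3) t) auto
  let ?p = "d ep n (fst z)" and ?q = "d' ep n (fst z)" and ?p' = "d ep (Suc n) (ext n (fst z) b)" and ?q' = "d' ep (Suc n) (ext n (fst z) b)"
  have eq: "?p' * ?q' - ?p * ?q = (?p' - ?p) * ?q' + ?p * (?q' - ?q)" by (simp add: algebra_simps)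
  have 1: "\<bar>?p' - ?p\<bar> * \<bar>?q'\<bar> <= (ep * D * V n (fst z)) * D'"
   by (intro mult_mono D(4) D'(3) t mult_nonneg_nonneg V0 D(1) less_imp_le[OF t(1)]) auto
  have 2: "\<bar>?p\<bar> * \<bar>?q' - ?q\<bar> <= D * (ep * D' * V n (fst z))"
   by (intro mult_mono D(2) D'(4) t less_imp_le[OF t(3)] D(1)) auto
  have "\<bar>?p' * ?q' - ?p * ?q\<bar> <= \<bar>?p' - ?p\<bar> * \<bar>?q'\<bar> + \<bar>?p\<bar> * \<bar>?q' - ?q\<bar>"
   unfolding eq abs_mult[symmetric] by (rule abs_triangle_ineq)
  also have "... <= (ep * D * V n (fst z)) * D' + D * (ep * D' * V n (fst z))" by (rule add_mono[OF 1 2])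
  also have "... = ep * (2 * (D * D')) * V n (fst z)" by simp
  finally show "\<bar>?p' * ?q' - ?p * ?q\<bar> <= ep * (2 * (D * D')) * V n (fst z)" .
 qed
qed

lemma slowly_diff:
 assumes "slowly d" "slowly d'"
 shows "slowly (%ep n om. d ep n om - d' ep n om)"
proof -
 obtain D where "slow_by d D" using assms(1) unfolding slowly_def ..
 note D = slow_byD[OF this]
 obtain D' where "slow_by d' D'" using assms(2) unfolding slowly_def ..
 note D' = slow_byD[OF this]
 have tri: "\<bar>u - v\<bar> <= p + q" if "\<bar>u\<bar> <= p" "\<bar>v\<bar> <= q" for u v p q :: real using that by linarith
 show ?thesis
 proof (rule slowlyI[of "D + D'"])
  show "0 <= D + D'" using D(1) D'(1) by simp
  show "\<bar>d ep n (fst z) - d' ep n (fst z)\<bar> <= D + D'"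
   if "0 < ep" "ep <= 1" "n <= horizon ep" "z \<in> set_pmf (J ep n)" for ep n z
   by (intro tri D(2) D'(2) that)
  fix ep :: real and n and z :: "('s, 'k) path \<times> 's" and b
  assume t: "0 < ep" "ep <= 1" "n < horizon ep" "z \<in> set_pmf (J ep n)" "b \<in> Bs"
  show "\<bar>d ep (Suc n) (ext n (fst z) b) - d' ep (Suc n) (ext n (fst z) b)\<bar> <= D + D'" by (intro tri D(3) D'(3) t)
  let ?p = "d ep n (fst z)" and ?q = "d' ep n (fst z)" and ?p' = "d ep (Suc n) (ext n (fst z) b)" and ?q' = "d' ep (Suc n) (ext n (fst z) b)"
  have "\<bar>(?p' - ?p) - (?q' - ?q)\<bar> <= ep * D * V n (fst z) + ep * D' * V n (fst z)" by (intro tri D(4) D'(4) t)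
  then show "\<bar>?p' - ?q' - (?p - ?q)\<bar> <= ep * (D + D') * V n (fst z)" by (simp add: algebra_simps)
 qed
qed

lemma slowly_uminus: "slowly d ==> slowly (%ep n om. - d ep n om)"
 using slowly_diff[OF slowly_const[of 0]] by simp

lemma slowly_policy:
 assumes f: "bounded_lipschitz H f"
 shows "slowly (%ep n om. f (a ep n om))"
proof -
 obtain Q where Q: "0 <= Q" "\<And>p. p \<in> H ==> \<bar>f p\<bar> <= Q" "\<And>p q. p \<in> H ==> q \<in> H ==> \<bar>f p - f q\<bar> <= Q * dist p q"
  using bounded_lipschitzE[OF f] by blast
 have le: "Q <= Q + Q * Gmax" using Q(1) Gmax(1) by simp
 show ?thesis
 proof (rule slowlyI[of "Q + Q * Gmax"])
  show "0 <= Q + Q * Gmax" using Q(1) Gmax(1) by simp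
  show "\<bar>f (a ep n (fst z))\<bar> <= Q + Q * Gmax" if "0 < ep" for ep n and z :: "('s, 'k) path \<times> 's" by (intro order_trans[OF Q(2) le] a_in that)
  show "\<bar>f (a ep (Suc n) (ext n (fst z) b))\<bar> <= Q + Q * Gmax" if "0 < ep" for ep n b and z :: "('s, 'k) path \<times> 's" by (intro order_trans[OF Q(2) le] a_in that)
  fix ep :: real and n and z :: "('s, 'k) path \<times> 's" and b
  assume t: "0 < ep" "ep <= 1" "n < horizon ep" "z \<in> set_pmf (J ep n)" "b \<in> Bs"
  have "\<bar>f (a ep (Suc n) (ext n (fst z) b)) - f (a ep n (fst z))\<bar> <= Q * dist (a ep (Suc n) (ext n (fst z) b)) (a ep n (fst z))"
   by (intro Q(3) a_in t(1))
  also have "... <= Q * (ep * (Gmax * V n (fst z)))" by (intro mult_left_mono Q(1) a_move t less_imp_le[OF t(3)])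
  also have "... <= ep * (Q + Q * Gmax) * V n (fst z)" using t(1) Q(1) V0[of n "fst z"] by (simp add: algebra_simps)
  finally show "\<bar>f (a ep (Suc n) (ext n (fst z) b)) - f (a ep n (fst z))\<bar> <= ep * (Q + Q * Gmax) * V n (fst z)" .
 qed
qed

lemma slowly_lam: "slowly (%ep n om. lam ep n om $ j)"
proof (rule slowlyI[of "Lmax + Bmax"])
 show "0 <= Lmax + Bmax" using Lmax Bmax(1) by simp
 have l: "\<bar>lam ep n (fst z) $ j\<bar> <= Lmax" if "0 < ep" "n <= horizon ep" "z \<in> set_pmf (J ep n)" for ep n z
  using component_le_norm_cart[of "lam ep n (fst z)" j] lam_bound[OF that] by linarith
 have b: "\<bar>Bhat (map fst b) $ j\<bar> <= Bmax" if "b \<in> Bs" for b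
  using component_le_norm_cart[of "Bhat (map fst b)" j] Bmax(2)[OF that] by linarith
 show "\<bar>lam ep n (fst z) $ j\<bar> <= Lmax + Bmax" if "0 < ep" "ep <= 1" "n <= horizon ep" "z \<in> set_pmf (J ep n)" for ep n z
  using l[OF that(1,3,4)] Bmax(1) by linarith
 fix ep :: real and n and z :: "('s, 'k) path \<times> 's" and b
 assume t: "0 < ep" "ep <= 1" "n < horizon ep" "z \<in> set_pmf (J ep n)" "b \<in> Bs"
 have step: "\<bar>ep * Bhat (map fst b) $ j\<bar> <= ep * Bmax" using t(1) by (simp add: abs_mult b[OF t(5)] mult_left_mono)
 have e1: "ep * Bmax <= Bmax" using mult_right_mono[OF t(2) Bmax(1)] by simp
 show "\<bar>lam ep (Suc n) (ext n (fst z) b) $ j\<bar> <= Lmax + Bmax"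
  using step e1 l[OF t(1) less_imp_le[OF t(3)] t(4)] unfolding lam_ext[OF t(1,5)] by simp
 have "ep * Bmax <= ep * (Lmax + Bmax) * V n (fst z)"
 proof -
  have "ep * Bmax * 1 <= ep * (Lmax + Bmax) * V n (fst z)"
   using t(1) Lmax Bmax(1) V_ge(1)[of n "fst z"] by (intro mult_mono) auto
  then show ?thesis by simp
 qed
 then show "\<bar>lam ep (Suc n) (ext n (fst z) b) $ j - lam ep n (fst z) $ j\<bar> <= ep * (Lmax + Bmax) * V n (fst z)"
  using step unfolding lam_ext[OF t(1,5)] by simp
qed

lemma slowly_time:
 assumes D: "0 <= D" "\<And>t. t \<in> {0..T} ==> \<bar>x t\<bar> <= D" "\<And>s t. s \<in> {0..T} ==> t \<in> {0..T} ==> \<bar>x s - x t\<bar> <= D * \<bar>s - t\<bar>"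
 shows "slowly (%ep n _. x (real n * ep))"
proof (rule slowlyI[OF D(1)])
 have tt: "real n * ep \<in> {0..T}" if "0 < ep" "n <= horizon ep" for ep n using horizon[OF that] that(1) by simp
 show "\<bar>x (real n * ep)\<bar> <= D" if "0 < ep" "ep <= 1" "n <= horizon ep" for ep n by (rule D(2)[OF tt[OF that(1,3)]])
 fix ep :: real and n and z :: "('s, 'k) path \<times> 's" and b
 assume t: "0 < ep" "ep <= 1" "n < horizon ep" "z \<in> set_pmf (J ep n)" "b \<in> Bs"
 have S: "Suc n <= horizon ep" using t(3) by simp
 show "\<bar>x (real (Suc n) * ep)\<bar> <= D" by (rule D(2)[OF tt[OF t(1) S]])
 have "\<bar>x (real (Suc n) * ep) - x (real n * ep)\<bar> <= D * \<bar>real (Suc n) * ep - real n * ep\<bar>"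
  by (rule D(3)[OF tt[OF t(1) S] tt[OF t(1) less_imp_le[OF t(3)]]])
 also have "... = (ep * D) * 1" using t(1) by (simp add: algebra_simps)
 also have "... <= ep * D * V n (fst z)" using t(1) D(1) V_ge(1)[of n "fst z"] by (intro mult_left_mono) auto
 finally show "\<bar>x (real (Suc n) * ep) - x (real n * ep)\<bar> <= ep * D * V n (fst z)" .
qed

text \<open>One constant has to serve for the weight, the speed of the parameter and the second
  moment of \<open>V\<close>, hence the sum of the three bounds.\<close>

lemma slowly_slow:
 assumes "slowly d"
 shows "\<exists>D\<ge>0. \<forall>ep. 0 < ep --> ep <= 1 --> slow \<nu> (a ep) (d ep) V D ep (horizon ep)"
proof -
 obtain D where "slow_by d D" using assms unfolding slowly_def ..
 note D = slow_byD[OF this]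
 define E where "E = D + Gmax + Vmax"
 have E: "0 <= E" "D <= E" "Gmax <= E" "Vmax <= E" using D(1) Gmax(1) Vmax(1) by (auto simp: E_def)
 show ?thesis
 proof (intro exI[of _ E] conjI allI impI E(1))
  fix ep :: real assume e: "0 < ep" "ep <= 1"
  have up: "ep * C * V n om <= ep * E * V n om" if "C <= E" for C n om
   using e that V0[of n om] by (intro mult_right_mono mult_left_mono) auto
  show "slow \<nu> (a ep) (d ep) V E ep (horizon ep)"
   unfolding slow_def
  proof (intro conjI allI impI ballI)
   show "0 <= ep" using e by simp
   show "\<bar>d ep n (fst z)\<bar> <= E" if "n <= horizon ep" "z \<in> set_pmf (J ep n)" for n z
    by (rule order_trans[OF D(2)[OF e that] E(2)])
   show "0 <= V n (fst z)" for n z by (rule V0)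
   show "expect (J ep n) (%z. (V n (fst z))\<^sup>2) <= E" for n
    by (rule order_trans[OF Vmax(2)[OF e(1)] E(4)])
   fix n z b assume t: "n < horizon ep" "z \<in> set_pmf (J ep n)" "b \<in> Bs"
   show "\<bar>d ep (Suc n) (ext n (fst z) b) - d ep n (fst z)\<bar> <= ep * E * V n (fst z)"
    by (rule order_trans[OF D(4)[OF e t] up[OF E(2)]])
   have "dist (a ep (Suc n) (ext n (fst z) b)) (a ep n (fst z)) <= ep * Gmax * V n (fst z)"
    using a_move[OF e(1) less_imp_le[OF t(1)] t(2,3)] by (simp only: mult.assoc)
   then show "dist (a ep (Suc n) (ext n (fst z) b)) (a ep n (fst z)) <= ep * E * V n (fst z)"
    by (rule order_trans[OF _ up[OF E(3)]])
  qed
 qed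
qed

definition drift_sum :: "(real => nat => ('s, 'k) path => ('s, 'k) mark list => real) => real => nat => real" where
 "drift_sum F ep n = (\<Sum>k<n. expect (J ep k) (%z. seg_exp (seg (a ep k (fst z)) (snd z)) (%l _. F ep k (fst z) l)))"

text \<open>For \<open>n\<close> up to \<open>T / ep\<close>, multiplying by \<open>ep\<close>
  leaves at most \<open>ep * Q + T * (\<eta> + Q * ep)\<close>, which is below any given size once
  \<open>\<eta>\<close> and then \<open>ep\<close> are small.\<close>

definition vanishing :: "(real => nat => ('s, 'k) path => ('s, 'k) mark list => real) => bool" where
 "vanishing F \<longleftrightarrow> (\<forall>\<eta>>0. \<exists>Q\<ge>0. \<forall>ep. 0 < ep --> ep <= 1 --> (\<forall>n\<le>horizon ep. \<bar>drift_sum F ep n\<bar> <= Q + real n * (\<eta> + Q * ep)))"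

lemma vanishing_average:
 assumes d: "slowly d" and G: "ergodic_average Gv mean"
 shows "vanishing (%ep k om l. d ep k om * (Gv k om l - mean (a ep k om)))"
 unfolding vanishing_def
proof (intro allI impI)
 fix \<eta> :: real assume \<eta>: "0 < \<eta>"
 obtain D where D: "0 <= D" "\<And>ep. 0 < ep ==> ep <= 1 ==> slow \<nu> (a ep) (d ep) V D ep (horizon ep)"
  using slowly_slow[OF d] by blast
 note G' = G[unfolded ergodic_average_def, THEN conjunct2, THEN conjunct2, THEN spec, THEN spec, THEN mp, THEN mp, OF D(1) \<eta>]
 show "\<exists>Q\<ge>0. \<forall>ep. 0 < ep --> ep <= 1 --> (\<forall>n\<le>horizon ep. \<bar>drift_sum (%ep k om l. d ep k om * (Gv k om l - mean (a ep k om))) ep n\<bar> <= Q + real n * (\<eta> + Q * ep))"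
 proof (rule exE[OF G'], erule conjE)
  fix Q assume Q: "0 <= Q" and avg: "\<forall>\<nu> a d V ep h. policy a --> slow \<nu> a d V D ep h -->
     (\<forall>n\<le>h. \<bar>\<Sum>k<n. expect (joint \<nu> a k) (%z. d k (fst z) *
      (seg_exp (seg (a k (fst z)) (snd z)) (%l _. Gv k (fst z) l) - mean (a k (fst z))))\<bar> <= Q + real n * (\<eta> + Q * ep))"
  show ?thesis
  proof (intro exI[of _ Q] conjI allI impI Q)
   fix ep :: real and n assume e: "0 < ep" "ep <= 1" and n: "n <= horizon ep"
   have eq: "seg_exp (seg (a ep k (fst z)) (snd z)) (%l _. d ep k (fst z) * (Gv k (fst z) l - mean (a ep k (fst z))))
    = d ep k (fst z) * (seg_exp (seg (a ep k (fst z)) (snd z)) (%l _. Gv k (fst z) l) - mean (a ep k (fst z)))"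
    for k and z :: "('s, 'k) path \<times> 's"
    unfolding seg_exp_def integral_mult_right_zero
     expectation_diff_finite[OF finite_seg_law[OF a_in[OF e(1)]]] expectation_const ..
   show "\<bar>drift_sum (%ep k om l. d ep k om * (Gv k om l - mean (a ep k om))) ep n\<bar> <= Q + real n * (\<eta> + Q * ep)"
    unfolding drift_sum_def eq
    by (rule avg[THEN spec, THEN spec, THEN spec, THEN spec, THEN spec, THEN spec, THEN mp, THEN mp, THEN spec, THEN mp,
       OF a_policy[OF e(1)] D(2)[OF e] n])
  qed
 qed
qed

lemma vanishing_sum:
 assumes fin: "finite I" and F: "\<And>i. i \<in> I ==> vanishing (F i)"
 shows "vanishing (%ep k om l. \<Sum>i\<in>I. F i ep k om l)"
 unfolding vanishing_def
proof (intro allI impI)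
 fix \<eta> :: real assume \<eta>: "0 < \<eta>"
 define \<eta>' where "\<eta>' = \<eta> / (real (card I) + 1)"
 have \<eta>': "0 < \<eta>'" "real (card I) * \<eta>' <= \<eta>" using \<eta> by (auto simp: \<eta>'_def field_simps)
 have "\<forall>i\<in>I. \<exists>Q. 0 <= Q \<and> (\<forall>ep. 0 < ep --> ep <= 1 --> (\<forall>n\<le>horizon ep. \<bar>drift_sum (F i) ep n\<bar> <= Q + real n * (\<eta>' + Q * ep)))"
  using F \<eta>'(1) unfolding vanishing_def by blast
 from bchoice[OF this] obtain Q where Q: "\<And>i. i \<in> I ==> 0 <= Q i"
  "\<And>i ep n. i \<in> I ==> 0 < ep ==> ep <= 1 ==> n <= horizon ep ==> \<bar>drift_sum (F i) ep n\<bar> <= Q i + real n * (\<eta>' + Q i * ep)" by blast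
 show "\<exists>Q\<ge>0. \<forall>ep. 0 < ep --> ep <= 1 --> (\<forall>n\<le>horizon ep. \<bar>drift_sum (%ep k om l. \<Sum>i\<in>I. F i ep k om l) ep n\<bar> <= Q + real n * (\<eta> + Q * ep))"
 proof (intro exI[of _ "\<Sum>i\<in>I. Q i"] conjI allI impI)
  show "0 <= (\<Sum>i\<in>I. Q i)" by (intro sum_nonneg Q)
  fix ep :: real and n assume e: "0 < ep" "ep <= 1" and n: "n <= horizon ep"
  have eq: "drift_sum (%ep k om l. \<Sum>i\<in>I. F i ep k om l) ep n = (\<Sum>i\<in>I. drift_sum (F i) ep n)"
   unfolding drift_sum_def seg_exp_sum_finite[OF a_in[OF e(1)]] expectation_sum_finite[OF finite_joint[OF a_policy[OF e(1)]]]
   by (rule sum.swap)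
  have "\<bar>\<Sum>i\<in>I. drift_sum (F i) ep n\<bar> <= (\<Sum>i\<in>I. Q i + real n * (\<eta>' + Q i * ep))"
   by (intro order_trans[OF sum_abs] sum_mono Q(2) e n)
  also have "... = (\<Sum>i\<in>I. Q i) + real n * (real (card I) * \<eta>' + (\<Sum>i\<in>I. Q i) * ep)"
   by (simp add: sum.distrib sum_distrib_left sum_distrib_right algebra_simps)
  also have "... <= (\<Sum>i\<in>I. Q i) + real n * (\<eta> + (\<Sum>i\<in>I. Q i) * ep)"
   using \<eta>' by (intro add_left_mono mult_left_mono add_right_mono) auto
  finally show "\<bar>drift_sum (%ep k om l. \<Sum>i\<in>I. F i ep k om l) ep n\<bar> <= (\<Sum>i\<in>I. Q i) + real n * (\<eta> + (\<Sum>i\<in>I. Q i) * ep)"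
   unfolding eq .
 qed
qed

lemma vanishing_add:
 assumes "vanishing F" "vanishing F'"
 shows "vanishing (%ep k om l. F ep k om l + F' ep k om l)"
 using vanishing_sum[of "UNIV :: bool set" "%b. if b then F else F'"] assms by (simp add: UNIV_bool add.commute)

lemma drift_sum_cong:
 assumes e: "0 < ep" and "\<And>k z l. k < n ==> z \<in> set_pmf (J ep k) ==> l \<in> Bs ==> F ep k (fst z) l = F' ep k (fst z) l"
 shows "drift_sum F ep n = drift_sum F' ep n"
 unfolding drift_sum_def seg_exp_def
proof (intro sum.cong refl expectation_cong_pmf)
 fix k z v assume "k \<in> {..<n}" and z: "z \<in> set_pmf (J ep k)" and v: "v \<in> set_pmf (seg (a ep k (fst z)) (snd z))"
 moreover have "v \<in> Bs \<times> UNIV" using seg_support[OF a_in[OF e, of k "fst z"], of N "snd z"] v by blast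
 ultimately show "F ep k (fst z) (fst v) = F' ep k (fst z) (fst v)" by (intro assms(2)) auto
qed

end

lemma linear_bound:
 fixes f :: "real => 'e::euclidean_space"
 assumes "0 <= B" "(f has_integral I) {s..t}" "s <= t" "\<And>r. r \<in> {s..t} ==> norm (f r) <= B"
 shows "norm I <= B * (t - s)"
 using has_integral_bound[OF assms(1), of f I s t] assms(2-4) by (simp add: cbox_interval)

text \<open>One coordinate of estimator minus field is split into centred terms, each a weight times
  a batch functional minus its mean. The product \<open>b j * v j\<close> is centred at its own mean
  \<open>mb j\<close>, not at a product of means.\<close>

lemma noise_algebra:
 fixes D w u mc r :: real
 shows "- (D * (w * (u + (\<Sum>j\<in>S. (la j + r * b j) * v j)) - (w * mc + r * (\<Sum>j\<in>S. w * mb j) + (\<Sum>j\<in>S. la j * (w * m j)))))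
  = - (D * w) * (u - mc) + ((\<Sum>j\<in>S. - (D * w) * la j * (v j - m j)) + (\<Sum>j\<in>S. - (D * w) * r * (b j * v j - mb j)))"
 by (simp add: algebra_simps sum_distrib_left sum.distrib sum_subtractf sum_negf)

section \<open>Mean square distance to a given solution\<close>

locale scheme_solution = scheme M \<mu> N c \<beta> \<gamma> Bhat \<Gamma>c \<Gamma>\<beta> \<rho> T \<alpha>0 lam0 \<nu> a lam
 for M :: "('s::finite, 'k::finite) ctrl_chain" and \<mu> :: real and N :: nat
  and c :: "'s \<times> nat => real" and \<beta> :: "'l::finite => 's \<times> nat => real" and \<gamma> :: "real ^ 'l"
  and Bhat :: "('s \<times> nat) list => real ^ 'l"
  and \<Gamma>c :: "('s \<times> nat) list => real" and \<Gamma>\<beta> :: "'l => ('s \<times> nat) list => real"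
  and \<rho> T :: real and \<alpha>0 :: "real ^ 'k" and lam0 :: "real ^ 'l"
  and \<nu> :: "'s pmf" and a :: "real => nat => ('s, 'k) path => real ^ 'k"
  and lam :: "real => nat => ('s, 'k) path => real ^ 'l" +
 fixes x :: "real => (real ^ 'k) \<times> (real ^ 'l)"
 assumes sol: "is_sol x"
begin

definition X :: "real => real ^ 'k" where "X t = fst (x t)"
definition Y :: "real => real ^ 'l" where "Y t = snd (x t)"
definition vel :: "real => real ^ 'k" where "vel t = G (X t) (Y t)"

lemma sol_start: "X 0 = \<alpha>0" "Y 0 = lam0"
 using sol by (simp_all add: is_sol_def X_def Y_def)

lemma sol_reflected:
 "\<exists>z. \<forall>t\<in>{0..T}. X t \<in> H \<and> minimal_reflection H (X t) (- vel t) (z t) \<and>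
   ((%s. - vel s + z s) has_integral (X t - X 0)) {0..t}"
proof -
 let ?v = "%t. field (fst (x t)) (snd (x t))"
 have "solves_truncated H T ?v (%t. fst (x t))" using sol unfolding is_sol_def by blast
 then obtain z where z: "\<forall>t\<in>{0..T}. fst (x t) \<in> H \<and> minimal_reflection H (fst (x t)) (- ?v t) (z t) \<and>
   ((%s. - ?v s + z s) has_integral (fst (x t) - fst (x 0))) {0..t}"
  unfolding solves_truncated_def ..
 have v: "?v t = vel t" if "t \<in> {0..T}" for t
  unfolding vel_def X_def Y_def by (rule field_eq) (use z that in blast)
 show ?thesis
 proof (intro exI[of _ z] ballI conjI)
  fix t assume t: "t \<in> {0..T}"
  note zt = bspec[OF z t]
  show "X t \<in> H" using zt unfolding X_def by (rule conjunct1)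
  show "minimal_reflection H (X t) (- vel t) (z t)"
   using zt[THEN conjunct2, THEN conjunct1] unfolding v[OF t] X_def .
  show "((%s. - vel s + z s) has_integral (X t - X 0)) {0..t}"
   unfolding X_def
  proof (rule has_integral_eq[OF _ zt[THEN conjunct2, THEN conjunct2]])
   fix s assume "s \<in> {0..t}"
   then have "s \<in> {0..T}" using t by auto
   from v[OF this] show "- ?v s + z s = - vel s + z s" by simp
  qed
 qed
qed

lemma X_in: "t \<in> {0..T} ==> X t \<in> H"
 using sol_reflected by blast

definition push :: "real => real ^ 'k" where
 "push = (SOME z. \<forall>t\<in>{0..T}. X t \<in> H \<and> minimal_reflection H (X t) (- vel t) (z t) \<and>
   ((%s. - vel s + z s) has_integral (X t - X 0)) {0..t})"

lemma push:
 assumes "t \<in> {0..T}"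
 shows "minimal_reflection H (X t) (- vel t) (push t)" "((%s. - vel s + push s) has_integral (X t - X 0)) {0..t}"
 using bspec[OF someI_ex[OF sol_reflected, folded push_def] assms] by blast+

lemma push_cone: "t \<in> {0..T} ==> y \<in> H ==> inner (- push t) (y - X t) <= 0"
 using push(1)[of t] unfolding minimal_reflection_def is_arg_min_def normal_cone_def by blast

lemma push_norm: "t \<in> {0..T} ==> norm (push t) <= norm (vel t)"
 using minimal_reflection_norm[OF \<mu>(2) X_in push(1), of t] by simp

lemma X_diff:
 assumes "s \<in> {0..T}" "t \<in> {0..T}" "s <= t"
 shows "((%r. - vel r + push r) has_integral (X t - X s)) {s..t}"
proof -
 let ?f = "%r. - vel r + push r"
 have t: "(?f has_integral (X t - X 0)) {0..t}" and s: "(?f has_integral (X s - X 0)) {0..s}"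
  using push(2) assms by auto
 have "?f integrable_on {s..t}" by (rule integrable_subinterval_real[OF has_integral_integrable[OF t]]) (use assms in auto)
 moreover have "integral {0..s} ?f + integral {s..t} ?f = integral {0..t} ?f"
  by (rule Henstock_Kurzweil_Integration.integral_combine[OF _ _ has_integral_integrable[OF t]]) (use assms in auto)
 then have "integral {s..t} ?f = integral {0..t} ?f - integral {0..s} ?f" by (simp only: eq_diff_eq add.commute)
 then have "integral {s..t} ?f = X t - X s" unfolding integral_unique[OF t] integral_unique[OF s] by simp
 ultimately show ?thesis using has_integral_integrable_integral by blast
qed

lemma Y_diff:
 assumes "s \<in> {0..T}" "t \<in> {0..T}" "s <= t"
 shows "((%r. Bmean (X r)) has_integral (Y t - Y s)) {s..t}"
proof (rule fundamental_theorem_of_calculus[OF assms(3)])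
 fix r assume r: "r \<in> {s..t}"
 then have rT: "r \<in> {0..T}" using assms by auto
 have "(Y has_vector_derivative constraint_mean M \<beta> \<gamma> (X r)) (at r within {0..T})"
  using sol rT unfolding is_sol_def X_def Y_def[abs_def] by blast
 then have "(Y has_vector_derivative Bmean (X r)) (at r within {0..T})" unfolding constraint_mean_eq[OF X_in[OF rT]] .
 then show "(Y has_vector_derivative Bmean (X r)) (at r within {s..t})"
  by (rule has_vector_derivative_within_subset) (use assms in auto)
qed

text \<open>\<open>R\<close> dominates the multipliers of the algorithm and of the solution alike,
  so that one Lipschitz constant of \<open>G\<close> applies along both.\<close>

definition bounds :: "real => real => real => bool" where
 "bounds Qb Q R \<longleftrightarrow> 0 <= Qb \<and> 0 <= Q \<and> 0 <= R \<and> Lmax <= R \<and> (\<forall>p\<in>H. norm (Bmean p) <= Qb) \<and>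
   (\<forall>p\<in>H. \<forall>q\<in>H. norm (Bmean p - Bmean q) <= Qb * norm (p - q)) \<and>
   (\<forall>t\<in>{0..T}. norm (Y t) <= R) \<and>
   (\<forall>p\<in>H. \<forall>v. norm v <= R --> norm (G p v) <= Q) \<and>
   (\<forall>p\<in>H. \<forall>q\<in>H. \<forall>v w. norm v <= R --> norm (G p v - G q w) <= Q * norm (p - q) + Q * norm (v - w))"

lemma boundsD:
 assumes "bounds Qb Q R"
 shows "0 <= Qb" "0 <= Q" "0 <= R" "Lmax <= R" "\<And>p. p \<in> H ==> norm (Bmean p) <= Qb"
  "\<And>p q. p \<in> H ==> q \<in> H ==> norm (Bmean p - Bmean q) <= Qb * norm (p - q)"
  "\<And>t. t \<in> {0..T} ==> norm (Y t) <= R"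
  "\<And>p v. p \<in> H ==> norm v <= R ==> norm (G p v) <= Q"
  "\<And>p q v w. p \<in> H ==> q \<in> H ==> norm v <= R ==> norm (G p v - G q w) <= Q * norm (p - q) + Q * norm (v - w)"
 using assms unfolding bounds_def by simp_all

lemma bounds_exist: "\<exists>Qb Q R. bounds Qb Q R"
proof -
 obtain Qb where Qb: "0 <= Qb" "\<And>p. p \<in> H ==> norm (Bmean p) <= Qb" "\<And>p q. p \<in> H ==> q \<in> H ==> norm (Bmean p - Bmean q) <= Qb * dist p q"
  using Bmean_bl by blast
 define R where "R = Lmax + norm lam0 + Qb * T"
 have R: "0 <= R" "Lmax <= R" using Lmax Qb(1) T by (simp_all add: R_def)
 have Y: "norm (Y t) <= R" if t: "t \<in> {0..T}" for t
 proof -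
  have hi: "((%r. Bmean (X r)) has_integral (Y t - Y 0)) {0..t}" by (rule Y_diff) (use t in auto)
  have bn: "norm (Bmean (X r)) <= Qb" if "r \<in> {0..t}" for r by (intro Qb(2) X_in) (use that t in auto)
  have "norm (Y t - Y 0) <= Qb * (t - 0)" by (rule linear_bound[OF Qb(1) hi _ bn]) (use t in auto)
  also have "... <= Qb * T" using Qb(1) t by (intro mult_left_mono) auto
  finally have "norm (Y t - Y 0) <= Qb * T" .
  moreover have "norm (Y t) <= norm (Y 0) + norm (Y t - Y 0)" using norm_triangle_sub[of "Y t" "Y 0"] by (simp add: add.commute)
  ultimately show ?thesis using Lmax by (simp add: R_def sol_start)
 qed
 obtain Q where Q: "0 <= Q" "\<And>p v. p \<in> H ==> norm v <= R ==> norm (G p v) <= Q"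
   "\<And>p v q w. p \<in> H ==> norm v <= R ==> q \<in> H ==> norm (G p v - G q w) <= Q * dist p q + Q * norm (v - w)"
  using G_bl[OF R(1)] by blast
 have "bounds Qb Q R"
  unfolding bounds_def using Qb(1) R Q(1)
  by (intro conjI ballI allI impI Qb(2) Qb(3)[unfolded dist_norm] Y Q(2) Q(3)[unfolded dist_norm]) assumption+
 then show ?thesis by blast
qed

definition err :: "real => nat => ('s, 'k) path => real" where
 "err ep n om = (norm (a ep n om - X (real n * ep)))\<^sup>2 + (norm (lam ep n om - Y (real n * ep)))\<^sup>2"

text \<open>First-order change of \<open>err\<close> caused by replacing the random increments by
  their means; the parameter descends and the multiplier ascends, hence the signs.\<close>

definition noise :: "real => nat => ('s, 'k) path => ('s, 'k) mark list => real" where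
 "noise ep n om l = - inner (a ep n om - X (real n * ep)) (grad_tot ep n (ext n om l) - G (a ep n om) (lam ep n om))
   + inner (lam ep n om - Y (real n * ep)) (Bhat (map fst l) - Bmean (a ep n om))"

lemma solution_lipschitz:
 "\<exists>K\<ge>0. \<forall>s\<in>{0..T}. \<forall>t\<in>{0..T}. norm (X t - X s) <= K * \<bar>t - s\<bar> \<and> norm (Y t - Y s) <= K * \<bar>t - s\<bar>"
proof -
 obtain Qb Q R where bd: "bounds Qb Q R" using bounds_exist by blast
 note Qb = boundsD(1,5)[OF bd] and Q = boundsD(2)[OF bd] and Y = boundsD(7)[OF bd] and GB = boundsD(8)[OF bd]
 have v: "norm (- vel r + push r) <= 2 * Q" if "r \<in> {0..T}" for r
 proof -
  have "norm (vel r) <= Q" unfolding vel_def by (intro GB X_in Y that)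
  then show ?thesis using push_norm[OF that] norm_triangle_ineq[of "- vel r" "push r"] by simp
 qed
 have le: "norm (X t - X s) <= (2 * Q + Qb) * \<bar>t - s\<bar> \<and> norm (Y t - Y s) <= (2 * Q + Qb) * \<bar>t - s\<bar>"
  if st: "s \<in> {0..T}" "t \<in> {0..T}" "s <= t" for s t
 proof -
  have "norm (X t - X s) <= 2 * Q * (t - s)"
   by (rule linear_bound[OF _ X_diff[OF st] st(3)]) (use Q v st in auto)
  moreover have "norm (Y t - Y s) <= Qb * (t - s)"
   by (rule linear_bound[OF Qb(1) Y_diff[OF st] st(3)]) (use Qb X_in st in auto)
  moreover have "2 * Q * (t - s) <= (2 * Q + Qb) * (t - s)" "Qb * (t - s) <= (2 * Q + Qb) * (t - s)"
   using Q Qb(1) st(3) by (auto intro!: mult_right_mono)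
  ultimately show ?thesis using st(3) by simp
 qed
 show ?thesis
 proof (intro exI[of _ "2 * Q + Qb"] conjI ballI)
  show "0 <= 2 * Q + Qb" using Q Qb by simp
  fix s t assume st: "s \<in> {0..T}" "t \<in> {0..T}"
  have *: "norm (X t - X s) <= (2 * Q + Qb) * \<bar>t - s\<bar> \<and> norm (Y t - Y s) <= (2 * Q + Qb) * \<bar>t - s\<bar>"
   using le[OF st] le[OF st(2,1)] by (cases "s <= t") (auto simp: norm_minus_commute abs_minus_commute)
  show "norm (X t - X s) <= (2 * Q + Qb) * \<bar>t - s\<bar>" "norm (Y t - Y s) <= (2 * Q + Qb) * \<bar>t - s\<bar>"
   using * by blast+
 qed
qed

text \<open>The normal cone condition holds at \<open>X r\<close> for each time \<open>r\<close>,
  whereas the base point of the inner product is \<open>X s\<close>; moving it costs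
  \<open>norm (push r)\<close> times \<open>K * (t - s)\<close>. Replacing \<open>vel r\<close> by
  \<open>vel s\<close> gives the rest of \<open>C\<close>.\<close>

lemma reflected_increment:
 "\<exists>C\<ge>0. \<forall>s\<in>{0..T}. \<forall>t\<in>{0..T}. \<forall>y\<in>H. s <= t -->
   - inner (y - X s) (X t - X s) <= (t - s) * (inner (y - X s) (vel s) + C * (t - s))"
proof -
 obtain Qb Q R where bd: "bounds Qb Q R" using bounds_exist by blast
 note Q = boundsD(2)[OF bd] and Y = boundsD(7)[OF bd] and GB = boundsD(8)[OF bd] and GL = boundsD(9)[OF bd]
 obtain K where K: "0 <= K" "\<And>s t. s \<in> {0..T} ==> t \<in> {0..T} ==> norm (X t - X s) <= K * \<bar>t - s\<bar>"
   "\<And>s t. s \<in> {0..T} ==> t \<in> {0..T} ==> norm (Y t - Y s) <= K * \<bar>t - s\<bar>"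
  using solution_lipschitz by blast
 obtain dm where dm: "\<And>p q. p \<in> H ==> q \<in> H ==> norm (p - q) <= dm"
  using bounded_param_box[of \<mu>] unfolding bounded_two_points dist_norm by blast
 have dm0: "0 <= dm" using dm[OF \<alpha>0 \<alpha>0] by simp
 define C where "C = dm * (2 * (Q * K)) + Q * K"
 have C0: "0 <= C" using dm0 Q K(1) by (simp add: C_def)
 show ?thesis
 proof (intro exI[of _ C] conjI ballI impI C0)
  fix s t y assume s: "s \<in> {0..T}" and t: "t \<in> {0..T}" and y: "y \<in> H" and st: "s <= t"
  let ?d = "y - X s"
  have "((%r. - inner ?d (- vel r + push r)) has_integral (- inner ?d (X t - X s))) {s..t}"
   by (intro has_integral_neg has_integral_linear[OF X_diff[OF s t st] bounded_linear_inner_right, unfolded o_def])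
  moreover have "((%r. inner ?d (vel s) + C * (t - s)) has_integral ((t - s) *\<^sub>R (inner ?d (vel s) + C * (t - s)))) {s..t}"
   using has_integral_const_real[of "inner ?d (vel s) + C * (t - s)" s t] st by simp
  ultimately have "- inner ?d (X t - X s) <= (t - s) *\<^sub>R (inner ?d (vel s) + C * (t - s))"
  proof (rule has_integral_le)
   fix r assume r: "r \<in> {s..t}"
   then have rT: "r \<in> {0..T}" and rs: "0 <= r - s" "r - s <= t - s" using s t by auto
   have kr: "norm (X r - X s) <= K * (t - s)" "norm (Y r - Y s) <= K * (t - s)"
    using K(2)[OF s rT] K(3)[OF s rT] mult_left_mono[OF rs(2) K(1)] rs by auto
   have "norm (vel r - vel s) <= Q * norm (X r - X s) + Q * norm (Y r - Y s)"
    unfolding vel_def by (intro GL X_in Y rT s)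
   also have "... <= Q * (K * (t - s)) + Q * (K * (t - s))" by (intro add_mono mult_left_mono kr Q)
   finally have vl: "norm (vel r - vel s) <= 2 * (Q * K) * (t - s)" by (simp add: mult_ac)
   have "inner ?d (vel r - vel s) <= norm ?d * norm (vel r - vel s)" by (rule norm_cauchy_schwarz)
   also have "... <= dm * (2 * (Q * K) * (t - s))" by (intro mult_mono dm y X_in s vl dm0 norm_ge_zero)
   finally have 1: "inner ?d (vel r - vel s) <= dm * (2 * (Q * K)) * (t - s)" by (simp only: mult.assoc)
   have "norm (push r) <= Q" using push_norm[OF rT] GB[OF X_in[OF rT] Y[OF rT]] unfolding vel_def by simp
   then have "inner (- push r) (X r - X s) <= Q * (K * (t - s))"
    using norm_cauchy_schwarz[of "- push r" "X r - X s"] kr(1) mult_mono[of "norm (push r)" Q "norm (X r - X s)" "K * (t - s)"] Q by simp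
   moreover have "inner (- push r) (y - X r) <= 0" by (rule push_cone[OF rT y])
   moreover have "- inner ?d (- vel r + push r) = inner ?d (vel s) + inner ?d (vel r - vel s) + inner (- push r) (y - X r) + inner (- push r) (X r - X s)"
    by (simp add: inner_diff_left inner_diff_right inner_add_right inner_commute)
   ultimately show "- inner ?d (- vel r + push r) <= inner ?d (vel s) + C * (t - s)"
    using 1 unfolding C_def distrib_right by (simp only: mult.assoc)
  qed
  then show "- inner ?d (X t - X s) <= (t - s) * (inner ?d (vel s) + C * (t - s))" by simp
 qed
qed

text \<open>Since \<open>X t\<close> lies in the box, nonexpansiveness lets the squared distance be
  expanded before projection. The reflection of the solution has the good sign by
  \<open>reflected_increment\<close>, the mean velocities differ by a multiple of the distance, and
  what is left is noise or of second order.\<close>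

lemma err_step:
 "\<exists>C\<ge>0. \<exists>C'\<ge>0. \<forall>ep n z l. 0 < ep --> ep <= 1 --> n < horizon ep --> z \<in> set_pmf (J ep n) --> l \<in> Bs -->
   err ep (Suc n) (ext n (fst z) l) <= err ep n (fst z) + ep * (C * err ep n (fst z)) + 2 * ep * noise ep n (fst z) l
    + ep\<^sup>2 * (C' * (V n (fst z))\<^sup>2)"
proof -
 obtain Qb Q R where bd: "bounds Qb Q R" using bounds_exist by blast
 note Qb = boundsD(1,5,6)[OF bd] and Q = boundsD(2)[OF bd] and R = boundsD(3,4)[OF bd] and Y = boundsD(7)[OF bd] and GL = boundsD(9)[OF bd]
 obtain K where K: "0 <= K" "\<And>s t. s \<in> {0..T} ==> t \<in> {0..T} ==> norm (X t - X s) <= K * \<bar>t - s\<bar>"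
   "\<And>s t. s \<in> {0..T} ==> t \<in> {0..T} ==> norm (Y t - Y s) <= K * \<bar>t - s\<bar>"
  using solution_lipschitz by blast
 obtain C1 where C1: "0 <= C1" "\<And>s t y. s \<in> {0..T} ==> t \<in> {0..T} ==> y \<in> H ==> s <= t ==>
   - inner (y - X s) (X t - X s) <= (t - s) * (inner (y - X s) (vel s) + C1 * (t - s))"
  using reflected_increment by blast
 define k1 where "k1 = Qb * K"
 have k1: "0 <= k1" using Qb K by (simp add: k1_def)
 define C' where "C' = 2 * C1 + 2 * Gmax\<^sup>2 + 2 * K\<^sup>2 + 4 * (R * k1) + 2 * (Bmax + Qb)\<^sup>2 + 2 * k1\<^sup>2"
 have rest0: "0 <= 2 * C1 + 2 * K\<^sup>2 + 4 * (R * k1) + 2 * (Bmax + Qb)\<^sup>2 + 2 * k1\<^sup>2"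
  using C1(1) R(1) k1 by (intro add_nonneg_nonneg mult_nonneg_nonneg) auto
 show ?thesis
 proof (rule exI[of _ "4 * Q + 2 * Qb"], intro conjI exI[of _ C'] allI impI)
  show "0 <= 4 * Q + 2 * Qb" using Q Qb by simp
  have "C' = 2 * Gmax\<^sup>2 + (2 * C1 + 2 * K\<^sup>2 + 4 * (R * k1) + 2 * (Bmax + Qb)\<^sup>2 + 2 * k1\<^sup>2)" by (simp add: C'_def)
  then show "0 <= C'" using rest0 zero_le_power2[of Gmax] by linarith
  fix ep :: real and n and z :: "('s, 'k) path \<times> 's" and l
  assume e: "0 < ep" "ep <= 1" and n: "n < horizon ep" and z: "z \<in> set_pmf (J ep n)" and l: "l \<in> Bs"
  define s t where "s = real n * ep" and "t = real (Suc n) * ep"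
  have sT: "s \<in> {0..T}" and tT: "t \<in> {0..T}" and ts: "t - s = ep"
   using horizon[OF e(1), of n] horizon[OF e(1), of "Suc n"] n e by (auto simp: s_def t_def algebra_simps)
  have st: "s <= t" using ts e by simp
  define al la where "al = a ep n (fst z)" and "la = lam ep n (fst z)"
  define g b where "g = grad_tot ep n (ext n (fst z) l)" and "b = Bhat (map fst l)"
  define D Mm where "D = al - X s" and "Mm = la - Y s"
  define v where "v = V n (fst z)"
  have v1: "1 <= v\<^sup>2" using V_ge(1)[of n "fst z"] by (simp add: v_def)
  have alH: "al \<in> H" unfolding al_def by (rule a_in[OF e(1)])
  have laR: "norm la <= R" using lam_bound[OF e(1) less_imp_le[OF n] z] R(2) by (simp add: la_def)
  have gb: "norm g <= Gmax * v" unfolding g_def v_def by (rule Gmax(2)[OF e(1) less_imp_le[OF n] z l])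
  have bb: "norm b <= Bmax" unfolding b_def by (rule Bmax(2)[OF l])
  define W where "W = (norm D)\<^sup>2 + (norm Mm)\<^sup>2"
  have W0: "0 <= W" by (simp add: W_def)
  have DM: "norm D * norm D <= W" "norm D * norm Mm <= W"
   using sum_squares_bound[of "norm D" "norm Mm"] zero_le_power2[of "norm D"] zero_le_power2[of "norm Mm"]
   unfolding W_def power2_eq_square by linarith+
  define \<Delta> where "\<Delta> = X t - X s"
  have \<Delta>: "norm \<Delta> <= K * ep" using K(2)[OF sT tT] ts e unfolding \<Delta>_def by simp
  have sqb: "(norm (p + q))\<^sup>2 <= 2 * (norm p)\<^sup>2 + 2 * (norm q)\<^sup>2" for p q :: "'e::real_inner"
  proof -
   have "(norm (p + q))\<^sup>2 <= (norm p + norm q)\<^sup>2" by (rule power_mono[OF norm_triangle_ineq norm_ge_zero])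
   then show ?thesis using sum_squares_bound[of "norm p" "norm q"] by (simp add: power2_sum)
  qed
  have A: "(norm (a ep (Suc n) (ext n (fst z) l) - X t))\<^sup>2 <= (norm D)\<^sup>2 + 2 * ep * (- inner D (g - G al la)) + ep * (4 * Q * W)
    + ep\<^sup>2 * (2 * C1 + 2 * Gmax\<^sup>2 * v\<^sup>2 + 2 * K\<^sup>2)"
  proof -
   have "norm (a ep (Suc n) (ext n (fst z) l) - X t) = dist (closest_point H (al - ep *\<^sub>R g)) (closest_point H (X t))"
    unfolding a_step[OF e(1)] scheme_ext[OF e(1)] closest_point_self[OF X_in[OF tT]] dist_norm al_def g_def ..
   also have "... <= dist (al - ep *\<^sub>R g) (X t)"
    by (rule closest_point_lipschitz[OF convex_param_box closed_param_box H_ne])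
   also have "... = norm (D - (ep *\<^sub>R g + \<Delta>))" unfolding dist_norm D_def \<Delta>_def by (simp add: algebra_simps)
   finally have "(norm (a ep (Suc n) (ext n (fst z) l) - X t))\<^sup>2 <= (norm (D - (ep *\<^sub>R g + \<Delta>)))\<^sup>2" by (intro power_mono) auto
   also have "... = (norm D)\<^sup>2 - 2 * ep * inner D g - 2 * inner D \<Delta> + (norm (ep *\<^sub>R g + \<Delta>))\<^sup>2"
    unfolding power2_norm_eq_inner by (simp add: inner_diff_left inner_diff_right inner_add_left inner_add_right inner_commute algebra_simps)
   finally have main: "(norm (a ep (Suc n) (ext n (fst z) l) - X t))\<^sup>2 <= (norm D)\<^sup>2 - 2 * ep * inner D g - 2 * inner D \<Delta> + (norm (ep *\<^sub>R g + \<Delta>))\<^sup>2" .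
   have refl: "- inner D \<Delta> <= ep * (inner D (vel s) + C1 * ep)"
    using C1(2)[OF sT tT alH st] unfolding ts D_def \<Delta>_def .
   have "(norm (ep *\<^sub>R g))\<^sup>2 = ep\<^sup>2 * (norm g)\<^sup>2" by (simp add: power_mult_distrib)
   also have "... <= ep\<^sup>2 * (Gmax * v)\<^sup>2" by (intro mult_left_mono power_mono gb) auto
   finally have g2: "(norm (ep *\<^sub>R g))\<^sup>2 <= ep\<^sup>2 * (Gmax\<^sup>2 * v\<^sup>2)" by (simp add: power_mult_distrib)
   have d2: "(norm \<Delta>)\<^sup>2 <= ep\<^sup>2 * K\<^sup>2" using power_mono[OF \<Delta>, of 2] by (simp add: power_mult_distrib mult.commute)
   have "inner D (vel s - G al la) <= norm D * norm (vel s - G al la)" by (rule norm_cauchy_schwarz)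
   also have "... <= norm D * (Q * norm D + Q * norm Mm)"
   proof (rule mult_left_mono)
    have "norm (vel s - G al la) <= Q * norm (X s - al) + Q * norm (Y s - la)"
     unfolding vel_def by (rule GL[OF X_in[OF sT] alH Y[OF sT]])
    then show "norm (vel s - G al la) <= Q * norm D + Q * norm Mm" by (simp add: D_def Mm_def norm_minus_commute)
   qed simp
   also have "... = Q * (norm D * norm D) + Q * (norm D * norm Mm)" by (simp add: algebra_simps)
   also have "... <= Q * W + Q * W" by (intro add_mono mult_left_mono DM Q)
   finally have vv: "inner D (vel s) - inner D (G al la) <= 2 * Q * W" by (simp add: inner_diff_right)
   have "2 * ep * (inner D (vel s) - inner D (G al la)) <= 2 * ep * (2 * Q * W)" using e by (intro mult_left_mono vv) auto
   moreover have "- 2 * inner D \<Delta> <= 2 * ep * inner D (vel s) + ep\<^sup>2 * (2 * C1)"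
    using refl by (simp add: algebra_simps power2_eq_square)
   moreover have "(norm (ep *\<^sub>R g + \<Delta>))\<^sup>2 <= 2 * (ep\<^sup>2 * (Gmax\<^sup>2 * v\<^sup>2)) + 2 * (ep\<^sup>2 * K\<^sup>2)"
    using sqb[of "ep *\<^sub>R g" \<Delta>] g2 d2 by linarith
   ultimately show ?thesis using main by (simp add: inner_diff_right algebra_simps)
  qed
  \<comment> \<open>Error of freezing \<open>Bmean (X u)\<close> at \<open>u = s\<close> over one
    step; it is of order \<open>ep ^ 2\<close> since \<open>X\<close> and \<open>Bmean\<close> are
    Lipschitz.\<close>
  define r where "r = ep *\<^sub>R Bmean (X s) - (Y t - Y s)"
  have r: "norm r <= k1 * ep\<^sup>2"
  proof -
   have hi: "((%u. Bmean (X s) - Bmean (X u)) has_integral r) {s..t}"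
    unfolding r_def ts[symmetric] using has_integral_diff[OF has_integral_const_real[of "Bmean (X s)" s t] Y_diff[OF sT tT st]] st by simp
   have "norm r <= (k1 * ep) * (t - s)"
   proof (rule linear_bound[OF _ hi st])
    show "0 <= k1 * ep" using k1 e by simp
    fix u assume u: "u \<in> {s..t}"
    then have uT: "u \<in> {0..T}" and us: "\<bar>s - u\<bar> <= ep" using sT tT ts by auto
    have "norm (Bmean (X s) - Bmean (X u)) <= Qb * norm (X s - X u)" by (intro Qb(3) X_in sT uT)
    also have "... <= Qb * (K * ep)"
     using K(2)[OF uT sT] mult_left_mono[OF us K(1)] by (intro mult_left_mono Qb(1)) linarith
    finally show "norm (Bmean (X s) - Bmean (X u)) <= k1 * ep" by (simp add: k1_def mult.assoc)
   qed
   then show ?thesis unfolding ts by (simp add: power2_eq_square mult.assoc)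
  qed
  have L: "(norm (lam ep (Suc n) (ext n (fst z) l) - Y t))\<^sup>2 <= (norm Mm)\<^sup>2 + 2 * ep * inner Mm (b - Bmean al) + ep * (2 * Qb * W)
    + ep\<^sup>2 * (4 * (R * k1) + 2 * (Bmax + Qb)\<^sup>2 + 2 * k1\<^sup>2)"
  proof -
   have eq: "lam ep (Suc n) (ext n (fst z) l) - Y t = Mm + (ep *\<^sub>R (b - Bmean (X s)) + r)"
    unfolding lam_ext[OF e(1) l] by (simp add: Mm_def la_def b_def r_def algebra_simps)
   have main: "(norm (lam ep (Suc n) (ext n (fst z) l) - Y t))\<^sup>2 = (norm Mm)\<^sup>2 + 2 * ep * inner Mm (b - Bmean (X s)) + 2 * inner Mm r + (norm (ep *\<^sub>R (b - Bmean (X s)) + r))\<^sup>2"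
    unfolding eq power2_norm_eq_inner by (simp add: inner_add_left inner_add_right inner_commute algebra_simps)
   have MR: "norm Mm <= 2 * R" using norm_triangle_ineq4[of la "Y s"] laR Y[OF sT] by (simp add: Mm_def)
   have "inner Mm r <= norm Mm * norm r" by (rule norm_cauchy_schwarz)
   also have "... <= 2 * R * (k1 * ep\<^sup>2)" by (rule mult_mono[OF MR r]) (use R in auto)
   finally have mr: "inner Mm r <= ep\<^sup>2 * (2 * (R * k1))" by (simp add: algebra_simps)
   have "norm (b - Bmean (X s)) <= Bmax + Qb" using norm_triangle_ineq4[of b "Bmean (X s)"] bb Qb(2)[OF X_in[OF sT]] by linarith
   then have "(norm (b - Bmean (X s)))\<^sup>2 <= (Bmax + Qb)\<^sup>2" by (rule power_mono) simp
   then have b2: "(norm (ep *\<^sub>R (b - Bmean (X s))))\<^sup>2 <= ep\<^sup>2 * (Bmax + Qb)\<^sup>2" by (simp add: power_mult_distrib mult_left_mono)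
   have "ep\<^sup>2 <= 1" using e by (simp add: power_le_one)
   then have "k1 * ep\<^sup>2 <= k1 * ep" using k1 e by (intro mult_left_mono) (auto simp: power2_eq_square mult_left_le)
   then have "(norm r)\<^sup>2 <= (k1 * ep)\<^sup>2" using r by (intro power_mono) auto
   then have r2: "(norm r)\<^sup>2 <= ep\<^sup>2 * k1\<^sup>2" by (simp add: power_mult_distrib mult.commute)
   have "inner Mm (Bmean al - Bmean (X s)) <= norm Mm * norm (Bmean al - Bmean (X s))" by (rule norm_cauchy_schwarz)
   also have "... <= norm Mm * (Qb * norm D)" unfolding D_def by (intro mult_left_mono Qb(3) alH X_in sT) auto
   also have "... = Qb * (norm D * norm Mm)" by (simp add: mult_ac)
   also have "... <= Qb * W" by (intro mult_left_mono DM Qb(1))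
   finally have "2 * ep * inner Mm (Bmean al - Bmean (X s)) <= 2 * ep * (Qb * W)" using e by (intro mult_left_mono) auto
   moreover have "(norm (ep *\<^sub>R (b - Bmean (X s)) + r))\<^sup>2 <= 2 * (ep\<^sup>2 * (Bmax + Qb)\<^sup>2) + 2 * (ep\<^sup>2 * k1\<^sup>2)"
    using sqb[of "ep *\<^sub>R (b - Bmean (X s))" r] b2 r2 by linarith
   ultimately show ?thesis using mr unfolding main by (simp add: inner_diff_right algebra_simps)
  qed
  \<comment> \<open>Second-order terms without memory; they are absorbed into the envelope because
    \<open>1 <= v ^ 2\<close>.\<close>
  define rest where "rest = 2 * C1 + 2 * K\<^sup>2 + 4 * (R * k1) + 2 * (Bmax + Qb)\<^sup>2 + 2 * k1\<^sup>2"
  have "rest * 1 <= rest * v\<^sup>2" using rest0 v1 unfolding rest_def by (intro mult_left_mono)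
  then have fin: "ep\<^sup>2 * (2 * Gmax\<^sup>2 * v\<^sup>2 + rest) <= ep\<^sup>2 * (C' * v\<^sup>2)"
   by (intro mult_left_mono) (auto simp: C'_def rest_def algebra_simps)
  have E1: "err ep (Suc n) (ext n (fst z) l) = (norm (a ep (Suc n) (ext n (fst z) l) - X t))\<^sup>2 + (norm (lam ep (Suc n) (ext n (fst z) l) - Y t))\<^sup>2"
   by (simp add: err_def t_def)
  have E0: "err ep n (fst z) = W" by (simp add: err_def W_def D_def Mm_def al_def la_def s_def)
  have "noise ep n (fst z) l = - inner D (g - G al la) + inner Mm (b - Bmean al)"
   by (simp add: noise_def D_def Mm_def al_def la_def s_def g_def b_def)
  then have NN: "2 * ep * noise ep n (fst z) l = 2 * ep * (- inner D (g - G al la)) + 2 * ep * inner Mm (b - Bmean al)"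
   by (simp only: distrib_left)
  have p1: "ep * (4 * Q * W) + ep * (2 * Qb * W) = ep * ((4 * Q + 2 * Qb) * W)" by (simp add: algebra_simps)
  have p2: "ep\<^sup>2 * (2 * C1 + 2 * Gmax\<^sup>2 * v\<^sup>2 + 2 * K\<^sup>2) + ep\<^sup>2 * (4 * (R * k1) + 2 * (Bmax + Qb)\<^sup>2 + 2 * k1\<^sup>2) = ep\<^sup>2 * (2 * Gmax\<^sup>2 * v\<^sup>2 + rest)"
   unfolding rest_def distrib_left[symmetric] by (simp add: algebra_simps)
  show "err ep (Suc n) (ext n (fst z) l) <= err ep n (fst z) + ep * ((4 * Q + 2 * Qb) * err ep n (fst z)) + 2 * ep * noise ep n (fst z) l
    + ep\<^sup>2 * (C' * (V n (fst z))\<^sup>2)"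
   unfolding E1 E0 NN v_def[symmetric] using add_mono[OF A L] fin p1 p2 W_def by linarith
 qed
qed

lemma bl_coord: "bounded_lipschitz H (%\<alpha>. \<alpha> $ i)"
proof (rule bounded_lipschitzI[of pi 1])
 show "\<bar>p $ i\<bar> <= pi" if "p \<in> H" for p
 proof -
  have "\<mu> <= p $ i" "p $ i <= pi / 2 - \<mu>" using that by (auto simp: param_box_def)
  then show ?thesis using \<mu>(1) pi_gt_zero unfolding abs_le_iff by linarith
 qed
 show "\<bar>p $ i - q $ i\<bar> <= 1 * dist p q" for p q :: "real ^ 'k"
  using component_le_norm_cart[of "p - q" i] by (simp add: dist_norm)
qed simp_all

lemma slowly_solution: "slowly (%ep n _. X (real n * ep) $ i)" "slowly (%ep n _. Y (real n * ep) $ j)"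
proof -
 obtain K where K: "0 <= K" "\<And>s t. s \<in> {0..T} ==> t \<in> {0..T} ==> norm (X t - X s) <= K * \<bar>t - s\<bar>"
   "\<And>s t. s \<in> {0..T} ==> t \<in> {0..T} ==> norm (Y t - Y s) <= K * \<bar>t - s\<bar>"
  using solution_lipschitz by blast
 have 0: "0 \<in> {0..T}" using T by simp
 have cmp: "\<bar>p $ i\<bar> <= norm p" for p :: "real ^ 'n::finite" and i by (rule component_le_norm_cart)
 have gen: "slowly (%ep n _. F (real n * ep) $ i)"
  if F: "\<And>s t. s \<in> {0..T} ==> t \<in> {0..T} ==> norm (F t - F s) <= K * \<bar>t - s\<bar>" for F :: "real => real ^ 'n::finite" and i
 proof (rule slowly_time[of "K + K * T + norm (F 0)"])
  show "0 <= K + K * T + norm (F 0)" using K(1) T by simp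
  fix t assume t: "t \<in> {0..T}"
  have "\<bar>F t $ i\<bar> <= norm (F 0) + norm (F t - F 0)" using cmp[of "F t" i] norm_triangle_sub[of "F t" "F 0"] by linarith
  also have "... <= norm (F 0) + K * T" using F[OF 0 t] mult_left_mono[OF _ K(1), of t T] t by auto
  finally show "\<bar>F t $ i\<bar> <= K + K * T + norm (F 0)" using K(1) by linarith
  fix s assume s: "s \<in> {0..T}"
  have "\<bar>F s $ i - F t $ i\<bar> <= K * \<bar>s - t\<bar>" using cmp[of "F s - F t" i] F[OF t s] by simp
  also have "... <= (K + K * T + norm (F 0)) * \<bar>s - t\<bar>" using K(1) T by (intro mult_right_mono) auto
  finally show "\<bar>F s $ i - F t $ i\<bar> <= (K + K * T + norm (F 0)) * \<bar>s - t\<bar>" .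
 qed
 show "slowly (%ep n _. X (real n * ep) $ i)" "slowly (%ep n _. Y (real n * ep) $ j)"
  by (rule gen, rule K(2), assumption+) (rule gen, rule K(3), assumption+)
qed

text \<open>Coordinate of the error times the common factor of the gradient estimator, with the sign
  of descent. It varies slowly because it is built from Lipschitz functions of the parameter and of
  time.\<close>

definition wdx :: "'k => real => nat => ('s, 'k) path => real" where
 "wdx i ep n om = - ((a ep n om $ i - X (real n * ep) $ i) * (2 / real N * weight_factor M (a ep n om) i))"

lemma slowly_wdx: "slowly (wdx i)"
 unfolding wdx_def[abs_def]
 by (intro slowly_uminus slowly_mult slowly_diff slowly_solution slowly_const slowly_policy[of "%\<alpha>. \<alpha> $ i"] bl_coord
   slowly_policy[of "%\<alpha>. weight_factor M \<alpha> i"] bl_weight_factor)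

text \<open>Every summand pairs a slowly varying weight with a centred batch functional. The terms
  with \<open>\<rho>\<close> use \<open>grad_val\<close> weighted by \<open>Bhat\<close>, so the
  correlation within a batch is part of what is averaged.\<close>

lemma vanishing_noise: "vanishing noise"
proof -
 let ?u = "%i n om l. grad_val (%_. 1) c \<Gamma>c i n om l" and ?mc = "grad_mean (%_. 1) c \<Gamma>c"
 let ?v = "%i j n om l. grad_val (%_. 1) (\<beta> j) (\<Gamma>\<beta> j) i n om l" and ?m = "%i j. grad_mean (%_. 1) (\<beta> j) (\<Gamma>\<beta> j) i"
 let ?b = "%j ob. Bhat ob $ j"
 let ?bv = "%i j n om l. grad_val (?b j) (\<beta> j) (\<Gamma>\<beta> j) i n om l" and ?mb = "%i j. grad_mean (?b j) (\<beta> j) (\<Gamma>\<beta> j) i"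
 define F where "F ep k om l = (\<Sum>i\<in>UNIV. wdx i ep k om * (?u i k om l - ?mc i (a ep k om))
   + ((\<Sum>j\<in>UNIV. wdx i ep k om * lam ep k om $ j * (?v i j k om l - ?m i j (a ep k om)))
   + (\<Sum>j\<in>UNIV. wdx i ep k om * \<rho> * (?bv i j k om l - ?mb i j (a ep k om)))))
   + (\<Sum>j\<in>UNIV. (lam ep k om $ j - Y (real k * ep) $ j) * (?b j (map fst l) - obs_mean (?b j) (a ep k om)))" for ep k om l
 have v1: "vanishing (%ep k om l. wdx i ep k om * (?u i k om l - ?mc i (a ep k om)))" for i
  by (rule vanishing_average[OF slowly_wdx grad_mean])
 have v2: "vanishing (%ep k om l. wdx i ep k om * lam ep k om $ j * (?v i j k om l - ?m i j (a ep k om)))" for i j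
  by (rule vanishing_average[OF slowly_mult[OF slowly_wdx slowly_lam] grad_mean])
 have v3: "vanishing (%ep k om l. wdx i ep k om * \<rho> * (?bv i j k om l - ?mb i j (a ep k om)))" for i j
  by (rule vanishing_average[OF slowly_mult[OF slowly_wdx slowly_const] grad_mean])
 have v4: "vanishing (%ep k om l. (lam ep k om $ j - Y (real k * ep) $ j) * (?b j (map fst l) - obs_mean (?b j) (a ep k om)))" for j
  by (rule vanishing_average[OF slowly_diff[OF slowly_lam slowly_solution(2)] obs_mean])
 have vF: "vanishing F"
  unfolding F_def[abs_def]
  by (rule vanishing_add[OF vanishing_sum[OF finite vanishing_add[OF v1 vanishing_add[OF vanishing_sum[OF finite v2] vanishing_sum[OF finite v3]]]]
     vanishing_sum[OF finite v4]])
 have eq: "noise ep n (fst z) l = F ep n (fst z) l" if e: "0 < ep" and z: "z \<in> set_pmf (J ep n)" and l: "l \<in> Bs" for ep n z l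
 proof -
  let ?w = "fst z"
  let ?al = "a ep n ?w" and ?la = "lam ep n ?w"
  have 1: "- ((?al - X (real n * ep)) $ i * (grad_tot ep n (ext n ?w l) - G ?al ?la) $ i) =
    wdx i ep n ?w * (?u i n ?w l - ?mc i ?al)
   + ((\<Sum>j\<in>UNIV. wdx i ep n ?w * ?la $ j * (?v i j n ?w l - ?m i j ?al))
   + (\<Sum>j\<in>UNIV. wdx i ep n ?w * \<rho> * (?bv i j n ?w l - ?mb i j ?al)))" for i
  proof -
   have Gi: "G ?al ?la $ i = 2 / real N * weight_factor M ?al i * ?mc i ?al + \<rho> * (\<Sum>j\<in>UNIV. 2 / real N * weight_factor M ?al i * ?mb i j ?al)
     + (\<Sum>j\<in>UNIV. ?la $ j * (2 / real N * weight_factor M ?al i * ?m i j ?al))"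
    by (simp add: G_def G0_def G1_def drift_vec_def)
   show ?thesis
    unfolding vector_minus_component Gi grad_tot_ext[OF e z l] wdx_def grad_val_scale[of "?b _"]
    by (rule noise_algebra)
  qed
  show ?thesis
   unfolding noise_def F_def inner_vec_def inner_real_def sum_negf[symmetric] 1
   by (simp add: Bmean_def)
 qed
 have "drift_sum noise ep n = drift_sum F ep n" if "0 < ep" for ep n
 proof (rule drift_sum_cong[where F = noise and F' = F, OF that])
  fix k l and z :: "('s, 'k) path \<times> 's"
  assume "z \<in> set_pmf (J ep k)" "l \<in> Bs"
  then show "noise ep k (fst z) l = F ep k (fst z) l" by (rule eq[OF that])
 qed
 then show ?thesis using vF unfolding vanishing_def by simp
qed

abbreviation mse :: "real => nat => real" where
 "mse ep n \<equiv> expect (J ep n) (%z. err ep n (fst z))"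

text \<open>Summing \<open>err_step\<close>, from \<open>err = 0\<close> at the start, keeps the
  noise together as \<open>drift_sum\<close>; its smallness shows in the sum and not in single
  terms.\<close>

lemma err_expectation_step:
 "\<exists>C\<ge>0. \<exists>C'\<ge>0. \<forall>ep n. 0 < ep --> ep <= 1 --> n <= horizon ep -->
   mse ep n <= ep * C * (\<Sum>k<n. mse ep k)
    + 2 * ep * drift_sum noise ep n + real n * ep\<^sup>2 * C'"
proof -
 obtain C C' where C: "0 <= C" "0 <= C'" and step0: "\<forall>ep n z l. 0 < ep --> ep <= 1 --> n < horizon ep --> z \<in> set_pmf (J ep n) --> l \<in> Bs -->
   err ep (Suc n) (ext n (fst z) l) <= err ep n (fst z) + ep * (C * err ep n (fst z)) + 2 * ep * noise ep n (fst z) l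
    + ep\<^sup>2 * (C' * (V n (fst z))\<^sup>2)"
  using err_step by (elim exE conjE) (rule that)
 note step = step0[THEN spec, THEN spec, THEN spec, THEN spec, THEN mp, THEN mp, THEN mp, THEN mp, THEN mp]
 show ?thesis
 proof (rule exI[of _ C], intro conjI C exI[of _ "C' * Vmax"] allI impI)
  show "0 <= C' * Vmax" using C Vmax(1) by simp
  fix ep :: real and n assume e: "0 < ep" "ep <= 1" and "n <= horizon ep"
  let ?nz = "%n z. seg_exp (seg (a ep n (fst z)) (snd z)) (%l _. noise ep n (fst z) l)"
  show "mse ep n <= ep * C * (\<Sum>k<n. mse ep k) + 2 * ep * drift_sum noise ep n + real n * ep\<^sup>2 * (C' * Vmax)"
   using \<open>n <= horizon ep\<close>
  proof (induction n)
   case 0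
   have "mse ep 0 = expect (J ep 0) (%_. 0)"
    by (rule expectation_cong_pmf) (simp add: err_def a_0[OF e(1)] lam_0[OF e(1)] sol_start)
   then show ?case by (simp add: drift_sum_def)
  next
   case (Suc n)
   have n: "n < horizon ep" using Suc(2) by simp
   note fin = finite_joint[OF a_policy[OF e(1)], of \<nu> n]
   have "mse ep (Suc n) = expect (J ep n) (%z. seg_exp (seg (a ep n (fst z)) (snd z)) (%l _. err ep (Suc n) (ext n (fst z) l)))"
    unfolding joint_expectation_step[OF a_policy[OF e(1)]] by simp
   also have "... <= expect (J ep n) (%z. err ep n (fst z) + ep * (C * err ep n (fst z)) + 2 * ep * ?nz n z + ep\<^sup>2 * (C' * (V n (fst z))\<^sup>2))"
   proof (rule expectation_mono_finite[OF fin])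
    fix z assume z: "z \<in> set_pmf (J ep n)"
    note fs = finite_seg_law[OF a_in[OF e(1), of n "fst z"], of N "snd z"]
    have "seg_exp (seg (a ep n (fst z)) (snd z)) (%l _. err ep (Suc n) (ext n (fst z) l)) \<le>
      seg_exp (seg (a ep n (fst z)) (snd z)) (%l _. (err ep n (fst z) + ep * (C * err ep n (fst z))) + 2 * ep * noise ep n (fst z) l + ep\<^sup>2 * (C' * (V n (fst z))\<^sup>2))"
     unfolding seg_exp_def
    proof (rule expectation_mono_finite[OF fs])
     fix v assume v: "v \<in> set_pmf (seg (a ep n (fst z)) (snd z))"
     have "v \<in> Bs \<times> UNIV" using seg_support[OF a_in[OF e(1), of n "fst z"], of N "snd z"] v by blast
     then show "err ep (Suc n) (ext n (fst z) (fst v)) <= err ep n (fst z) + ep * (C * err ep n (fst z)) + 2 * ep * noise ep n (fst z) (fst v) + ep\<^sup>2 * (C' * (V n (fst z))\<^sup>2)"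
      by (intro step[OF e n z]) auto
    qed
    also have "... = err ep n (fst z) + ep * (C * err ep n (fst z)) + 2 * ep * ?nz n z + ep\<^sup>2 * (C' * (V n (fst z))\<^sup>2)"
     unfolding seg_exp_def expectation_add_finite[OF fs] integral_mult_right_zero expectation_const ..
    finally show "seg_exp (seg (a ep n (fst z)) (snd z)) (%l _. err ep (Suc n) (ext n (fst z) l)) <= err ep n (fst z) + ep * (C * err ep n (fst z)) + 2 * ep * ?nz n z + ep\<^sup>2 * (C' * (V n (fst z))\<^sup>2)" .
   qed
   also have "... = mse ep n + ep * (C * mse ep n) + 2 * ep * expect (J ep n) (?nz n) + ep\<^sup>2 * (C' * expect (J ep n) (%z. (V n (fst z))\<^sup>2))"
    unfolding expectation_add_finite[OF fin] integral_mult_right_zero ..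
   also have "... <= mse ep n + ep * (C * mse ep n) + 2 * ep * expect (J ep n) (?nz n) + ep\<^sup>2 * (C' * Vmax)"
    by (intro add_left_mono mult_left_mono Vmax(2) e C) auto
   finally have "mse ep (Suc n) <= mse ep n + ep * (C * mse ep n) + 2 * ep * expect (J ep n) (?nz n) + ep\<^sup>2 * (C' * Vmax)" .
   moreover have "drift_sum noise ep (Suc n) = drift_sum noise ep n + expect (J ep n) (?nz n)" by (simp add: drift_sum_def)
   moreover have "mse ep n <= ep * C * (\<Sum>k<n. mse ep k) + 2 * ep * drift_sum noise ep n + real n * ep\<^sup>2 * (C' * Vmax)" using Suc by simp
   moreover have "E' <= ep * C * (S + E) + 2 * ep * (d + q) + (real n + 1) * ep\<^sup>2 * (C' * Vmax)"
    if "E' <= E + ep * (C * E) + 2 * ep * q + ep\<^sup>2 * (C' * Vmax)" "E <= ep * C * S + 2 * ep * d + real n * ep\<^sup>2 * (C' * Vmax)" for E' E S d q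
    using that by (simp add: algebra_simps)
   ultimately have "mse ep (Suc n) <= ep * C * ((\<Sum>k<n. mse ep k) + mse ep n) + 2 * ep * drift_sum noise ep (Suc n) + (real n + 1) * ep\<^sup>2 * (C' * Vmax)" by simp
   moreover have "real (Suc n) = real n + 1" by simp
   ultimately show ?case by (simp only: sum.lessThan_Suc)
  qed
 qed
qed

text \<open>After multiplication by \<open>ep\<close> the noise contributes at most
  \<open>2 * T * \<eta>'\<close> plus terms of order \<open>ep\<close>; Gronwall costs the factor
  \<open>E\<close>. Half of \<open>\<eta>\<close> is reserved for each of the two
  contributions.\<close>

lemma mean_square_convergence:
 assumes \<eta>: "0 < \<eta>"
 shows "\<exists>ep0>0. \<forall>ep. 0 < ep --> ep < ep0 --> (\<forall>n\<le>horizon ep. mse ep n <= \<eta>)"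
proof -
 obtain C C' where C: "0 <= C" "0 <= C'" and step0: "\<forall>ep n. 0 < ep --> ep <= 1 --> n <= horizon ep -->
   mse ep n <= ep * C * (\<Sum>k<n. mse ep k)
    + 2 * ep * drift_sum noise ep n + real n * ep\<^sup>2 * C'"
  using err_expectation_step by (elim exE conjE) (rule that)
 note step = step0[THEN spec, THEN spec, THEN mp, THEN mp, THEN mp]
 define E where "E = exp (C * T)"
 have E: "0 < E" by (simp add: E_def)
 define \<eta>' where "\<eta>' = \<eta> / (4 * T * E)"
 have \<eta>': "0 < \<eta>'" "2 * T * \<eta>' * E = \<eta> / 2" using \<eta> T E by (auto simp: \<eta>'_def)
 obtain Q where Q0: "0 <= Q" and Q1: "\<forall>ep. 0 < ep --> ep <= 1 --> (\<forall>n\<le>horizon ep. \<bar>drift_sum noise ep n\<bar> <= Q + real n * (\<eta>' + Q * ep))"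
  using vanishing_noise[unfolded vanishing_def, THEN spec, THEN mp, OF \<eta>'(1)] by (elim exE conjE) (rule that)
 note Q = Q0 Q1[THEN spec, THEN mp, THEN mp, THEN spec, THEN mp]
 define S where "S = 2 * Q + 2 * T * Q + T * C'"
 have S: "0 <= S" using Q(1) T C by (simp add: S_def)
 define ep0 where "ep0 = min 1 (\<eta> / (2 * E * (S + 1)))"
 show ?thesis
 proof (intro exI[of _ ep0] conjI allI impI)
  show "0 < ep0" using \<eta> E S by (simp add: ep0_def)
  fix ep :: real and n assume e0: "0 < ep" "ep < ep0" and n: "n <= horizon ep"
  have e: "0 < ep" "ep <= 1" using e0 by (auto simp: ep0_def)
  have "ep * (2 * E * (S + 1)) <= \<eta>" using e0 E S by (simp add: ep0_def pos_less_divide_eq)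
  moreover have "ep * (2 * E * S) <= ep * (2 * E * (S + 1))" using e(1) E by (intro mult_left_mono) auto
  ultimately have small: "ep * S * E <= \<eta> / 2" by (simp add: algebra_simps)
  define K where "K = ep * S + 2 * T * \<eta>'"
  have K: "0 <= K" using e(1) S T \<eta>'(1) by (simp add: K_def)
  have rec: "mse ep m <= K + ep * C * (\<Sum>k<m. mse ep k)" if m: "m <= horizon ep" for m
  proof -
   have mT: "real m * ep <= T" by (rule horizon[OF e(1) m])
   have "2 * ep * drift_sum noise ep m <= 2 * ep * (Q + real m * (\<eta>' + Q * ep))"
    using Q(2)[OF e m] e(1) by (intro mult_left_mono) auto
   also have "... = 2 * ep * Q + 2 * (real m * ep) * (\<eta>' + Q * ep)" by (simp add: algebra_simps)
   also have "... <= 2 * ep * Q + 2 * T * (\<eta>' + Q * ep)"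
    using mT \<eta>'(1) Q(1) e(1) by (intro add_left_mono mult_right_mono) auto
   finally have 1: "2 * ep * drift_sum noise ep m <= 2 * ep * Q + 2 * T * (\<eta>' + Q * ep)" .
   have "real m * ep\<^sup>2 * C' = (real m * ep) * (ep * C')" by (simp add: power2_eq_square mult_ac)
   also have "... <= T * (ep * C')" using mT e(1) C by (intro mult_right_mono) auto
   finally have 2: "real m * ep\<^sup>2 * C' <= T * (ep * C')" .
   have "2 * ep * Q + 2 * T * (\<eta>' + Q * ep) + T * (ep * C') = K" by (simp add: K_def S_def algebra_simps)
   then show ?thesis using step[OF e m] 1 2 by linarith
  qed
  have eC: "0 <= ep * C" using e(1) C by simp
  have "mse ep n <= K * (1 + ep * C) ^ n" by (rule discrete_gronwall[OF eC rec n])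
  also have "... <= K * E"
  proof (rule mult_left_mono[OF _ K])
   have "(1 + ep * C) ^ n <= exp (ep * C) ^ n" using eC by (intro power_mono) auto
   also have "... = exp (C * (real n * ep))" by (simp add: exp_of_nat_mult[symmetric] mult_ac)
   also have "... <= E" unfolding E_def using mult_left_mono[OF horizon[OF e(1) n] C(1)] by simp
   finally show "(1 + ep * C) ^ n <= E" .
  qed
  also have "... = ep * S * E + 2 * T * \<eta>' * E" by (simp add: K_def algebra_simps)
  also have "... <= \<eta>" using small \<eta>'(2) by simp
  finally show "mse ep n <= \<eta>" .
 qed
qed

end

section \<open>Convergence on the path space\<close>

lemma interpolation_skorokhod:
 fixes y :: "nat => 'e::metric_space"
 assumes e: "0 < ep"
 shows "interpolation ep T y \<in> skorokhod_paths T"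
 unfolding skorokhod_paths_def mem_Collect_eq
proof (intro conjI ballI)
 let ?f = "interpolation ep T y"
 show "?f \<in> extensional {0..T}" by (simp add: interpolation_def)
 show "(?f \<longlongrightarrow> ?f t) (at_right t)" if t: "t \<in> {0..<T}" for t
 proof (rule tendsto_eventually, unfold eventually_at_right_field, intro exI conjI allI impI)
  let ?b = "min T ((of_int \<lfloor>t / ep\<rfloor> + 1) * ep)"
  have "t / ep < of_int \<lfloor>t / ep\<rfloor> + 1" by linarith
  from pos_divide_less_eq[THEN iffD1, OF e this] show "t < ?b" using t by simp
  fix s assume s: "t < s" "s < ?b"
  have "t / ep < s / ep" using s e by (simp add: divide_strict_right_mono)
  moreover have "s / ep < of_int \<lfloor>t / ep\<rfloor> + 1" using s e by (simp add: pos_divide_less_eq)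
  ultimately have "\<lfloor>s / ep\<rfloor> = \<lfloor>t / ep\<rfloor>" by linarith
  then show "?f s = ?f t" using s t by (simp add: interpolation_def)
 qed
 show "\<exists>l. (?f \<longlongrightarrow> l) (at_left t)" if t: "t \<in> {0<..T}" for t
 proof (intro exI, rule tendsto_eventually, unfold eventually_at_left_field, intro exI conjI allI impI)
  \<comment> \<open>Immediately to the left of \<open>t\<close> the index is the ceiling minus 1,
    also at a grid point, where the path jumps.\<close>
  let ?b = "max 0 ((of_int \<lceil>t / ep\<rceil> - 1) * ep)"
  have "of_int \<lceil>t / ep\<rceil> - 1 < t / ep" by linarith
  from pos_less_divide_eq[THEN iffD1, OF e this] show "?b < t" using t by simp
  fix s assume s: "?b < s" "s < t"
  have "s / ep < t / ep" using s e by (simp add: divide_strict_right_mono)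
  moreover have "of_int \<lceil>t / ep\<rceil> - 1 < s / ep" using s e by (simp add: pos_less_divide_eq)
  ultimately have "\<lfloor>s / ep\<rfloor> = \<lceil>t / ep\<rceil> - 1" by linarith
  then show "?f s = y (nat (\<lceil>t / ep\<rceil> - 1))" using s t by (simp add: interpolation_def)
 qed
qed

lemma continuous_skorokhod:
 fixes x :: "real => 'e::metric_space"
 assumes x: "x \<in> extensional {0..T}" and c: "continuous_on {0..T} x"
 shows "x \<in> skorokhod_paths T"
 unfolding skorokhod_paths_def mem_Collect_eq
proof (intro conjI ballI x)
 have lim: "(x \<longlongrightarrow> x t) (at t within S)" if "t \<in> {0..T}" "S \<subseteq> {0..T}" for t S
  using c that tendsto_within_subset unfolding continuous_on_def by blast
 show "(x \<longlongrightarrow> x t) (at_right t)" if t: "t \<in> {0..<T}" for t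
 proof -
  have eq: "at t within {t<..T} = at t within {t<..}"
   by (rule at_within_nhd[where S = "{..<T}"]) (use t in auto)
  have sub: "{t<..T} \<subseteq> {0..T}" using t by auto
  have "t \<in> {0..T}" using t by auto
  from lim[OF this sub] show ?thesis unfolding eq by (intro exI | assumption)+
 qed
 show "\<exists>l. (x \<longlongrightarrow> l) (at_left t)" if t: "t \<in> {0<..T}" for t
 proof -
  have eq: "at t within {0..<t} = at t within {..<t}"
   by (rule at_within_nhd[where S = "{0<..}"]) (use t in auto)
  have sub: "{0..<t} \<subseteq> {0..T}" using t by auto
  have "t \<in> {0..T}" using t by auto
  from lim[OF this sub] show ?thesis unfolding eq by (intro exI | assumption)+
 qed
qed

lemma skorokhod_dist_le_uniform:
 assumes "f \<in> skorokhod_paths T" "g \<in> skorokhod_paths T" "0 <= r" "\<And>t. t \<in> {0..T} ==> dist (f t) (g t) <= r"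
 shows "skorokhod_dist T f g <= r"
proof -
 have "skorokhod_close T f g r"
  unfolding skorokhod_close_def using time_change_id[of T] assms(3,4) by (intro conjI bexI[of _ "%t. t"]) auto
 moreover have "bdd_below {r. skorokhod_close T f g r}" by (rule bdd_belowI[of _ 0]) (auto simp: skorokhod_close_def)
 ultimately show ?thesis using assms(1,2) unfolding skorokhod_dist_def by (simp add: cInf_lower)
qed

context scheme
begin

text \<open>Later batches only append to the path, so a property of the past that holds almost
  surely at \<open>n\<close> persists.\<close>

lemma joint_prefix_induct:
 assumes e: "0 < ep" and P: "\<And>z. z \<in> set_pmf (J ep n) ==> P (fst z)"
  and pre: "\<And>om om'. (\<And>i. i <= n * N ==> om i = om' i) ==> P om = P om'"
 shows "n <= m ==> z \<in> set_pmf (J ep m) ==> P (fst z)"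
proof (induction m arbitrary: z rule: dec_induct)
 case base
 then show ?case by (rule P)
next
 case (step m)
 obtain y l where y: "y \<in> set_pmf (J ep m)" and z: "fst z = ext m (fst y) l" by (rule joint_Suc_cases[OF e step.prems])
 have "P (ext m (fst y) l) = P (fst y)"
 proof (rule pre)
  fix i assume "i <= n * N"
  also have "... <= m * N" using step.hyps by simp
  finally show "ext m (fst y) l i = fst y i" by (rule append_path_le)
 qed
 then show ?case using step.IH[OF y] z by simp
qed

text \<open>Appending batches leaves \<open>F\<close> unchanged, so the laws for different horizons
  are consistent on it.\<close>

lemma expectation_prefix:
 fixes F :: "('s, 'k) path => real"
 assumes e: "0 < ep" and pre: "\<forall>om om'. (\<forall>i\<le>n * N. om i = om' i) --> F om = F om'"
 shows "n <= m ==> expect (J ep m) (%z. F (fst z)) = expect (J ep n) (%z. F (fst z))"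
proof (induction m rule: dec_induct)
 case (step m)
 have "F (ext m om l) = F om" for om l
 proof (rule pre[THEN spec, THEN spec, THEN mp], intro allI impI)
  fix i assume "i <= n * N"
  also have "... <= m * N" using step.hyps by simp
  finally show "ext m om l i = om i" by (rule append_path_le)
 qed
 then show ?case unfolding joint_expectation_step[OF a_policy[OF e]] using step.IH by (simp add: seg_exp_def)
qed simp

lemma V_prefix: "(\<And>i. i <= n * N ==> om i = om' i) ==> V n om = V n om'"
 unfolding V_def using mem_prefix[of n N om om'] by simp

definition move :: "real => nat => ('s, 'k) path => real" where
 "move ep n om = dist (a ep (Suc n) om) (a ep n om) + dist (lam ep (Suc n) om) (lam ep n om)"

lemma move_bound:
 assumes e: "0 < ep" and n: "n < m" "m <= horizon ep" and z: "z \<in> set_pmf (J ep m)"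
 shows "move ep n (fst z) <= ep * ((Gmax + Bmax) * V n (fst z))"
proof (rule joint_prefix_induct[where n = "Suc n" and P = "%om. move ep n om <= ep * ((Gmax + Bmax) * V n om)", OF e _ _ _ z])
 show "Suc n <= m" using n by simp
 fix om om' :: "('s, 'k) path" assume eq: "\<And>i. i <= Suc n * N ==> om i = om' i"
 have eq': "om i = om' i" if "i <= n * N" for i using eq[of i] that by simp
 have vv: "V n om = V n om'" by (rule V_prefix) (rule eq')
 show "(move ep n om <= ep * ((Gmax + Bmax) * V n om)) = (move ep n om' <= ep * ((Gmax + Bmax) * V n om'))"
  unfolding move_def vv using scheme_cong[OF e, of "Suc n" om om', OF eq] scheme_cong[OF e, of n om om', OF eq'] by simp
next
 fix z assume "z \<in> set_pmf (J ep (Suc n))"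
 then obtain y l where y: "y \<in> set_pmf (J ep n)" and l: "l \<in> Bs" and z: "fst z = ext n (fst y) l" by (rule joint_Suc_cases[OF e])
 have nh: "n <= horizon ep" using n by simp
 have Vx: "V n (ext n (fst y) l) = V n (fst y)" by (rule V_prefix) (rule append_path_le)
 have "dist (lam ep (Suc n) (ext n (fst y) l)) (lam ep n (fst y)) = ep * norm (Bhat (map fst l))"
  unfolding lam_ext[OF e l] using e by (simp add: dist_norm)
 also have "... <= ep * (Bmax * V n (fst y))"
  using e Bmax(2)[OF l] mult_left_mono[OF V_ge(1)[of n "fst y"] Bmax(1)] by (intro mult_left_mono) auto
 finally have "dist (lam ep (Suc n) (ext n (fst y) l)) (lam ep n (fst y)) <= ep * (Bmax * V n (fst y))" .
 then show "move ep n (fst z) <= ep * ((Gmax + Bmax) * V n (fst z))"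
  using a_move[OF e nh y l] unfolding move_def z Vx scheme_ext[OF e] by (simp add: algebra_simps)
qed

lemma move_sum: "n <= m ==> dist (a ep m om) (a ep n om) + dist (lam ep m om) (lam ep n om) <= (\<Sum>k\<in>{n..<m}. move ep k om)"
proof (induction m rule: dec_induct)
 case (step m)
 have "dist (a ep (Suc m) om) (a ep n om) <= dist (a ep (Suc m) om) (a ep m om) + dist (a ep m om) (a ep n om)"
  "dist (lam ep (Suc m) om) (lam ep n om) <= dist (lam ep (Suc m) om) (lam ep m om) + dist (lam ep m om) (lam ep n om)"
  by (rule dist_triangle)+
 then show ?case using step by (simp add: move_def)
qed simp

lemma move_nonneg: "0 <= move ep n om" by (simp add: move_def)

text \<open>Cauchy-Schwarz contributes one factor \<open>card I\<close> and the sum another: the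
  second moment is quadratic in the time length \<open>ep * real (card I)\<close>, with no
  independence between batches involved.\<close>

lemma block_second_moment:
 assumes e: "0 < ep" and I: "finite I" "I \<subseteq> {..<horizon ep}"
 shows "expect (J ep (horizon ep)) (%z. (\<Sum>k\<in>I. move ep k (fst z))\<^sup>2)
  <= (ep * real (card I) * (Gmax + Bmax))\<^sup>2 * Vmax"
proof -
 let ?C = "Gmax + Bmax" and ?h = "horizon ep"
 have C: "0 <= ?C" using Gmax(1) Bmax(1) by simp
 note fin = finite_joint[OF a_policy[OF e], of \<nu> ?h]
 have "expect (J ep ?h) (%z. (\<Sum>k\<in>I. move ep k (fst z))\<^sup>2)
  <= expect (J ep ?h) (%z. real (card I) * (\<Sum>k\<in>I. (ep * ?C)\<^sup>2 * (V k (fst z))\<^sup>2))"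
 proof (rule expectation_mono_finite[OF fin])
  fix z assume z: "z \<in> set_pmf (J ep ?h)"
  have "(\<Sum>k\<in>I. move ep k (fst z))\<^sup>2 <= real (card I) * (\<Sum>k\<in>I. (move ep k (fst z))\<^sup>2)" by (rule sum_square_le[OF I(1)])
  also have "... <= real (card I) * (\<Sum>k\<in>I. (ep * ?C)\<^sup>2 * (V k (fst z))\<^sup>2)"
  proof (intro mult_left_mono sum_mono)
   fix k assume "k \<in> I"
   then have "move ep k (fst z) <= ep * (?C * V k (fst z))" using I(2) by (intro move_bound[OF e _ le_refl z]) auto
   then have "(move ep k (fst z))\<^sup>2 <= (ep * (?C * V k (fst z)))\<^sup>2" by (rule power_mono[OF _ move_nonneg])
   then show "(move ep k (fst z))\<^sup>2 <= (ep * ?C)\<^sup>2 * (V k (fst z))\<^sup>2" by (simp add: power_mult_distrib mult.assoc)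
  qed simp
  finally show "(\<Sum>k\<in>I. move ep k (fst z))\<^sup>2 <= real (card I) * (\<Sum>k\<in>I. (ep * ?C)\<^sup>2 * (V k (fst z))\<^sup>2)" .
 qed
 also have "... = real (card I) * (\<Sum>k\<in>I. (ep * ?C)\<^sup>2 * expect (J ep ?h) (%z. (V k (fst z))\<^sup>2))"
  unfolding integral_mult_right_zero expectation_sum_finite[OF fin] ..
 also have "... <= real (card I) * (\<Sum>k\<in>I. (ep * ?C)\<^sup>2 * Vmax)"
 proof (intro mult_left_mono sum_mono)
  fix k assume "k \<in> I"
  then have k: "k <= ?h" using I(2) by auto
  have "\<forall>om om'. (\<forall>i\<le>k * N. om i = om' i) --> (V k om)\<^sup>2 = (V k om')\<^sup>2"
   using V_prefix[of k] by metis
  from expectation_prefix[OF e this k] show "expect (J ep ?h) (%z. (V k (fst z))\<^sup>2) <= Vmax"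
   using Vmax(2)[OF e, of k] by simp
 qed auto
 also have "... = (ep * real (card I) * ?C)\<^sup>2 * Vmax" by (simp add: power2_eq_square mult_ac)
 finally show ?thesis .
qed

end

context scheme_solution
begin

lemma err_prefix:
 assumes "0 < ep"
 shows "\<forall>om om'. (\<forall>i\<le>n * N. om i = om' i) --> err ep n om = err ep n om'"
proof (intro allI impI)
 fix om om' :: "('s, 'k) path" assume "\<forall>i\<le>n * N. om i = om' i"
 then have "a ep n om = a ep n om' \<and> lam ep n om = lam ep n om'" by (intro scheme_cong assms) simp
 then show "err ep n om = err ep n om'" by (simp add: err_def)
qed

lemma pair_dist_le: "dist (p, q) (p', q') <= dist p p' + dist q q'"
 unfolding dist_Pair_Pair by (rule sqrt_sum_squares_le_sum) auto

lemma solution_path: "x \<in> skorokhod_paths T"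
proof (rule continuous_skorokhod)
 show "x \<in> extensional {0..T}" using sol by (simp add: is_sol_def)
 obtain K where K: "0 <= K" "\<And>s t. s \<in> {0..T} ==> t \<in> {0..T} ==> norm (X t - X s) <= K * \<bar>t - s\<bar>"
   "\<And>s t. s \<in> {0..T} ==> t \<in> {0..T} ==> norm (Y t - Y s) <= K * \<bar>t - s\<bar>"
  using solution_lipschitz by blast
 have "K-lipschitz_on {0..T} X" "K-lipschitz_on {0..T} Y"
  using K by (auto intro!: lipschitz_onI simp: dist_norm)
 then have "continuous_on {0..T} (%t. (X t, Y t))" by (intro continuous_on_Pair lipschitz_on_continuous_on)
 then show "continuous_on {0..T} x" by (simp add: X_def Y_def)
qed

definition deviates :: "real => real => ('s, 'k) path => bool" where
 "deviates ep r om \<longleftrightarrow> \<not> (\<forall>t\<in>{0..T}. dist (interpolation ep T (%n. (a ep n om, lam ep n om)) t) (x t) <= r)"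

text \<open>
 Blocks of length about \<open>\<delta> / ep\<close>: the path deviates only if, in some block, its displacement or its
 error at the left endpoint is large. One application of Markov's inequality to the sum over all
 blocks suffices, because the second moment of the displacement is of order \<open>\<delta>\<^sup>2\<close> and there are
 about \<open>T / \<delta>\<close> blocks.
\<close>

lemma deviation_bound:
 assumes e: "0 < ep" "ep <= \<delta>" and r: "0 < r" and \<eta>: "0 <= \<eta>"
  and K: "0 <= K" "\<And>s t. s \<in> {0..T} ==> t \<in> {0..T} ==> norm (X t - X s) <= K * \<bar>t - s\<bar>"
   "\<And>s t. s \<in> {0..T} ==> t \<in> {0..T} ==> norm (Y t - Y s) <= K * \<bar>t - s\<bar>"
  and small: "6 * K * \<delta> <= r / 2"
  and mse: "\<And>n. n <= horizon ep ==> mse ep n <= \<eta>"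
 shows "expect (J ep (horizon ep)) (%z. of_bool (deviates ep r (fst z)))
  <= 12 / r\<^sup>2 * ((T / \<delta> + 1) * ((2 * \<delta> * (Gmax + Bmax))\<^sup>2 * Vmax + \<eta>))"
proof -
 \<comment> \<open>Rounding up gives blocks of time length between \<open>\<delta>\<close> and
   \<open>2 * \<delta>\<close>, because \<open>ep <= \<delta>\<close>.\<close>
 define m where "m = nat \<lceil>\<delta> / ep\<rceil>"
 have d0: "0 < \<delta>" using e by simp
 have m: "\<delta> <= real m * ep" "real m * ep <= 2 * \<delta>" "0 < m"
 proof -
  have dl: "1 <= \<delta> / ep" using e by simp
  have mr: "real m = of_int \<lceil>\<delta> / ep\<rceil>" using dl unfolding m_def by (simp add: of_nat_nat)
  have "\<delta> / ep <= real m" "real m <= \<delta> / ep + 1" unfolding mr by linarith+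
  then show "\<delta> <= real m * ep" "real m * ep <= 2 * \<delta>" using e by (auto simp: field_simps)
  show "0 < m" using dl unfolding m_def by simp
 qed
 define h where "h = horizon ep"
 define blk where "blk j = {j * m..<Suc j * m} \<inter> {..<h}" for j
 have blk: "finite (blk j)" "blk j \<subseteq> {..<horizon ep}" "card (blk j) <= m" for j
 proof -
  show "finite (blk j)" "blk j \<subseteq> {..<horizon ep}" by (auto simp: blk_def h_def)
  have "card (blk j) <= card {j * m..<Suc j * m}" unfolding blk_def by (rule card_mono) auto
  then show "card (blk j) <= m" by simp
 qed
 define q where "q om = (\<Sum>j\<le>h div m. (\<Sum>k\<in>blk j. move ep k om)\<^sup>2 + err ep (j * m) om)" for om
 have err0: "0 <= err ep n om" for n om by (simp add: err_def)
 have q0: "0 <= q om" for om unfolding q_def by (intro sum_nonneg add_nonneg_nonneg err0) auto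
 \<comment> \<open>\<open>12 = 3 * 4\<close>: a factor 3 for the square of three summands and 4 for
   the threshold \<open>r / 2\<close>. The other half of \<open>r\<close> covers the motion of the
   solution, at most \<open>3 * K * \<delta>\<close> in each of \<open>X\<close> and
   \<open>Y\<close>.\<close>
 have close: "\<not> deviates ep r om" if q: "12 * q om <= r\<^sup>2" for om
  unfolding deviates_def not_not
 proof
  fix t assume t: "t \<in> {0..T}"
  define n where "n = nat \<lfloor>t / ep\<rfloor>"
  have t0: "0 <= t / ep" using t e by simp
  have nr: "real n = of_int \<lfloor>t / ep\<rfloor>" using t0 unfolding n_def by (simp add: of_nat_nat)
  have "real n <= t / ep" "t / ep < real n + 1" unfolding nr by linarith+
  then have nt: "real n * ep <= t" "t <= real n * ep + ep" using e by (auto simp: field_simps)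
  have nh: "n <= h" unfolding n_def h_def horizon_def using t e by (intro nat_mono floor_mono divide_right_mono) auto
  define j where "j = n div m"
  have jm: "j * m <= n" "n < Suc j * m" unfolding j_def using m(3) by (auto simp: dividend_less_times_div mult.commute)
  have jh: "j <= h div m" unfolding j_def by (rule div_le_mono[OF nh])
  have tn: "real n * ep \<in> {0..T}" using nt t e by auto
  have "real (j * m) * ep <= real n * ep" using jm(1) e by (intro mult_right_mono of_nat_mono) auto
  moreover have "0 <= real (j * m) * ep" using e by (intro mult_nonneg_nonneg of_nat_0_le_iff) auto
  ultimately have tj: "real (j * m) * ep \<in> {0..T}" using tn unfolding atLeastAtMost_iff by linarith
  have gap: "\<bar>real n * ep - real (j * m) * ep\<bar> <= 2 * \<delta>"
  proof -
   have "n <= m + j * m" using jm(2) by simp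
   then have "real n <= real m + real (j * m)" unfolding of_nat_add[symmetric] by (rule of_nat_mono)
   then have "real n - real (j * m) <= real m" by simp
   then have "(real n - real (j * m)) * ep <= real m * ep" using e by (intro mult_right_mono) auto
   moreover have "real (j * m) <= real n" using jm(1) by (rule of_nat_mono)
   then have "0 <= (real n - real (j * m)) * ep" using e(1) by simp
   ultimately show ?thesis using m(2) by (simp add: left_diff_distrib)
  qed
  let ?S = "\<Sum>k\<in>blk j. move ep k om"
  let ?D = "norm (a ep (j * m) om - X (real (j * m) * ep))" and ?M = "norm (lam ep (j * m) om - Y (real (j * m) * ep))"
  have qb: "?S\<^sup>2 + err ep (j * m) om <= q om"
   unfolding q_def
   by (rule member_le_sum[where f = "%j. (\<Sum>k\<in>blk j. move ep k om)\<^sup>2 + err ep (j * m) om"]) (use jh err0 in auto)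
  have "12 * (?S\<^sup>2 + err ep (j * m) om) <= 12 * q om" by (rule mult_left_mono[OF qb]) simp
  from order_trans[OF this q] have sq: "12 * (?S\<^sup>2 + (?D\<^sup>2 + ?M\<^sup>2)) <= r\<^sup>2" unfolding err_def .
  have "(?S + ?D + ?M)\<^sup>2 <= 3 * (?S\<^sup>2 + (?D\<^sup>2 + ?M\<^sup>2))"
   using sum_squares_bound[of ?S ?D] sum_squares_bound[of ?S ?M] sum_squares_bound[of ?D ?M] by (simp add: power2_eq_square algebra_simps)
  then have "(?S + ?D + ?M)\<^sup>2 <= (r / 2)\<^sup>2" using sq by (simp add: power_divide)
  then have main: "?S + ?D + ?M <= r / 2" by (rule power2_le_imp_le) (use r in simp)
  have "(\<Sum>k\<in>{j * m..<n}. move ep k om) <= ?S"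
   by (rule sum_mono2[OF blk(1)]) (use jm nh move_nonneg in \<open>auto simp: blk_def\<close>)
  then have mv: "dist (a ep n om) (a ep (j * m) om) + dist (lam ep n om) (lam ep (j * m) om) <= ?S"
   using move_sum[OF jm(1), of ep om] by linarith
  have kk: "K * \<bar>real n * ep - real (j * m) * ep\<bar> <= 2 * K * \<delta>" "K * \<bar>t - real n * ep\<bar> <= K * \<delta>"
   using mult_left_mono[OF gap K(1)] mult_left_mono[of "\<bar>t - real n * ep\<bar>" \<delta> K] nt e K(1) by (auto simp: mult_ac)
  have "dist (interpolation ep T (%n. (a ep n om, lam ep n om)) t) (x t) = dist (a ep n om, lam ep n om) (X t, Y t)"
   using t by (simp add: interpolation_def n_def X_def Y_def)
  also have "... <= dist (a ep n om) (X t) + dist (lam ep n om) (Y t)" by (rule pair_dist_le)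
  also have "... <= r"
  proof -
   have "dist (a ep n om) (X t) <= dist (a ep n om) (a ep (j * m) om) + ?D + norm (X (real n * ep) - X (real (j * m) * ep)) + norm (X t - X (real n * ep))"
    using dist_triangle[of "a ep n om" "X t" "a ep (j * m) om"] dist_triangle[of "a ep (j * m) om" "X t" "X (real (j * m) * ep)"]
     dist_triangle[of "X (real (j * m) * ep)" "X t" "X (real n * ep)"]
    unfolding dist_norm norm_minus_commute[of "X (real (j * m) * ep)" "X (real n * ep)"] norm_minus_commute[of "X (real n * ep)" "X t"] by linarith
   moreover have "dist (lam ep n om) (Y t) <= dist (lam ep n om) (lam ep (j * m) om) + ?M + norm (Y (real n * ep) - Y (real (j * m) * ep)) + norm (Y t - Y (real n * ep))"
    using dist_triangle[of "lam ep n om" "Y t" "lam ep (j * m) om"] dist_triangle[of "lam ep (j * m) om" "Y t" "Y (real (j * m) * ep)"]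
     dist_triangle[of "Y (real (j * m) * ep)" "Y t" "Y (real n * ep)"]
    unfolding dist_norm norm_minus_commute[of "Y (real (j * m) * ep)" "Y (real n * ep)"] norm_minus_commute[of "Y (real n * ep)" "Y t"] by linarith
   ultimately show ?thesis
    using K(2)[OF tj tn] K(3)[OF tj tn] K(2)[OF tn t] K(3)[OF tn t] kk mv main small by linarith
  qed
  finally show "dist (interpolation ep T (%n. (a ep n om, lam ep n om)) t) (x t) <= r" .
 qed
 note fin = finite_joint[OF a_policy[OF e(1)], of \<nu> h]
 have "expect (J ep h) (%z. of_bool (deviates ep r (fst z))) <= expect (J ep h) (%z. 12 / r\<^sup>2 * q (fst z))"
 proof (rule expectation_mono_finite[OF fin])
  fix z
  show "of_bool (deviates ep r (fst z)) <= 12 / r\<^sup>2 * q (fst z)"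
  proof (cases "deviates ep r (fst z)")
   case True
   then have "r\<^sup>2 <= 12 * q (fst z)" using close[of "fst z"] by linarith
   then show ?thesis using True r by (simp add: field_simps)
  qed (use q0 r in simp)
 qed
 also have "... = 12 / r\<^sup>2 * (\<Sum>j\<le>h div m. expect (J ep h) (%z. (\<Sum>k\<in>blk j. move ep k (fst z))\<^sup>2) + expect (J ep h) (%z. err ep (j * m) (fst z)))"
  unfolding integral_mult_right_zero q_def expectation_sum_finite[OF fin] expectation_add_finite[OF fin] ..
 also have "... <= 12 / r\<^sup>2 * (\<Sum>j\<le>h div m. (2 * \<delta> * (Gmax + Bmax))\<^sup>2 * Vmax + \<eta>)"
 proof (intro mult_left_mono sum_mono add_mono)
  fix j assume "j \<in> {..h div m}"
  then have "j * m <= h div m * m" by (intro mult_right_mono) auto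
  then have jh: "j * m <= h" using div_times_less_eq_dividend[of h m] by linarith
  have C: "0 <= Gmax + Bmax" using Gmax(1) Bmax(1) by simp
  have "ep * real (card (blk j)) <= real m * ep" using blk(3)[of j] e by (simp add: mult.commute)
  then have "ep * real (card (blk j)) <= 2 * \<delta>" using m(2) by linarith
  then have "(ep * real (card (blk j)) * (Gmax + Bmax))\<^sup>2 <= (2 * \<delta> * (Gmax + Bmax))\<^sup>2"
   using C e by (intro power_mono mult_right_mono) auto
  then have "(ep * real (card (blk j)) * (Gmax + Bmax))\<^sup>2 * Vmax <= (2 * \<delta> * (Gmax + Bmax))\<^sup>2 * Vmax" by (rule mult_right_mono[OF _ Vmax(1)])
  then show "expect (J ep h) (%z. (\<Sum>k\<in>blk j. move ep k (fst z))\<^sup>2) <= (2 * \<delta> * (Gmax + Bmax))\<^sup>2 * Vmax"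
   using block_second_moment[OF e(1) blk(1,2)[of j]] unfolding h_def by linarith
  show "expect (J ep h) (%z. err ep (j * m) (fst z)) <= \<eta>"
   using expectation_prefix[OF e(1) err_prefix[OF e(1)] jh] mse[of "j * m"] jh unfolding h_def by simp
 qed (use r in simp)
 also have "... = 12 / r\<^sup>2 * ((real (h div m) + 1) * ((2 * \<delta> * (Gmax + Bmax))\<^sup>2 * Vmax + \<eta>))" by (simp add: add.commute)
 also have "... <= 12 / r\<^sup>2 * ((T / \<delta> + 1) * ((2 * \<delta> * (Gmax + Bmax))\<^sup>2 * Vmax + \<eta>))"
 proof (intro mult_left_mono mult_right_mono add_right_mono)
  have "real (h div m) * \<delta> <= real (h div m) * (real m * ep)" by (intro mult_left_mono m) auto
  also have "... = real (h div m * m) * ep" by simp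
  also have "... <= T" by (rule horizon[OF e(1)]) (simp add: h_def)
  finally show "real (h div m) <= T / \<delta>" using d0 by (simp add: pos_le_divide_eq)
  show "0 <= (2 * \<delta> * (Gmax + Bmax))\<^sup>2 * Vmax + \<eta>" using Vmax(1) \<eta> by simp
 qed (use r in simp)
 finally show ?thesis unfolding h_def .
qed

text \<open>Radius and probability fix \<open>\<delta>\<close>, which makes the displacement term
  small; \<open>\<delta>\<close> then fixes the accuracy \<open>\<eta>\<close> of the mean square
  bound, and that fixes \<open>ep0\<close>. The order matters because \<open>\<eta>\<close> is
  multiplied by the number of blocks, about \<open>T / \<delta>\<close>.\<close>

lemma uniform_convergence:
 fixes r p :: real
 assumes r: "0 < r" and p: "0 < p"
 shows "\<exists>ep0>0. \<forall>ep. 0 < ep --> ep < ep0 -->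
  expect (J ep (horizon ep)) (%z. of_bool (deviates ep r (fst z))) <= p"
proof -
 obtain K where K: "0 <= K" "\<And>s t. s \<in> {0..T} ==> t \<in> {0..T} ==> norm (X t - X s) <= K * \<bar>t - s\<bar>"
   "\<And>s t. s \<in> {0..T} ==> t \<in> {0..T} ==> norm (Y t - Y s) <= K * \<bar>t - s\<bar>"
  using solution_lipschitz by blast
 define A where "A = 12 / r\<^sup>2"
 define B where "B = 4 * (Gmax + Bmax)\<^sup>2 * Vmax"
 have A: "0 < A" and B: "0 <= B" using r Vmax(1) by (auto simp: A_def B_def)
 \<comment> \<open>The second bound keeps the motion of the solution below \<open>r / 2\<close>, the
   third makes the displacement term at most \<open>p / 2\<close>; \<open>K + 1\<close> and
   \<open>B + 1\<close> avoid division by 0.\<close>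
 define \<delta> where "\<delta> = min 1 (min (r / (12 * (K + 1))) (p / (2 * A * (T + 1) * (B + 1))))"
 have d: "0 < \<delta>" "\<delta> <= 1" "\<delta> <= r / (12 * (K + 1))" "\<delta> <= p / (2 * A * (T + 1) * (B + 1))"
  using r p A B T K(1) by (auto simp: \<delta>_def)
 have small: "6 * K * \<delta> <= r / 2"
 proof -
  have "\<delta> * (12 * (K + 1)) <= r" using d(3) K(1) by (simp add: pos_le_divide_eq)
  then show ?thesis using d(1) by (simp add: algebra_simps)
 qed
 define \<eta> where "\<eta> = p / (2 * A * (T / \<delta> + 1))"
 have \<eta>: "0 < \<eta>" "A * ((T / \<delta> + 1) * \<eta>) = p / 2"
 proof -
  have pos: "0 < T / \<delta> + 1" using T d(1) by (simp add: add_pos_pos)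
  show "0 < \<eta>" using p A pos by (simp add: \<eta>_def)
  show "A * ((T / \<delta> + 1) * \<eta>) = p / 2" using A pos by (simp add: \<eta>_def)
 qed
 have first: "A * ((T / \<delta> + 1) * ((2 * \<delta> * (Gmax + Bmax))\<^sup>2 * Vmax)) <= p / 2"
 proof -
  have "(T / \<delta> + 1) * ((2 * \<delta> * (Gmax + Bmax))\<^sup>2 * Vmax) = ((T + \<delta>) * B) * \<delta>"
   using d(1) by (simp add: B_def power2_eq_square field_simps)
  also have "... <= ((T + 1) * (B + 1)) * \<delta>" using d B T by (intro mult_right_mono mult_mono) auto
  finally have "A * ((T / \<delta> + 1) * ((2 * \<delta> * (Gmax + Bmax))\<^sup>2 * Vmax)) <= A * (((T + 1) * (B + 1)) * \<delta>)" using A by (intro mult_left_mono) auto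
  moreover have "\<delta> * (2 * A * (T + 1) * (B + 1)) <= p"
   using d(4) A B T by (simp add: pos_le_divide_eq)
  then have "A * (((T + 1) * (B + 1)) * \<delta>) <= p / 2" by (simp add: mult_ac)
  ultimately show ?thesis by linarith
 qed
 obtain ep1 where e1: "0 < ep1" "\<And>ep n. 0 < ep ==> ep < ep1 ==> n <= horizon ep ==> mse ep n <= \<eta>"
  using mean_square_convergence[OF \<eta>(1)] by blast
 show ?thesis
 proof (intro exI[of _ "min ep1 \<delta>"] conjI allI impI)
  show "0 < min ep1 \<delta>" using e1 d by simp
  fix ep :: real assume e: "0 < ep" "ep < min ep1 \<delta>"
  have "expect (J ep (horizon ep)) (%z. of_bool (deviates ep r (fst z)))
   <= 12 / r\<^sup>2 * ((T / \<delta> + 1) * ((2 * \<delta> * (Gmax + Bmax))\<^sup>2 * Vmax + \<eta>))"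
   by (rule deviation_bound[OF e(1) _ r _ K small]) (use e \<eta>(1) e1(2)[OF e(1)] in auto)
  also have "... = A * ((T / \<delta> + 1) * ((2 * \<delta> * (Gmax + Bmax))\<^sup>2 * Vmax)) + A * ((T / \<delta> + 1) * \<eta>)"
   unfolding A_def by (simp add: distrib_left)
  also have "... <= p" using first \<eta>(2) by linarith
  finally show "expect (J ep (horizon ep)) (%z. of_bool (deviates ep r (fst z))) <= p" .
 qed
qed

text \<open>The limit is a single path, so continuity of \<open>f\<close> at \<open>x\<close> is the
  point: paths uniformly close to \<open>x\<close> give close values, and the remaining event is
  rare by \<open>uniform_convergence\<close> and costs at most \<open>2 * B\<close>.\<close>

lemma converges_to_solution:
 "converges_in_distribution (skorokhod_topology T)
   (%ep. map_pmf (%om. interpolation ep T (%n. (a ep n om, lam ep n om)))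
      (path_law M N \<nu> (a ep) (nat \<lfloor>T / ep\<rfloor> * N)))
   (return_pmf x) (at_right 0)"
 unfolding converges_in_distribution_def topspace_skorokhod
proof (intro conjI allI impI)
 let ?p = "%ep om. interpolation ep T (%n. (a ep n om, lam ep n om))"
 show "\<forall>\<^sub>F ep in at_right 0. set_pmf (map_pmf (?p ep) (path_law M N \<nu> (a ep) (nat \<lfloor>T / ep\<rfloor> * N))) \<subseteq> skorokhod_paths T"
  unfolding eventually_at_right_field by (intro exI[of _ 1]) (auto intro: interpolation_skorokhod)
 show "set_pmf (return_pmf x) \<subseteq> skorokhod_paths T" using solution_path by simp
 fix f :: "(real => (real ^ 'k) \<times> (real ^ 'l)) => real"
 assume f: "continuous_map (skorokhod_topology T) euclideanreal f \<and> bounded (f ` skorokhod_paths T)"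
 obtain B where B: "\<And>y. y \<in> skorokhod_paths T ==> \<bar>f y\<bar> <= B"
  using conjunct2[OF f] unfolding bounded_iff by auto
 have B0: "0 <= B" using B[OF solution_path] by simp
 show "((%ep. expect (map_pmf (?p ep) (path_law M N \<nu> (a ep) (nat \<lfloor>T / ep\<rfloor> * N))) f)
   \<longlongrightarrow> expect (return_pmf x) f) (at_right 0)"
 proof (rule tendstoI)
  fix \<kappa> :: real assume \<kappa>: "0 < \<kappa>"
  have "\<forall>U. openin euclideanreal U \<and> f x \<in> U --> (\<exists>r>0. \<forall>y. y \<in> skorokhod_paths T \<and> skorokhod_dist T x y < r --> f y \<in> U)"
   using conjunct1[OF f, unfolded skorokhod_topology_def Metric_space.continuous_map_from_metric[OF skorokhod_metric]] solution_path by blast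
  from this[THEN spec, of "ball (f x) (\<kappa> / 2)"] obtain r where r: "0 < r"
    "\<And>y. y \<in> skorokhod_paths T ==> skorokhod_dist T x y < r ==> \<bar>f x - f y\<bar> < \<kappa> / 2"
   using \<kappa> by (auto simp: dist_real_def)
  define p where "p = \<kappa> / (4 * (B + 1))"
  have p: "0 < p" "2 * B * p < \<kappa> / 2"
   using \<kappa> B0 by (auto simp: p_def field_simps)
  \<comment> \<open>Half the radius, because the uniform bound is weak while the continuity
    condition is a strict inequality.\<close>
  have r2: "0 < r / 2" using r(1) by simp
  obtain ep0 where e0: "0 < ep0" and dev: "\<And>ep. 0 < ep ==> ep < ep0 ==>
    expect (J ep (horizon ep)) (%z. of_bool (deviates ep (r / 2) (fst z))) <= p"
   using uniform_convergence[OF r2 p(1)] by blast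
  show "\<forall>\<^sub>F ep in at_right 0. dist (expect (map_pmf (?p ep) (path_law M N \<nu> (a ep) (nat \<lfloor>T / ep\<rfloor> * N))) f)
    (expect (return_pmf x) f) < \<kappa>"
   unfolding eventually_at_right_field
  proof (intro exI[of _ ep0] conjI allI impI e0)
   fix ep :: real assume e: "0 < ep" "ep < ep0"
   let ?E = "expect (J ep (horizon ep))"
   note fin = finite_joint[OF a_policy[OF e(1)], of \<nu> "horizon ep"]
   have "\<bar>?E (%z. f (?p ep (fst z)) - f x)\<bar> <= ?E (%z. \<kappa> / 2 + 2 * B * of_bool (deviates ep (r / 2) (fst z)))"
   proof (rule expectation_abs_le_finite[OF fin])
    fix z :: "('s, 'k) path \<times> 's"
    let ?y = "?p ep (fst z)"
    have y: "?y \<in> skorokhod_paths T" by (rule interpolation_skorokhod[OF e(1)])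
    show "\<bar>f ?y - f x\<bar> <= \<kappa> / 2 + 2 * B * of_bool (deviates ep (r / 2) (fst z))"
    proof (cases "deviates ep (r / 2) (fst z)")
     case True
     then show ?thesis using B[OF y] B[OF solution_path] \<kappa> by simp
    next
     case False
     then have "skorokhod_dist T x ?y <= r / 2"
      using r(1) by (intro skorokhod_dist_le_uniform solution_path y) (auto simp: deviates_def dist_commute)
     then have "\<bar>f x - f ?y\<bar> < \<kappa> / 2" using r(1) by (intro r(2) y) simp
     then show ?thesis using False by (simp add: abs_minus_commute)
    qed
   qed
   also have "... = \<kappa> / 2 + 2 * B * ?E (%z. of_bool (deviates ep (r / 2) (fst z)))"
    unfolding expectation_add_finite[OF fin] integral_mult_right_zero expectation_const ..
   also have "... <= \<kappa> / 2 + 2 * B * p" using dev[OF e] B0 by (intro add_left_mono mult_left_mono) auto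
   also have "... < \<kappa>" using p(2) by simp
   finally have "\<bar>?E (%z. f (?p ep (fst z)) - f x)\<bar> < \<kappa>" .
   then show "dist (expect (map_pmf (?p ep) (path_law M N \<nu> (a ep) (nat \<lfloor>T / ep\<rfloor> * N))) f)
    (expect (return_pmf x) f) < \<kappa>"
    unfolding dist_real_def horizon_def[symmetric] path_law_joint map_pmf_comp integral_map_pmf
     expectation_diff_finite[OF fin] expectation_const by simp
  qed
 qed
qed

end

context scheme
begin

text \<open>Both solutions are mean square limits of the same algorithm, so at each time their
  squared distance is bounded by twice the sum of two vanishing errors.\<close>

lemma solution_unique:
 assumes "is_sol x" "is_sol x'"
 shows "x = x'"
proof -
 interpret S: scheme_solution M \<mu> N c \<beta> \<gamma> Bhat \<Gamma>c \<Gamma>\<beta> \<rho> T \<alpha>0 lam0 \<nu> a lam x by unfold_locales (rule assms)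
 interpret S': scheme_solution M \<mu> N c \<beta> \<gamma> Bhat \<Gamma>c \<Gamma>\<beta> \<rho> T \<alpha>0 lam0 \<nu> a lam x' by unfold_locales (rule assms)
 have eq: "S.X t = S'.X t \<and> S.Y t = S'.Y t" if t: "t \<in> {0..T}" for t
 proof (cases "t = 0")
  case True
  then show ?thesis by (simp add: S.sol_start S'.sol_start)
 next
  case False
  then have t0: "0 < t" using t by simp
  let ?c = "(norm (S.X t - S'.X t))\<^sup>2 + (norm (S.Y t - S'.Y t))\<^sup>2"
  have "?c <= 0 + \<eta>" if \<eta>: "0 < \<eta>" for \<eta>
  proof -
   have \<eta>4: "0 < \<eta> / 4" using \<eta> by simp
   obtain e1 where e1: "0 < e1" "\<And>ep n. 0 < ep ==> ep < e1 ==> n <= horizon ep ==> S.mse ep n <= \<eta> / 4"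
    using S.mean_square_convergence[OF \<eta>4] by blast
   obtain e2 where e2: "0 < e2" "\<And>ep n. 0 < ep ==> ep < e2 ==> n <= horizon ep ==> S'.mse ep n <= \<eta> / 4"
    using S'.mean_square_convergence[OF \<eta>4] by blast
   \<comment> \<open>The step size \<open>t / n\<close> makes \<open>t\<close> itself a grid time,
     so the errors compare the solutions exactly at \<open>t\<close>; \<open>n\<close> is large
     enough to put the step below both thresholds.\<close>
   obtain n where n: "t / min e1 e2 < real n" using reals_Archimedean2 by blast
   have m0: "0 < min e1 e2" using e1 e2 by simp
   then have n0: "0 < real n" using n t0 by (smt (verit) divide_pos_pos)
   define ep where "ep = t / real n"
   have e: "0 < ep" using t0 n0 by (simp add: ep_def)
   have "t < real n * min e1 e2" using n m0 by (simp only: pos_divide_less_eq)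
   then have lt: "ep < min e1 e2" using n0 by (simp only: ep_def pos_divide_less_eq mult.commute)
   have nt: "real n * ep = t" using n0 by (simp add: ep_def)
   have "t / ep = real n" using t0 by (simp add: ep_def)
   then have "n = nat \<lfloor>t / ep\<rfloor>" by simp
   also have "... <= horizon ep" unfolding horizon_def using t e by (intro nat_mono floor_mono divide_right_mono) auto
   finally have nh: "n <= horizon ep" .
   note fin = finite_joint[OF a_policy[OF e], of \<nu> n]
   have sq: "(norm (p - q))\<^sup>2 <= 2 * (norm (u - p))\<^sup>2 + 2 * (norm (u - q))\<^sup>2" for u p q :: "real ^ 'n::finite"
   proof -
    have "norm (p - q) <= norm (u - p) + norm (u - q)"
     using norm_triangle_ineq4[of "u - q" "u - p"] by simp
    then have "(norm (p - q))\<^sup>2 <= (norm (u - p) + norm (u - q))\<^sup>2" by (rule power_mono) simp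
    then show ?thesis using sum_squares_bound[of "norm (u - p)" "norm (u - q)"] by (simp add: power2_sum)
   qed
   have "?c = expect (J ep n) (%_. ?c)" by simp
   also have "... <= expect (J ep n) (%z. 2 * S.err ep n (fst z) + 2 * S'.err ep n (fst z))"
   proof (rule expectation_mono_finite[OF fin])
    fix z :: "('s, 'k) path \<times> 's"
    show "?c <= 2 * S.err ep n (fst z) + 2 * S'.err ep n (fst z)"
     unfolding S.err_def S'.err_def nt
     using add_mono[OF sq[of "S.X t" "S'.X t" "a ep n (fst z)"] sq[of "S.Y t" "S'.Y t" "lam ep n (fst z)"]] by (simp add: algebra_simps)
   qed
   also have "... = 2 * S.mse ep n + 2 * S'.mse ep n"
    unfolding expectation_add_finite[OF fin] integral_mult_right_zero ..
   also have "... <= \<eta>" using e1(2)[OF e _ nh] e2(2)[OF e _ nh] lt by simp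
   finally show ?thesis by simp
  qed
  then have "?c <= 0" by (rule field_le_epsilon)
  then show ?thesis using zero_le_power2[of "norm (S.X t - S'.X t)"] zero_le_power2[of "norm (S.Y t - S'.Y t)"]
   by (simp add: sum_power2_le_zero_iff)
 qed
 show ?thesis
 proof (rule extensionalityI[of x "{0..T}"])
  show "x \<in> extensional {0..T}" "x' \<in> extensional {0..T}" using assms by (auto simp: is_sol_def)
  show "x t = x' t" if "t \<in> {0..T}" for t
   using eq[OF that] unfolding S.X_def S'.X_def S.Y_def S'.Y_def by (simp add: prod_eq_iff)
 qed
qed

end

theorem proposition1:
  fixes M :: "('s::finite, 'k::finite) ctrl_chain"
    and c :: "'s \<times> nat \<Rightarrow> real" and \<beta> :: "'l::finite \<Rightarrow> 's \<times> nat \<Rightarrow> real" and \<gamma> :: "real ^ 'l"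
    and Bhat :: "('s \<times> nat) list \<Rightarrow> real ^ 'l"
    and \<Gamma>c :: "('s \<times> nat) list \<Rightarrow> real" and \<Gamma>\<beta> :: "'l \<Rightarrow> ('s \<times> nat) list \<Rightarrow> real"
    and \<mu> \<rho> T :: real and N :: nat and \<nu> :: "'s pmf"
    and \<alpha>0 :: "real ^ 'k" and lam0 :: "real ^ 'l"
    and a :: "real \<Rightarrow> nat \<Rightarrow> ('s, 'k) path \<Rightarrow> real ^ 'k"
    and lam :: "real \<Rightarrow> nat \<Rightarrow> ('s, 'k) path \<Rightarrow> real ^ 'l"
  defines "B \<equiv> constraint_mean M \<beta> \<gamma>"
    and "h0 \<equiv> inv_grad M N c \<Gamma>c"
    and "h \<equiv> (\<lambda>l. inv_grad M N (\<beta> l) (\<Gamma>\<beta> l))"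
    and "\<kappa> \<equiv> kappa M N \<rho> \<beta> \<Gamma>\<beta> Bhat"
  defines "is_solution \<equiv> (\<lambda>x :: real \<Rightarrow> (real ^ 'k) \<times> (real ^ 'l).
        x \<in> extensional {0..T} \<and> x 0 = (\<alpha>0, lam0) \<and>
        solves_truncated (param_box \<mu>) T
          (\<lambda>t. h0 (fst (x t))
             + (\<Sum>l\<in>UNIV. (snd (x t) $ l + \<rho> * B (fst (x t)) $ l) *\<^sub>R h l (fst (x t)))
             + \<kappa> (fst (x t)))
          (\<lambda>t. fst (x t)) \<and>
        (\<forall>t\<in>{0..T}. ((\<lambda>s. snd (x s)) has_vector_derivative B (fst (x t))) (at t within {0..T})))"
  assumes wf: "wf_ctrl_chain M"
    and ergodic: "\<forall>\<alpha>\<in>open_params. irreducible_on (state_acts M) (pair_kernel M \<alpha>)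
                                 \<and> aperiodic_on (state_acts M) (pair_kernel M \<alpha>)"
    and unbiased: "\<forall>\<alpha>\<in>open_params. \<forall>n. stat_exp M N \<alpha> n (\<lambda>\<omega>. Bhat (batch_obs N n \<omega>)) = B \<alpha>"
    and \<mu>: "0 < \<mu>" "\<mu> < pi / 4" and \<rho>: "0 < \<rho>" and N: "1 \<le> N" and T: "0 < T"
    and \<alpha>0: "\<alpha>0 \<in> param_box \<mu>"
    and a_0: "\<And>\<epsilon> \<omega>. 0 < \<epsilon> \<Longrightarrow> a \<epsilon> 0 \<omega> = \<alpha>0"
    and a_Suc: "\<And>\<epsilon> n \<omega>. 0 < \<epsilon> \<Longrightarrow> a \<epsilon> (Suc n) \<omega> = closest_point (param_box \<mu>)
          (a \<epsilon> n \<omega> - \<epsilon> *\<^sub>R (grad_est M N c \<Gamma>c (a \<epsilon> n \<omega>) n \<omega>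
             + (\<Sum>l\<in>UNIV. (lam \<epsilon> n \<omega> $ l + \<rho> * Bhat (batch_obs N n \<omega>) $ l)
                           *\<^sub>R grad_est M N (\<beta> l) (\<Gamma>\<beta> l) (a \<epsilon> n \<omega>) n \<omega>)))"
    and lam_0: "\<And>\<epsilon> \<omega>. 0 < \<epsilon> \<Longrightarrow> lam \<epsilon> 0 \<omega> = lam0"
    and lam_Suc: "\<And>\<epsilon> n \<omega>. 0 < \<epsilon> \<Longrightarrow>
          lam \<epsilon> (Suc n) \<omega> = lam \<epsilon> n \<omega> + \<epsilon> *\<^sub>R Bhat (batch_obs N n \<omega>)"
  shows "(\<forall>\<alpha>\<in>param_box \<mu>.
            convergent (\<lambda>n. stat_exp M N \<alpha> n (grad_est M N c \<Gamma>c \<alpha> n)) \<and>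
            (\<forall>l. convergent (\<lambda>n. stat_exp M N \<alpha> n (grad_est M N (\<beta> l) (\<Gamma>\<beta> l) \<alpha> n))) \<and>
            convergent (cov_sum M N \<beta> \<Gamma>\<beta> Bhat \<alpha>)) \<and>
         (\<exists>!x. is_solution x) \<and>
         (\<forall>x. is_solution x \<longrightarrow>
            converges_in_distribution (skorokhod_topology T)
              (\<lambda>\<epsilon>. map_pmf (\<lambda>\<omega>. interpolation \<epsilon> T (\<lambda>n. (a \<epsilon> n \<omega>, lam \<epsilon> n \<omega>)))
                     (path_law M N \<nu> (a \<epsilon>) (nat \<lfloor>T / \<epsilon>\<rfloor> * N)))
              (return_pmf x) (at_right 0))"
proof -
 interpret scheme M \<mu> N c \<beta> \<gamma> Bhat \<Gamma>c \<Gamma>\<beta> \<rho> T \<alpha>0 lam0 \<nu> a lam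
 proof
  show "wf_ctrl_chain M" by (rule wf)
  show "0 < \<mu>" "\<mu> < pi / 4" by (rule \<mu>)+
  show "1 <= N" by (rule N)
  show "irreducible_on (state_acts M) (pair_kernel M \<alpha>)" "aperiodic_on (state_acts M) (pair_kernel M \<alpha>)" if "\<alpha> \<in> open_params" for \<alpha>
   using ergodic that by blast+
  show "stat_exp M N \<alpha> n (%om. Bhat (batch_obs N n om)) = constraint_mean M \<beta> \<gamma> \<alpha>" if "\<alpha> \<in> open_params" for \<alpha> n
   using unbiased that unfolding B_def by blast
  show "0 < T" by (rule T)
  show "\<alpha>0 \<in> param_box \<mu>" by (rule \<alpha>0)
 qed (fact a_0 a_Suc lam_0 lam_Suc)+
 have sol: "is_solution = is_sol"
  by (intro ext) (simp only: is_solution_def is_sol_def B_def h0_def h_def \<kappa>_def)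
 have conv: "converges_in_distribution (skorokhod_topology T)
   (%ep. map_pmf (%om. interpolation ep T (%n. (a ep n om, lam ep n om))) (path_law M N \<nu> (a ep) (nat \<lfloor>T / ep\<rfloor> * N)))
   (return_pmf x) (at_right 0)" if "is_sol x" for x
 proof -
  interpret scheme_solution M \<mu> N c \<beta> \<gamma> Bhat \<Gamma>c \<Gamma>\<beta> \<rho> T \<alpha>0 lam0 \<nu> a lam x by unfold_locales (rule that)
  show ?thesis by (rule converges_to_solution)
 qed
 show ?thesis
  unfolding sol
 proof (intro conjI ballI allI impI conv)
  show "convergent (%n. stat_exp M N \<alpha> n (grad_est M N c \<Gamma>c \<alpha> n))" if "\<alpha> \<in> param_box \<mu>" for \<alpha>
   by (rule grad_convergent[OF that])
  show "convergent (%n. stat_exp M N \<alpha> n (grad_est M N (\<beta> l) (\<Gamma>\<beta> l) \<alpha> n))" if "\<alpha> \<in> param_box \<mu>" for \<alpha> l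
   by (rule grad_convergent[OF that])
  show "convergent (cov_sum M N \<beta> \<Gamma>\<beta> Bhat \<alpha>)" if "\<alpha> \<in> param_box \<mu>" for \<alpha>
   by (rule convergentI[OF cov_sum_limit[OF that]])
  show "\<exists>!x. is_sol x"
   using solution_exists by (rule ex_ex1I) (rule solution_unique)
 qed
qed

end
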